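(* Let $T>0$ and let $(\rho^E,u^E)$ be the smooth solution on $[0,T]\times\overline\Omega$ of the compressible Euler system $$\partial_t\rho^E+\operatorname{div}(\rho^E u^E)=0,\qquad \partial_t(\rho^E u^E)+\operatorname{div}(\rho^E u^E\otimes u^E)+\nabla_x p(\rho^E)=0,\qquad u^E\cdot n|_{\partial\Omega}=0,$$ associated with smooth compatible initial data $(\rho^E_0,u^E_0)$ such that $0<\inf_\Omega\rho^E_0$ and $\sup_\Omega\rho^E_0<\infty$, with $0<\inf_{(0,T)\times\Omega}\rho^E$ and $\sup_{(0,T)\times\Omega}\rho^E<\infty$. For every $\varepsilon\in(0,1)$ let $\beta=\beta^\varepsilon\ge0$, let $(\rho_0,u_0)=(\rho_0^\varepsilon,u_0^\varepsilon)$ be initial data such that $\rho_0\ge 0$, $\rho_0\in L^\gamma(\Omega)$, $\rho_0|u_0|^2\in L^1(\Omega)$, and let $(\rho,u)=(\rho^\varepsilon,u^\varepsilon)$ be a corresponding finite energy weak solution on $[0,T]$ of the compressible Navier-Stokes system with scaling factor $\varepsilon$ and Navier boundary conditions with friction coefficient $\beta^\varepsilon$ (as defined in the context). Assume that $$\|\rho_0-\rho^E_0\|_{L^\gamma(\Omega)}+\int_\Omega\rho_0|u_0-u^E_0|^2\,dx\to0\quad\text{when }\varepsilon\to0,$$ and that $\beta^\varepsilon\to0$ when $\varepsilon\to0$. Then $$\sup_{t\in(0,T)}\Big(\|\rho-\rho^E\|_{L^\gamma(\Omega)}+\int_\Omega\tfrac12\rho|u-u^E|^2\,dx\Big)(t)\to0\quad\text{when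 }\varepsilon\to0.$$
   Context: $\Omega\subset\mathbb{R}^3$ is a bounded regular (smooth) domain, $n$ is the unit outward normal on $\partial\Omega$, and $d\sigma$ is the surface measure on $\partial\Omega$. The pressure is $p(\rho)=\rho^\gamma$ with a fixed $\gamma>\frac32$. The viscosity coefficients are fixed constants $\mu>0$, $\eta\ge0$, and $$\mathbb{S}(\nabla_x u):=\mu\Big(\nabla_x u+(\nabla_x u)^T-\tfrac23(\operatorname{div}u)\operatorname{Id}\Big)+\eta(\operatorname{div}u)\operatorname{Id},$$ where $\nabla_x u$ is the Jacobian matrix of $u$. The compressible Navier-Stokes system is $$\partial_t\rho+\operatorname{div}(\rho u)=0,\qquad \partial_t(\rho u)+\operatorname{div}(\rho u\otimes u)+\nabla_x p(\rho)=\varepsilon\operatorname{div}\mathbb{S}(\nabla_x u),$$ with initial conditions $\rho|_{t=0}=\rho_0$, $(\rho u)|_{t=0}=\rho_0u_0$, and with Navier boundary conditions (impermeability $u\cdot n=0$ and tangential slip with friction coefficient $\beta\ge0$), understood through the weak formulation below. Energy: $\mathcal{E}(\rho,u):=\int_\Omega\big(\frac12\rho|u|^2+H(\rho)\big)dx$ with $H(\rho):=\frac{\rho^\gamma}{\gamma-1}$. Finite energy weak solution (Navier conditions). Given $(\rho_0,u_0)$ with $\rho_0\ge0$, $\rho_0\in L^\gamma(\Omega)$, $\rho_0|u_0|^2\in L^1(\Omega)$, let $q_0:=\rho_0u_0$. A pair $(\rho,u)$, with $\rho\ge 0$, is a finite energy weak solution on $[0,T]$ associated to $(\rho_0,u_0)$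 if: (i) $\rho\in C_w([0,T];L^\gamma(\Omega))$, $\rho u\in C_w([0,T];L^{\frac{2\gamma}{\gamma+1}}(\Omega))$, $\nabla_xu\in L^2(0,T;L^2(\Omega))$, $\rho|u|^2\in C_w([0,T];L^1(\Omega))$ ($C_w$ means continuous in time for the weak topology); (ii) $\int_\Omega\rho(T,\cdot)\phi(T,\cdot)dx-\int_\Omega\rho_0\phi(0,\cdot)dx=\int_0^T\int_\Omega(\rho\,\partial_t\phi+\rho u\cdot\nabla_x\phi)\,dx\,dt$ for all $\phi\in C^\infty_c([0,T]\times\overline\Omega;\mathbb{R})$; (iii) $\int_\Omega\rho(T,\cdot)u(T,\cdot)\cdot\phi(T,\cdot)dx-\int_\Omega q_0\cdot\phi(0,\cdot)dx=-\beta\int_0^T\int_{\partial\Omega}u\cdot\phi\,d\sigma dt+\int_0^T\int_\Omega\big(\rho u\cdot\partial_t\phi+\rho u\otimes u:\nabla_x\phi+p(\rho)\operatorname{div}\phi-\varepsilon\mathbb{S}(\nabla_xu):\nabla_x\phi\big)dx\,dt$ for all $\phi\in C^\infty_c([0,T]\times\overline\Omega;\mathbb{R}^3)$ such that $\phi\cdot n=0$ on $\partial\Omega$; (iv) for almost every $\tau\in[0,T]$, $\mathcal{E}(\rho(\tau,\cdot),u(\tau,\cdot))+\varepsilon\int_0^\tau\int_\Omega\mathbb{S}(\nabla_xu):\nabla_xu\,dx\,dt+\beta\int_0^\tau\int_{\partial\Omega}|u|^2d\sigma dt\le\mathcal{E}(\rho_0,u_0)$. "Compatible" initial data for Euler means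 that the data satisfy the conditions on $\partial\Omega$ that are necessary for the existence of a smooth solution up to $t=0$. *)

theory Defs
  imports "HOL-Analysis.Analysis"
begin

section \<open>Smooth functions and smooth domains\<close>

primrec C_k_on :: "nat \<Rightarrow> 'a::real_normed_vector set \<Rightarrow> ('a \<Rightarrow> 'b::real_normed_vector) \<Rightarrow> bool" where
  "C_k_on 0 U f \<longleftrightarrow> continuous_on U f"
| "C_k_on (Suc k) U f \<longleftrightarrow> (\<forall>x\<in>U. f differentiable (at x))
     \<and> (\<forall>v. C_k_on k U (\<lambda>x. frechet_derivative f (at x) v))"

definition smooth_on :: "'a::real_normed_vector set \<Rightarrow> ('a \<Rightarrow> 'b::real_normed_vector) \<Rightarrow> bool" where
  "smooth_on U f \<longleftrightarrow> open U \<and> (\<forall>k. C_k_on k U f)"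

text \<open>Smoothness on a set that need not be open, used for the compact sets
  \<open>closure \<Omega>\<close> and \<open>[0,T] \<times> closure \<Omega>\<close>: \<open>f\<close> is the restriction of a function that is smooth on
  a neighbourhood.\<close>

definition smooth_up_to :: "'a::real_normed_vector set \<Rightarrow> ('a \<Rightarrow> 'b::real_normed_vector) \<Rightarrow> bool" where
  "smooth_up_to S f \<longleftrightarrow> (\<exists>U g. S \<subseteq> U \<and> smooth_on U g \<and> (\<forall>x\<in>S. g x = f x))"

definition grad :: "(real^3 \<Rightarrow> real) \<Rightarrow> real^3 \<Rightarrow> real^3" where
  "grad f x = (\<chi> j. frechet_derivative f (at x) (axis j 1))"

definition divergence :: "(real^3 \<Rightarrow> real^3) \<Rightarrow> real^3 \<Rightarrow> real" where
  "divergence v x = trace (jacobian v (at x))"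

definition div_matrix :: "(real^3 \<Rightarrow> real^3^3) \<Rightarrow> real^3 \<Rightarrow> real^3" where
  "div_matrix M x = (\<chi> i. divergence (\<lambda>y. M y $ i) x)"

definition time_deriv :: "(real \<Rightarrow> real^3 \<Rightarrow> 'b::real_normed_vector) \<Rightarrow> real \<Rightarrow> real^3 \<Rightarrow> 'b" where
  "time_deriv f t x = vector_derivative (\<lambda>s. f s x) (at t)"

definition tensor :: "real^3 \<Rightarrow> real^3 \<Rightarrow> real^3^3" where
  "tensor a b = (\<chi> i j. a $ i * b $ j)"

text \<open>A local defining function of \<open>\<Omega>\<close> near the boundary point \<open>x\<close>: negative inside, with
  non-vanishing gradient, so that its normalised gradient is the outward normal.\<close>

definition local_defining ::
  "(real^3) set \<Rightarrow> real^3 \<Rightarrow> (real^3) set \<Rightarrow> (real^3 \<Rightarrow> real) \<Rightarrow> bool" where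
  "local_defining \<Omega> x U r \<longleftrightarrow> x \<in> U \<and> smooth_on U r \<and> (\<forall>y\<in>U. grad r y \<noteq> 0)
     \<and> \<Omega> \<inter> U = {y\<in>U. r y < 0}"

definition smooth_bounded_domain :: "(real^3) set \<Rightarrow> bool" where
  "smooth_bounded_domain \<Omega> \<longleftrightarrow> open \<Omega> \<and> connected \<Omega> \<and> bounded \<Omega> \<and> \<Omega> \<noteq> {}
     \<and> (\<forall>x\<in>frontier \<Omega>. \<exists>U r. local_defining \<Omega> x U r)"

definition outward_normal :: "(real^3) set \<Rightarrow> real^3 \<Rightarrow> real^3" where
  "outward_normal \<Omega> x =
     (THE n. \<exists>U r. local_defining \<Omega> x U r \<and> n = grad r x /\<^sub>R norm (grad r x))"


section \<open>Surface measure\<close>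

text \<open>The surface measure on \<open>frontier \<Omega>\<close> is the two-dimensional Hausdorff measure, normalised
  so that it agrees with area. \<open>hausdorff2_outer\<close> is a metric outer measure, hence countably
  additive on the Borel sets.\<close>

definition hausdorff2_pre :: "real \<Rightarrow> (real^3) set \<Rightarrow> ennreal" where
  "hausdorff2_pre \<delta> A =
     (INF U\<in>{U :: nat \<Rightarrow> (real^3) set.
               A \<subseteq> (\<Union>i. U i) \<and> (\<forall>i. bounded (U i) \<and> diameter (U i) \<le> \<delta>)}.
        \<Sum>i. ennreal (pi * (diameter (U i) / 2)^2))"

definition hausdorff2_outer :: "(real^3) set \<Rightarrow> ennreal" where
  "hausdorff2_outer A = (SUP \<delta>\<in>{0<..}. hausdorff2_pre \<delta> A)"

definition hausdorff2 :: "(real^3) measure" where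
  "hausdorff2 = measure_of UNIV (sets borel) hausdorff2_outer"

definition surface_measure :: "(real^3) set \<Rightarrow> (real^3) measure" where
  "surface_measure \<Omega> = restrict_space hausdorff2 (frontier \<Omega>)"


section \<open>Lebesgue and Sobolev notions\<close>

text \<open>Elements of \<open>L\<^sup>p\<close> are handled through Borel measurable representatives.\<close>

definition in_Lp :: "real \<Rightarrow> 'a::euclidean_space set \<Rightarrow> ('a \<Rightarrow> 'b::euclidean_space) \<Rightarrow> bool" where
  "in_Lp p S f \<longleftrightarrow> set_borel_measurable lborel S f
     \<and> set_integrable lborel S (\<lambda>x. norm (f x) powr p)"

definition Lp_norm :: "real \<Rightarrow> 'a::euclidean_space set \<Rightarrow> ('a \<Rightarrow> 'b::euclidean_space) \<Rightarrow> real" where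
  "Lp_norm p S f = (\<integral>x\<in>S. (norm (f x) powr p) \<partial>lborel) powr (1 / p)"

text \<open>For \<open>1 \<le> p < \<infinity>\<close>, the functionals on \<open>L\<^sup>p\<close> are the integrals against elements of the dual
  space \<open>L\<^bsup>p/(p-1)\<^esup>\<close>, respectively \<open>L\<^sup>\<infinity>\<close> if \<open>p = 1\<close>; every class in \<open>L\<^sup>\<infinity>\<close> has a bounded
  representative.\<close>

definition in_Lp_dual :: "real \<Rightarrow> 'a::euclidean_space set \<Rightarrow> ('a \<Rightarrow> 'b::euclidean_space) \<Rightarrow> bool" where
  "in_Lp_dual p S \<psi> \<longleftrightarrow>
     (if p = 1 then set_borel_measurable lborel S \<psi> \<and> bounded (\<psi> ` S)
      else in_Lp (p / (p - 1)) S \<psi>)"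

definition weakly_continuous_Lp ::
  "real \<Rightarrow> real \<Rightarrow> (real^3) set \<Rightarrow> (real \<Rightarrow> real^3 \<Rightarrow> 'b::euclidean_space) \<Rightarrow> bool" where
  "weakly_continuous_Lp T p \<Omega> f \<longleftrightarrow> (\<forall>t\<in>{0..T}. in_Lp p \<Omega> (f t))
     \<and> (\<forall>\<psi>. in_Lp_dual p \<Omega> \<psi> \<longrightarrow>
          continuous_on {0..T} (\<lambda>t. \<integral>x\<in>\<Omega>. (f t x \<bullet> \<psi> x) \<partial>lborel))"

definition locally_integrable :: "(real^3) set \<Rightarrow> (real^3 \<Rightarrow> 'b::euclidean_space) \<Rightarrow> bool" where
  "locally_integrable \<Omega> f \<longleftrightarrow> (\<forall>K. compact K \<and> K \<subseteq> \<Omega> \<longrightarrow> set_integrable lborel K f)"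

definition weak_jacobian ::
  "(real^3) set \<Rightarrow> (real^3 \<Rightarrow> real^3) \<Rightarrow> (real^3 \<Rightarrow> real^3^3) \<Rightarrow> bool" where
  "weak_jacobian \<Omega> w A \<longleftrightarrow> locally_integrable \<Omega> w \<and> locally_integrable \<Omega> A
     \<and> (\<forall>\<phi> :: real^3 \<Rightarrow> real.
          smooth_on UNIV \<phi> \<and> (\<exists>K. compact K \<and> K \<subseteq> \<Omega> \<and> (\<forall>x. x \<notin> K \<longrightarrow> \<phi> x = 0)) \<longrightarrow>
          (\<forall>i j. (\<integral>x\<in>\<Omega>. (w x $ i * grad \<phi> x $ j) \<partial>lborel)
                 = - (\<integral>x\<in>\<Omega>. (A x $ i $ j * \<phi> x) \<partial>lborel)))"

text \<open>\<open>g\<close> is the boundary trace of the \<open>H\<^sup>1\<close> field \<open>w\<close> with weak Jacobian \<open>A\<close>: the trace operator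
  is the continuous extension to \<open>H\<^sup>1(\<Omega>)\<close> of the map restricting fields that are smooth up to
  the boundary to \<open>frontier \<Omega>\<close>.\<close>

definition boundary_trace ::
  "(real^3) set \<Rightarrow> (real^3 \<Rightarrow> real^3) \<Rightarrow> (real^3 \<Rightarrow> real^3^3) \<Rightarrow> (real^3 \<Rightarrow> real^3) \<Rightarrow> bool" where
  "boundary_trace \<Omega> w A g \<longleftrightarrow> set_borel_measurable borel (frontier \<Omega>) g
     \<and> (\<exists>v :: nat \<Rightarrow> real^3 \<Rightarrow> real^3.
          (\<forall>k. smooth_up_to (closure \<Omega>) (v k))
          \<and> (\<lambda>k. \<integral>\<^sup>+x\<in>\<Omega>. ennreal ((norm (v k x - w x))^2) \<partial>lborel) \<longlonglongrightarrow> 0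
          \<and> (\<lambda>k. \<integral>\<^sup>+x\<in>\<Omega>. ennreal ((norm (jacobian (v k) (at x) - A x))^2) \<partial>lborel) \<longlonglongrightarrow> 0
          \<and> (\<lambda>k. \<integral>\<^sup>+x. ennreal ((norm (v k x - g x))^2) \<partial>surface_measure \<Omega>) \<longlonglongrightarrow> 0)"


section \<open>The Navier-Stokes and Euler systems\<close>

definition pressure :: "real \<Rightarrow> real \<Rightarrow> real" where
  "pressure \<gamma> \<rho> = \<rho> powr \<gamma>"

text \<open>The viscous stress as a function of the Jacobian matrix, whose trace is the divergence.\<close>

definition viscous_stress :: "real \<Rightarrow> real \<Rightarrow> real^3^3 \<Rightarrow> real^3^3" where
  "viscous_stress \<mu> \<eta> A =
     \<mu> *\<^sub>R (A + transpose A - (2/3 * trace A) *\<^sub>R mat 1) + (\<eta> * trace A) *\<^sub>R mat 1"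

definition energy :: "real \<Rightarrow> (real^3) set \<Rightarrow> (real^3 \<Rightarrow> real) \<Rightarrow> (real^3 \<Rightarrow> real^3) \<Rightarrow> real" where
  "energy \<gamma> \<Omega> \<rho> u =
     (\<integral>x\<in>\<Omega>. (1/2 * \<rho> x * (norm (u x))^2 + \<rho> x powr \<gamma> / (\<gamma> - 1)) \<partial>lborel)"

definition admissible_data ::
  "real \<Rightarrow> (real^3) set \<Rightarrow> (real^3 \<Rightarrow> real) \<Rightarrow> (real^3 \<Rightarrow> real^3) \<Rightarrow> bool" where
  "admissible_data \<gamma> \<Omega> \<rho>\<^sub>0 u\<^sub>0 \<longleftrightarrow> (AE x\<in>\<Omega> in lborel. 0 \<le> \<rho>\<^sub>0 x)
     \<and> in_Lp \<gamma> \<Omega> \<rho>\<^sub>0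
     \<and> set_borel_measurable lborel \<Omega> u\<^sub>0
     \<and> in_Lp 1 \<Omega> (\<lambda>x. \<rho>\<^sub>0 x * (norm (u\<^sub>0 x))^2)"

definition weak_continuity_equation ::
  "(real^3) set \<Rightarrow> real \<Rightarrow> (real^3 \<Rightarrow> real) \<Rightarrow> (real \<Rightarrow> real^3 \<Rightarrow> real)
     \<Rightarrow> (real \<Rightarrow> real^3 \<Rightarrow> real^3) \<Rightarrow> bool" where
  "weak_continuity_equation \<Omega> T \<rho>\<^sub>0 \<rho> u \<longleftrightarrow>
     (\<forall>\<phi> :: real \<Rightarrow> real^3 \<Rightarrow> real.
        smooth_up_to ({0..T} \<times> closure \<Omega>) (\<lambda>(t, x). \<phi> t x) \<longrightarrow>
        (\<integral>x\<in>\<Omega>. (\<rho> T x * \<phi> T x) \<partial>lborel) - (\<integral>x\<in>\<Omega>. (\<rho>\<^sub>0 x * \<phi> 0 x) \<partial>lborel)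
        = (\<integral>t\<in>{0<..<T}. (\<integral>x\<in>\<Omega>.
             (\<rho> t x * time_deriv \<phi> t x + (\<rho> t x *\<^sub>R u t x) \<bullet> grad (\<phi> t) x)
           \<partial>lborel) \<partial>lborel))"

text \<open>\<open>G t\<close> and \<open>g t\<close> stand for the weak Jacobian and the boundary trace of \<open>u t\<close>.
  The inner product of matrices is the Frobenius product.\<close>

definition weak_momentum_equation ::
  "real \<Rightarrow> real \<Rightarrow> real \<Rightarrow> (real^3) set \<Rightarrow> real \<Rightarrow> real \<Rightarrow> real
     \<Rightarrow> (real^3 \<Rightarrow> real) \<Rightarrow> (real^3 \<Rightarrow> real^3)
     \<Rightarrow> (real \<Rightarrow> real^3 \<Rightarrow> real) \<Rightarrow> (real \<Rightarrow> real^3 \<Rightarrow> real^3)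
     \<Rightarrow> (real \<Rightarrow> real^3 \<Rightarrow> real^3^3) \<Rightarrow> (real \<Rightarrow> real^3 \<Rightarrow> real^3) \<Rightarrow> bool" where
  "weak_momentum_equation \<gamma> \<mu> \<eta> \<Omega> T \<epsilon> \<beta> \<rho>\<^sub>0 u\<^sub>0 \<rho> u G g \<longleftrightarrow>
     (\<forall>\<phi> :: real \<Rightarrow> real^3 \<Rightarrow> real^3.
        smooth_up_to ({0..T} \<times> closure \<Omega>) (\<lambda>(t, x). \<phi> t x)
        \<and> (\<forall>t\<in>{0..T}. \<forall>x\<in>frontier \<Omega>. \<phi> t x \<bullet> outward_normal \<Omega> x = 0) \<longrightarrow>
        (\<integral>x\<in>\<Omega>. ((\<rho> T x *\<^sub>R u T x) \<bullet> \<phi> T x) \<partial>lborel)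
          - (\<integral>x\<in>\<Omega>. ((\<rho>\<^sub>0 x *\<^sub>R u\<^sub>0 x) \<bullet> \<phi> 0 x) \<partial>lborel)
        = - \<beta> * (\<integral>t\<in>{0<..<T}. (\<integral>x. g t x \<bullet> \<phi> t x \<partial>surface_measure \<Omega>) \<partial>lborel)
          + (\<integral>t\<in>{0<..<T}. (\<integral>x\<in>\<Omega>.
               ((\<rho> t x *\<^sub>R u t x) \<bullet> time_deriv \<phi> t x
                + (\<rho> t x *\<^sub>R tensor (u t x) (u t x)) \<bullet> jacobian (\<phi> t) (at x)
                + pressure \<gamma> (\<rho> t x) * divergence (\<phi> t) x
                - \<epsilon> * (viscous_stress \<mu> \<eta> (G t x) \<bullet> jacobian (\<phi> t) (at x)))
             \<partial>lborel) \<partial>lborel))"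

text \<open>All terms on the left are nonnegative; the boundary dissipation is an extended nonnegative
  integral, so that its finiteness (if \<open>\<beta> > 0\<close>) is part of the inequality.\<close>

definition energy_inequality ::
  "real \<Rightarrow> real \<Rightarrow> real \<Rightarrow> (real^3) set \<Rightarrow> real \<Rightarrow> real \<Rightarrow> real
     \<Rightarrow> (real^3 \<Rightarrow> real) \<Rightarrow> (real^3 \<Rightarrow> real^3)
     \<Rightarrow> (real \<Rightarrow> real^3 \<Rightarrow> real) \<Rightarrow> (real \<Rightarrow> real^3 \<Rightarrow> real^3)
     \<Rightarrow> (real \<Rightarrow> real^3 \<Rightarrow> real^3^3) \<Rightarrow> (real \<Rightarrow> real^3 \<Rightarrow> real^3) \<Rightarrow> bool" where
  "energy_inequality \<gamma> \<mu> \<eta> \<Omega> T \<epsilon> \<beta> \<rho>\<^sub>0 u\<^sub>0 \<rho> u G g \<longleftrightarrow>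
     (AE \<tau>\<in>{0..T} in lborel.
        ennreal (energy \<gamma> \<Omega> (\<rho> \<tau>) (u \<tau>))
        + ennreal (\<epsilon> * (\<integral>t\<in>{0<..<\<tau>}. (\<integral>x\<in>\<Omega>.
            (viscous_stress \<mu> \<eta> (G t x) \<bullet> G t x) \<partial>lborel) \<partial>lborel))
        + ennreal \<beta> * (\<integral>\<^sup>+t\<in>{0<..<\<tau>}.
            (\<integral>\<^sup>+x. ennreal ((norm (g t x))^2) \<partial>surface_measure \<Omega>) \<partial>lborel)
        \<le> ennreal (energy \<gamma> \<Omega> \<rho>\<^sub>0 u\<^sub>0))"

definition finite_energy_weak_solution ::
  "real \<Rightarrow> real \<Rightarrow> real \<Rightarrow> (real^3) set \<Rightarrow> real \<Rightarrow> real \<Rightarrow> real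
     \<Rightarrow> (real^3 \<Rightarrow> real) \<Rightarrow> (real^3 \<Rightarrow> real^3)
     \<Rightarrow> (real \<Rightarrow> real^3 \<Rightarrow> real) \<Rightarrow> (real \<Rightarrow> real^3 \<Rightarrow> real^3) \<Rightarrow> bool" where
  "finite_energy_weak_solution \<gamma> \<mu> \<eta> \<Omega> T \<epsilon> \<beta> \<rho>\<^sub>0 u\<^sub>0 \<rho> u \<longleftrightarrow>
     set_borel_measurable borel ({0<..<T} \<times> \<Omega>) (\<lambda>(t, x). \<rho> t x)
     \<and> set_borel_measurable borel ({0<..<T} \<times> \<Omega>) (\<lambda>(t, x). u t x)
     \<and> (\<forall>t\<in>{0..T}. AE x\<in>\<Omega> in lborel. 0 \<le> \<rho> t x)
     \<and> weakly_continuous_Lp T \<gamma> \<Omega> \<rho>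
     \<and> weakly_continuous_Lp T (2 * \<gamma> / (\<gamma> + 1)) \<Omega> (\<lambda>t x. \<rho> t x *\<^sub>R u t x)
     \<and> weakly_continuous_Lp T 1 \<Omega> (\<lambda>t x. \<rho> t x * (norm (u t x))^2)
     \<and> weak_continuity_equation \<Omega> T \<rho>\<^sub>0 \<rho> u
     \<and> (\<exists>(G :: real \<Rightarrow> real^3 \<Rightarrow> real^3^3) (g :: real \<Rightarrow> real^3 \<Rightarrow> real^3).
          in_Lp 2 ({0<..<T} \<times> \<Omega>) (\<lambda>(t, x). G t x)
          \<and> set_borel_measurable borel ({0<..<T} \<times> frontier \<Omega>) (\<lambda>(t, x). g t x)
          \<and> (AE t\<in>{0<..<T} in lborel. weak_jacobian \<Omega> (u t) (G t)
               \<and> boundary_trace \<Omega> (u t) (G t) (g t))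
          \<and> weak_momentum_equation \<gamma> \<mu> \<eta> \<Omega> T \<epsilon> \<beta> \<rho>\<^sub>0 u\<^sub>0 \<rho> u G g
          \<and> energy_inequality \<gamma> \<mu> \<eta> \<Omega> T \<epsilon> \<beta> \<rho>\<^sub>0 u\<^sub>0 \<rho> u G g)"

text \<open>Smoothness up to \<open>t = 0\<close> contains the compatibility of the initial data: compatibility
  consists of the conditions on \<open>frontier \<Omega>\<close> that such a solution forces on its initial values.\<close>

definition smooth_euler_solution ::
  "real \<Rightarrow> (real^3) set \<Rightarrow> real \<Rightarrow> (real^3 \<Rightarrow> real) \<Rightarrow> (real^3 \<Rightarrow> real^3)
     \<Rightarrow> (real \<Rightarrow> real^3 \<Rightarrow> real) \<Rightarrow> (real \<Rightarrow> real^3 \<Rightarrow> real^3) \<Rightarrow> bool" where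
  "smooth_euler_solution \<gamma> \<Omega> T \<rho>\<^sub>0 u\<^sub>0 \<rho> u \<longleftrightarrow>
     smooth_up_to ({0..T} \<times> closure \<Omega>) (\<lambda>(t, x). \<rho> t x)
     \<and> smooth_up_to ({0..T} \<times> closure \<Omega>) (\<lambda>(t, x). u t x)
     \<and> (\<forall>t\<in>{0<..<T}. \<forall>x\<in>\<Omega>.
          time_deriv \<rho> t x + divergence (\<lambda>y. \<rho> t y *\<^sub>R u t y) x = 0)
     \<and> (\<forall>t\<in>{0<..<T}. \<forall>x\<in>\<Omega>.
          time_deriv (\<lambda>s y. \<rho> s y *\<^sub>R u s y) t x
          + div_matrix (\<lambda>y. \<rho> t y *\<^sub>R tensor (u t y) (u t y)) x
          + grad (\<lambda>y. pressure \<gamma> (\<rho> t y)) x = 0)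
     \<and> (\<forall>t\<in>{0..T}. \<forall>x\<in>frontier \<Omega>. u t x \<bullet> outward_normal \<Omega> x = 0)
     \<and> (\<forall>x\<in>closure \<Omega>. \<rho> 0 x = \<rho>\<^sub>0 x \<and> u 0 x = u\<^sub>0 x)"

end

(* The relative energy of a weak solution (rho, u) with respect to the Euler flow (r, U) is
   E(t) = int 1/2 rho |u - U|^2 + H(rho) - H(r) - H'(r) (rho - r).
   Expanding the square, E is the energy minus int rho u . U plus int rho (1/2 |U|^2 - H'(r)) plus
   int r^gamma.  The energy inequality controls the first term; testing the momentum equation with U and
   the continuity equation with 1/2 |U|^2 - H'(r) controls the next two.  By the Euler equations all terms
   that are linear in (rho - r, u - U) cancel up to the integral of div (r^gamma U), which vanishes because
   U is tangent to the boundary.  What remains is bounded by a multiple of E, by epsilon (Young's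
   inequality for the viscous stress) and by beta (Young's inequality for the friction), so that Gronwall's
   lemma gives E(t) <= C (E(0) + epsilon + beta) for almost every t, hence for all t by weak lower
   semicontinuity.  Finally E controls and is controlled by the quantities in the statement. *)

theory Submission
  imports Defs
begin


section \<open>Smooth functions\<close>

text \<open>Three obstacles shape the proof. The weak equations are given between the times 0 and T
  only, with smooth test functions, so a cut-off at an intermediate time is not admissible. Testing
  with \<open>t ^ n\<close> times a fixed field for every n instead makes all moments of the defect
  of the localised equation vanish; the defect is continuous in time, hence zero. The divergence
  integral of a tangent field is found from volumes rather than boundary integrals: the map x + h V
  x sends \<Omega> into \<Omega> enlarged by a tube of width O(h^2) around the boundary, so the
  volume cannot grow to first order in h, neither for V nor for - V. The coverings of the boundary
  that bound the tube also make the surface measure finite, which the friction term requires.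
  Finally, for \<gamma> < 2 the L^\<gamma> gap of the densities is not bounded by a multiple of the
  relative potential, which is quadratic near equal densities while the power \<gamma> is larger
  there. The bound used has the form \<delta> plus a multiple, depending on \<delta>, of the
  potential, so the limit in \<epsilon> precedes the one in \<delta> and no rate results for the
  density.\<close>

lemma C_k_on_cong:
  assumes "open U" "\<And>x. x \<in> U \<Longrightarrow> f x = g x"
  shows "C_k_on k U f \<longleftrightarrow> C_k_on k U g"
  using assms(2)
proof (induction k arbitrary: f g)
  case 0
  then show ?case by (simp cong: continuous_on_cong)
next
  case (Suc k)
  have D: "(f has_derivative D) (at x) \<longleftrightarrow> (g has_derivative D) (at x)" if "x \<in> U" for x D
    using has_derivative_transform_within_open[of f D x UNIV U g] has_derivative_transform_within_open[of g D x UNIV U f]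
      that Suc.prems assms(1) by auto
  have diff: "f differentiable (at x) \<longleftrightarrow> g differentiable (at x)" if "x \<in> U" for x
    using D[OF that] unfolding differentiable_def by simp
  have fr: "frechet_derivative f (at x) = frechet_derivative g (at x)" if "x \<in> U" for x
    unfolding frechet_derivative_def using D[OF that] by simp
  have "C_k_on k U (\<lambda>x. frechet_derivative f (at x) v) \<longleftrightarrow> C_k_on k U (\<lambda>x. frechet_derivative g (at x) v)" for v
    by (rule Suc.IH) (simp add: fr)
  then show ?case using diff by auto
qed

text \<open>Smoothness of composite functions is proved by recursion on derivative formulas. This
  rule accepts any formula \<open>f'\<close> for the derivative, because on an open set
  \<open>C_k_on_cong\<close> exchanges it for \<open>frechet_derivative\<close>.\<close>

lemma C_k_on_SucI:
  assumes "open U" "\<And>x. x \<in> U \<Longrightarrow> (f has_derivative f' x) (at x)"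
    "\<And>v. C_k_on k U (\<lambda>x. f' x v)"
  shows "C_k_on (Suc k) U f"
proof -
  have "C_k_on k U (\<lambda>x. frechet_derivative f (at x) v)" for v
    using assms frechet_derivative_at[OF assms(2)] C_k_on_cong[OF assms(1), of "\<lambda>x. frechet_derivative f (at x) v" "\<lambda>x. f' x v" k]
    by auto
  then show ?thesis using assms(2) by (auto simp: differentiable_def)
qed

lemma C_k_on_SucD: "C_k_on (Suc k) U f \<Longrightarrow> C_k_on k U f"
proof (induction k arbitrary: f)
  case 0
  then show ?case
    by (auto intro!: continuous_at_imp_continuous_on differentiable_imp_continuous_within)
qed simp

lemma C_k_on_has_derivative:
  "C_k_on (Suc k) U f \<Longrightarrow> x \<in> U \<Longrightarrow> (f has_derivative frechet_derivative f (at x)) (at x)"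
  by (simp add: frechet_derivative_works)

lemma C_k_on_const: "open U \<Longrightarrow> C_k_on k U (\<lambda>x. c)"
  by (induction k arbitrary: c) auto

lemma C_k_on_linear:
  assumes "open U" "bounded_linear h"
  shows "C_k_on k U h"
proof (cases k)
  case 0
  then show ?thesis using assms linear_continuous_on by auto
next
  case (Suc j)
  show ?thesis unfolding Suc
    by (rule C_k_on_SucI[OF assms(1) bounded_linear_imp_has_derivative[OF assms(2)]])
       (rule C_k_on_const[OF assms(1)])
qed

lemma C_k_on_add:
  assumes "open U"
  shows "C_k_on k U f \<Longrightarrow> C_k_on k U g \<Longrightarrow> C_k_on k U (\<lambda>x. f x + g x)"
proof (induction k arbitrary: f g)
  case 0
  then show ?case by (auto intro: continuous_intros)
next
  case (Suc k)
  show ?case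
    by (rule C_k_on_SucI[OF assms has_derivative_add[OF C_k_on_has_derivative[OF Suc.prems(1)]
           C_k_on_has_derivative[OF Suc.prems(2)]]]) (use Suc in auto)
qed

text \<open>The Leibniz rule produces two terms of the same shape, each with one factor
  differentiated. Hence the induction runs over all pairs \<open>f\<close>, \<open>g\<close>, and
  \<open>C_k_on_SucD\<close> lowers the order of the undifferentiated factor. One statement serves
  products, scalings and inner products.\<close>

lemma C_k_on_bilinear:
  assumes "open U" "bounded_bilinear b"
  shows "C_k_on k U f \<Longrightarrow> C_k_on k U g \<Longrightarrow> C_k_on k U (\<lambda>x. b (f x) (g x))"
proof (induction k arbitrary: f g)
  case 0
  then show ?case by (auto intro: bounded_bilinear.continuous_on[OF assms(2)])
next
  case (Suc k)
  show ?case
  proof (rule C_k_on_SucI[OF assms(1) bounded_bilinear.FDERIV[OF assms(2)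
        C_k_on_has_derivative[OF Suc.prems(1)] C_k_on_has_derivative[OF Suc.prems(2)]]])
    fix v
    show "C_k_on k U (\<lambda>x. b (f x) (frechet_derivative g (at x) v) + b (frechet_derivative f (at x) v) (g x))"
      by (intro C_k_on_add[OF assms(1)] Suc.IH) (use Suc.prems C_k_on_SucD in auto)
  qed
qed

text \<open>The exponent is generalised in the induction because differentiation lowers it by one.
  Positivity of \<open>f\<close> keeps every real exponent differentiable.\<close>

lemma C_k_on_powr:
  fixes f :: "'a::real_normed_vector \<Rightarrow> real"
  assumes "open U" "\<And>x. x \<in> U \<Longrightarrow> f x > 0"
  shows "C_k_on k U f \<Longrightarrow> C_k_on k U (\<lambda>x. f x powr a)"
proof (induction k arbitrary: a)
  case 0
  then show ?case using assms(2) by (auto intro!: continuous_intros dest: less_imp_neq[symmetric])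
next
  case (Suc k)
  have d: "((\<lambda>x. f x powr a) has_derivative (\<lambda>v. a * (f x powr (a - 1) * frechet_derivative f (at x) v))) (at x)"
    if "x \<in> U" for x
  proof -
    have "((\<lambda>y. y powr a) has_derivative (*) (a * f x powr (a - 1))) (at (f x))"
      using has_real_derivative_powr[OF assms(2)[OF that], of a] unfolding has_field_derivative_def
      by (rule back_subst[of "\<lambda>D. (_ has_derivative D) _"]) (auto simp: fun_eq_iff)
    from has_derivative_compose[OF C_k_on_has_derivative[OF Suc.prems that] this]
    show ?thesis by (simp add: mult.assoc)
  qed
  show ?case
    by (rule C_k_on_SucI[OF assms(1) d])
       (use Suc C_k_on_SucD in \<open>auto intro!: C_k_on_bilinear[OF assms(1) bounded_bilinear_mult] C_k_on_const[OF assms(1)]\<close>)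
qed

lemma smooth_on_open_subset: 
  assumes "smooth_on U f" "open V" "V \<subseteq> U" shows "smooth_on V f"
proof -
  have "C_k_on k U f \<Longrightarrow> C_k_on k V f" for k
    using assms(3) by (induction k arbitrary: f) (auto intro: continuous_on_subset)
  then show ?thesis using assms by (auto simp: smooth_on_def)
qed

section \<open>Smoothness up to the boundary\<close>

lemma smooth_up_to_bilinear:
  assumes "bounded_bilinear b" "smooth_up_to S f" "smooth_up_to S g"
  shows "smooth_up_to S (\<lambda>x. b (f x) (g x))"
proof -
  obtain U f' V g' where *: "S \<subseteq> U" "smooth_on U f'" "\<forall>x\<in>S. f' x = f x" 
    "S \<subseteq> V" "smooth_on V g'" "\<forall>x\<in>S. g' x = g x"
    using assms(2,3) unfolding smooth_up_to_def by metis
  have o: "open (U \<inter> V)" using * by (auto simp: smooth_on_def)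
  have "smooth_on (U \<inter> V) f'" "smooth_on (U \<inter> V) g'"
    using * o smooth_on_open_subset by (metis Int_lower1 Int_lower2)+
  then have "smooth_on (U \<inter> V) (\<lambda>x. b (f' x) (g' x))"
    using C_k_on_bilinear[OF o assms(1)] by (auto simp: smooth_on_def)
  then show ?thesis unfolding smooth_up_to_def using * 
    by (intro exI[of _ "U \<inter> V"] exI[of _ "\<lambda>x. b (f' x) (g' x)"]) auto
qed

lemma smooth_up_to_add:
  assumes "smooth_up_to S f" "smooth_up_to S g"
  shows "smooth_up_to S (\<lambda>x. f x + g x)"
proof -
  obtain U f' V g' where *: "S \<subseteq> U" "smooth_on U f'" "\<forall>x\<in>S. f' x = f x" 
    "S \<subseteq> V" "smooth_on V g'" "\<forall>x\<in>S. g' x = g x"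
    using assms unfolding smooth_up_to_def by metis
  have o: "open (U \<inter> V)" using * by (auto simp: smooth_on_def)
  have "smooth_on (U \<inter> V) f'" "smooth_on (U \<inter> V) g'"
    using * o smooth_on_open_subset by (metis Int_lower1 Int_lower2)+
  then have "smooth_on (U \<inter> V) (\<lambda>x. f' x + g' x)"
    using C_k_on_add[OF o, of _ f' g'] o by (simp add: smooth_on_def)
  then show ?thesis unfolding smooth_up_to_def using * 
    by (intro exI[of _ "U \<inter> V"] exI[of _ "\<lambda>x. f' x + g' x"]) auto
qed

lemma smooth_up_to_const: "smooth_up_to S (\<lambda>x. c)"
  unfolding smooth_up_to_def smooth_on_def using C_k_on_const[OF open_UNIV] by blast

lemma smooth_up_to_linear: "bounded_linear h \<Longrightarrow> smooth_up_to S h"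
  unfolding smooth_up_to_def smooth_on_def using C_k_on_linear[OF open_UNIV] by blast

lemma smooth_up_to_continuous_on: "smooth_up_to S f \<Longrightarrow> continuous_on S f"
proof -
  assume "smooth_up_to S f"
  then obtain U g where *: "S \<subseteq> U" "smooth_on U g" "\<forall>x\<in>S. g x = f x"
    unfolding smooth_up_to_def by metis
  then have "C_k_on 0 U g" unfolding smooth_on_def by blast
  then have "continuous_on S g" using continuous_on_subset[of U g S] *(1) by simp
  then show ?thesis using *(3) continuous_on_cong[of S S g f] by simp
qed

lemma smooth_up_to_powr:
  fixes f :: "'a::real_normed_vector \<Rightarrow> real"
  assumes "smooth_up_to S f" "\<And>x. x \<in> S \<Longrightarrow> f x > 0"
  shows "smooth_up_to S (\<lambda>x. f x powr a)"
proof -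
  obtain U g where *: "S \<subseteq> U" "smooth_on U g" "\<forall>x\<in>S. g x = f x"
    using assms(1) unfolding smooth_up_to_def by metis
  then have "C_k_on 0 U g" "open U" unfolding smooth_on_def by blast+
  then have "continuous_on U g" "open U" by auto
  \<comment> \<open>The extension is known to be positive on \<open>S\<close> only, so its domain is
    shrunk to the open set where it stays positive.\<close>
  then have o: "open (U \<inter> g -` {0<..})" by (simp add: continuous_on_open_vimage Int_commute)
  have "smooth_on (U \<inter> g -` {0<..}) g"
    using * o smooth_on_open_subset by (metis Int_lower1)
  then have "smooth_on (U \<inter> g -` {0<..}) (\<lambda>x. g x powr a)"
    using C_k_on_powr[OF o, of g] by (auto simp: smooth_on_def)
  then show ?thesis unfolding smooth_up_to_def using * assms(2)
    by (intro exI[of _ "U \<inter> g -` {0<..}"] exI[of _ "\<lambda>x. g x powr a"]) auto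
qed

lemma smooth_up_to_power:
  fixes f :: "'a::real_normed_vector \<Rightarrow> real"
  assumes "smooth_up_to S f" shows "smooth_up_to S (\<lambda>x. f x ^ n)"
  by (induction n) (auto intro: smooth_up_to_const smooth_up_to_bilinear[OF bounded_bilinear_mult assms])

text \<open>\<open>C_k_on\<close> makes the derivative continuous in one direction at a time.
  Evaluation at the finitely many basis vectors turns this into a bound on the operator norm by a
  sum that is continuous in the base point.\<close>

lemma norm_linear_Basis_bound:
  fixes D :: "'a::euclidean_space \<Rightarrow> 'b::real_normed_vector"
  assumes "bounded_linear D"
  shows "norm (D v) \<le> (\<Sum>b\<in>Basis. norm (D b)) * norm v"
proof -
  have "D v = D (\<Sum>b\<in>Basis. (v \<bullet> b) *\<^sub>R b)" by (simp add: euclidean_representation)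
  also have "\<dots> = (\<Sum>b\<in>Basis. (v \<bullet> b) *\<^sub>R D b)"
    using assms by (simp add: bounded_linear.linear linear_sum linear_scale)
  also have "norm \<dots> \<le> (\<Sum>b\<in>Basis. norm (D b) * norm v)"
  proof (rule sum_norm_le)
    fix b :: 'a assume "b \<in> Basis"
    then have "\<bar>v \<bullet> b\<bar> * norm (D b) \<le> norm v * norm (D b)"
      by (intro mult_right_mono Basis_le_norm) auto
    then show "norm ((v \<bullet> b) *\<^sub>R D b) \<le> norm (D b) * norm v" by (simp only: norm_scaleR mult.commute)
  qed
  finally show ?thesis by (simp add: sum_distrib_right)
qed

lemma C_1_locally_lipschitz:
  fixes f :: "'a::euclidean_space \<Rightarrow> 'b::real_normed_vector"
  assumes "open U" "C_k_on 1 U f" "x \<in> U"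
  shows "\<exists>d>0. \<exists>L. ball x d \<subseteq> U \<and> L-lipschitz_on (ball x d) f"
proof -
  let ?s = "\<lambda>y. \<Sum>b\<in>Basis. norm (frechet_derivative f (at y) b)"
  have d: "(f has_derivative frechet_derivative f (at y)) (at y)" if "y \<in> U" for y
    using C_k_on_has_derivative[of 0] assms that by simp
  have "continuous_on U (\<lambda>y. frechet_derivative f (at y) b)" for b
    using assms(2) by simp
  then have "continuous_on U ?s" by (intro continuous_intros)
  then have "isCont ?s x" using assms(1,3) continuous_on_eq_continuous_at by blast
  then have "(?s \<longlongrightarrow> ?s x) (nhds x)"
    using tendsto_at_iff_tendsto_nhds[of ?s x] unfolding isCont_def by blast
  \<comment> \<open>Near \<open>x\<close> the basis sum stays below its value at \<open>x\<close>
    plus one. On a ball, which is convex, this bound on the derivative is a Lipschitz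
    constant.\<close>
  then have "eventually (\<lambda>y. ?s y < ?s x + 1) (nhds x)"
    using order_tendstoD(2)[of ?s "?s x" "nhds x" "?s x + 1"] by simp
  then obtain W where W: "open W" "x \<in> W" "\<forall>y\<in>W. ?s y < ?s x + 1"
    unfolding eventually_nhds by blast
  obtain d where d0: "d > 0" "ball x d \<subseteq> U \<inter> W"
    using W assms(1,3) open_contains_ball[of "U \<inter> W"] by (meson IntI open_Int)
  have "(?s x + 1)-lipschitz_on (ball x d) f"
  proof (rule bounded_derivative_imp_lipschitz[OF has_derivative_at_withinI[OF d]])
    show "0 \<le> ?s x + 1" by (simp add: sum_nonneg add_nonneg_nonneg)
    fix y assume y: "y \<in> ball x d"
    then have yU: "y \<in> U" using d0 by auto
    have bl: "bounded_linear (frechet_derivative f (at y))" using d[OF yU] by (rule has_derivative_bounded_linear)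
    show "onorm (frechet_derivative f (at y)) \<le> ?s x + 1"
    proof (rule onorm_le)
      fix v
      have "norm (frechet_derivative f (at y) v) \<le> ?s y * norm v" by (rule norm_linear_Basis_bound[OF bl])
      also have "\<dots> \<le> (?s x + 1) * norm v" 
      proof (rule mult_right_mono)
        have "y \<in> W" using d0(2) y by blast
        then show "?s y \<le> ?s x + 1" using W(3) less_imp_le by blast
      qed simp
      finally show "norm (frechet_derivative f (at y) v) \<le> (?s x + 1) * norm v" .
    qed
  qed (use d0 in auto)
  then show ?thesis using d0 by auto
qed

text \<open>A segment between two points of \<open>K\<close> may leave \<open>U\<close>, so the mean
  value theorem does not apply globally. Local Lipschitz bounds are combined by compactness instead;
  the time variable of \<open>local_lipschitz\<close> ranges over the single value 0.\<close>

lemma C_1_lipschitz_on_compact: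
  fixes f :: "'a::euclidean_space \<Rightarrow> 'b::real_normed_vector"
  assumes "open U" "C_k_on 1 U f" "compact K" "K \<subseteq> U"
  shows "\<exists>L. L-lipschitz_on K f"
proof -
  have "local_lipschitz {0::real} K (\<lambda>_. f)"
    unfolding local_lipschitz_def
  proof (intro ballI)
    fix t::real and x assume "t \<in> {0}" "x \<in> K"
    then obtain d L where *: "d > 0" "L-lipschitz_on (ball x d) f"
      using C_1_locally_lipschitz[OF assms(1,2)] assms(4) by blast
    have "L-lipschitz_on (cball x (d/2) \<inter> K) f"
      by (rule lipschitz_on_subset[OF *(2)]) (use * in auto)
    then show "\<exists>u>0. \<exists>L. \<forall>t\<in>cball t u \<inter> {0}. L-lipschitz_on (cball x u \<inter> K) f"
      using * by (intro exI[of _ "d/2"]) auto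
  qed
  from local_lipschitz_compact_implies_lipschitz[OF this assms(3)]
  show ?thesis by auto
qed

text \<open>\<open>D\<close> is the derivative of a smooth extension of \<open>f\<close>. On the
  boundary of \<open>S\<close> it depends on that extension, so it is tied to \<open>f\<close> only
  in the interior, while continuity and the bound hold on all of \<open>S\<close>.\<close>

lemma smooth_up_to_derivative:
  fixes f :: "'a::euclidean_space \<Rightarrow> 'b::real_normed_vector"
  assumes "smooth_up_to S f" "compact S"
  obtains D C where "\<And>v. continuous_on S (\<lambda>p. D p v)"
    "\<And>p. p \<in> interior S \<Longrightarrow> (f has_derivative D p) (at p)"
    "\<And>p v. p \<in> S \<Longrightarrow> norm (D p v) \<le> C * norm v"
proof -
  obtain U g where *: "S \<subseteq> U" "smooth_on U g" "\<forall>x\<in>S. g x = f x"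
    using assms(1) unfolding smooth_up_to_def by metis
  define D where "D p = frechet_derivative g (at p)" for p
  have c1: "C_k_on 1 U g" using *(2) by (simp add: smooth_on_def)
  have c: "continuous_on S (\<lambda>p. D p v)" for v
    unfolding D_def by (rule continuous_on_subset[OF _ *(1)]) (use c1 in simp)
  have d: "(g has_derivative D p) (at p)" if "p \<in> U" for p
    using C_k_on_has_derivative[of 0 U g p] c1 that unfolding D_def by simp
  have "\<exists>C. \<forall>p\<in>S. (\<Sum>b\<in>Basis. norm (D p b)) \<le> C"
  proof -
    have "continuous_on S (\<lambda>p. \<Sum>b\<in>Basis. norm (D p b))" by (intro continuous_intros c)
    then have "bounded ((\<lambda>p. \<Sum>b\<in>Basis. norm (D p b)) ` S)"
      by (intro compact_imp_bounded compact_continuous_image assms(2))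
    then obtain C where "\<forall>y\<in>(\<lambda>p. \<Sum>b\<in>Basis. norm (D p b)) ` S. norm y \<le> C" unfolding bounded_iff by blast
    then show ?thesis by (intro exI[of _ C]) (simp add: abs_le_iff)
  qed
  then obtain C where C: "\<forall>p\<in>S. (\<Sum>b\<in>Basis. norm (D p b)) \<le> C" ..
  show ?thesis
  proof
    show "continuous_on S (\<lambda>p. D p v)" for v by (rule c)
    show "(f has_derivative D p) (at p)" if "p \<in> interior S" for p
    proof (rule has_derivative_transform_within_open[OF d open_interior that])
      show "p \<in> U" using that *(1) interior_subset by blast
      show "g x = f x" if "x \<in> interior S" for x using that *(3) interior_subset by blast
    qed
    show "norm (D p v) \<le> C * norm v" if "p \<in> S" for p v
    proof -
      have "norm (D p v) \<le> (\<Sum>b\<in>Basis. norm (D p b)) * norm v"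
        by (rule norm_linear_Basis_bound[OF has_derivative_bounded_linear[OF d]]) (use that *(1) in auto)
      also have "\<dots> \<le> C * norm v" using C that by (intro mult_right_mono) auto
      finally show ?thesis .
    qed
  qed
qed

lemma spacetime_partials:
  fixes f :: "real \<Rightarrow> 'a::real_normed_vector \<Rightarrow> 'b::real_normed_vector"
  assumes "((\<lambda>(t, x). f t x) has_derivative D) (at (t, x))"
  shows "((\<lambda>s. f s x) has_vector_derivative D (1, 0)) (at t)"
    and "(f t has_derivative (\<lambda>v. D (0, v))) (at x)"
proof -
  have D: "linear D" using assms has_derivative_linear by blast
  have "((\<lambda>s. (s, x)) has_derivative (\<lambda>h. (h, 0))) (at t)"
    by (intro has_derivative_Pair has_derivative_ident has_derivative_const)
  from has_derivative_compose[OF this assms]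
  have "((\<lambda>s. f s x) has_derivative (\<lambda>h. D (h, 0))) (at t)" by simp
  moreover have "(\<lambda>h. D (h, 0)) = (\<lambda>h. h *\<^sub>R D (1, 0))"
  proof
    show "D (h, 0) = h *\<^sub>R D (1, 0)" for h using linear_scale[OF D, of h "(1, 0)"] by simp
  qed
  ultimately show "((\<lambda>s. f s x) has_vector_derivative D (1, 0)) (at t)"
    unfolding has_vector_derivative_def by simp
  have "((\<lambda>y. (t, y)) has_derivative (\<lambda>h. (0, h))) (at x)"
    by (intro has_derivative_Pair has_derivative_ident has_derivative_const)
  from has_derivative_compose[OF this assms]
  show "(f t has_derivative (\<lambda>v. D (0, v))) (at x)" by simp
qed

lemma interior_cylinder:
  fixes t T :: real
  assumes "open \<Omega>" "t \<in> {0<..<T}" "x \<in> \<Omega>"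
  shows "(t, x) \<in> interior ({0..T} \<times> closure \<Omega>)"
proof (rule interiorI[of "{0<..<T} \<times> \<Omega>"])
  show "{0<..<T} \<times> \<Omega> \<subseteq> {0..T} \<times> closure \<Omega>"
    using closure_subset[of \<Omega>] by (intro Sigma_mono) auto
qed (use assms in \<open>auto intro: open_Times\<close>)


section \<open>Area and volume near the boundary\<close>

text \<open>The passage through a finite subcover, isolated because it serves two different
  properties: coverings of the boundary and uniform constants along it.\<close>

lemma compact_local_to_global:
  fixes S :: "'a::metric_space set"
  assumes "compact S" and loc: "\<And>p. p \<in> S \<Longrightarrow> \<exists>d>0. Q (S \<inter> ball p d)"
    and "Q {}" and un: "\<And>A B. Q A \<Longrightarrow> Q B \<Longrightarrow> Q (A \<union> B)"
  shows "Q S"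
proof -
  obtain d where d: "\<And>p. p \<in> S \<Longrightarrow> d p > 0" "\<And>p. p \<in> S \<Longrightarrow> Q (S \<inter> ball p (d p))"
    using loc by metis
  obtain D where D: "D \<subseteq> S" "finite D" "S \<subseteq> (\<Union>p\<in>D. ball p (d p))"
  proof (rule compactE_image[OF assms(1), of S "\<lambda>p. ball p (d p)"])
    show "S \<subseteq> (\<Union>p\<in>S. ball p (d p))" using d(1) by force
  qed auto
  have "Q (\<Union>p\<in>D. S \<inter> ball p (d p))"
    using D(2,1)
  proof (induction D rule: finite_induct)
    case empty
    show ?case by (simp only: image_empty Union_empty assms(3))
  next
    case (insert p D)
    have "Q (S \<inter> ball p (d p))" "Q (\<Union>p\<in>D. S \<inter> ball p (d p))" using insert d(2) by auto
    from un[OF this] show ?case by simp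
  qed
  moreover have "(\<Union>p\<in>D. S \<inter> ball p (d p)) = S" using D(3) by auto
  ultimately show ?thesis by simp
qed

text \<open>A two-dimensional upper Minkowski (box counting) bound: at scale \<open>h\<close> about
  \<open>1 / h\<^sup>2\<close> sets suffice. It controls both the Hausdorff measure of
  \<open>S\<close> and the volume of tubes around \<open>S\<close>.\<close>

definition quad_covered :: "'a::metric_space set \<Rightarrow> bool" where
  "quad_covered S \<longleftrightarrow> (\<exists>C. \<forall>h. 0 < h \<and> h \<le> 1 \<longrightarrow> (\<exists>\<A>. finite \<A> \<and> S \<subseteq> \<Union>\<A>
     \<and> (\<forall>A\<in>\<A>. bounded A \<and> diameter A \<le> h) \<and> real (card \<A>) * h\<^sup>2 \<le> C))"

lemma quad_covered_empty: "quad_covered {}"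
  unfolding quad_covered_def by (intro exI[of _ 0] allI impI exI[of _ "{}"]) auto

lemma quad_covered_Un:
  assumes "quad_covered S" "quad_covered T" shows "quad_covered (S \<union> T)"
proof -
  obtain C where C: "\<And>h. 0 < h \<Longrightarrow> h \<le> 1 \<Longrightarrow> \<exists>\<A>. finite \<A> \<and> S \<subseteq> \<Union>\<A>
     \<and> (\<forall>A\<in>\<A>. bounded A \<and> diameter A \<le> h) \<and> real (card \<A>) * h\<^sup>2 \<le> C"
    using assms(1) unfolding quad_covered_def by blast
  obtain C' where C': "\<And>h. 0 < h \<Longrightarrow> h \<le> 1 \<Longrightarrow> \<exists>\<A>. finite \<A> \<and> T \<subseteq> \<Union>\<A>
     \<and> (\<forall>A\<in>\<A>. bounded A \<and> diameter A \<le> h) \<and> real (card \<A>) * h\<^sup>2 \<le> C'"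
    using assms(2) unfolding quad_covered_def by blast
  show ?thesis unfolding quad_covered_def
  proof (intro exI[of _ "C + C'"] allI impI)
    fix h :: real assume h: "0 < h \<and> h \<le> 1"
    obtain \<A> where \<A>: "finite \<A>" "S \<subseteq> \<Union>\<A>" "\<forall>A\<in>\<A>. bounded A \<and> diameter A \<le> h" "real (card \<A>) * h\<^sup>2 \<le> C"
      using C[of h] h by blast
    obtain \<B> where \<B>: "finite \<B>" "T \<subseteq> \<Union>\<B>" "\<forall>A\<in>\<B>. bounded A \<and> diameter A \<le> h" "real (card \<B>) * h\<^sup>2 \<le> C'"
      using C'[of h] h by blast
    have "real (card (\<A> \<union> \<B>)) * h\<^sup>2 \<le> (real (card \<A>) + real (card \<B>)) * h\<^sup>2"
      using card_Un_le[of \<A> \<B>] by (intro mult_right_mono zero_le_power2) linarith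
    then have "real (card (\<A> \<union> \<B>)) * h\<^sup>2 \<le> C + C'" using \<A>(4) \<B>(4) by (simp add: distrib_right)
    then show "\<exists>\<A>. finite \<A> \<and> S \<union> T \<subseteq> \<Union>\<A> \<and> (\<forall>A\<in>\<A>. bounded A \<and> diameter A \<le> h) \<and> real (card \<A>) * h\<^sup>2 \<le> C + C'"
      using \<A>(1-3) \<B>(1-3) by (intro exI[of _ "\<A> \<union> \<B>"]) auto
  qed
qed

text \<open>The second hypothesis makes \<open>S\<close> a Lipschitz graph over the coordinates
  \<open>i\<close> and \<open>j\<close>. Cells of a square grid in these two coordinates therefore
  pull back to small subsets of \<open>S\<close>, and a square of side \<open>2 * M\<close> has of
  order \<open>1 / h\<^sup>2\<close> cells.\<close>

lemma quad_covered_lipschitz_graph: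
  fixes S :: "(real^3) set"
  assumes "bounded S"
    and L: "\<And>a b. a \<in> S \<Longrightarrow> b \<in> S \<Longrightarrow> norm (a - b) \<le> L * (\<bar>a $ i - b $ i\<bar> + \<bar>a $ j - b $ j\<bar>)"
    and "L \<ge> 1"
  shows "quad_covered S"
proof -
  obtain M0 where M0: "\<And>x. x \<in> S \<Longrightarrow> norm x \<le> M0" using assms(1) unfolding bounded_iff by blast
  define M where "M = max M0 1"
  have M: "M \<ge> 1" "\<And>x. x \<in> S \<Longrightarrow> norm x \<le> M" using M0 by (auto simp: M_def intro: max.coboundedI1)
  show ?thesis unfolding quad_covered_def
  proof (intro exI[of _ "100 * M\<^sup>2 * L\<^sup>2"] allI impI)
    fix h :: real assume h: "0 < h \<and> h \<le> 1"
    \<comment> \<open>Two points in one cell differ by at most \<open>s\<close> in both coordinates,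
      hence by at most \<open>2 * L * s = h\<close> in norm.\<close>
    define s where "s = h / (2 * L)"
    have s: "0 < s" "s \<le> 1" using h \<open>L \<ge> 1\<close> by (auto simp: s_def field_simps)
    define n where "n = \<lceil>M / s\<rceil>"
    define key where "key x = (\<lfloor>x $ i / s\<rfloor>, \<lfloor>x $ j / s\<rfloor>)" for x :: "real^3"
    define \<A> where "\<A> = (\<lambda>k. {x\<in>S. key x = k}) ` ({-n..n} \<times> {-n..n})"
    have "M / s \<ge> 1" using M s by (simp add: field_simps)
    have floor_in: "\<lfloor>x $ k / s\<rfloor> \<in> {-n..n}" if "x \<in> S" for x k
    proof -
      have "\<bar>x $ k\<bar> \<le> M" using M(2)[OF that] component_le_norm_cart[of x k] by linarith
      then have "\<bar>x $ k / s\<bar> \<le> M / s" using s by (simp add: divide_right_mono)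
      then have "x $ k / s \<le> M / s" "- (M / s) \<le> x $ k / s" by linarith+
      then show ?thesis unfolding n_def by (auto intro!: le_floor_iff[THEN iffD2] simp: floor_le_iff) linarith+
    qed
    have "finite \<A>" by (simp add: \<A>_def)
    moreover have "S \<subseteq> \<Union>\<A>" using floor_in by (auto simp: \<A>_def key_def)
    moreover have "bounded A \<and> diameter A \<le> h" if "A \<in> \<A>" for A
    proof
      obtain k where A: "A = {x\<in>S. key x = k}" using \<open>A \<in> \<A>\<close> unfolding \<A>_def by blast
      show "bounded A" using bounded_subset[OF assms(1)] A by simp
      have close: "\<bar>a $ l - b $ l\<bar> \<le> s" if "\<lfloor>a $ l / s\<rfloor> = \<lfloor>b $ l / s\<rfloor>" for a b :: "real^3" and l
      proof -
        have "\<bar>a $ l / s - b $ l / s\<bar> \<le> 1" using that by linarith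
        then have "\<bar>a $ l - b $ l\<bar> / s \<le> 1" using s by (simp add: diff_divide_distrib[symmetric])
        then show ?thesis using s by (simp add: divide_le_eq)
      qed
      show "diameter A \<le> h"
      proof (rule diameter_le)
        show "A \<noteq> {} \<or> 0 \<le> h" using h by simp
        fix a b assume "a \<in> A" "b \<in> A"
        then have ab: "a \<in> S" "b \<in> S" "key a = key b" using A by auto
        have "norm (a - b) \<le> L * (\<bar>a $ i - b $ i\<bar> + \<bar>a $ j - b $ j\<bar>)" using L ab by blast
        also have "\<dots> \<le> L * (s + s)" using ab(3) close \<open>L \<ge> 1\<close> by (intro mult_left_mono add_mono) (auto simp: key_def)
        also have "\<dots> = h" using \<open>L \<ge> 1\<close> by (simp add: s_def)
        finally show "norm (a - b) \<le> h" .
      qed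
    qed
    moreover have "real (card \<A>) * h\<^sup>2 \<le> 100 * M\<^sup>2 * L\<^sup>2"
    proof -
      have n0: "n \<ge> 0" "real_of_int n \<le> M / s + 1" unfolding n_def using \<open>M / s \<ge> 1\<close> by linarith+
      have "card \<A> \<le> card ({-n..n} \<times> {-n..n})" unfolding \<A>_def by (rule card_image_le) simp
      also have "\<dots> = (nat (2 * n + 1))\<^sup>2" by (simp add: card_cartesian_product power2_eq_square) 
      finally have "real (card \<A>) \<le> (real (nat (2 * n + 1)))\<^sup>2" by (metis of_nat_le_iff of_nat_power)
      \<comment> \<open>From \<open>n \<le> M / s + 1\<close> and \<open>1 \<le> M / s\<close>
        follows \<open>2 * n + 1 \<le> 5 * (M / s)\<close>.\<close>
      also have "\<dots> \<le> (5 * (M / s))\<^sup>2" using n0 \<open>M / s \<ge> 1\<close> by (intro power_mono) auto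
      finally have "real (card \<A>) * h\<^sup>2 \<le> (5 * (M / s))\<^sup>2 * h\<^sup>2" by (rule mult_right_mono) simp
      also have "\<dots> = 100 * M\<^sup>2 * L\<^sup>2" using h \<open>L \<ge> 1\<close> by (simp add: s_def power_mult_distrib power_divide)
      finally show ?thesis .
    qed
    ultimately show "\<exists>\<A>. finite \<A> \<and> S \<subseteq> \<Union>\<A> \<and> (\<forall>A\<in>\<A>. bounded A \<and> diameter A \<le> h) \<and> real (card \<A>) * h\<^sup>2 \<le> 100 * M\<^sup>2 * L\<^sup>2"
      by blast
  qed
qed

lemma hausdorff2_outer_finite:
  assumes "quad_covered S" shows "hausdorff2_outer S < \<infinity>"
proof -
  obtain C where C: "\<And>h. 0 < h \<Longrightarrow> h \<le> 1 \<Longrightarrow> \<exists>\<A>. finite \<A> \<and> S \<subseteq> \<Union>\<A>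
     \<and> (\<forall>A\<in>\<A>. bounded A \<and> diameter A \<le> h) \<and> real (card \<A>) * h\<^sup>2 \<le> C"
    using assms unfolding quad_covered_def by blast
  have "hausdorff2_pre \<delta> S \<le> ennreal (pi * C)" if "\<delta> > 0" for \<delta>
  proof -
    \<comment> \<open>\<open>quad_covered\<close> offers coverings at scales up to 1 only.\<close>
    define h where "h = min \<delta> 1"
    have h: "0 < h" "h \<le> 1" "h \<le> \<delta>" using that by (auto simp: h_def)
    obtain \<A> where \<A>: "finite \<A>" "S \<subseteq> \<Union>\<A>" "\<forall>A\<in>\<A>. bounded A \<and> diameter A \<le> h" "real (card \<A>) * h\<^sup>2 \<le> C"
      using C[of h] h(1,2) by blast
    obtain xs where xs: "set xs = \<A>" "distinct xs" using finite_distinct_list[OF \<A>(1)] by blast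
    \<comment> \<open>The finite cover is padded with empty sets to the sequence required by
      \<open>hausdorff2_pre\<close>; their diameter is 0, so they add nothing to the sum.\<close>
    define U where "U i = (if i < length xs then xs ! i else {})" for i
    have cov: "S \<subseteq> (\<Union>i. U i)"
    proof
      fix x assume "x \<in> S"
      then obtain A where A: "x \<in> A" "A \<in> set xs" using \<A>(2) xs(1) by blast
      then obtain i where "i < length xs" "A = xs ! i" by (auto simp: in_set_conv_nth)
      then show "x \<in> (\<Union>i. U i)" using A(1) by (auto simp: U_def intro!: exI[of _ i])
    qed
    have U: "bounded (U i) \<and> diameter (U i) \<le> h" for i
    proof (cases "i < length xs")
      case True
      then have "xs ! i \<in> \<A>" using xs(1) nth_mem by blast
      then show ?thesis using \<A>(3) True by (simp add: U_def)
    qed (use h in \<open>simp add: U_def\<close>)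
    have "U \<in> {U. S \<subseteq> (\<Union>i. U i) \<and> (\<forall>i. bounded (U i) \<and> diameter (U i) \<le> \<delta>)}"
    proof (intro CollectI conjI allI cov)
      show "bounded (U i)" "diameter (U i) \<le> \<delta>" for i using U[of i] h(3) by linarith+
    qed
    then have "hausdorff2_pre \<delta> S \<le> (\<Sum>i. ennreal (pi * (diameter (U i) / 2)^2))"
      unfolding hausdorff2_pre_def by (rule INF_lower)
    also have "\<dots> = (\<Sum>i<length xs. ennreal (pi * (diameter (U i) / 2)^2))"
      by (rule suminf_finite) (auto simp: U_def)
    also have "\<dots> \<le> (\<Sum>i<length xs. ennreal (pi * h^2))"
    proof (rule sum_mono, rule ennreal_leI, rule mult_left_mono, rule power_mono)
      show "diameter (U i) / 2 \<le> h" "0 \<le> diameter (U i) / 2" for i using U[of i] diameter_ge_0[of "U i"] h by auto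
    qed simp
    also have "\<dots> = ennreal (real (length xs) * (pi * h\<^sup>2))"
      by (subst sum_ennreal) auto
    also have "\<dots> \<le> ennreal (pi * C)"
    proof (rule ennreal_leI)
      have "real (length xs) = real (card \<A>)" using distinct_card[OF xs(2)] xs(1) by simp
      then have "real (length xs) * (pi * h\<^sup>2) = pi * (real (card \<A>) * h\<^sup>2)" by simp
      also have "\<dots> \<le> pi * C" using \<A>(4) by (intro mult_left_mono) auto
      finally show "real (length xs) * (pi * h\<^sup>2) \<le> pi * C" .
    qed
    finally show ?thesis .
  qed
  then have "hausdorff2_outer S \<le> ennreal (pi * C)"
    unfolding hausdorff2_outer_def by (intro SUP_least) auto
  then show ?thesis by (rule le_less_trans) simp
qed

text \<open>A ball of radius \<open>2 * h\<close> around any point of a covering set contains the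
  \<open>h\<close>-neighbourhood of that set. There are of order \<open>1 / h\<^sup>2\<close> such
  balls, each of volume of order \<open>h ^ 3\<close>.\<close>

lemma quad_covered_tube:
  fixes S :: "(real^3) set"
  assumes "quad_covered S"
  shows "\<exists>C\<ge>0. \<forall>h. 0 < h \<and> h \<le> 1 \<longrightarrow> (\<exists>B\<in>lmeasurable. {z. \<exists>y\<in>S. dist z y \<le> h} \<subseteq> B \<and> measure lebesgue B \<le> C * h)"
proof -
  obtain C where C: "\<And>h. 0 < h \<Longrightarrow> h \<le> 1 \<Longrightarrow> \<exists>\<A>. finite \<A> \<and> S \<subseteq> \<Union>\<A>
     \<and> (\<forall>A\<in>\<A>. bounded A \<and> diameter A \<le> h) \<and> real (card \<A>) * h\<^sup>2 \<le> C"
    using assms unfolding quad_covered_def by blast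
  have "C \<ge> 0"
  proof -
    obtain \<A> :: "(real^3) set set" where "real (card \<A>) * 1\<^sup>2 \<le> C" using C[of 1] by auto
    then show ?thesis by (smt (verit) mult_nonneg_nonneg of_nat_0_le_iff zero_le_power2)
  qed
  define v where "v = unit_ball_vol 3"
  have "v \<ge> 0" by (simp add: v_def)
  show ?thesis
  proof (intro exI[of _ "8 * v * C"] conjI allI impI)
    show "0 \<le> 8 * v * C" using \<open>C \<ge> 0\<close> \<open>v \<ge> 0\<close> by simp
    fix h :: real assume h: "0 < h \<and> h \<le> 1"
    obtain \<A> where \<A>: "finite \<A>" "S \<subseteq> \<Union>\<A>" "\<forall>A\<in>\<A>. bounded A \<and> diameter A \<le> h" "real (card \<A>) * h\<^sup>2 \<le> C"
      using C[of h] h by blast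
    define c where "c A = (SOME x. x \<in> A)" for A :: "(real^3) set"
    define B where "B = (\<Union>A\<in>\<A>. cball (c A) (2 * h))"
    have "B \<in> lmeasurable" unfolding B_def using \<A>(1) by (intro fmeasurable.finite_UN) auto
    moreover have "{z. \<exists>y\<in>S. dist z y \<le> h} \<subseteq> B"
    proof clarify
      fix z y assume y: "y \<in> S" "dist z y \<le> h"
      then obtain A where A: "A \<in> \<A>" "y \<in> A" using \<A>(2) by blast
      have "c A \<in> A" unfolding c_def using A(2) by (rule someI)
      then have "dist (c A) y \<le> h" using diameter_bounded_bound[of A "c A" y] \<A>(3) A by fastforce
      then have "dist (c A) z \<le> 2 * h" using y(2) dist_triangle[of "c A" z y] by (simp add: dist_commute)
      then show "z \<in> B" using A(1) by (auto simp: B_def)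
    qed
    moreover have "measure lebesgue B \<le> 8 * v * C * h"
    proof -
      have "measure lebesgue B \<le> (\<Sum>A\<in>\<A>. measure lebesgue (cball (c A) (2 * h)))"
        unfolding B_def using \<A>(1) by (intro measure_UNION_le) auto
      also have "\<dots> = (\<Sum>A\<in>\<A>. v * (2 * h)^3)"
        using h by (intro sum.cong) (simp_all add: content_cball v_def)
      also have "\<dots> = 8 * v * (real (card \<A>) * h\<^sup>2) * h" by (simp add: power3_eq_cube power2_eq_square)
      also have "\<dots> \<le> 8 * v * C * h" using \<A>(4) \<open>v \<ge> 0\<close> h by (intro mult_right_mono mult_left_mono) auto
      finally show ?thesis .
    qed
    ultimately show "\<exists>B\<in>lmeasurable. {z. \<exists>y\<in>S. dist z y \<le> h} \<subseteq> B \<and> measure lebesgue B \<le> 8 * v * C * h"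
      by blast
  qed
qed

section \<open>Defining functions and the outward normal\<close>

lemma linear_eq_inner_partials:
  fixes D :: "real^'n \<Rightarrow> real"
  assumes "linear D" shows "D v = (\<chi> j. D (axis j 1)) \<bullet> v"
proof -
  have "D v = D (\<Sum>j\<in>UNIV. v $ j *\<^sub>R axis j 1)" using basis_expansion[of v] by (simp add: scalar_mult_eq_scaleR)
  also have "\<dots> = (\<Sum>j\<in>UNIV. v $ j * D (axis j 1))" using assms by (simp add: linear_sum linear_scale)
  also have "\<dots> = (\<chi> j. D (axis j 1)) \<bullet> v" by (simp add: inner_vec_def mult.commute)
  finally show ?thesis .
qed

lemma grad_inner:
  assumes "(f has_derivative D) (at x)" shows "grad f x \<bullet> v = D v"
  using linear_eq_inner_partials[of D v] has_derivative_linear[OF assms] frechet_derivative_at[OF assms]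
  by (simp add: grad_def)

text \<open>The gradient is taken at a third point \<open>y\<close>, typically on the boundary,
  while \<open>a\<close> and \<open>b\<close> are free. The derivative of \<open>r\<close> is
  Lipschitz near \<open>x\<close>, so along the segment from \<open>a\<close> to \<open>b\<close> it
  differs from the derivative at \<open>y\<close> by at most \<open>L\<close> times the distances of
  \<open>a\<close> and \<open>b\<close> to \<open>y\<close>.\<close>

lemma local_defining_taylor:
  assumes "local_defining \<Omega> x U r"
  shows "\<exists>d>0. \<exists>L\<ge>0. ball x d \<subseteq> U \<and> (\<forall>y\<in>ball x d. \<forall>a\<in>ball x d. \<forall>b\<in>ball x d.
    \<bar>r b - r a - grad r y \<bullet> (b - a)\<bar> \<le> L * (norm (a - y) + norm (b - y)) * norm (b - a))"
proof -
  have U: "open U" "x \<in> U" and C: "\<And>k. C_k_on k U r"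
    using assms by (auto simp: local_defining_def smooth_on_def)
  let ?D = "\<lambda>y. frechet_derivative r (at y)"
  have der: "(r has_derivative ?D y) (at y)" if "y \<in> U" for y
    using C_k_on_has_derivative[of 0] C[of 1] that by simp
  have "C_k_on 1 U (\<lambda>y. ?D y b)" for b using C[of 2] by (simp add: numeral_2_eq_2)
  then have "\<forall>b. \<exists>d>0. \<exists>L. ball x d \<subseteq> U \<and> L-lipschitz_on (ball x d) (\<lambda>y. ?D y b)"
    using C_1_locally_lipschitz[OF U(1) _ U(2)] by blast
  then obtain d0 L0 where dL: "\<And>b. d0 b > 0" "\<And>b. ball x (d0 b) \<subseteq> U" "\<And>b. (L0 b)-lipschitz_on (ball x (d0 b)) (\<lambda>y. ?D y b)"
    by metis
  define d where "d = Min (d0 ` Basis)"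
  define L where "L = (\<Sum>b\<in>(Basis :: (real^3) set). L0 b)"
  have d: "d > 0" "\<And>b. b \<in> Basis \<Longrightarrow> d \<le> d0 b" using dL(1) by (auto simp: d_def)
  have L0: "L0 b \<ge> 0" for b using dL(3) lipschitz_on_nonneg by blast
  have sub: "ball x d \<subseteq> U"
  proof -
    obtain b :: "real^3" where "b \<in> Basis" using nonempty_Basis by blast
    then show ?thesis using d(2)[of b] dL(2)[of b] subset_ball[of d "d0 b" x] by blast
  qed
  have lip: "onorm (?D y - ?D z) \<le> L * norm (y - z)" if "y \<in> ball x d" "z \<in> ball x d" for y z
  proof (rule onorm_le)
    fix v
    have bl: "bounded_linear (\<lambda>v. ?D y v - ?D z v)"
      using der sub that by (intro bounded_linear_sub has_derivative_bounded_linear[OF der]) auto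
    have "norm (?D y v - ?D z v) \<le> (\<Sum>b\<in>Basis. norm (?D y b - ?D z b)) * norm v"
      by (rule norm_linear_Basis_bound[OF bl])
    also have "\<dots> \<le> (\<Sum>b\<in>Basis. L0 b * norm (y - z)) * norm v"
    proof (intro mult_right_mono sum_mono norm_ge_zero)
      fix b :: "real^3" assume "b \<in> Basis"
      then have "y \<in> ball x (d0 b)" "z \<in> ball x (d0 b)" using that d(2)[of b] by auto
      then show "norm (?D y b - ?D z b) \<le> L0 b * norm (y - z)" using lipschitz_on_normD[OF dL(3)] by blast
    qed
    finally show "norm ((?D y - ?D z) v) \<le> L * norm (y - z) * norm v" by (simp add: L_def sum_distrib_right)
  qed
  show ?thesis
  proof (rule exI[of _ d], intro conjI exI[of _ L] ballI)
    show "d > 0" "L \<ge> 0" "ball x d \<subseteq> U" using d(1) L0 sub by (auto simp: L_def sum_nonneg)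
    fix y a b assume yab: "y \<in> ball x d" "a \<in> ball x d" "b \<in> ball x d"
    let ?R = "norm (a - y) + norm (b - y)"
    \<comment> \<open>The first ball keeps the segment in the domain of \<open>r\<close>, the second
      keeps it close to \<open>y\<close>; the intersection is convex and contains \<open>a\<close>
      and \<open>b\<close>.\<close>
    let ?S = "ball x d \<inter> cball y ?R"
    have "norm (r b - r a - ?D y (b - a)) \<le> norm (b - a) * (L * ?R)"
    proof (rule differentiable_bound_linearization[where S = ?S])
      have cx: "convex ?S" by (intro convex_Int) auto
      have "a \<in> ?S" "b \<in> ?S" using yab by (auto simp: dist_norm norm_minus_commute)
      then have "closed_segment a b \<subseteq> ?S" using cx by (simp add: closed_segment_subset)
      moreover have "a + t *\<^sub>R (b - a) \<in> closed_segment a b" if "t \<in> {0..1}" for t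
        using that unfolding closed_segment_def
        by (intro CollectI exI[of _ t]) (auto simp: scaleR_diff_left scaleR_diff_right)
      ultimately show "a + t *\<^sub>R (b - a) \<in> ?S" if "t \<in> {0..1}" for t
        using that by (meson subsetD)
      show "(r has_derivative ?D z) (at z within ?S)" if "z \<in> ?S" for z
        by (rule has_derivative_at_withinI[OF der]) (use sub that in blast)
      show "onorm (?D z - ?D y) \<le> L * ?R" if "z \<in> ?S" for z
      proof -
        have "onorm (?D z - ?D y) \<le> L * norm (z - y)" using lip that yab by auto
        also have "\<dots> \<le> L * ?R" using that L0 by (intro mult_left_mono) (auto simp: dist_norm norm_minus_commute L_def sum_nonneg)
        finally show ?thesis .
      qed
      show "y \<in> ?S" using yab by simp
    qed
    moreover have "?D y (b - a) = grad r y \<bullet> (b - a)" using grad_inner[OF der] sub yab by auto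
    ultimately show "\<bar>r b - r a - grad r y \<bullet> (b - a)\<bar> \<le> L * ?R * norm (b - a)"
      by (simp add: mult.commute mult.left_commute)
  qed
qed

text \<open>A boundary point is not in the open set \<Omega>, so \<open>r\<close> is not negative
  there. A positive value would persist on a neighbourhood, which would then miss \<Omega>.\<close>

lemma local_defining_frontier:
  assumes "local_defining \<Omega> x U r" "open \<Omega>" "y \<in> frontier \<Omega>" "y \<in> U"
  shows "r y = 0"
proof (rule antisym)
  have U: "open U" and C: "continuous_on U r"
    using assms(1) C_k_on.simps(1)[of U r] unfolding local_defining_def smooth_on_def by blast+
  have eq: "\<Omega> \<inter> U = {y\<in>U. r y < 0}" using assms(1) by (simp add: local_defining_def)
  have "y \<notin> \<Omega>" using assms(2,3) by (simp add: frontier_def interior_open)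
  then show "0 \<le> r y" using eq assms(4) by force
  show "r y \<le> 0"
  proof (rule ccontr)
    assume "\<not> r y \<le> 0"
    then have y: "y \<in> U \<inter> r -` {0<..}" using assms(4) by simp
    have "open (U \<inter> r -` {0<..})" using C U by (simp add: continuous_on_open_vimage Int_commute)
    then have "\<Omega> \<inter> (U \<inter> r -` {0<..}) \<noteq> {}"
      using y assms(3) open_Int_closure_eq_empty[of "U \<inter> r -` {0<..}" \<Omega>] by (auto simp: frontier_def)
    then show False using eq by force
  qed
qed

text \<open>\<open>outward_normal\<close> is a definite description, so it has a meaning only once
  this is known. If two defining functions gave different unit normals \<open>n\<close> and
  \<open>n'\<close>, a small move from \<open>x\<close> along \<open>n' - n\<close> would decrease
  the first function and increase the second, so the same point would be inside and outside
  \<Omega>.\<close>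

lemma outward_normal_direction_unique:
  assumes "local_defining \<Omega> x U r" "local_defining \<Omega> x U' r'" "open \<Omega>" "x \<in> frontier \<Omega>"
  shows "grad r x /\<^sub>R norm (grad r x) = grad r' x /\<^sub>R norm (grad r' x)"
proof (rule ccontr)
  define n n' where "n = grad r x /\<^sub>R norm (grad r x)" and "n' = grad r' x /\<^sub>R norm (grad r' x)"
  note n_def = this
  assume "grad r x /\<^sub>R norm (grad r x) \<noteq> grad r' x /\<^sub>R norm (grad r' x)"
  then have ne: "n \<noteq> n'" by (simp add: n_def)
  define v where "v = n' - n"
  have x: "x \<in> U" "x \<in> U'" and g: "grad r x \<noteq> 0" "grad r' x \<noteq> 0"
    using assms(1,2) by (auto simp: local_defining_def)
  have unit: "n \<bullet> n = 1" "n' \<bullet> n' = 1" using g by (simp_all add: n_def dot_square_norm power2_eq_square)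
  have "v \<bullet> v > 0" using ne by (simp add: v_def)
  then have lt: "n \<bullet> n' < 1" using unit by (simp add: v_def inner_diff inner_commute)
  \<comment> \<open>\<open>m\<close> is the rate of change along \<open>v\<close>:
    \<open>n \<bullet> v = - m\<close> and \<open>n' \<bullet> v = m\<close>.\<close>
  define m where "m = 1 - n \<bullet> n'"
  have m: "m > 0" using lt by (simp add: m_def)
  have "grad r x = norm (grad r x) *\<^sub>R n" "grad r' x = norm (grad r' x) *\<^sub>R n'" using g by (simp_all add: n_def)
  then have s: "grad r x \<bullet> v = - norm (grad r x) * m" "grad r' x \<bullet> v = norm (grad r' x) * m"
    using unit by (metis (no_types, lifting) inner_scaleR_left inner_diff_right v_def m_def mult_minus_left mult_minus_right minus_diff_eq,
     metis (no_types, lifting) inner_scaleR_left inner_diff_right v_def m_def inner_commute)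
  obtain d L where d: "d > 0" "L \<ge> 0" "ball x d \<subseteq> U" and T: "\<And>y a b. y\<in>ball x d \<Longrightarrow> a\<in>ball x d \<Longrightarrow> b\<in>ball x d \<Longrightarrow>
    \<bar>r b - r a - grad r y \<bullet> (b - a)\<bar> \<le> L * (norm (a - y) + norm (b - y)) * norm (b - a)"
    using local_defining_taylor[OF assms(1)] by blast
  obtain d' L' where d': "d' > 0" "L' \<ge> 0" "ball x d' \<subseteq> U'" and T': "\<And>y a b. y\<in>ball x d' \<Longrightarrow> a\<in>ball x d' \<Longrightarrow> b\<in>ball x d' \<Longrightarrow>
    \<bar>r' b - r' a - grad r' y \<bullet> (b - a)\<bar> \<le> L' * (norm (a - y) + norm (b - y)) * norm (b - a)"
    using local_defining_taylor[OF assms(2)] by blast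
  define N where "N = norm v"
  have N: "N > 0" using \<open>v \<bullet> v > 0\<close> by (auto simp: N_def)
  \<comment> \<open>For small \<open>t\<close> the quadratic Taylor errors are dominated by the
    first-order changes, which are \<open>t * m\<close> times the norms of the gradients.\<close>
  have "\<forall>\<^sub>F t in at_right 0. t * N < d \<and> t * N < d' \<and> L * N\<^sup>2 * t < norm (grad r x) * m \<and> L' * N\<^sup>2 * t < norm (grad r' x) * m \<and> t > 0"
  proof (intro eventually_conj)
    have *: "((\<lambda>t. c * t) \<longlongrightarrow> c * 0) (at_right 0)" for c :: real by (intro tendsto_intros)
    show "\<forall>\<^sub>F t in at_right 0. t * N < d" "\<forall>\<^sub>F t in at_right 0. t * N < d'"
      using order_tendstoD(2)[OF *[of N]] d(1) d'(1) by (simp_all add: mult.commute)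
    show "\<forall>\<^sub>F t in at_right 0. L * N\<^sup>2 * t < norm (grad r x) * m" 
      using order_tendstoD(2)[OF *[of "L * N\<^sup>2"]] g m by simp
    show "\<forall>\<^sub>F t in at_right 0. L' * N\<^sup>2 * t < norm (grad r' x) * m" 
      using order_tendstoD(2)[OF *[of "L' * N\<^sup>2"]] g m by simp
    show "\<forall>\<^sub>F t::real in at_right 0. 0 < t" by (simp add: eventually_at_right_less)
  qed
  then obtain t where t: "t * N < d" "t * N < d'" "L * N\<^sup>2 * t < norm (grad r x) * m" "L' * N\<^sup>2 * t < norm (grad r' x) * m" "t > 0"
    using eventually_happens'[OF trivial_limit_at_right_real] by blast
  let ?z = "x + t *\<^sub>R v"
  have z: "?z \<in> ball x d" "?z \<in> ball x d'" using t by (auto simp: dist_norm N_def)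
  have r0: "r x = 0" "r' x = 0" using local_defining_frontier assms x by blast+
  have "\<bar>r ?z - r x - grad r x \<bullet> (?z - x)\<bar> \<le> L * (norm (x - x) + norm (?z - x)) * norm (?z - x)"
    by (rule T) (use z d in auto)
  then have "\<bar>r ?z - t * (grad r x \<bullet> v)\<bar> \<le> t * (L * N\<^sup>2 * t)" using r0 t(5) by (simp add: N_def power2_eq_square mult_ac)
  also have "\<dots> < t * (norm (grad r x) * m)" using t(3,5) by simp
  finally have "r ?z < 0" unfolding s(1) by (simp add: abs_less_iff)
  then have "?z \<in> \<Omega>" using assms(1) z(1) d(3) by (auto simp: local_defining_def)
  have "\<bar>r' ?z - r' x - grad r' x \<bullet> (?z - x)\<bar> \<le> L' * (norm (x - x) + norm (?z - x)) * norm (?z - x)"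
    by (rule T') (use z d' in auto)
  then have "\<bar>r' ?z - t * (grad r' x \<bullet> v)\<bar> \<le> t * (L' * N\<^sup>2 * t)" using r0 t(5) by (simp add: N_def power2_eq_square mult_ac)
  also have "\<dots> < t * (norm (grad r' x) * m)" using t(4,5) by simp
  finally have "r' ?z > 0" unfolding s(2) by (simp add: abs_less_iff)
  moreover have "r' ?z < 0" using assms(2) z(2) d'(3) \<open>?z \<in> \<Omega>\<close> by (auto simp: local_defining_def)
  ultimately show False by simp
qed

lemma outward_normal_eq:
  assumes "local_defining \<Omega> x U r" "open \<Omega>" "x \<in> frontier \<Omega>"
  shows "outward_normal \<Omega> x = grad r x /\<^sub>R norm (grad r x)"
  unfolding outward_normal_def
proof (rule the_equality)
  show "\<exists>U r'. local_defining \<Omega> x U r' \<and> grad r x /\<^sub>R norm (grad r x) = grad r' x /\<^sub>R norm (grad r' x)"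
    using assms(1) by blast
qed (use outward_normal_direction_unique[OF _ assms(1,2,3)] in blast)

lemma local_defining_other_point:
  "local_defining \<Omega> x U r \<Longrightarrow> y \<in> U \<Longrightarrow> local_defining \<Omega> y U r"
  by (simp add: local_defining_def)

lemma tangent_grad_eq_0:
  assumes "local_defining \<Omega> x U r" "open \<Omega>" "y \<in> U" "y \<in> frontier \<Omega>" "v \<bullet> outward_normal \<Omega> y = 0"
  shows "grad r y \<bullet> v = 0"
proof -
  have "local_defining \<Omega> y U r" using assms(1,3) local_defining_other_point by blast
  moreover then have "grad r y \<noteq> 0" by (simp add: local_defining_def)
  ultimately show ?thesis
    using outward_normal_eq[of \<Omega> y U r] assms by (simp add: inner_commute)
qed

text \<open>Solving the almost vanishing \<open>n \<bullet> v\<close> for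
  \<open>n $ k * v $ k\<close> and absorbing half of it bounds the coordinate \<open>k\<close> of
  \<open>v\<close> by the other two. The hypothesis \<open>UN\<close> says that \<open>i\<close>,
  \<open>j\<close>, \<open>k\<close> enumerate the three indices.\<close>

lemma frontier_graph_estimate:
  fixes n :: "real^3"
  assumes "n $ k \<noteq> 0" and UN: "\<And>f :: 3 \<Rightarrow> real. sum f UNIV = f i + f j + f k"
  defines "L \<equiv> 2 + 2 * norm n / \<bar>n $ k\<bar>"
  assumes "\<bar>n \<bullet> v\<bar> \<le> \<bar>n $ k\<bar> / 2 * norm v"
  shows "norm v \<le> L * (\<bar>v $ i\<bar> + \<bar>v $ j\<bar>)"
proof -
  let ?s = "\<bar>v $ i\<bar> + \<bar>v $ j\<bar>"
  have nv: "norm v \<le> ?s + \<bar>v $ k\<bar>"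
    using norm_le_l1_cart[of v] UN[of "\<lambda>l. \<bar>v $ l\<bar>"] by simp
  have "n \<bullet> v = n $ i * v $ i + n $ j * v $ j + n $ k * v $ k"
    unfolding inner_vec_def by (simp add: UN)
  then have "\<bar>n $ k\<bar> * \<bar>v $ k\<bar> \<le> \<bar>n \<bullet> v\<bar> + \<bar>n $ i\<bar> * \<bar>v $ i\<bar> + \<bar>n $ j\<bar> * \<bar>v $ j\<bar>"
    unfolding abs_mult[symmetric] by linarith
  also have "\<dots> \<le> \<bar>n $ k\<bar> / 2 * (?s + \<bar>v $ k\<bar>) + norm n * \<bar>v $ i\<bar> + norm n * \<bar>v $ j\<bar>"
    using assms(4) mult_left_mono[OF nv, of "\<bar>n $ k\<bar> / 2"]
    by (intro add_mono mult_right_mono component_le_norm_cart) auto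
  finally have "\<bar>n $ k\<bar> * \<bar>v $ k\<bar> \<le> (\<bar>n $ k\<bar> + 2 * norm n) * ?s" by (simp add: algebra_simps)
  then have "\<bar>v $ k\<bar> \<le> (\<bar>n $ k\<bar> + 2 * norm n) * ?s / \<bar>n $ k\<bar>"
    using assms(1) by (simp add: pos_le_divide_eq mult.commute)
  also have "\<dots> = (L - 1) * ?s" using assms(1) by (simp add: L_def field_simps)
  finally show ?thesis using nv by (simp add: algebra_simps)
qed

text \<open>Since \<open>r\<close> vanishes at any two boundary points near \<open>p\<close>, their
  difference is almost orthogonal to the gradient at \<open>p\<close>. If the component
  \<open>k\<close> of the gradient is nonzero, the boundary near \<open>p\<close> is therefore a
  Lipschitz graph over the other two coordinates.\<close>

lemma quad_covered_frontier:
  assumes "smooth_bounded_domain \<Omega>" shows "quad_covered (frontier \<Omega>)"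
proof (rule compact_local_to_global)
  have dom: "open \<Omega>" "bounded \<Omega>" and loc: "\<And>x. x \<in> frontier \<Omega> \<Longrightarrow> \<exists>U r. local_defining \<Omega> x U r"
    using assms by (auto simp: smooth_bounded_domain_def)
  show "compact (frontier \<Omega>)" using dom by (simp add: compact_frontier_bounded)
  fix p assume p: "p \<in> frontier \<Omega>"
  obtain U r where Ur: "local_defining \<Omega> p U r" using loc[OF p] by blast
  define n where "n = grad r p"
  have "n \<noteq> 0" using Ur by (auto simp: local_defining_def n_def)
  then obtain k where k: "n $ k \<noteq> 0" by (metis vec_eq_iff zero_index)
  obtain i j where UN: "\<And>f :: 3 \<Rightarrow> real. sum f UNIV = f i + f j + f k"
  proof -
    have "sum f UNIV = f 2 + f 3 + f 1" "sum f UNIV = f 1 + f 3 + f 2" for f :: "3 \<Rightarrow> real" by (simp_all add: sum_3)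
    then show ?thesis using that sum_3 exhaust_3[of k] by metis
  qed
  obtain d L where d: "d > 0" "L \<ge> 0" "ball p d \<subseteq> U" and T: "\<And>y a b. y\<in>ball p d \<Longrightarrow> a\<in>ball p d \<Longrightarrow> b\<in>ball p d \<Longrightarrow>
    \<bar>r b - r a - grad r y \<bullet> (b - a)\<bar> \<le> L * (norm (a - y) + norm (b - y)) * norm (b - a)"
    using local_defining_taylor[OF Ur] by blast
  \<comment> \<open>This radius keeps the relative Taylor error, about \<open>2 * L * e\<close>,
    below \<open>\<bar>n $ k\<bar> / 2\<close>, the tolerance of
    \<open>frontier_graph_estimate\<close>.\<close>
  define e where "e = min d (\<bar>n $ k\<bar> / (4 * (L + 1)))"
  have e: "e > 0" "e \<le> d" "e \<le> \<bar>n $ k\<bar> / (4 * (L + 1))" using d k by (auto simp: e_def)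
  have "quad_covered (frontier \<Omega> \<inter> ball p e)"
  proof (rule quad_covered_lipschitz_graph)
    show "bounded (frontier \<Omega> \<inter> ball p e)" by (simp add: bounded_Int)
    show "1 \<le> 2 + 2 * norm n / \<bar>n $ k\<bar>" by (simp add: add_nonneg_nonneg)
    fix a b assume ab: "a \<in> frontier \<Omega> \<inter> ball p e" "b \<in> frontier \<Omega> \<inter> ball p e"
    then have abU: "a \<in> ball p d" "b \<in> ball p d" using e by auto
    have "r a = 0" "r b = 0" using local_defining_frontier[OF Ur dom(1)] ab abU d(3) by auto
    then have "\<bar>n \<bullet> (a - b)\<bar> \<le> L * (norm (b - p) + norm (a - p)) * norm (a - b)"
      using T[of p b a] abU d(1) by (simp add: n_def)
    also have "\<dots> \<le> \<bar>n $ k\<bar> / 2 * norm (a - b)"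
    proof (rule mult_right_mono)
      have "L * (norm (b - p) + norm (a - p)) \<le> (L + 1) * (e + e)"
        using ab d(2) by (intro mult_mono add_mono) (auto simp: dist_norm norm_minus_commute)
      also have "\<dots> \<le> \<bar>n $ k\<bar> / 2" using e(3) d(2) by (simp add: field_simps)
      finally show "L * (norm (b - p) + norm (a - p)) \<le> \<bar>n $ k\<bar> / 2" .
    qed simp
    finally show "norm (a - b) \<le> (2 + 2 * norm n / \<bar>n $ k\<bar>) * (\<bar>a $ i - b $ i\<bar> + \<bar>a $ j - b $ j\<bar>)"
      using frontier_graph_estimate[OF k UN, of "a - b"] by simp
  qed
  then show "\<exists>d>0. quad_covered (frontier \<Omega> \<inter> ball p d)" using e(1) by blast
qed (auto intro: quad_covered_empty quad_covered_Un)

lemma finite_measure_surface: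
  assumes "smooth_bounded_domain \<Omega>" shows "finite_measure (surface_measure \<Omega>)"
proof
  have fs: "frontier \<Omega> \<in> sets borel" by (simp add: borel_closed)
  have s: "sets hausdorff2 = sets borel" "space hausdorff2 = UNIV"
    unfolding hausdorff2_def using sets.sigma_sets_eq[of borel] by (simp_all add: space_measure_of_conv sets_measure_of_conv)
  have sp: "space (surface_measure \<Omega>) = frontier \<Omega>" by (simp add: surface_measure_def space_restrict_space s)
  have "emeasure (surface_measure \<Omega>) (frontier \<Omega>) = emeasure hausdorff2 (frontier \<Omega>)"
    unfolding surface_measure_def by (rule emeasure_restrict_space) (use fs s in auto)
  \<comment> \<open>\<open>measure_of\<close> yields either the prescribed set function or zero, and
    \<open>hausdorff2_outer\<close> is an upper bound in both cases.\<close>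
  also have "\<dots> \<le> hausdorff2_outer (frontier \<Omega>)" unfolding hausdorff2_def by (simp add: emeasure_measure_of_conv)
  also have "\<dots> < \<infinity>" by (rule hausdorff2_outer_finite[OF quad_covered_frontier[OF assms]])
  finally show "emeasure (surface_measure \<Omega>) (space (surface_measure \<Omega>)) \<noteq> \<infinity>" by (simp add: sp)
qed


section \<open>The divergence theorem for tangent fields\<close>

text \<open>A point \<open>x + h V x\<close> leaving \<open>\<Omega>\<close> crosses the boundary near a point where \<open>V\<close> is tangent,
  so it overshoots by at most order \<open>h\<^sup>2\<close>.\<close>

lemma tangent_step_close_local:
  assumes dom: "open \<Omega>" and loc: "local_defining \<Omega> p W r" and p: "p \<in> frontier \<Omega>"
    and V: "M-lipschitz_on (closure \<Omega>) V" and K: "\<And>x. x \<in> closure \<Omega> \<Longrightarrow> norm (V x) \<le> K"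
    and tan: "\<And>x. x \<in> frontier \<Omega> \<Longrightarrow> V x \<bullet> outward_normal \<Omega> x = 0"
  shows "\<exists>d>0. \<exists>C>0. \<forall>y\<in>frontier \<Omega> \<inter> ball p d. \<forall>h x. 0 < h \<and> h \<le> 1 / C \<and> x \<in> \<Omega> \<and> norm (x - y) \<le> h * K
    \<and> x + h *\<^sub>R V x \<notin> \<Omega> \<longrightarrow> (\<exists>w\<in>frontier \<Omega>. dist (x + h *\<^sub>R V x) w \<le> C * h\<^sup>2)"
proof -
  have eq: "\<Omega> \<inter> W = {y\<in>W. r y < 0}" using loc by (simp add: local_defining_def)
  have M: "M \<ge> 0" using V lipschitz_on_nonneg by blast
  have clp: "p \<in> closure \<Omega>" using p by (simp add: frontier_def)
  have K0: "K \<ge> 0" using K[OF clp] norm_ge_zero[of "V p"] by linarith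
  define n where "n = grad r p"
  have n: "n \<noteq> 0" using loc by (auto simp: local_defining_def n_def)
  obtain d0 L where d0: "d0 > 0" "L \<ge> 0" "ball p d0 \<subseteq> W" and T: "\<And>y a b. y\<in>ball p d0 \<Longrightarrow> a\<in>ball p d0 \<Longrightarrow> b\<in>ball p d0 \<Longrightarrow>
    \<bar>r b - r a - grad r y \<bullet> (b - a)\<bar> \<le> L * (norm (a - y) + norm (b - y)) * norm (b - a)"
    using local_defining_taylor[OF loc] by blast
  define N where "N = norm n"
  have N: "N > 0" using n by (simp add: N_def)
  text \<open>\<open>e\<close> is so small that \<open>r\<close> decreases at rate at least \<open>1/2\<close> along \<open>- n / N\<^sup>2\<close>.\<close>
  define e where "e = min d0 (N / (4 * (L + 1)))"
  have e: "e > 0" "e \<le> d0" "L * (2 * e) \<le> N / 2"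
  proof -
    show "e > 0" "e \<le> d0" using d0 N by (auto simp: e_def)
    have "L * (2 * e) \<le> (L + 1) * (2 * (N / (4 * (L + 1))))"
      using d0(2) \<open>e > 0\<close> by (intro mult_mono) (auto simp: e_def)
    also have "\<dots> = N / 2" using d0(2) by (simp add: field_simps)
    finally show "L * (2 * e) \<le> N / 2" .
  qed
  text \<open>The gradient is bounded near \<open>p\<close> by the Taylor estimate itself.\<close>
  define G where "G = N + 2 * L * d0"
  have G0: "G \<ge> 0" using N d0 by (simp add: G_def)
  have grad_bd: "\<bar>grad r y \<bullet> v\<bar> \<le> G * norm v" if y: "y \<in> ball p (e / 2)" for y v
  proof (cases "v = 0")
    case False
    define t where "t = e / 2 / norm v"
    define w where "w = t *\<^sub>R v"
    have t: "t > 0" "norm w = e / 2" using False e by (auto simp: t_def w_def)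
    have z: "y + w \<in> ball p d0" 
    proof -
      have "dist p (y + w) \<le> dist p y + norm (w)" by (metis dist_norm dist_triangle add_diff_cancel_left' norm_minus_commute)
      then show ?thesis using y e t by simp
    qed
    have yb: "y \<in> ball p d0" "p \<in> ball p d0" using y e d0 by auto
    have 1: "\<bar>r (y + w) - r y - grad r y \<bullet> (w)\<bar> \<le> L * (e / 2) * (e / 2)"
      using T[OF yb(1) yb(1) z] t by (simp add: mult.assoc)
    have 2: "\<bar>r (y + w) - r y - n \<bullet> (w)\<bar> \<le> L * (norm (y - p) + norm (y + w - p)) * (e / 2)"
      using T[OF yb(2) yb(1) z] t by (simp add: n_def)
    have "norm (y - p) \<le> e / 2" using y by (simp add: dist_norm norm_minus_commute)
    moreover have "norm (y + w - p) \<le> norm (y - p) + norm (w)" 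
      using norm_triangle_ineq[of "y - p" "w"] by (simp add: algebra_simps)
    ultimately have 3: "norm (y - p) + norm (y + w - p) \<le> 3 * (e / 2)" using t by linarith
    have "L * (norm (y - p) + norm (y + w - p)) * (e / 2) \<le> L * (3 * (e / 2)) * (e / 2)"
      using 3 d0(2) e(1) by (intro mult_right_mono mult_left_mono) auto
    then have "\<bar>grad r y \<bullet> (w) - n \<bullet> (w)\<bar> \<le> L * (e / 2) * (e / 2) + L * (3 * (e / 2)) * (e / 2)"
      using add_mono[OF 1 order_trans[OF 2]] abs_triangle_ineq4[of "r (y + w) - r y - n \<bullet> w" "r (y + w) - r y - grad r y \<bullet> w"] by fastforce
    also have "\<dots> = (2 * L * e) * (e / 2)" by (simp add: algebra_simps)
    finally have "\<bar>grad r y \<bullet> (w)\<bar> \<le> (2 * L * e) * (e / 2) + \<bar>n \<bullet> (w)\<bar>" by linarith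
    also have "\<dots> \<le> (2 * L * d0) * (e / 2) + N * (e / 2)"
    proof (rule add_mono)
      show "2 * L * e * (e / 2) \<le> 2 * L * d0 * (e / 2)" using e d0 by (intro mult_right_mono mult_left_mono) auto
      show "\<bar>n \<bullet> (w)\<bar> \<le> N * (e / 2)" using Cauchy_Schwarz_ineq2[of n "w"] unfolding t(2) N_def .
    qed
    also have "\<dots> = G * norm (w)" unfolding t(2) G_def by (simp add: algebra_simps)
    finally show ?thesis using t(1) by (simp add: w_def abs_mult)
  qed simp
  text \<open>\<open>C1 h\<^sup>2\<close> bounds \<open>r (x + h V x)\<close>.\<close>
  define C1 where "C1 = (3 * L * K + G * M) * K + 1"
  have C1: "C1 \<ge> 1" using d0 K0 G0 M by (simp add: C1_def)
  define d where "d = e / 4"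
  \<comment> \<open>The summands have separate tasks: \<open>8 * (K + 1) / e\<close> keeps
    \<open>x\<close> and \<open>z\<close> near \<open>p\<close>, \<open>12 * C1 / (N * e)\<close>
    does the same for \<open>z'\<close>, and \<open>3 * C1 / N\<close> bounds the final distance to
    the boundary.\<close>
  define C where "C = 1 + 8 * (K + 1) / e + 3 * C1 / N + 12 * C1 / (N * e)"
  have Cpos: "C \<ge> 1" "8 * (K + 1) / e \<le> C" "3 * C1 / N \<le> C" "12 * C1 / (N * e) \<le> C"
    using K0 e N C1 by (simp_all add: C_def)
  show ?thesis
  proof (rule exI[of _ d], intro conjI exI[of _ C] ballI allI impI)
    show "d > 0" using e by (simp add: d_def)
    show "C > 0" using Cpos by simp
    fix y h x
    assume y: "y \<in> frontier \<Omega> \<inter> ball p d"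
      and A: "0 < h \<and> h \<le> 1 / C \<and> x \<in> \<Omega> \<and> norm (x - y) \<le> h * K \<and> x + h *\<^sub>R V x \<notin> \<Omega>"
    have h: "h > 0" "h * C \<le> 1" using A Cpos(1) by (auto simp: field_simps)
    then have h1: "h \<le> 1" using mult_left_mono[OF Cpos(1), of h] by linarith
    have hK: "h * (8 * (K + 1) / e) \<le> 1" "h * (12 * C1 / (N * e)) \<le> 1"
      using h Cpos mult_left_mono[of _ C h] by (meson less_imp_le order_trans)+
    have hK': "h * (K + 1) \<le> e / 8" using hK(1) e by (simp add: field_simps)
    then have hKe: "h * K \<le> e / 8" using h by (simp add: algebra_simps)
    have xcl: "x \<in> closure \<Omega>" and ycl: "y \<in> closure \<Omega>" using A y closure_subset by (auto simp: frontier_def)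
    define z where "z = x + h *\<^sub>R V x"
    have xy: "norm (x - y) \<le> h * K" using A by simp
    have Vx: "norm (V x) \<le> K" "norm (V y) \<le> K" using K xcl ycl by auto
    have zx: "norm (z - x) \<le> h * K" using Vx h by (simp add: z_def)
    have zy: "norm (z - y) \<le> 2 * (h * K)"
      using norm_triangle_ineq[of "z - x" "x - y"] zx xy by simp
    have yp: "norm (y - p) < e / 4" using y by (simp add: d_def dist_norm norm_minus_commute)
    have xp: "norm (x - p) < 3 * e / 8" using norm_triangle_ineq[of "x - y" "y - p"] xy yp hKe by simp
    have zp: "norm (z - p) < e / 2" using norm_triangle_ineq[of "z - y" "y - p"] zy yp hKe by simp
    have inb: "y \<in> ball p (e / 2)" "y \<in> ball p d0" "x \<in> ball p d0" "z \<in> ball p d0" "p \<in> ball p d0"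
      using yp xp zp e d0 by (auto simp: dist_norm norm_minus_commute)
    have "r x < 0" using eq A inb(3) d0(3) by blast
    have "\<bar>r z - r x - grad r y \<bullet> (z - x)\<bar> \<le> L * (norm (x - y) + norm (z - y)) * norm (z - x)"
      by (rule T[OF inb(2,3,4)])
    also have "\<dots> \<le> L * (3 * (h * K)) * (h * K)"
      using xy zy zx d0(2) h K0 by (intro mult_mono mult_left_mono) auto
    finally have 1: "\<bar>r z - r x - h * (grad r y \<bullet> V x)\<bar> \<le> L * (3 * (h * K)) * (h * K)" by (simp add: z_def)
    \<comment> \<open>Tangency removes the first-order term at \<open>y\<close>. At \<open>x\<close>
      this term is still of order \<open>h\<close> by the Lipschitz bound on \<open>V\<close>, so
      \<open>r z\<close> exceeds 0 by at most order \<open>h\<^sup>2\<close>.\<close>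
    have "grad r y \<bullet> V y = 0"
      using tangent_grad_eq_0[OF loc dom _ _ tan] y inb(2) d0(3) by blast
    then have "\<bar>grad r y \<bullet> V x\<bar> = \<bar>grad r y \<bullet> (V x - V y)\<bar>" by (simp add: inner_diff_right)
    also have "\<dots> \<le> G * norm (V x - V y)" by (rule grad_bd[OF inb(1)])
    also have "\<dots> \<le> G * (M * (h * K))"
    proof (rule mult_left_mono[OF _ G0])
      have "norm (V x - V y) \<le> M * norm (x - y)" using lipschitz_on_normD[OF V xcl ycl] .
      also have "\<dots> \<le> M * (h * K)" using xy M by (rule mult_left_mono)
      finally show "norm (V x - V y) \<le> M * (h * K)" .
    qed
    finally have "h * (grad r y \<bullet> V x) \<le> h * (G * (M * (h * K)))"
      using h(1) by (intro mult_left_mono) auto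
    then have "r z < L * (3 * (h * K)) * (h * K) + h * (G * (M * (h * K)))"
      using 1 \<open>r x < 0\<close> by linarith
    also have "\<dots> = (C1 - 1) * h\<^sup>2" by (simp add: C1_def power2_eq_square algebra_simps)
    also have "\<dots> \<le> C1 * h\<^sup>2" by (intro mult_right_mono) auto
    finally have rz: "r z < C1 * h\<^sup>2" .
    \<comment> \<open>Moving from \<open>z\<close> by \<open>s / N\<close> against the gradient
      lowers \<open>r\<close> by at least \<open>s / 2\<close>, which exceeds the overshoot
      \<open>C1 * h\<^sup>2\<close>. So \<open>z'\<close> is inside, and the boundary is crossed
      between \<open>z\<close> and \<open>z'\<close>.\<close>
    define s where "s = 3 * C1 * h\<^sup>2"
    have s: "s > 0" "s / N \<le> e / 4"
    proof -
      show "s > 0" using C1 h by (simp add: s_def)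
      have "s / N = 3 * C1 / N * h * h" by (simp add: s_def power2_eq_square)
      also have "\<dots> \<le> 3 * C1 / N * h * 1" using h1 C1 N h by (intro mult_left_mono) auto
      also have "\<dots> \<le> e / 4" using hK(2) e N by (simp add: field_simps)
      finally show "s / N \<le> e / 4" .
    qed
    define z' where "z' = z - (s / N\<^sup>2) *\<^sub>R n"
    have z'z: "z' - z = - (s / N\<^sup>2) *\<^sub>R n" "norm (z' - z) = s / N"
      using s N by (auto simp: z'_def N_def power2_eq_square)
    have "norm (z' - p) \<le> norm (z' - z) + norm (z - p)" using norm_triangle_ineq[of "z' - z" "z - p"] by simp
    then have z'p: "norm (z' - p) < 3 * e / 4" using z'z(2) s(2) zp by linarith
    then have z'b: "z' \<in> ball p d0" using e by (simp add: dist_norm norm_minus_commute)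
    have "\<bar>r z' - r z - n \<bullet> (z' - z)\<bar> \<le> L * (norm (z - p) + norm (z' - p)) * norm (z' - z)"
      unfolding n_def by (rule T[OF inb(5,4) z'b])
    also have "\<dots> \<le> L * (2 * e) * (s / N)" unfolding z'z(2)
      using zp z'p d0(2) s(1) N e(1) by (intro mult_right_mono mult_left_mono) auto
    also have "\<dots> \<le> N / 2 * (s / N)" using e(3) s(1) N by (intro mult_right_mono) auto
    also have "\<dots> = s / 2" using N by simp
    finally have "\<bar>r z' - r z + s\<bar> \<le> s / 2"
      using N by (simp add: z'z(1) dot_square_norm N_def[symmetric])
    then have "r z' < 0" using rz s(1) s_def by linarith
    then have "z' \<in> \<Omega>" using eq z'b d0(3) by blast
    moreover have "z \<notin> \<Omega>" using A by (simp add: z_def)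
    ultimately have "closed_segment z z' \<inter> frontier \<Omega> \<noteq> {}"
      by (intro connected_Int_frontier) (auto simp: connected_segment)
    then obtain w where w: "w \<in> closed_segment z z'" "w \<in> frontier \<Omega>" by blast
    have "dist z w \<le> dist z z'" using dist_in_closed_segment[OF w(1)] by (simp add: dist_commute)
    also have "\<dots> = 3 * C1 / N * h\<^sup>2" using z'z(2) by (simp add: dist_norm norm_minus_commute s_def)
    also have "\<dots> \<le> C * h\<^sup>2" using Cpos(3) by (intro mult_right_mono) auto
    finally show "\<exists>w\<in>frontier \<Omega>. dist (x + h *\<^sub>R V x) w \<le> C * h\<^sup>2" using w(2) unfolding z_def by blast
  qed
qed

text \<open>The segment from \<open>x\<close> to its displaced point outside \<Omega> meets the
  boundary at some \<open>y\<close>; \<open>P C y\<close> is the claim with this crossing point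
  fixed, which is local in \<open>y\<close>. Enlarging \<open>C\<close> shortens the range of
  \<open>h\<close> and weakens the estimate, so the local constants combine by a maximum.\<close>

lemma tangent_step_close:
  assumes "smooth_bounded_domain \<Omega>"
    and V: "M-lipschitz_on (closure \<Omega>) V"
    and tan: "\<And>x. x \<in> frontier \<Omega> \<Longrightarrow> V x \<bullet> outward_normal \<Omega> x = 0"
  shows "\<exists>C>0. \<forall>h x. 0 < h \<and> h \<le> 1 / C \<and> x \<in> \<Omega> \<and> x + h *\<^sub>R V x \<notin> \<Omega> \<longrightarrow>
    (\<exists>w\<in>frontier \<Omega>. dist (x + h *\<^sub>R V x) w \<le> C * h\<^sup>2)"
proof -
  have dom: "open \<Omega>" "bounded \<Omega>" and loc: "\<And>x. x \<in> frontier \<Omega> \<Longrightarrow> \<exists>U r. local_defining \<Omega> x U r"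
    using assms by (auto simp: smooth_bounded_domain_def)
  have "compact (V ` closure \<Omega>)"
    using dom lipschitz_on_continuous_on[OF V] by (intro compact_continuous_image) auto
  then have "bounded (V ` closure \<Omega>)" by (rule compact_imp_bounded)
  then obtain K where K: "\<And>x. x \<in> closure \<Omega> \<Longrightarrow> norm (V x) \<le> K"
    unfolding bounded_iff by blast
  define P where "P C y \<longleftrightarrow> (\<forall>h x. 0 < h \<and> h \<le> 1 / C \<and> x \<in> \<Omega> \<and> norm (x - y) \<le> h * K
    \<and> x + h *\<^sub>R V x \<notin> \<Omega> \<longrightarrow> (\<exists>w\<in>frontier \<Omega>. dist (x + h *\<^sub>R V x) w \<le> C * h\<^sup>2))" for C y
  have mono: "P C' y" if PC: "P C y" and "C \<le> C'" "C > 0" for C C' y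
    unfolding P_def
  proof (intro allI impI)
    fix h x assume A: "0 < h \<and> h \<le> 1 / C' \<and> x \<in> \<Omega> \<and> norm (x - y) \<le> h * K \<and> x + h *\<^sub>R V x \<notin> \<Omega>"
    have "1 / C' \<le> 1 / C" using that by (simp add: frac_le)
    then have "h \<le> 1 / C" using A by linarith
    then obtain w where w: "w \<in> frontier \<Omega>" "dist (x + h *\<^sub>R V x) w \<le> C * h\<^sup>2"
      using PC A unfolding P_def by blast
    moreover have "C * h\<^sup>2 \<le> C' * h\<^sup>2" using that by (intro mult_right_mono) auto
    ultimately show "\<exists>w\<in>frontier \<Omega>. dist (x + h *\<^sub>R V x) w \<le> C' * h\<^sup>2" by (meson order_trans)
  qed
  have "\<exists>C>0. \<forall>y\<in>frontier \<Omega>. P C y"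
  proof (rule compact_local_to_global[where Q = "\<lambda>S. \<exists>C>0. \<forall>y\<in>S. P C y"])
    show "compact (frontier \<Omega>)" using dom by (simp add: compact_frontier_bounded)
    fix p assume p: "p \<in> frontier \<Omega>"
    obtain W r where "local_defining \<Omega> p W r" using loc[OF p] by blast
    from tangent_step_close_local[OF dom(1) this p V K tan]
    show "\<exists>d>0. \<exists>C>0. \<forall>y\<in>frontier \<Omega> \<inter> ball p d. P C y" unfolding P_def by blast
  next
    show "\<exists>C::real>0. \<forall>y\<in>{}. P C y" by (intro exI[of _ 1]) auto
    fix A B assume "\<exists>C>0. \<forall>y\<in>A. P C y" "\<exists>C>0. \<forall>y\<in>B. P C y"
    then obtain C C' where C: "C > 0" "\<forall>y\<in>A. P C y" "C' > 0" "\<forall>y\<in>B. P C' y" by blast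
    have "\<forall>y\<in>A \<union> B. P (max C C') y" using C mono[of C _ "max C C'"] mono[of C' _ "max C C'"] by auto
    then show "\<exists>C>0. \<forall>y\<in>A \<union> B. P C y" using C by (intro exI[of _ "max C C'"]) auto
  qed
  then obtain C where C: "C > 0" "\<And>y. y \<in> frontier \<Omega> \<Longrightarrow> P C y" by blast
  show ?thesis
  proof (intro exI[of _ C] conjI allI impI C(1))
    fix h x assume A: "0 < h \<and> h \<le> 1 / C \<and> x \<in> \<Omega> \<and> x + h *\<^sub>R V x \<notin> \<Omega>"
    let ?z = "x + h *\<^sub>R V x"
    have "closed_segment x ?z \<inter> frontier \<Omega> \<noteq> {}"
      using A by (intro connected_Int_frontier) (auto simp: connected_segment)
    then obtain y where y: "y \<in> closed_segment x ?z" "y \<in> frontier \<Omega>" by blast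
    have "norm (x - y) \<le> dist x ?z" using dist_in_closed_segment[OF y(1)] by (simp add: dist_norm norm_minus_commute)
    also have "\<dots> = h * norm (V x)" using A by (simp add: dist_norm)
    also have "\<dots> \<le> h * K" using A K[of x] closure_subset[of \<Omega>] by (intro mult_left_mono) auto
    finally show "\<exists>w\<in>frontier \<Omega>. dist ?z w \<le> C * h\<^sup>2"
      using C(2)[OF y(2)] A unfolding P_def by blast
  qed
qed

section \<open>The volume of a slightly displaced domain\<close>

lemma set_integrable_continuous_bounded:
  fixes f :: "'a::euclidean_space \<Rightarrow> 'b::euclidean_space"
  assumes "S \<in> sets borel" "bounded S" "continuous_on S f" "\<And>x. x \<in> S \<Longrightarrow> norm (f x) \<le> B"
  shows "set_integrable lborel S f"
proof -
  have "integrable lborel (\<lambda>x. indicator S x *\<^sub>R (indicator S x *\<^sub>R f x))"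
  proof (rule integrableI_bounded_set_indicator[where B = B])
    show "(\<lambda>x. indicator S x *\<^sub>R f x) \<in> borel_measurable lborel"
      using borel_measurable_continuous_on_indicator[OF assms(1,3)] by simp
    show "emeasure lborel S < \<infinity>" using emeasure_bounded_finite[OF assms(2)] by simp
  qed (use assms in auto)
  moreover have "(\<lambda>x. indicator S x *\<^sub>R (indicator S x *\<^sub>R f x)) = (\<lambda>x. indicat_real S x *\<^sub>R f x)"
    by (auto simp: indicator_def)
  ultimately show ?thesis by (simp add: set_integrable_def)
qed

text \<open>The determinant is \<open>1 + h * trace A + h\<^sup>2 * q + h ^ 3 * det A\<close>, where
  \<open>q\<close> is the sum of the principal two-by-two minors. Both \<open>q\<close> and
  \<open>det A\<close> consist of six monomials in the entries.\<close>

lemma det_perturbed_identity: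
  fixes A :: "real^3^3"
  assumes B: "\<And>i j. \<bar>A $ i $ j\<bar> \<le> B" and h: "0 \<le> h" "h \<le> 1"
  shows "\<bar>det (mat 1 + h *\<^sub>R A) - (1 + h * trace A)\<bar> \<le> (6 * B\<^sup>2 + 6 * B^3) * h\<^sup>2"
proof -
  define q where "q = A$1$1 * A$2$2 + A$1$1 * A$3$3 + A$2$2 * A$3$3 - A$1$2 * A$2$1 - A$1$3 * A$3$1 - A$2$3 * A$3$2"
  have B0: "B \<ge> 0" using B[of 1 1] by linarith
  have 2: "\<bar>A$i$j * A$k$l\<bar> \<le> B\<^sup>2" for i j k l
    unfolding abs_mult power2_eq_square using B B0 by (intro mult_mono) auto
  have 3: "\<bar>A$i$j * A$k$l * A$m$n\<bar> \<le> B^3" for i j k l m n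
    unfolding abs_mult[of "_ * _"] power3_eq_cube using 2[of i j k l] B B0
    by (intro mult_mono) (auto simp: power2_eq_square)
  have q: "\<bar>q\<bar> \<le> 6 * B\<^sup>2" unfolding q_def
    using 2[of 1 1 2 2] 2[of 1 1 3 3] 2[of 2 2 3 3] 2[of 1 2 2 1] 2[of 1 3 3 1] 2[of 2 3 3 2] by linarith
  have d: "\<bar>det A\<bar> \<le> 6 * B^3" unfolding det_3
    using 3[of 1 1 2 2 3 3] 3[of 1 2 2 3 3 1] 3[of 1 3 2 1 3 2] 3[of 1 1 2 3 3 2] 3[of 1 2 2 1 3 3] 3[of 1 3 2 2 3 1] by linarith
  have "det (mat 1 + h *\<^sub>R A) - (1 + h * trace A) = h\<^sup>2 * q + h^3 * det A"
    unfolding det_3 q_def trace_def sum_3 by (simp add: mat_def algebra_simps power2_eq_square power3_eq_cube)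
  also have "\<bar>\<dots>\<bar> \<le> h\<^sup>2 * \<bar>q\<bar> + h^3 * \<bar>det A\<bar>" using h by (simp add: abs_mult order_trans[OF abs_triangle_ineq])
  also have "\<dots> \<le> h\<^sup>2 * (6 * B\<^sup>2) + h\<^sup>2 * (6 * B^3)"
  proof (intro add_mono mult_mono q d)
    show "h^3 \<le> h\<^sup>2" using h by (intro power_decreasing) auto
  qed (use B0 h in auto)
  finally show ?thesis by (simp add: algebra_simps)
qed

text \<open>The volume of \<open>(id + h V)(\<Omega>)\<close> is \<open>|\<Omega>| + h \<integral> div V + O(h\<^sup>2)\<close>, but since \<open>V\<close> is tangent to the
  boundary it cannot exceed \<open>|\<Omega>| + O(h\<^sup>2)\<close>.\<close>

lemma integral_divergence_tangent_nonpos: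
  assumes dom: "smooth_bounded_domain \<Omega>"
    and V: "M-lipschitz_on (closure \<Omega>) V"
    and der: "\<And>x. x \<in> \<Omega> \<Longrightarrow> (V has_derivative (\<lambda>v. A x *v v)) (at x)"
    and cA: "continuous_on \<Omega> A" and B: "\<And>x i j. x \<in> \<Omega> \<Longrightarrow> \<bar>A x $ i $ j\<bar> \<le> B"
    and tan: "\<And>x. x \<in> frontier \<Omega> \<Longrightarrow> V x \<bullet> outward_normal \<Omega> x = 0"
  shows "(\<integral>x\<in>\<Omega>. trace (A x) \<partial>lborel) \<le> 0"
proof -
  have o: "open \<Omega>" "bounded \<Omega>" "\<Omega> \<noteq> {}" using dom by (auto simp: smooth_bounded_domain_def)
  have B0: "B \<ge> 0" using o(3) B[of _ 1 1] by fastforce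
  have M: "M \<ge> 0" using V lipschitz_on_nonneg by blast
  have lm: "\<Omega> \<in> lmeasurable" using o by (simp add: lmeasurable_open)
  obtain C where C: "C > 0" "\<And>h x. 0 < h \<Longrightarrow> h \<le> 1 / C \<Longrightarrow> x \<in> \<Omega> \<Longrightarrow> x + h *\<^sub>R V x \<notin> \<Omega> \<Longrightarrow>
    \<exists>w\<in>frontier \<Omega>. dist (x + h *\<^sub>R V x) w \<le> C * h\<^sup>2"
    using tangent_step_close[OF dom V tan] by blast
  obtain C' where C': "C' \<ge> 0" "\<And>h. 0 < h \<Longrightarrow> h \<le> 1 \<Longrightarrow>
    \<exists>B\<in>lmeasurable. {z. \<exists>y\<in>frontier \<Omega>. dist z y \<le> h} \<subseteq> B \<and> measure lebesgue B \<le> C' * h"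
    using quad_covered_tube[OF quad_covered_frontier[OF dom]] by blast
  define D where "D = 6 * B\<^sup>2 + 6 * B^3"
  define m where "m = measure lebesgue \<Omega>"
  define I where "I = (\<integral>x\<in>\<Omega>. trace (A x) \<partial>lborel)"
  have cAij: "continuous_on \<Omega> (\<lambda>x. A x $ i $ j)" for i j
    by (intro continuous_intros cA)
  have trb: "\<bar>trace (A x)\<bar> \<le> 3 * B" if "x \<in> \<Omega>" for x
    using B[OF that, of 1 1] B[OF that, of 2 2] B[OF that, of 3 3] unfolding trace_def sum_3 by linarith
  have tri: "set_integrable lborel \<Omega> (\<lambda>x. trace (A x))"
    using trb o by (intro set_integrable_continuous_bounded[where B = "3 * B"])
      (auto simp: trace_def sum_3 intro!: continuous_intros cAij)
  have ci: "set_integrable lborel \<Omega> (\<lambda>x. c)" for c :: real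
    using o by (intro set_integrable_continuous_bounded[where B = "\<bar>c\<bar>"]) auto
  have key: "I \<le> (D * m + C' * C) * h" if h: "0 < h" "h \<le> 1" "h \<le> 1 / C" "h * (M + 1) \<le> 1" "C * h\<^sup>2 \<le> 1" for h
  proof -
    define f where "f x = x + h *\<^sub>R V x" for x
    define J where "J x = mat 1 + h *\<^sub>R A x" for x
    have df: "(f has_derivative (\<lambda>v. J x *v v)) (at x within \<Omega>)" if "x \<in> \<Omega>" for x
      unfolding f_def J_def
      by (rule has_derivative_at_withinI)
        (auto intro!: derivative_eq_intros der[OF that] simp: matrix_vector_mult_add_rdistrib scaleR_matrix_vector_assoc)
    \<comment> \<open>As \<open>h * M < 1\<close>, the displacement is a contraction and
      \<open>f\<close> is injective, so the volume of the image is exactly the integral of the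
      Jacobian determinant.\<close>
    have inj: "inj_on f \<Omega>"
    proof (rule inj_onI)
      fix x y assume xy: "x \<in> \<Omega>" "y \<in> \<Omega>" "f x = f y"
      then have "x - y = h *\<^sub>R (V y - V x)" by (simp add: f_def algebra_simps)
      then have "norm (x - y) = h * norm (V y - V x)" using h by simp
      also have "\<dots> \<le> h * (M * norm (y - x))"
        using xy h closure_subset by (intro mult_left_mono lipschitz_on_normD[OF V]) auto
      finally have "norm (x - y) \<le> h * M * norm (x - y)" by (simp add: norm_minus_commute)
      moreover have "h * M < 1" using h by (simp add: algebra_simps)
      ultimately have "\<not> norm (x - y) > 0" by (metis mult_less_cancel_right2 not_less)
      then show "x = y" by simp
    qed
    have det: "\<bar>det (J x) - (1 + h * trace (A x))\<bar> \<le> D * h\<^sup>2" if "x \<in> \<Omega>" for x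
      unfolding J_def D_def using h by (intro det_perturbed_identity B[OF that]) auto
    have deti: "set_integrable lborel \<Omega> (\<lambda>x. \<bar>det (J x)\<bar>)"
    proof (rule set_integrable_continuous_bounded[where B = "D * h\<^sup>2 + 1 + h * (3 * B)"])
      show "continuous_on \<Omega> (\<lambda>x. \<bar>det (J x)\<bar>)"
        unfolding J_def det_3 by (auto intro!: continuous_intros cAij)
      fix x assume x: "x \<in> \<Omega>"
      have "\<bar>h * trace (A x)\<bar> \<le> h * (3 * B)" using trb[OF x] h by (simp add: abs_mult)
      then show "norm \<bar>det (J x)\<bar> \<le> D * h\<^sup>2 + 1 + h * (3 * B)" using det[OF x] by simp
    qed (use o in auto)
    have fi: "f ` \<Omega> \<in> lmeasurable" "measure lebesgue (f ` \<Omega>) = (\<integral>x\<in>\<Omega>. \<bar>det (J x)\<bar> \<partial>lborel)"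
      using has_measure_differentiable_image[OF _ df inj, of "\<integral>x\<in>\<Omega>. \<bar>det (J x)\<bar> \<partial>lborel"]
        set_borel_integral_eq_integral[OF deti] lm by (auto simp: has_integral_iff fmeasurableD)
    obtain E where E: "E \<in> lmeasurable" "{z. \<exists>y\<in>frontier \<Omega>. dist z y \<le> C * h\<^sup>2} \<subseteq> E" "measure lebesgue E \<le> C' * (C * h\<^sup>2)"
      using C'(2)[of "C * h\<^sup>2"] C(1) h by auto
    \<comment> \<open>A displaced point outside \<Omega> is within \<open>C * h\<^sup>2\<close> of
      the boundary, so the image exceeds \<Omega> by at most a tube of volume of order
      \<open>h\<^sup>2\<close>.\<close>
    have sub: "f ` \<Omega> \<subseteq> \<Omega> \<union> E"
    proof
      fix z assume "z \<in> f ` \<Omega>"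
      then obtain x where x: "x \<in> \<Omega>" "z = x + h *\<^sub>R V x" by (auto simp: f_def)
      show "z \<in> \<Omega> \<union> E"
      proof (cases "z \<in> \<Omega>")
        case False
        then have "\<exists>w\<in>frontier \<Omega>. dist z w \<le> C * h\<^sup>2" using C(2)[OF h(1,3) x(1)] x(2) by simp
        then show ?thesis using E(2) by blast
      qed simp
    qed
    have "measure lebesgue (f ` \<Omega>) \<le> measure lebesgue (\<Omega> \<union> E)"
      using lm E(1) by (intro measure_mono_fmeasurable[OF sub]) (auto simp: fi(1) fmeasurableD)
    also have "\<dots> \<le> m + measure lebesgue E" unfolding m_def
      using lm E(1) by (intro measure_Un_le) (auto simp: fmeasurableD)
    finally have up: "(\<integral>x\<in>\<Omega>. \<bar>det (J x)\<bar> \<partial>lborel) \<le> m + C' * (C * h\<^sup>2)" using E(3) fi(2) by linarith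
    have lin: "set_integrable lborel \<Omega> (\<lambda>x. (1 - D * h\<^sup>2) + h * trace (A x))"
      by (intro set_integral_add ci set_integrable_mult_right tri)
    have "(\<integral>x\<in>\<Omega>. ((1 - D * h\<^sup>2) + h * trace (A x)) \<partial>lborel) = (1 - D * h\<^sup>2) * m + h * I"
    proof -
      have "(\<integral>x\<in>\<Omega>. ((1 - D * h\<^sup>2) + h * trace (A x)) \<partial>lborel) = (\<integral>x\<in>\<Omega>. (1 - D * h\<^sup>2) \<partial>lborel) + (\<integral>x\<in>\<Omega>. h * trace (A x) \<partial>lborel)"
        by (intro set_integral_add ci set_integrable_mult_right tri)
      moreover have "(\<integral>x\<in>\<Omega>. (1 - D * h\<^sup>2) \<partial>lborel) = (1 - D * h\<^sup>2) * m"
        using o by (simp add: set_lebesgue_integral_def m_def measure_def mult.commute)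
      ultimately show ?thesis by (simp add: I_def)
    qed
    moreover have "(\<integral>x\<in>\<Omega>. ((1 - D * h\<^sup>2) + h * trace (A x)) \<partial>lborel) \<le> (\<integral>x\<in>\<Omega>. \<bar>det (J x)\<bar> \<partial>lborel)"
    proof (rule set_integral_mono[OF lin deti])
      show "(1 - D * h\<^sup>2) + h * trace (A x) \<le> \<bar>det (J x)\<bar>" if "x \<in> \<Omega>" for x using det[OF that] by linarith
    qed
    ultimately have "h * I \<le> h * ((D * m + C' * C) * h)" using up by (simp add: algebra_simps power2_eq_square)
    then show ?thesis using h(1) by simp
  qed
  define E where "E = D * m + C' * C"
  have E0: "E \<ge> 0" using B0 C C' by (simp add: E_def D_def m_def)
  have "I \<le> 0"
  proof (rule ccontr)
    assume "\<not> I \<le> 0"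
    then have I: "I > 0" by simp
    \<comment> \<open>\<open>key\<close> reads \<open>I \<le> E * h\<close>, which a positive
      \<open>I\<close> violates once \<open>h\<close> is small against \<open>I / (E + 1)\<close>;
      the increment covers \<open>E = 0\<close>.\<close>
    define h where "h = Min {1, 1 / C, 1 / (M + 1), I / (2 * (E + 1))}"
    have h: "h > 0" "h \<le> 1" "h \<le> 1 / C" "h \<le> 1 / (M + 1)" "h \<le> I / (2 * (E + 1))"
      using C M E0 I by (auto simp: h_def)
    have "C * h\<^sup>2 = (C * h) * h" by (simp add: power2_eq_square)
    also have "\<dots> \<le> 1 * 1" using h C(1) by (intro mult_mono) (auto simp: field_simps)
    finally have "C * h\<^sup>2 \<le> 1" by simp
    moreover have "h * (M + 1) \<le> 1" using h(4) M by (simp add: field_simps)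
    ultimately have "I \<le> E * h" using key h unfolding E_def by blast
    also have "\<dots> \<le> E * (I / (2 * (E + 1)))" using h(5) E0 by (rule mult_left_mono)
    also have "\<dots> < I" using E0 I by (simp add: field_simps add_nonneg_pos)
    finally show False by simp
  qed
  then show ?thesis by (simp add: I_def)
qed

text \<open>Changing the sign of \<open>V\<close> preserves tangency, so the one-sided bound applies
  to both \<open>V\<close> and \<open>- V\<close>.\<close>

lemma integral_divergence_tangent:
  assumes dom: "smooth_bounded_domain \<Omega>"
    and V: "M-lipschitz_on (closure \<Omega>) V"
    and der: "\<And>x. x \<in> \<Omega> \<Longrightarrow> (V has_derivative (\<lambda>v. A x *v v)) (at x)"
    and cA: "continuous_on \<Omega> A" and B: "\<And>x i j. x \<in> \<Omega> \<Longrightarrow> \<bar>A x $ i $ j\<bar> \<le> B"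
    and tan: "\<And>x. x \<in> frontier \<Omega> \<Longrightarrow> V x \<bullet> outward_normal \<Omega> x = 0"
  shows "(\<integral>x\<in>\<Omega>. trace (A x) \<partial>lborel) = 0"
proof (rule antisym)
  show "(\<integral>x\<in>\<Omega>. trace (A x) \<partial>lborel) \<le> 0"
    by (rule integral_divergence_tangent_nonpos[OF assms])
  have "(\<integral>x\<in>\<Omega>. trace (- A x) \<partial>lborel) \<le> 0"
  proof (rule integral_divergence_tangent_nonpos[OF dom])
    show "M-lipschitz_on (closure \<Omega>) (\<lambda>x. - V x)" using lipschitz_on_minus[OF V] .
    show "((\<lambda>x. - V x) has_derivative (\<lambda>v. (- A x) *v v)) (at x)" if "x \<in> \<Omega>" for x
      using has_derivative_minus[OF der[OF that]] 
      by (rule back_subst[of "\<lambda>D. (_ has_derivative D) _"]) (simp add: fun_eq_iff vec_eq_iff matrix_vector_mult_def sum_negf)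
  qed (use B tan in \<open>auto intro!: continuous_intros cA\<close>)
  moreover have "trace (- A x) = - trace (A x)" for x by (simp add: trace_def sum_negf)
  ultimately show "0 \<le> (\<integral>x\<in>\<Omega>. trace (A x) \<partial>lborel)" by (simp add: set_lebesgue_integral_def)
qed


section \<open>Integration over time intervals and cylinders\<close>

lemma set_fubini:
  fixes h :: "'a::euclidean_space \<times> 'b::euclidean_space \<Rightarrow> real"
  assumes "set_integrable lborel (A \<times> B) h"
  shows "AE t in lborel. t \<in> A \<longrightarrow> set_integrable lborel B (\<lambda>x. h (t, x))"
    and "set_integrable lborel A (\<lambda>t. LINT x:B|lborel. h (t, x))"
    and "(LINT t:A|lborel. LINT x:B|lborel. h (t, x)) = (LINT p:A \<times> B|lborel. h p)"
proof -
  let ?f = "\<lambda>p. indicat_real (A \<times> B) p *\<^sub>R h p"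
  have f: "integrable (lborel \<Otimes>\<^sub>M lborel) ?f"
    using assms unfolding set_integrable_def lborel_prod .
  have eq: "(\<lambda>x. ?f (t, x)) = (\<lambda>x. indicat_real A t * (indicat_real B x *\<^sub>R h (t, x)))" for t
    by (auto simp: indicator_def)
  have inner: "(\<integral>x. ?f (t, x) \<partial>lborel) = indicat_real A t *\<^sub>R (LINT x:B|lborel. h (t, x))" for t
    unfolding eq set_lebesgue_integral_def by simp
  show "AE t in lborel. t \<in> A \<longrightarrow> set_integrable lborel B (\<lambda>x. h (t, x))"
    using lborel_pair.AE_integrable_fst'[OF f]
  proof eventually_elim
    case (elim t)
    then show ?case unfolding eq by (cases "t \<in> A") (simp_all add: set_integrable_def)
  qed
  show "set_integrable lborel A (\<lambda>t. LINT x:B|lborel. h (t, x))"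
    using lborel_pair.integrable_fst'[OF f] unfolding inner set_integrable_def .
  show "(LINT t:A|lborel. LINT x:B|lborel. h (t, x)) = (LINT p:A \<times> B|lborel. h p)"
    using lborel_pair.integral_fst'[OF f] unfolding inner
    by (simp add: set_lebesgue_integral_def lborel_prod)
qed

text \<open>Tonelli's theorem in the form in which the solution is controlled: the spatial integrals
  are bounded uniformly in time, and the time interval is finite.\<close>

lemma set_integrable_prodI:
  fixes h :: "'a::euclidean_space \<times> 'b::euclidean_space \<Rightarrow> real"
  assumes m: "set_borel_measurable borel (A \<times> B) h"
    and A: "A \<in> sets borel" "emeasure lborel A < \<infinity>"
    and bd: "AE t in lborel. t \<in> A \<longrightarrow> set_integrable lborel B (\<lambda>x. h (t, x)) \<and> (LINT x:B|lborel. \<bar>h (t, x)\<bar>) \<le> K"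
  shows "set_integrable lborel (A \<times> B) h"
proof -
  let ?f = "\<lambda>p. indicat_real (A \<times> B) p *\<^sub>R h p"
  have f[measurable]: "?f \<in> borel_measurable (lborel \<Otimes>\<^sub>M lborel)"
    using m unfolding set_borel_measurable_def lborel_prod by simp
  have eq: "(\<lambda>x. ?f (t, x)) = (\<lambda>x. indicat_real A t * (indicat_real B x *\<^sub>R h (t, x)))" for t
    by (auto simp: indicator_def)
  have neq: "(\<lambda>x. norm (?f (t, x))) = (\<lambda>x. indicat_real A t * (indicat_real B x *\<^sub>R \<bar>h (t, x)\<bar>))" for t
    by (auto simp: indicator_def)
  have "integrable (lborel \<Otimes>\<^sub>M lborel) ?f"
  proof (rule lborel_pair.Fubini_integrable[OF f])
    show "AE t in lborel. integrable lborel (\<lambda>x. ?f (t, x))"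
      using bd
    proof eventually_elim
      case (elim t)
      then show ?case unfolding eq by (cases "t \<in> A") (simp_all add: set_integrable_def)
    qed
    have "integrable lborel (\<lambda>t. indicat_real A t *\<^sub>R (\<integral>x. norm (?f (t, x)) \<partial>lborel))"
    proof (rule integrableI_bounded_set_indicator[where B = K])
      show "AE t in lborel. t \<in> A \<longrightarrow> norm (\<integral>x. norm (?f (t, x)) \<partial>lborel) \<le> K"
        using bd
      proof (eventually_elim, intro impI)
        fix t assume *: "t \<in> A \<longrightarrow> set_integrable lborel B (\<lambda>x. h (t, x)) \<and> (LINT x:B|lborel. \<bar>h (t, x)\<bar>) \<le> K" and "t \<in> A"
        then have "(\<integral>x. norm (?f (t, x)) \<partial>lborel) = (LINT x:B|lborel. \<bar>h (t, x)\<bar>)"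
          unfolding neq by (simp add: set_lebesgue_integral_def)
        moreover have "(\<integral>x. norm (?f (t, x)) \<partial>lborel) \<ge> 0" by (rule Bochner_Integration.integral_nonneg) simp
        ultimately show "norm (\<integral>x. norm (?f (t, x)) \<partial>lborel) \<le> K" using * \<open>t \<in> A\<close> by simp
      qed
      show "(\<lambda>t. \<integral>x. norm (?f (t, x)) \<partial>lborel) \<in> borel_measurable lborel" by measurable
    qed (use A in auto)
    moreover have "(\<lambda>t. indicat_real A t *\<^sub>R (\<integral>x. norm (?f (t, x)) \<partial>lborel)) = (\<lambda>t. \<integral>x. norm (?f (t, x)) \<partial>lborel)"
      unfolding neq by (auto simp: indicator_def)
    ultimately show "integrable lborel (\<lambda>t. \<integral>x. norm (?f (t, x)) \<partial>lborel)" by (simp only:)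
  qed
  then show ?thesis by (simp add: set_integrable_def lborel_prod)
qed

section \<open>Functions of time: primitives, moments and Gronwall's lemma\<close>

lemma set_integral_Ioo_eq_integral_Icc:
  fixes f :: "real \<Rightarrow> real"
  assumes "set_integrable lborel {a<..<b} f"
  shows "f integrable_on {a..b}" "(LINT t:{a<..<b}|lborel. f t) = integral {a..b} f"
  using set_borel_integral_eq_integral[OF assms]
  by (simp_all add: integrable_on_Icc_iff_Ioo integral_open_interval_real)

lemma set_integrable_Ioo_continuous:
  fixes f :: "real \<Rightarrow> real"
  assumes "continuous_on {a..b} f" shows "set_integrable lborel {a<..<b} f"
  by (rule set_integrable_subset[OF borel_integrable_atLeastAtMost'[OF assms]]) auto

lemma continuous_on_primitive:
  fixes R :: "real \<Rightarrow> real"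
  assumes "set_integrable lborel {0<..<T} R"
  shows "continuous_on {0..T} (\<lambda>\<tau>. LINT t:{0<..<\<tau>}|lborel. R t)"
proof -
  have "(LINT t:{0<..<\<tau>}|lborel. R t) = integral {0..\<tau>} R" if "\<tau> \<in> {0..T}" for \<tau>
    using that by (intro set_integral_Ioo_eq_integral_Icc set_integrable_subset[OF assms]) auto
  moreover have "continuous_on {0..T} (\<lambda>\<tau>. integral {0..\<tau>} R)"
    by (intro indefinite_integral_continuous_1 set_integral_Ioo_eq_integral_Icc assms)
  ultimately show ?thesis by (subst continuous_on_cong[OF refl]) auto
qed

text \<open>Polynomials integrate to zero against \<open>W\<close>; approximating \<open>W\<close>
  itself uniformly by them shows that the integral of \<open>W * W\<close> vanishes.\<close>

lemma continuous_moments_zero: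
  fixes W :: "real \<Rightarrow> real"
  assumes "T > 0" and W: "continuous_on {0..T} W" and mom: "\<And>n. integral {0..T} (\<lambda>t. W t * t ^ n) = 0"
  shows "\<forall>t\<in>{0..T}. W t = 0"
proof -
  have poly: "integral {0..T} (\<lambda>t. W t * p t) = 0" if "real_polynomial_function p" for p
  proof -
    obtain a n where p: "p = (\<lambda>x. \<Sum>i\<le>n. a i * x ^ i)" using \<open>real_polynomial_function p\<close> real_polynomial_function_iff_sum by blast
    have "integral {0..T} (\<lambda>t. W t * p t) = integral {0..T} (\<lambda>t. \<Sum>i\<le>n. a i * (W t * t ^ i))"
      by (simp add: p sum_distrib_left mult_ac)
    also have "\<dots> = (\<Sum>i\<le>n. integral {0..T} (\<lambda>t. a i * (W t * t ^ i)))"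
      by (intro integral_sum integrable_continuous_real continuous_intros W) auto
    also have "\<dots> = 0" by (simp add: mom)
    finally show ?thesis .
  qed
  define B where "B = integral {0..T} (\<lambda>t. \<bar>W t\<bar>)"
  have B: "B \<ge> 0" unfolding B_def by (intro integral_nonneg integrable_continuous_real continuous_intros W) auto
  have "integral {0..T} (\<lambda>t. W t * W t) \<le> 0"
  proof (rule field_le_epsilon)
    fix e :: real assume "e > 0"
    obtain p where p: "real_polynomial_function p" "\<And>x. x \<in> {0..T} \<Longrightarrow> \<bar>W x - p x\<bar> < e / (B + 1)"
      using Stone_Weierstrass_real_polynomial_function[of "{0..T}" W "e / (B + 1)"] W B \<open>e > 0\<close> by auto
    have cp: "continuous_on {0..T} p" using p(1) continuous_on_polymonial_function real_polynomial_function_eq by blast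
    have "integral {0..T} (\<lambda>t. W t * W t) = integral {0..T} (\<lambda>t. W t * (W t - p t)) + integral {0..T} (\<lambda>t. W t * p t)"
      by (subst integral_add[symmetric]) (auto intro!: integrable_continuous_real continuous_intros W cp simp: algebra_simps)
    also have "\<dots> = integral {0..T} (\<lambda>t. W t * (W t - p t))" using poly[OF p(1)] by simp
    also have "\<dots> \<le> integral {0..T} (\<lambda>t. \<bar>W t\<bar> * (e / (B + 1)))"
    proof (intro integral_le integrable_continuous_real continuous_intros W cp)
      fix t assume t: "t \<in> {0..T}"
      have "W t * (W t - p t) \<le> \<bar>W t\<bar> * \<bar>W t - p t\<bar>" by (metis abs_ge_self abs_mult)
      also have "\<dots> \<le> \<bar>W t\<bar> * (e / (B + 1))" using p(2)[OF t] by (intro mult_left_mono) auto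
      finally show "W t * (W t - p t) \<le> \<bar>W t\<bar> * (e / (B + 1))" .
    qed
    also have "\<dots> = B * (e / (B + 1))" by (simp add: B_def)
    also have "\<dots> \<le> e" using B \<open>e > 0\<close> by (simp add: field_simps)
    finally show "integral {0..T} (\<lambda>t. W t * W t) \<le> 0 + e" by simp
  qed
  moreover have "integral {0..T} (\<lambda>t. W t * W t) \<ge> 0"
    by (intro integral_nonneg integrable_continuous_real continuous_intros W) auto
  ultimately have "integral {0..T} (\<lambda>t. W t * W t) = 0" by simp
  moreover have "continuous_on {0..T} (\<lambda>t. W t * W t)" by (intro continuous_intros W)
  ultimately have "\<forall>t\<in>{0..T}. W t * W t = 0"
    using integral_eq_0_iff[of 0 T "\<lambda>t. W t * W t"] assms(1) zero_le_square by blast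
  then show ?thesis by simp
qed

text \<open>\<open>R\<close> is only integrable, so its primitive need not be differentiable. The
  identity is Fubini's theorem for \<open>R t * (real n * s ^ (n - 1))\<close> on the triangle
  \<open>t < s\<close>: integrating in \<open>s\<close> first gives \<open>T ^ n - t ^ n\<close>,
  integrating in \<open>t\<close> first gives the primitive.\<close>

lemma primitive_integration_by_parts:
  fixes R :: "real \<Rightarrow> real"
  assumes "T > 0" and R: "set_integrable lborel {0<..<T} R"
  shows "(LINT t:{0<..<T}|lborel. R t * t ^ n)
    = T ^ n * (LINT t:{0<..<T}|lborel. R t)
      - (LINT s:{0<..<T}|lborel. (LINT t:{0<..<s}|lborel. R t) * (real n * s ^ (n - 1)))"
proof -
  define u where "u t = indicat_real {0<..<T} t * R t" for t
  define v where "v s = indicat_real {0<..<T} s * (real n * s ^ (n - 1))" for s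
  define f where "f t s = (if t < s then u t * v s else 0)" for t s
  have u: "integrable lborel u" using R by (simp add: set_integrable_def u_def[abs_def])
  have cpow: "continuous_on {a..b} (\<lambda>s. real n * s ^ (n - 1))" for a b by (intro continuous_intros)
  have v: "integrable lborel v"
    using set_integrable_Ioo_continuous[OF cpow] by (simp add: set_integrable_def v_def[abs_def])
  have um[measurable]: "u \<in> borel_measurable borel" and vm[measurable]: "v \<in> borel_measurable borel" using u v by auto
  have uv: "integrable (lborel \<Otimes>\<^sub>M lborel) (\<lambda>(t, s). u t * v s)"
  proof (rule lborel_pair.Fubini_integrable)
    show "(\<lambda>(t, s). u t * v s) \<in> borel_measurable (lborel \<Otimes>\<^sub>M lborel)" by measurable
    have "(\<lambda>t. \<integral>s. norm (case (t, s) of (t, s) \<Rightarrow> u t * v s) \<partial>lborel) = (\<lambda>t. norm (u t) * (\<integral>s. norm (v s) \<partial>lborel))"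
      by (simp add: abs_mult)
    then show "integrable lborel (\<lambda>t. \<integral>s. norm (case (t, s) of (t, s) \<Rightarrow> u t * v s) \<partial>lborel)"
      using u by simp
    show "AE t in lborel. integrable lborel (\<lambda>s. case (t, s) of (t, s) \<Rightarrow> u t * v s)" using v by simp
  qed
  have f: "integrable (lborel \<Otimes>\<^sub>M lborel) (\<lambda>(t, s). f t s)"
  proof (rule Bochner_Integration.integrable_bound[OF uv])
    show "(\<lambda>(t, s). f t s) \<in> borel_measurable (lborel \<Otimes>\<^sub>M lborel)" unfolding f_def by measurable
  qed (auto simp: f_def)
  have in1: "(\<integral>s. f t s \<partial>lborel) = u t * (T ^ n - t ^ n)" for t
  proof (cases "t \<in> {0<..<T}")
    case True
    have "(\<integral>s. f t s \<partial>lborel) = u t * (LINT s:{t<..<T}|lborel. real n * s ^ (n - 1))"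
      unfolding set_lebesgue_integral_def integral_mult_right_zero[symmetric]
      by (rule Bochner_Integration.integral_cong) (use True in \<open>auto simp: f_def v_def indicator_def\<close>)
    also have "(LINT s:{t<..<T}|lborel. real n * s ^ (n - 1)) = integral {t..T} (\<lambda>s. real n * s ^ (n - 1))"
      by (rule set_integral_Ioo_eq_integral_Icc[OF set_integrable_Ioo_continuous[OF cpow]])
    also have "\<dots> = T ^ n - t ^ n"
    proof (rule integral_unique, rule fundamental_theorem_of_calculus)
      show "t \<le> T" using True by simp
      show "((\<lambda>s. s ^ n) has_vector_derivative real n * s ^ (n - 1)) (at s within {t..T})" for s
        by (auto intro!: derivative_eq_intros simp: has_real_derivative_iff_has_vector_derivative[symmetric])
    qed
    finally show ?thesis .
  next
    case False
    then have "u t = 0" by (auto simp: u_def)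
    then show ?thesis by (simp add: f_def cong: if_cong)
  qed
  have in2: "(\<integral>t. f t s \<partial>lborel) = v s * (LINT t:{0<..<s}|lborel. R t)" for s
    unfolding set_lebesgue_integral_def integral_mult_right_zero[symmetric]
    by (rule Bochner_Integration.integral_cong) (auto simp: f_def v_def u_def indicator_def)
  have "(\<integral>t. u t * (T ^ n - t ^ n) \<partial>lborel) = (\<integral>s. v s * (LINT t:{0<..<s}|lborel. R t) \<partial>lborel)"
    using lborel_pair.Fubini_integral[OF f] unfolding in1 in2 by simp
  moreover have "(\<integral>t. u t * (T ^ n - t ^ n) \<partial>lborel) = T ^ n * (LINT t:{0<..<T}|lborel. R t) - (LINT t:{0<..<T}|lborel. R t * t ^ n)"
  proof -
    have "integrable lborel (\<lambda>t. u t * t ^ n)"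
    proof (rule Bochner_Integration.integrable_bound[of _ "\<lambda>t. T ^ n * u t"])
      show "AE t in lborel. norm (u t * t ^ n) \<le> norm (T ^ n * u t)"
      proof (rule AE_I2)
        fix t
        have "\<bar>t\<bar> ^ n \<le> T ^ n" if "t \<in> {0<..<T}" using that by (intro power_mono) auto
        then show "norm (u t * t ^ n) \<le> norm (T ^ n * u t)"
          by (cases "t \<in> {0<..<T}") (auto simp: u_def abs_mult power_abs mult.commute intro!: mult_left_mono)
      qed
    qed (use u in auto)
    then have "(\<integral>t. T ^ n * u t - u t * t ^ n \<partial>lborel) = T ^ n * (\<integral>t. u t \<partial>lborel) - (\<integral>t. u t * t ^ n \<partial>lborel)"
      using u by simp
    then show ?thesis by (simp add: u_def set_lebesgue_integral_def algebra_simps)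
  qed
  ultimately show ?thesis by (simp add: v_def set_lebesgue_integral_def algebra_simps)
qed

text \<open>Testing a weak evolution equation with all monomials in time localises it to \<open>[0, \<tau>]\<close>.\<close>

lemma moment_localization:
  fixes F R :: "real \<Rightarrow> real"
  assumes T: "T > 0" and F: "continuous_on {0..T} F" and R: "set_integrable lborel {0<..<T} R"
    and mom: "\<And>n. F T * T ^ n - F0 * 0 ^ n = (LINT t:{0<..<T}|lborel. F t * (real n * t ^ (n - 1)) + R t * t ^ n)"
    and \<tau>: "\<tau> \<in> {0..T}"
  shows "F \<tau> = F0 + (LINT t:{0<..<\<tau>}|lborel. R t)"
proof -
  define I where "I \<tau> = (LINT t:{0<..<\<tau>}|lborel. R t)" for \<tau>
  \<comment> \<open>\<open>W\<close> is the defect of the claim. It is continuous, so it suffices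
    that all its moments vanish.\<close>
  define W where "W t = F t - F0 - I t" for t
  have cI: "continuous_on {0..T} I" unfolding I_def by (rule continuous_on_primitive[OF R])
  then have cW: "continuous_on {0..T} W" unfolding W_def by (intro continuous_intros F)
  have "integral {0..T} (\<lambda>t. W t * t ^ m) = 0" for m
  proof -
    let ?n = "Suc m"
    let ?d = "\<lambda>t. real ?n * t ^ m"
    have cd: "continuous_on {0..T} (\<lambda>t. G t * ?d t)" if "continuous_on {0..T} G" for G
      by (intro continuous_intros that)
    have Rt: "set_integrable lborel {0<..<T} (\<lambda>t. R t * t ^ n)" for n
    proof (rule set_integrable_bound[of _ _ "\<lambda>t. T ^ n * R t"])
      show "set_integrable lborel {0<..<T} (\<lambda>t. T ^ n * R t)" using R by simp
      show "set_borel_measurable lborel {0<..<T} (\<lambda>t. R t * t ^ n)"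
      proof -
        have "(\<lambda>t. (indicat_real {0<..<T} t *\<^sub>R R t) * t ^ n) \<in> borel_measurable lborel"
          using R unfolding set_integrable_def by (intro borel_measurable_times) auto
        then show ?thesis by (simp add: set_borel_measurable_def mult.assoc)
      qed
      have "norm (R t * t ^ n) \<le> norm (T ^ n * R t)" if "t \<in> {0<..<T}" for t
      proof -
        have "\<bar>t\<bar> ^ n \<le> T ^ n" using that by (intro power_mono) auto
        then show ?thesis using T by (simp add: abs_mult power_abs mult.commute mult_left_mono)
      qed
      then show "AE t in lborel. t \<in> {0<..<T} \<longrightarrow> norm (R t * t ^ n) \<le> norm (T ^ n * R t)" by simp
    qed
    \<comment> \<open>The exponent 0 is special: \<open>0 ^ 0 = 1\<close> brings in
      \<open>F0\<close> and gives the identity at time \<open>T\<close>. For positive exponents the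
      initial term disappears.\<close>
    have F0T: "F T - F0 = I T" using mom[of 0] by (simp add: I_def)
    have "F T * T ^ ?n = (LINT t:{0<..<T}|lborel. F t * ?d t + R t * t ^ ?n)"
      using mom[of ?n] by simp
    also have "\<dots> = (LINT t:{0<..<T}|lborel. F t * ?d t) + (LINT t:{0<..<T}|lborel. R t * t ^ ?n)"
      by (intro set_integral_add set_integrable_Ioo_continuous cd F Rt)
    also have "(LINT t:{0<..<T}|lborel. R t * t ^ ?n) = T ^ ?n * I T - (LINT t:{0<..<T}|lborel. I t * ?d t)"
      using primitive_integration_by_parts[OF T R, of ?n] by (simp add: I_def)
    also have "(LINT t:{0<..<T}|lborel. F t * ?d t) = integral {0..T} (\<lambda>t. F t * ?d t)"
      by (intro set_integral_Ioo_eq_integral_Icc set_integrable_Ioo_continuous cd F)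
    also have "(LINT t:{0<..<T}|lborel. I t * ?d t) = integral {0..T} (\<lambda>t. I t * ?d t)"
      by (intro set_integral_Ioo_eq_integral_Icc set_integrable_Ioo_continuous cd cI)
    finally have 1: "F0 * T ^ ?n = integral {0..T} (\<lambda>t. F t * ?d t) - integral {0..T} (\<lambda>t. I t * ?d t)"
      using F0T by (simp add: algebra_simps)
    have 2: "F0 * T ^ ?n = integral {0..T} (\<lambda>t. F0 * ?d t)"
    proof -
      have "((\<lambda>t. F0 * ?d t) has_integral F0 * T ^ ?n - F0 * 0 ^ ?n) {0..T}"
      proof (rule fundamental_theorem_of_calculus)
        show "((\<lambda>t. F0 * t ^ ?n) has_vector_derivative F0 * ?d t) (at t within {0..T})" for t
          unfolding has_real_derivative_iff_has_vector_derivative[symmetric]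
          by (rule DERIV_cong[OF DERIV_cmult[OF DERIV_pow[of ?n t]]]) simp
      qed (use T in simp)
      then have "((\<lambda>t. F0 * ?d t) has_integral F0 * T ^ ?n) {0..T}" by simp
      then show ?thesis by (rule integral_unique[symmetric])
    qed
    have "integral {0..T} (\<lambda>t. W t * ?d t) = integral {0..T} (\<lambda>t. F t * ?d t) - integral {0..T} (\<lambda>t. I t * ?d t) - integral {0..T} (\<lambda>t. F0 * ?d t)"
      by (subst integral_diff[symmetric], (intro integrable_continuous_real cd F cI)+,
          subst integral_diff[symmetric])
         (auto intro!: integrable_continuous_real continuous_intros F cI simp: W_def algebra_simps simp del: of_nat_Suc)
    then have "integral {0..T} (\<lambda>t. real ?n * (W t * t ^ m)) = 0" using 1 2 by (simp add: mult_ac)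
    then show ?thesis by simp
  qed
  from continuous_moments_zero[OF T cW this] \<tau> have "W \<tau> = 0" by blast
  then show ?thesis by (simp add: W_def I_def)
qed

text \<open>\<open>y\<close> is only integrable and its inequality holds only almost everywhere, so
  the differential argument is carried out for the continuous majorant \<open>w\<close>, whose
  primitive \<open>v\<close> is differentiable.\<close>

lemma gronwall_AE:
  fixes y :: "real \<Rightarrow> real"
  assumes y: "set_integrable lborel {0<..<T} y" and "c \<ge> 0"
    and le: "AE t in lborel. t \<in> {0<..<T} \<longrightarrow> y t \<le> a + c * (LINT s:{0<..<t}|lborel. y s)"
  shows "AE t in lborel. t \<in> {0<..<T} \<longrightarrow> y t \<le> a * exp (c * t)"
proof -
  define w where "w t = a + c * (LINT s:{0<..<t}|lborel. y s)" for t
  define v where "v t = integral {0..t} w" for t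
  have cw: "continuous_on {0..T} w" unfolding w_def by (intro continuous_intros continuous_on_primitive[OF y])
  have wv: "w t \<le> a + c * v t" if "t \<in> {0..T}" for t
  proof -
    have sub: "set_integrable lborel {0<..<t} y" using that by (intro set_integrable_subset[OF y]) auto
    have cwt: "continuous_on {0..t} w" using cw that by (rule_tac continuous_on_subset) auto
    have "(LINT s:{0<..<t}|lborel. y s) \<le> (LINT s:{0<..<t}|lborel. w s)"
    proof (rule set_integral_mono_AE[OF sub set_integrable_Ioo_continuous[OF cwt]])
      show "AE s\<in>{0<..<t} in lborel. y s \<le> w s"
        using le by eventually_elim (use that in \<open>auto simp: w_def\<close>)
    qed
    also have "\<dots> = v t" unfolding v_def
      by (rule set_integral_Ioo_eq_integral_Icc[OF set_integrable_Ioo_continuous[OF cwt]])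
    finally show ?thesis using \<open>c \<ge> 0\<close> by (simp add: w_def mult_left_mono)
  qed
  have cv: "continuous_on {0..T} v"
    unfolding v_def by (intro indefinite_integral_continuous_1 integrable_continuous_real cw)
  have bound: "a + c * v t \<le> a * exp (c * t)" if "t \<in> {0..T}" for t
  proof -
    \<comment> \<open>The exponential is the integrating factor: as
      \<open>v' = w \<le> a + c * v\<close>, the function \<open>q\<close> is nonincreasing.\<close>
    define q where "q s = (a + c * v s) * exp (- c * s)" for s
    have "q t \<le> q 0"
    proof (rule DERIV_nonpos_imp_decreasing_open[of 0 t q])
      show "0 \<le> t" using that by simp
      show "continuous_on {0..t} q" unfolding q_def
        using that by (intro continuous_intros continuous_on_subset[OF cv]) auto
      fix s assume s: "0 < s" "s < t"
      have "(v has_real_derivative w s) (at s within {0..T})"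
        unfolding v_def using s that by (intro integral_has_real_derivative cw) auto
      then have dv: "(v has_real_derivative w s) (at s)"
        using s that at_within_interior[of s "{0..T}"] by simp
      have "(q has_real_derivative c * w s * exp (- c * s) + (a + c * v s) * (exp (- c * s) * - c)) (at s)"
        unfolding q_def by (auto intro!: derivative_eq_intros dv)
      moreover have "c * w s * exp (- c * s) + (a + c * v s) * (exp (- c * s) * - c) = (c * (w s - (a + c * v s))) * exp (- c * s)"
        by (simp add: algebra_simps)
      moreover have "c * (w s - (a + c * v s)) \<le> 0"
        using wv[of s] s that \<open>c \<ge> 0\<close> by (intro mult_nonneg_nonpos) auto
      then have "(c * (w s - (a + c * v s))) * exp (- c * s) \<le> 0" by (rule mult_nonpos_nonneg) simp
      ultimately show "\<exists>z. (q has_real_derivative z) (at s) \<and> z \<le> 0" by metis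
    qed
    then have "(a + c * v t) * exp (- c * t) \<le> a" by (simp add: q_def v_def)
    then have "(a + c * v t) * exp (- c * t) * exp (c * t) \<le> a * exp (c * t)" by (rule mult_right_mono) simp
    then show ?thesis by (simp add: mult.assoc exp_add[symmetric])
  qed
  show ?thesis using le
  proof eventually_elim
    case (elim t)
    show ?case
    proof
      assume t: "t \<in> {0<..<T}"
      then have "y t \<le> w t" using elim by (simp add: w_def)
      also have "\<dots> \<le> a * exp (c * t)" using wv[of t] bound[of t] t by (auto intro: order_trans)
      finally show "y t \<le> a * exp (c * t)" .
    qed
  qed
qed


section \<open>The relative potential\<close>

text \<open>The Bregman divergence of the internal energy \<open>H\<close>, where
  \<open>H'(r) = \<gamma> * r powr (\<gamma> - 1) / (\<gamma> - 1)\<close>; the common denominator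
  is taken out.\<close>

definition rel_potential :: "real \<Rightarrow> real \<Rightarrow> real \<Rightarrow> real" where
  "rel_potential \<gamma> a r = (a powr \<gamma> - r powr \<gamma> - \<gamma> * r powr (\<gamma> - 1) * (a - r)) / (\<gamma> - 1)"

text \<open>Strict convexity, from the mean value theorem and the increasing derivative on either
  side of \<open>r\<close>. The value \<open>a = 0\<close> is separate because the derivative
  formula requires a positive argument.\<close>

lemma powr_tangent_strict:
  fixes a r \<gamma> :: real
  assumes "\<gamma> > 1" "a \<ge> 0" "r > 0" "a \<noteq> r"
  shows "a powr \<gamma> > r powr \<gamma> + \<gamma> * r powr (\<gamma> - 1) * (a - r)"
proof -
  have rr: "r powr (\<gamma> - 1) * r = r powr \<gamma>" using assms powr_add[of r "\<gamma> - 1" 1] by simp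
  have der: "((\<lambda>x. x powr \<gamma>) has_real_derivative \<gamma> * x powr (\<gamma> - 1)) (at x)" if "x > 0" for x
    using has_real_derivative_powr[OF that] .
  consider "a = 0" | "0 < a" "a < r" | "r < a" using assms by linarith
  then show ?thesis
  proof cases
    case 1
    have "\<gamma> * r powr (\<gamma> - 1) * (a - r) = - (\<gamma> * r powr \<gamma>)"
      by (simp only: 1 diff_0 mult_minus_right mult.assoc rr)
    moreover have "r powr \<gamma> < \<gamma> * r powr \<gamma>" using assms by simp
    moreover have "a powr \<gamma> = 0" by (simp add: 1)
    ultimately show ?thesis by linarith
  next
    case 2
    then obtain z where z: "a < z" "z < r" "r powr \<gamma> - a powr \<gamma> = (r - a) * (\<gamma> * z powr (\<gamma> - 1))"
      using MVT2[of a r "\<lambda>x. x powr \<gamma>" "\<lambda>x. \<gamma> * x powr (\<gamma> - 1)"] der by fastforce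
    have "z powr (\<gamma> - 1) < r powr (\<gamma> - 1)" using z 2 assms by (intro powr_less_mono2) auto
    then have "(r - a) * (\<gamma> * z powr (\<gamma> - 1)) < (r - a) * (\<gamma> * r powr (\<gamma> - 1))"
      using 2 assms by (intro mult_strict_left_mono) auto
    then show ?thesis using z by (simp add: algebra_simps)
  next
    case 3
    then obtain z where z: "r < z" "z < a" "a powr \<gamma> - r powr \<gamma> = (a - r) * (\<gamma> * z powr (\<gamma> - 1))"
      using MVT2[of r a "\<lambda>x. x powr \<gamma>" "\<lambda>x. \<gamma> * x powr (\<gamma> - 1)"] der assms by fastforce
    have "r powr (\<gamma> - 1) < z powr (\<gamma> - 1)" using z assms by (intro powr_less_mono2) auto
    then have "(a - r) * (\<gamma> * r powr (\<gamma> - 1)) < (a - r) * (\<gamma> * z powr (\<gamma> - 1))"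
      using 3 assms by (intro mult_strict_left_mono) auto
    then show ?thesis using z by (simp add: algebra_simps)
  qed
qed

lemma powr_tangent:
  fixes a r \<gamma> :: real
  assumes "\<gamma> > 1" "a \<ge> 0" "r \<ge> 0"
  shows "a powr \<gamma> \<ge> r powr \<gamma> + \<gamma> * r powr (\<gamma> - 1) * (a - r)"
  using powr_tangent_strict[of \<gamma> a r] assms by (cases "r = 0"; cases "a = r") auto

lemma rel_potential_nonneg: "\<gamma> > 1 \<Longrightarrow> a \<ge> 0 \<Longrightarrow> r \<ge> 0 \<Longrightarrow> rel_potential \<gamma> a r \<ge> 0"
  using powr_tangent[of \<gamma> a r] by (simp add: rel_potential_def)

lemma rel_potential_pos: "\<gamma> > 1 \<Longrightarrow> a \<ge> 0 \<Longrightarrow> r > 0 \<Longrightarrow> a \<noteq> r \<Longrightarrow> rel_potential \<gamma> a r > 0"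
  using powr_tangent_strict[of \<gamma> a r] by (simp add: rel_potential_def)

lemma powr_add_le:
  fixes x y p :: real
  assumes "p \<ge> 0" "x \<ge> 0" "y \<ge> 0"
  shows "(x + y) powr p \<le> 2 powr p * (x powr p + y powr p)"
proof -
  have "(x + y) powr p \<le> (2 * max x y) powr p" using assms by (intro powr_mono2) auto
  also have "\<dots> = 2 powr p * (max x y) powr p" using assms by (simp add: powr_mult)
  also have "\<dots> \<le> 2 powr p * (x powr p + y powr p)" by (intro mult_left_mono) (auto simp: max_def)
  finally show ?thesis .
qed

text \<open>By the tangent inequality at \<open>a\<close>, a Bregman divergence is at most
  \<open>(H'(a) - H'(r)) * (a - r)\<close>. For \<open>r \<le> M\<close> the difference of
  derivatives grows at most like a constant plus a multiple of
  \<open>\<bar>a - r\<bar> powr (\<gamma> - 1)\<close>.\<close>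

lemma rel_potential_le:
  assumes \<gamma>: "\<gamma> > 1" and "M > 0"
  shows "\<exists>C\<ge>0. \<forall>a r. 0 \<le> a \<longrightarrow> 0 < r \<longrightarrow> r \<le> M \<longrightarrow> rel_potential \<gamma> a r \<le> C * (\<bar>a - r\<bar> + \<bar>a - r\<bar> powr \<gamma>)"
proof -
  define k where "k = 2 powr (\<gamma> - 1)"
  define A where "A = k * M powr (\<gamma> - 1) + M powr (\<gamma> - 1)"
  define C where "C = \<gamma> * (A + k) / (\<gamma> - 1)"
  have k: "k \<ge> 0" "A \<ge> 0" by (auto simp: k_def A_def)
  have "rel_potential \<gamma> a r \<le> C * (\<bar>a - r\<bar> + \<bar>a - r\<bar> powr \<gamma>)" if a: "0 \<le> a" and r: "0 < r" "r \<le> M" for a r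
  proof -
    let ?d = "\<bar>a - r\<bar>"
    have dd: "?d powr (\<gamma> - 1) * ?d = ?d powr \<gamma>" using powr_add[of ?d "\<gamma> - 1" 1] by (cases "?d = 0") auto
    have "(\<gamma> - 1) * rel_potential \<gamma> a r = a powr \<gamma> - r powr \<gamma> - \<gamma> * r powr (\<gamma> - 1) * (a - r)"
      using \<gamma> by (simp add: rel_potential_def)
    also have "\<dots> \<le> \<gamma> * (a powr (\<gamma> - 1) - r powr (\<gamma> - 1)) * (a - r)"
      using powr_tangent[OF \<gamma>, of r a] a r by (simp add: algebra_simps)
    also have "\<dots> \<le> \<gamma> * (\<bar>a powr (\<gamma> - 1) - r powr (\<gamma> - 1)\<bar> * ?d)"
      using \<gamma> abs_ge_self[of "(a powr (\<gamma> - 1) - r powr (\<gamma> - 1)) * (a - r)"] by (simp add: abs_mult mult.assoc)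
    also have "\<dots> \<le> \<gamma> * ((k * ?d powr (\<gamma> - 1) + A) * ?d)"
    proof (intro mult_left_mono mult_right_mono)
      have "a powr (\<gamma> - 1) \<le> (?d + M) powr (\<gamma> - 1)" using a r \<gamma> by (intro powr_mono2) auto
      also have "\<dots> \<le> k * (?d powr (\<gamma> - 1) + M powr (\<gamma> - 1))" unfolding k_def using \<gamma> r by (intro powr_add_le) auto
      finally have "a powr (\<gamma> - 1) \<le> k * ?d powr (\<gamma> - 1) + k * M powr (\<gamma> - 1)" by (simp add: distrib_left)
      moreover have "r powr (\<gamma> - 1) \<le> M powr (\<gamma> - 1)" using r \<gamma> by (intro powr_mono2) auto
      moreover have "a powr (\<gamma> - 1) \<ge> 0" "r powr (\<gamma> - 1) \<ge> 0" "k * M powr (\<gamma> - 1) \<ge> 0" "k * ?d powr (\<gamma> - 1) \<ge> 0"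
        using k by auto
      ultimately show "\<bar>a powr (\<gamma> - 1) - r powr (\<gamma> - 1)\<bar> \<le> k * ?d powr (\<gamma> - 1) + A" unfolding A_def by linarith
    qed (use \<gamma> in auto)
    also have "\<dots> = \<gamma> * (k * ?d powr \<gamma> + A * ?d)" by (simp add: dd[symmetric] algebra_simps)
    also have "\<dots> \<le> \<gamma> * ((A + k) * ?d powr \<gamma> + (A + k) * ?d)"
      using \<gamma> k by (intro mult_left_mono add_mono mult_right_mono) auto
    also have "\<dots> = \<gamma> * (A + k) * (?d + ?d powr \<gamma>)" by (simp add: algebra_simps)
    also have "\<gamma> * (A + k) = (\<gamma> - 1) * C" using \<gamma> by (simp add: C_def)
    also have "(\<gamma> - 1) * C * (?d + ?d powr \<gamma>) = (\<gamma> - 1) * (C * (?d + ?d powr \<gamma>))" by (simp only: mult.assoc)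
    finally show ?thesis using \<gamma> by simp
  qed
  then show ?thesis using \<gamma> k by (intro exI[of _ C]) (auto simp: C_def)
qed

text \<open>For \<open>\<gamma> < 2\<close> no such bound holds with \<open>\<delta> = 0\<close>, as
  the relative potential is quadratic near \<open>a = r\<close>. Away from the diagonal there are
  two regimes: for \<open>a \<ge> K\<close> the term \<open>a powr \<gamma>\<close> dominates, and
  on the remaining compact set with \<open>\<bar>a - r\<bar> powr \<gamma> \<ge> \<delta>\<close>
  the continuous potential has a positive minimum.\<close>

lemma rel_potential_coercive:
  assumes \<gamma>: "\<gamma> > 1" and m: "0 < m" "m \<le> M" and \<delta>: "\<delta> > 0"
  shows "\<exists>C\<ge>0. \<forall>a r. 0 \<le> a \<longrightarrow> m \<le> r \<longrightarrow> r \<le> M \<longrightarrow> \<bar>a - r\<bar> powr \<gamma> \<le> \<delta> + C * rel_potential \<gamma> a r"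
proof -
  \<comment> \<open>\<open>K\<close> solves
    \<open>K powr (\<gamma> - 1) = 2 * \<gamma> * M powr (\<gamma> - 1)\<close>, so for
    \<open>a \<ge> K\<close> the linear term costs at most half of
    \<open>a powr \<gamma>\<close>.\<close>
  define K where "K = (2 * \<gamma>) powr (1 / (\<gamma> - 1)) * M"
  have M: "M > 0" using m by simp
  have K: "K \<ge> M"
  proof -
    have "(2 * \<gamma>) powr (1 / (\<gamma> - 1)) \<ge> 1" using \<gamma> by (intro ge_one_powr_ge_zero) auto
    then show ?thesis unfolding K_def using M by simp
  qed
  have Kp: "K powr (\<gamma> - 1) = 2 * \<gamma> * M powr (\<gamma> - 1)"
    unfolding K_def using \<gamma> M by (simp add: powr_mult powr_powr)
  have large: "\<bar>a - r\<bar> powr \<gamma> \<le> 2 * (\<gamma> - 1) * rel_potential \<gamma> a r" if "a \<ge> K" "m \<le> r" "r \<le> M" for a r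
  proof -
    have a: "a > 0" "r > 0" using that K M m by auto
    have aa: "a powr \<gamma> = a powr (\<gamma> - 1) * a" "r powr \<gamma> = r powr (\<gamma> - 1) * r"
      using a powr_add[of a "\<gamma> - 1" 1] powr_add[of r "\<gamma> - 1" 1] by auto
    have "2 * \<gamma> * r powr (\<gamma> - 1) \<le> 2 * \<gamma> * M powr (\<gamma> - 1)"
      using that a \<gamma> by (intro mult_left_mono powr_mono2) auto
    also have "\<dots> \<le> a powr (\<gamma> - 1)" unfolding Kp[symmetric] using that K M \<gamma> by (intro powr_mono2) auto
    finally have "2 * \<gamma> * r powr (\<gamma> - 1) * a \<le> a powr \<gamma>" unfolding aa using a by (intro mult_right_mono) auto
    moreover have "r powr \<gamma> \<le> \<gamma> * r powr (\<gamma> - 1) * r" 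
      using mult_right_mono[of 1 \<gamma> "r powr (\<gamma> - 1) * r"] a \<gamma> by (simp add: aa mult.assoc)
    ultimately have "a powr \<gamma> \<le> 2 * (a powr \<gamma> - r powr \<gamma> - \<gamma> * r powr (\<gamma> - 1) * (a - r))"
      by (simp add: algebra_simps)
    also have "a powr \<gamma> - r powr \<gamma> - \<gamma> * r powr (\<gamma> - 1) * (a - r) = (\<gamma> - 1) * rel_potential \<gamma> a r"
      using \<gamma> by (simp add: rel_potential_def)
    also have "2 * ((\<gamma> - 1) * rel_potential \<gamma> a r) = 2 * (\<gamma> - 1) * rel_potential \<gamma> a r" by (simp only: mult.assoc)
    finally have "a powr \<gamma> \<le> 2 * (\<gamma> - 1) * rel_potential \<gamma> a r" .
    moreover have "\<bar>a - r\<bar> powr \<gamma> \<le> a powr \<gamma>" using that a K \<gamma> by (intro powr_mono2) auto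
    ultimately show ?thesis by simp
  qed
  let ?S = "{p \<in> {0..K} \<times> {m..M}. \<delta> \<le> \<bar>fst p - snd p\<bar> powr \<gamma>}"
  have contd: "continuous_on ({0..K} \<times> {m..M}) (\<lambda>p. \<bar>fst p - snd p\<bar> powr \<gamma>)"
    using \<gamma> by (intro continuous_on_powr' continuous_intros) auto
  have "compact ?S"
  proof -
    have "closed ?S" using continuous_closed_preimage[OF contd _ closed_atLeast[of \<delta>]]
      by (simp add: closed_Times vimage_def Int_def)
    moreover have "bounded ?S"
      by (rule bounded_subset[OF compact_imp_bounded[OF compact_Times[OF compact_Icc[of 0 K] compact_Icc[of m M]]]]) auto
    ultimately show ?thesis by (simp add: compact_eq_bounded_closed)
  qed
  have contr: "continuous_on ?S (\<lambda>p. rel_potential \<gamma> (fst p) (snd p))"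
    unfolding rel_potential_def using \<gamma> m by (intro continuous_on_powr' continuous_intros) auto
  have "\<exists>c>0. \<forall>p\<in>?S. c \<le> rel_potential \<gamma> (fst p) (snd p)"
  proof (cases "?S = {}")
    case False
    then obtain p where p: "p \<in> ?S" "\<forall>q\<in>?S. rel_potential \<gamma> (fst p) (snd p) \<le> rel_potential \<gamma> (fst q) (snd q)"
      using continuous_attains_inf[OF \<open>compact ?S\<close> _ contr] by auto
    have "fst p \<noteq> snd p" using p(1) \<delta> by auto
    then have "rel_potential \<gamma> (fst p) (snd p) > 0" using p(1) m by (intro rel_potential_pos[OF \<gamma>]) auto
    then show ?thesis using p(2) by blast
  qed (auto intro: exI[of _ 1])
  then obtain c where c: "c > 0" "\<And>p. p \<in> ?S \<Longrightarrow> c \<le> rel_potential \<gamma> (fst p) (snd p)" by blast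
  define C where "C = 2 * (\<gamma> - 1) + K powr \<gamma> / c"
  have C: "C \<ge> 2 * (\<gamma> - 1)" "C \<ge> K powr \<gamma> / c" using c \<gamma> by (auto simp: C_def)
  have "\<bar>a - r\<bar> powr \<gamma> \<le> \<delta> + C * rel_potential \<gamma> a r" if a: "0 \<le> a" and r: "m \<le> r" "r \<le> M" for a r
  proof -
    have rp: "rel_potential \<gamma> a r \<ge> 0" using a r m by (intro rel_potential_nonneg[OF \<gamma>]) auto
    consider "a \<ge> K" | "a \<le> K" "\<bar>a - r\<bar> powr \<gamma> \<le> \<delta>" | "a \<le> K" "\<bar>a - r\<bar> powr \<gamma> \<ge> \<delta>" by linarith
    then show ?thesis
    proof cases
      case 1
      have "\<bar>a - r\<bar> powr \<gamma> \<le> 2 * (\<gamma> - 1) * rel_potential \<gamma> a r" by (rule large[OF 1 r])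
      also have "\<dots> \<le> C * rel_potential \<gamma> a r" using C rp by (intro mult_right_mono) auto
      finally show ?thesis using \<delta> by simp
    next
      case 2
      have "0 \<le> C * rel_potential \<gamma> a r" using C \<gamma> rp by (intro mult_nonneg_nonneg) auto
      then show ?thesis using 2 by simp
    next
      case 3
      have "c \<le> rel_potential \<gamma> a r" using c(2)[of "(a, r)"] 3 a r by simp
      have "\<bar>a - r\<bar> powr \<gamma> \<le> K powr \<gamma>" using 3 a r m K \<gamma> by (intro powr_mono2) auto
      also have "\<dots> = K powr \<gamma> / c * c" using c by simp
      also have "\<dots> \<le> C * rel_potential \<gamma> a r"
        using C \<open>c \<le> rel_potential \<gamma> a r\<close> c \<gamma> by (intro mult_mono) auto
      finally show ?thesis using \<delta> by simp
    qed
  qed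
  then show ?thesis using C \<gamma> by (intro exI[of _ C]) auto
qed

text \<open>Above the threshold \<delta> the decreasing power
  \<open>\<bar>d\<bar> powr (1 - \<gamma>)\<close> is at most its value at \<delta>. This trades the
  linear term of \<open>rel_potential_le\<close> for the power \<gamma> and a small
  constant.\<close>

lemma abs_le_powr:
  fixes d \<gamma> \<delta> :: real
  assumes "\<delta> > 0" "\<gamma> > 1" shows "\<bar>d\<bar> \<le> \<delta> + \<delta> powr (1 - \<gamma>) * \<bar>d\<bar> powr \<gamma>"
proof (cases "\<bar>d\<bar> \<le> \<delta>")
  case False
  then have "\<bar>d\<bar> = \<bar>d\<bar> powr (1 - \<gamma>) * \<bar>d\<bar> powr \<gamma>" using assms by (simp add: powr_add[symmetric])
  also have "\<dots> \<le> \<delta> powr (1 - \<gamma>) * \<bar>d\<bar> powr \<gamma>" using False assms by (intro mult_right_mono powr_mono2') auto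
  finally show ?thesis using assms by simp
qed (simp add: add_increasing2)


section \<open>Space-time cylinders\<close>

lemma trace_tensor: "trace (tensor a b) = a \<bullet> b"
  by (simp add: trace_def tensor_def inner_vec_def)

lemma tensor_matrix_vector: "tensor a b *v v = (b \<bullet> v) *\<^sub>R a"
  by (simp add: tensor_def matrix_vector_mult_def inner_vec_def vec_eq_iff sum_distrib_left mult_ac)

lemma tensor_inner: "tensor a a \<bullet> A = a \<bullet> (A *v a)"
  by (simp add: tensor_def matrix_vector_mult_def inner_vec_def sum_distrib_left mult_ac)

lemma jacobian_eq:
  fixes V :: "real^'n \<Rightarrow> real^'m"
  assumes "(V has_derivative (\<lambda>v. A *v v)) (at x)" shows "jacobian V (at x) = A"
  unfolding jacobian_def frechet_derivative_at[OF assms, symmetric] by simp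

lemma divergence_eq_trace:
  "(V has_derivative (\<lambda>v. A *v v)) (at x) \<Longrightarrow> divergence V x = trace A"
  by (simp add: divergence_def jacobian_eq)

lemma has_derivative_grad:
  "(f has_derivative D) (at x) \<Longrightarrow> (f has_derivative (\<lambda>v. grad f x \<bullet> v)) (at x)"
  using grad_inner[of f D x] by presburger

lemma grad_eq:
  assumes "(f has_derivative (\<lambda>v. g \<bullet> v)) (at x)" shows "grad f x = g"
  using grad_inner[OF assms] by (metis vector_eq_rdot inner_commute)

lemma has_derivative_scaleR_field:
  assumes "(f has_derivative (\<lambda>v. g \<bullet> v)) (at x)" "(V has_derivative (\<lambda>v. A *v v)) (at x)"
  shows "((\<lambda>y. f y *\<^sub>R V y) has_derivative (\<lambda>v. (f x *\<^sub>R A + tensor (V x) g) *v v)) (at x)"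
  using has_derivative_scaleR[OF assms]
  by (simp add: matrix_vector_mult_add_rdistrib scaleR_matrix_vector_assoc[symmetric] tensor_matrix_vector)

lemma trace_add: "trace (A + B :: real^3^3) = trace A + trace B"
  by (simp add: trace_def sum.distrib)

lemma trace_scaleR: "trace (c *\<^sub>R A :: real^3^3) = c * trace A"
  by (simp add: trace_def sum_distrib_left)

lemma divergence_scaleR:
  assumes "(f has_derivative (\<lambda>v. g \<bullet> v)) (at x)" "(V has_derivative (\<lambda>v. A *v v)) (at x)"
  shows "divergence (\<lambda>y. f y *\<^sub>R V y) x = f x * trace A + g \<bullet> V x"
  unfolding divergence_eq_trace[OF has_derivative_scaleR_field[OF assms]]
  by (simp add: trace_add trace_scaleR trace_tensor inner_commute)

lemma has_derivative_powr_grad: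
  fixes f :: "real^3 \<Rightarrow> real"
  assumes "(f has_derivative (\<lambda>v. g \<bullet> v)) (at x)" "f x > 0"
  shows "((\<lambda>y. f y powr a) has_derivative (\<lambda>v. ((a * f x powr (a - 1)) *\<^sub>R g) \<bullet> v)) (at x)"
proof -
  have "((\<lambda>z. z powr a) has_derivative (*) (a * f x powr (a - 1))) (at (f x))"
    using has_real_derivative_powr[OF assms(2), of a] unfolding has_field_derivative_def
    by (rule back_subst[of "\<lambda>D. (_ has_derivative D) _"]) (auto simp: fun_eq_iff)
  from has_derivative_compose[OF assms(1) this] show ?thesis by simp
qed

lemma has_real_derivative_powr_chain:
  fixes f :: "real \<Rightarrow> real"
  assumes "(f has_vector_derivative f') (at t)" "f t > 0"
  shows "((\<lambda>s. f s powr a) has_vector_derivative a * f t powr (a - 1) * f') (at t)"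
proof -
  have "(f has_real_derivative f') (at t)" using assms(1) by (simp add: has_real_derivative_iff_has_vector_derivative)
  from DERIV_chain2[OF has_real_derivative_powr[OF assms(2)] this]
  show ?thesis by (simp add: has_real_derivative_iff_has_vector_derivative)
qed

locale cylinder =
  fixes \<Omega> :: "(real^3) set" and T :: real
  assumes dom: "smooth_bounded_domain \<Omega>" and T: "T > 0"
begin

abbreviation "Q \<equiv> {0<..<T} \<times> \<Omega>"
abbreviation "Qc \<equiv> {0..T} \<times> closure \<Omega>"

lemma open_dom: "open \<Omega>" and bounded_dom: "bounded \<Omega>" and dom_nonempty: "\<Omega> \<noteq> {}"
  using dom by (auto simp: smooth_bounded_domain_def)

lemma borel_dom [measurable]: "\<Omega> \<in> sets borel" using open_dom by simp
lemma Q_sets [measurable]: "Q \<in> sets borel" by (intro borel_open open_Times open_dom) auto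
lemma compact_Qc: "compact Qc" using bounded_dom by (intro compact_Times) (auto simp: compact_closure)
lemma Q_subset: "Q \<subseteq> Qc" using closure_subset[of \<Omega>] by (intro Sigma_mono) auto
lemma bounded_Q: "bounded Q" using bounded_subset[OF compact_imp_bounded[OF compact_Qc] Q_subset] .
lemma finite_measure_dom: "emeasure lborel \<Omega> < \<infinity>" using emeasure_bounded_finite[OF bounded_dom] .

lemma closure_Q: "closure Q = Qc"
  unfolding closure_Times using T by simp

text \<open>On the open cylinder the partial derivatives are those of a smooth extension beyond the
  closed one, hence continuous and bounded. At its end times and on its boundary
  \<open>time_deriv\<close> and \<open>frechet_derivative\<close> would see values of
  \<open>f\<close> outside the cylinder.\<close>

lemma smooth_partials:
  fixes f :: "real \<Rightarrow> real^3 \<Rightarrow> 'b::real_normed_vector"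
  assumes "smooth_up_to Qc (\<lambda>(t, x). f t x)"
  obtains C where "C \<ge> 0"
    "\<And>t x. t \<in> {0<..<T} \<Longrightarrow> x \<in> \<Omega> \<Longrightarrow> ((\<lambda>s. f s x) has_vector_derivative time_deriv f t x) (at t)"
    "\<And>t x. t \<in> {0<..<T} \<Longrightarrow> x \<in> \<Omega> \<Longrightarrow> (f t has_derivative frechet_derivative (f t) (at x)) (at x)"
    "\<And>t x. t \<in> {0<..<T} \<Longrightarrow> x \<in> \<Omega> \<Longrightarrow> norm (time_deriv f t x) \<le> C"
    "\<And>t x v. t \<in> {0<..<T} \<Longrightarrow> x \<in> \<Omega> \<Longrightarrow> norm (frechet_derivative (f t) (at x) v) \<le> C * norm v"
    "continuous_on Q (\<lambda>(t, x). time_deriv f t x)"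
    "\<And>v. continuous_on Q (\<lambda>(t, x). frechet_derivative (f t) (at x) v)"
proof -
  obtain D C where D: "\<And>v. continuous_on Qc (\<lambda>p. D p v)"
    "\<And>p. p \<in> interior Qc \<Longrightarrow> ((\<lambda>(t, x). f t x) has_derivative D p) (at p)"
    "\<And>p v. p \<in> Qc \<Longrightarrow> norm (D p v) \<le> C * norm v"
    using smooth_up_to_derivative[OF assms compact_Qc] by blast
  have der: "((\<lambda>(t, x). f t x) has_derivative D (t, x)) (at (t, x))" if "t \<in> {0<..<T}" "x \<in> \<Omega>" for t x
    by (rule D(2)[OF interior_cylinder[OF open_dom that]])
  note p = spacetime_partials[OF der]
  have td: "time_deriv f t x = D (t, x) (1, 0)" if "t \<in> {0<..<T}" "x \<in> \<Omega>" for t x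
    unfolding time_deriv_def using p(1)[OF that] by (rule vector_derivative_at)
  have fd: "frechet_derivative (f t) (at x) = (\<lambda>v. D (t, x) (0, v))" if "t \<in> {0<..<T}" "x \<in> \<Omega>" for t x
    using frechet_derivative_at[OF p(2)[OF that]] by simp
  have mem: "(t, x) \<in> Qc" if "t \<in> {0<..<T}" "x \<in> \<Omega>" for t x using that Q_subset by blast
  show ?thesis
  proof (rule that[of "max C 0"])
    fix t x assume tx: "t \<in> {0<..<T}" "x \<in> \<Omega>"
    show "((\<lambda>s. f s x) has_vector_derivative time_deriv f t x) (at t)"
      unfolding td[OF tx] by (rule p(1)[OF tx])
    show "(f t has_derivative frechet_derivative (f t) (at x)) (at x)"
      unfolding fd[OF tx] by (rule p(2)[OF tx])
    have "norm (D (t, x) (1, 0)) \<le> C * norm (1::real, 0::real^3)" by (rule D(3)[OF mem[OF tx]])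
    then show "norm (time_deriv f t x) \<le> max C 0" unfolding td[OF tx] by (simp add: norm_Pair)
    fix v :: "real^3"
    have "norm (D (t, x) (0, v)) \<le> C * norm (0::real, v)" by (rule D(3)[OF mem[OF tx]])
    also have "\<dots> \<le> max C 0 * norm v" by (simp add: norm_Pair mult_right_mono)
    finally show "norm (frechet_derivative (f t) (at x) v) \<le> max C 0 * norm v" unfolding fd[OF tx] .
  next
    have "continuous_on Q (\<lambda>p. D p (1, 0))" using continuous_on_subset[OF D(1) Q_subset] .
    then show "continuous_on Q (\<lambda>(t, x). time_deriv f t x)"
      by (rule continuous_on_eq) (auto simp: td)
    fix v :: "real^3"
    have "continuous_on Q (\<lambda>p. D p (0, v))" using continuous_on_subset[OF D(1) Q_subset] .
    then show "continuous_on Q (\<lambda>(t, x). frechet_derivative (f t) (at x) v)"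
      by (rule continuous_on_eq) (auto simp: fd)
  qed simp
qed

lemma smooth_scalar_partials:
  fixes f :: "real \<Rightarrow> real^3 \<Rightarrow> real"
  assumes "smooth_up_to Qc (\<lambda>(t, x). f t x)"
  obtains C where "C \<ge> 0"
    "\<And>t x. t \<in> {0<..<T} \<Longrightarrow> x \<in> \<Omega> \<Longrightarrow> ((\<lambda>s. f s x) has_vector_derivative time_deriv f t x) (at t)"
    "\<And>t x. t \<in> {0<..<T} \<Longrightarrow> x \<in> \<Omega> \<Longrightarrow> (f t has_derivative (\<lambda>v. grad (f t) x \<bullet> v)) (at x)"
    "\<And>t x. t \<in> {0<..<T} \<Longrightarrow> x \<in> \<Omega> \<Longrightarrow> \<bar>time_deriv f t x\<bar> \<le> C"
    "\<And>t x. t \<in> {0<..<T} \<Longrightarrow> x \<in> \<Omega> \<Longrightarrow> norm (grad (f t) x) \<le> C"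
    "continuous_on Q (\<lambda>(t, x). time_deriv f t x)"
    "continuous_on Q (\<lambda>(t, x). grad (f t) x)"
proof -
  obtain C where C: "C \<ge> 0"
    "\<And>t x. t \<in> {0<..<T} \<Longrightarrow> x \<in> \<Omega> \<Longrightarrow> ((\<lambda>s. f s x) has_vector_derivative time_deriv f t x) (at t)"
    "\<And>t x. t \<in> {0<..<T} \<Longrightarrow> x \<in> \<Omega> \<Longrightarrow> (f t has_derivative frechet_derivative (f t) (at x)) (at x)"
    "\<And>t x. t \<in> {0<..<T} \<Longrightarrow> x \<in> \<Omega> \<Longrightarrow> norm (time_deriv f t x) \<le> C"
    "\<And>t x v. t \<in> {0<..<T} \<Longrightarrow> x \<in> \<Omega> \<Longrightarrow> norm (frechet_derivative (f t) (at x) v) \<le> C * norm v"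
    "continuous_on Q (\<lambda>(t, x). time_deriv f t x)"
    "\<And>v. continuous_on Q (\<lambda>(t, x). frechet_derivative (f t) (at x) v)"
    using smooth_partials[OF assms] by blast
  show ?thesis
  proof (rule that[OF C(1,2) has_derivative_grad[OF C(3)] _ _ C(6)])
    fix t x assume tx: "t \<in> {0<..<T}" "x \<in> \<Omega>"
    show "\<bar>time_deriv f t x\<bar> \<le> C" using C(4)[OF tx] by simp
    let ?g = "grad (f t) x"
    \<comment> \<open>Applying the derivative to the gradient itself turns the bound on directional
      derivatives into a bound on \<open>norm ?g\<close>.\<close>
    have *: "norm ?g * norm ?g = frechet_derivative (f t) (at x) ?g"
      using grad_inner[OF C(3)[OF tx], of ?g] by (simp add: dot_square_norm power2_eq_square)
    have "norm ?g * norm ?g = norm (frechet_derivative (f t) (at x) ?g)" unfolding *[symmetric] by simp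
    also have "\<dots> \<le> C * norm ?g" by (rule C(5)[OF tx])
    finally show "norm ?g \<le> C" using C(1) by (cases "?g = 0") auto
  next
    have "continuous_on Q (\<lambda>p. \<chi> j. (case p of (t, x) \<Rightarrow> frechet_derivative (f t) (at x) (axis j 1)))"
      by (intro continuous_on_vec_lambda C(7))
    then show "continuous_on Q (\<lambda>(t, x). grad (f t) x)"
      by (rule continuous_on_eq) (auto simp: grad_def)
  qed auto
qed

lemma smooth_vector_partials:
  fixes f :: "real \<Rightarrow> real^3 \<Rightarrow> real^3"
  assumes "smooth_up_to Qc (\<lambda>(t, x). f t x)"
  obtains C where "C \<ge> 0"
    "\<And>t x. t \<in> {0<..<T} \<Longrightarrow> x \<in> \<Omega> \<Longrightarrow> ((\<lambda>s. f s x) has_vector_derivative time_deriv f t x) (at t)"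
    "\<And>t x. t \<in> {0<..<T} \<Longrightarrow> x \<in> \<Omega> \<Longrightarrow> (f t has_derivative (\<lambda>v. jacobian (f t) (at x) *v v)) (at x)"
    "\<And>t x. t \<in> {0<..<T} \<Longrightarrow> x \<in> \<Omega> \<Longrightarrow> norm (time_deriv f t x) \<le> C"
    "\<And>t x i j. t \<in> {0<..<T} \<Longrightarrow> x \<in> \<Omega> \<Longrightarrow> \<bar>jacobian (f t) (at x) $ i $ j\<bar> \<le> C"
    "\<And>t x v. t \<in> {0<..<T} \<Longrightarrow> x \<in> \<Omega> \<Longrightarrow> norm (jacobian (f t) (at x) *v v) \<le> C * norm v"
    "continuous_on Q (\<lambda>(t, x). time_deriv f t x)"
    "continuous_on Q (\<lambda>(t, x). jacobian (f t) (at x))"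
proof -
  obtain C where C: "C \<ge> 0"
    "\<And>t x. t \<in> {0<..<T} \<Longrightarrow> x \<in> \<Omega> \<Longrightarrow> ((\<lambda>s. f s x) has_vector_derivative time_deriv f t x) (at t)"
    "\<And>t x. t \<in> {0<..<T} \<Longrightarrow> x \<in> \<Omega> \<Longrightarrow> (f t has_derivative frechet_derivative (f t) (at x)) (at x)"
    "\<And>t x. t \<in> {0<..<T} \<Longrightarrow> x \<in> \<Omega> \<Longrightarrow> norm (time_deriv f t x) \<le> C"
    "\<And>t x v. t \<in> {0<..<T} \<Longrightarrow> x \<in> \<Omega> \<Longrightarrow> norm (frechet_derivative (f t) (at x) v) \<le> C * norm v"
    "continuous_on Q (\<lambda>(t, x). time_deriv f t x)"
    "\<And>v. continuous_on Q (\<lambda>(t, x). frechet_derivative (f t) (at x) v)"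
    using smooth_partials[OF assms] by blast
  have J: "(f t has_derivative (\<lambda>v. jacobian (f t) (at x) *v v)) (at x)" if "t \<in> {0<..<T}" "x \<in> \<Omega>" for t x
    using C(3)[OF that] jacobian_works differentiable_def by blast
  have Jv: "jacobian (f t) (at x) *v v = frechet_derivative (f t) (at x) v" if "t \<in> {0<..<T}" "x \<in> \<Omega>" for t x v
    using frechet_derivative_at[OF J[OF that]] by simp
  show ?thesis
  proof (rule that[OF C(1,2) J C(4) _ _ C(6)])
    fix t x assume tx: "t \<in> {0<..<T}" "x \<in> \<Omega>"
    show le: "norm (jacobian (f t) (at x) *v v) \<le> C * norm v" for v using C(5)[OF tx] Jv[OF tx] by simp
    fix i j
    have "jacobian (f t) (at x) $ i $ j = (jacobian (f t) (at x) *v axis j 1) $ i"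
      by (simp add: matrix_vector_mult_basis column_def)
    then show "\<bar>jacobian (f t) (at x) $ i $ j\<bar> \<le> C"
      using component_le_norm_cart[of "jacobian (f t) (at x) *v axis j 1" i] le[of "axis j 1"] by simp
  next
    have "continuous_on Q (\<lambda>p. \<chi> i j. (case p of (t, x) \<Rightarrow> frechet_derivative (f t) (at x) (axis j 1)) $ i)"
      by (intro continuous_on_vec_lambda continuous_intros C(7))
    then show "continuous_on Q (\<lambda>(t, x). jacobian (f t) (at x))"
      by (rule continuous_on_eq) (auto simp: jacobian_def matrix_def)
  qed auto
qed

lemma time_deriv_monomial_scaleR:
  fixes f :: "real \<Rightarrow> real^3 \<Rightarrow> 'b::real_normed_vector"
  assumes "((\<lambda>s. f s x) has_vector_derivative d) (at t)"
  shows "time_deriv (\<lambda>s y. s ^ n *\<^sub>R f s y) t x = (real n * t ^ (n - 1)) *\<^sub>R f t x + t ^ n *\<^sub>R d"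
proof -
  have "((\<lambda>s. s ^ n) has_real_derivative real n * t ^ (n - 1)) (at t)"
    using DERIV_pow[of n t] by simp
  from has_vector_derivative_scaleR[OF this assms]
  show ?thesis unfolding time_deriv_def by (simp add: vector_derivative_at add.commute)
qed

text \<open>These products are the admissible test functions that supply the hypothesis of
  \<open>moment_localization\<close>.\<close>

lemma smooth_monomial_scaleR:
  fixes f :: "real \<Rightarrow> real^3 \<Rightarrow> 'b::real_normed_vector"
  assumes "smooth_up_to Qc (\<lambda>(t, x). f t x)"
  shows "smooth_up_to Qc (\<lambda>(t, x). t ^ n *\<^sub>R f t x)"
proof -
  have "smooth_up_to Qc (\<lambda>p. fst p ^ n)"
    by (intro smooth_up_to_power smooth_up_to_linear bounded_linear_fst)
  from smooth_up_to_bilinear[OF bounded_bilinear_scaleR this assms]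
  show ?thesis by (simp add: case_prod_beta')
qed

end


section \<open>The Euler flow\<close>

lemma set_borel_measurable_lborel: "set_borel_measurable lborel A f \<longleftrightarrow> set_borel_measurable borel A f"
  by (simp add: set_borel_measurable_def)

lemma set_integrable_bilinear_bounded:
  fixes f :: "'a \<Rightarrow> 'b::euclidean_space" and g :: "'a \<Rightarrow> 'c::euclidean_space"
    and prod :: "'b \<Rightarrow> 'c \<Rightarrow> 'd::euclidean_space"
  assumes b: "bounded_bilinear prod" and f: "set_integrable M A f" and g: "set_borel_measurable M A g"
    and B: "\<And>x. x \<in> A \<Longrightarrow> norm (g x) \<le> B"
  shows "set_integrable M A (\<lambda>x. prod (f x) (g x))"
proof -
  interpret bounded_bilinear prod by (rule b)
  obtain K where K: "K > 0" "\<And>a b. norm (prod a b) \<le> norm a * norm b * K" using pos_bounded by blast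
  have eq: "indicat_real A x *\<^sub>R prod (f x) (g x) = prod (indicat_real A x *\<^sub>R f x) (indicat_real A x *\<^sub>R g x)" for x
    by (cases "x \<in> A") (simp_all add: zero_left)
  have "integrable M (\<lambda>x. prod (indicat_real A x *\<^sub>R f x) (indicat_real A x *\<^sub>R g x))"
  proof (rule Bochner_Integration.integrable_bound[where f = "\<lambda>x. (\<bar>B\<bar> * K) *\<^sub>R norm (indicat_real A x *\<^sub>R f x)"])
    show "integrable M (\<lambda>x. (\<bar>B\<bar> * K) *\<^sub>R norm (indicat_real A x *\<^sub>R f x))"
      using f unfolding set_integrable_def by (intro integrable_scaleR_right integrable_norm)
    show "(\<lambda>x. prod (indicat_real A x *\<^sub>R f x) (indicat_real A x *\<^sub>R g x)) \<in> borel_measurable M"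
    proof (rule borel_measurable_continuous_Pair[where H = prod and f = "\<lambda>x. indicat_real A x *\<^sub>R f x" and g = "\<lambda>x. indicat_real A x *\<^sub>R g x"])
      show "(\<lambda>x. indicat_real A x *\<^sub>R f x) \<in> borel_measurable M" using f by (auto simp: set_integrable_def)
      show "(\<lambda>x. indicat_real A x *\<^sub>R g x) \<in> borel_measurable M" using g by (simp add: set_borel_measurable_def)
      show "continuous_on UNIV (\<lambda>x. prod (fst x) (snd x))" by (intro continuous_on continuous_intros)
    qed
    show "AE x in M. norm (prod (indicat_real A x *\<^sub>R f x) (indicat_real A x *\<^sub>R g x))
      \<le> norm ((\<bar>B\<bar> * K) *\<^sub>R norm (indicat_real A x *\<^sub>R f x))"
    proof (rule AE_I2)
      fix x
      show "norm (prod (indicat_real A x *\<^sub>R f x) (indicat_real A x *\<^sub>R g x)) \<le> norm ((\<bar>B\<bar> * K) *\<^sub>R norm (indicat_real A x *\<^sub>R f x))"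
      proof (cases "x \<in> A")
        case True
        have "norm (prod (f x) (g x)) \<le> norm (f x) * norm (g x) * K" by (rule K)
        also have "\<dots> \<le> norm (f x) * \<bar>B\<bar> * K" using B[OF True] K(1) by (intro mult_right_mono mult_left_mono) auto
        finally show ?thesis using True K(1) by (simp add: mult_ac)
      qed (simp add: zero_left)
    qed
  qed
  then show ?thesis by (simp only: set_integrable_def eq)
qed

lemma set_integrable_continuous_weight:
  fixes f :: "'a::euclidean_space \<Rightarrow> 'b::euclidean_space" and g :: "'a \<Rightarrow> 'c::euclidean_space"
    and prod :: "'b \<Rightarrow> 'c \<Rightarrow> 'd::euclidean_space"
  assumes "bounded_bilinear prod" "A \<in> sets borel" "set_integrable lborel A f" "continuous_on A g"
    and "\<And>x. x \<in> A \<Longrightarrow> norm (g x) \<le> B"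
  shows "set_integrable lborel A (\<lambda>x. prod (f x) (g x))"
  by (rule set_integrable_bilinear_bounded[OF assms(1,3) _ assms(5)])
     (use borel_measurable_continuous_on_indicator[OF assms(2,4)] in \<open>simp add: set_borel_measurable_def\<close>)

lemma set_fubini_swap:
  fixes h :: "'a::euclidean_space \<times> 'b::euclidean_space \<Rightarrow> real"
  assumes "set_integrable lborel (A \<times> B) h"
  shows "(LINT t:A|lborel. LINT x:B|lborel. h (t, x)) = (LINT x:B|lborel. LINT t:A|lborel. h (t, x))"
proof -
  let ?f = "\<lambda>t x. indicat_real (A \<times> B) (t, x) *\<^sub>R h (t, x)"
  have f: "integrable (lborel \<Otimes>\<^sub>M lborel) (\<lambda>(t, x). ?f t x)"
    using assms unfolding set_integrable_def lborel_prod by (simp add: case_prod_beta')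
  have 1: "(\<integral>x. ?f t x \<partial>lborel) = indicat_real A t *\<^sub>R (LINT x:B|lborel. h (t, x))" for t
    unfolding set_lebesgue_integral_def real_scaleR_def integral_mult_right_zero[symmetric]
    by (rule Bochner_Integration.integral_cong) (auto simp: indicator_def)
  have 2: "(\<integral>t. ?f t x \<partial>lborel) = indicat_real B x *\<^sub>R (LINT t:A|lborel. h (t, x))" for x
    unfolding set_lebesgue_integral_def real_scaleR_def integral_mult_right_zero[symmetric]
    by (rule Bochner_Integration.integral_cong) (auto simp: indicator_def)
  show ?thesis
    using lborel_pair.Fubini_integral[OF f] unfolding 1 2 by (simp add: set_lebesgue_integral_def)
qed

locale euler = cylinder +
  fixes \<gamma> :: real and r\<^sub>0 :: "real^3 \<Rightarrow> real" and U\<^sub>0 :: "real^3 \<Rightarrow> real^3"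
    and r :: "real \<Rightarrow> real^3 \<Rightarrow> real" and U :: "real \<Rightarrow> real^3 \<Rightarrow> real^3"
  assumes gamma: "\<gamma> > 1"
    and euler: "smooth_euler_solution \<gamma> \<Omega> T r\<^sub>0 U\<^sub>0 r U"
    and inf_pos: "0 < (INF (t, x)\<in>{0<..<T} \<times> \<Omega>. ereal (r t x))"
begin

lemma r_smooth: "smooth_up_to Qc (\<lambda>(t, x). r t x)" and U_smooth: "smooth_up_to Qc (\<lambda>(t, x). U t x)"
  and tangent: "\<And>t x. t \<in> {0..T} \<Longrightarrow> x \<in> frontier \<Omega> \<Longrightarrow> U t x \<bullet> outward_normal \<Omega> x = 0"
  and initial: "\<And>x. x \<in> closure \<Omega> \<Longrightarrow> r 0 x = r\<^sub>0 x" "\<And>x. x \<in> closure \<Omega> \<Longrightarrow> U 0 x = U\<^sub>0 x"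
  using euler by (auto simp: smooth_euler_solution_def)

text \<open>The lower bound is given on the open cylinder and passes to the closed one by
  continuity; the upper bound comes from compactness. Positivity up to the boundary is what makes
  powers of \<open>r\<close> smooth there.\<close>

lemma r_bounds: "\<exists>m>0. \<exists>M. \<forall>t\<in>{0..T}. \<forall>x\<in>closure \<Omega>. m \<le> r t x \<and> r t x \<le> M"
proof -
  let ?f = "\<lambda>(t, x). r t x"
  obtain m where m: "0 < ereal m" "ereal m < (INF (t, x)\<in>Q. ereal (r t x))"
    using ereal_dense2[OF inf_pos] by blast
  have low: "m \<le> ?f p" if "p \<in> Q" for p
  proof -
    have "(INF (t, x)\<in>Q. ereal (r t x)) \<le> (case p of (t, x) \<Rightarrow> ereal (r t x))" by (rule INF_lower[OF that])
    then show ?thesis using m(2) by (cases p) (auto dest: order.strict_trans2)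
  qed
  have c: "continuous_on Qc ?f" by (rule smooth_up_to_continuous_on[OF r_smooth])
  have "m \<le> ?f p" if "p \<in> Qc" for p
    by (rule continuous_ge_on_closure[of Q ?f]) (use c closure_Q that low in auto)
  moreover have "bounded (?f ` Qc)" by (intro compact_imp_bounded compact_continuous_image c compact_Qc)
  then obtain M where "\<forall>y\<in>?f ` Qc. norm y \<le> M" unfolding bounded_iff by blast
  then have up: "\<And>y. y \<in> ?f ` Qc \<Longrightarrow> norm y \<le> M" by blast
  have "?f p \<le> M" if "p \<in> Qc" for p
  proof -
    have "norm (?f p) \<le> M" by (rule up[OF imageI[OF that]])
    then show ?thesis by simp
  qed
  ultimately show ?thesis using m(1) by (intro exI[of _ m]) (auto intro!: exI[of _ M])
qed

lemma r_pos: "t \<in> {0..T} \<Longrightarrow> x \<in> closure \<Omega> \<Longrightarrow> r t x > 0"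
  using r_bounds by (meson less_le_trans)

lemma in_Qc: "t \<in> {0<..<T} \<Longrightarrow> t \<in> {0..T}" "x \<in> \<Omega> \<Longrightarrow> x \<in> closure \<Omega>"
  using closure_subset[of \<Omega>] by auto

lemma r_powr_smooth: "smooth_up_to Qc (\<lambda>(t, x). r t x powr a)"
  using smooth_up_to_powr[OF r_smooth, of a] r_pos by (auto simp: case_prod_beta')

text \<open>The test function for the continuity equation.\<close>

definition a :: "real \<Rightarrow> real^3 \<Rightarrow> real" where
  "a t x = 1/2 * (U t x \<bullet> U t x) - \<gamma> / (\<gamma> - 1) * r t x powr (\<gamma> - 1)"

lemma a_smooth: "smooth_up_to Qc (\<lambda>(t, x). a t x)"
proof -
  have "smooth_up_to Qc (\<lambda>p. 1/2 * ((\<lambda>(t, x). U t x) p \<bullet> (\<lambda>(t, x). U t x) p)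
      + (- (\<gamma> / (\<gamma> - 1))) * (\<lambda>(t, x). r t x powr (\<gamma> - 1)) p)"
    by (intro smooth_up_to_add smooth_up_to_bilinear[OF bounded_bilinear_mult]
        smooth_up_to_bilinear[OF bounded_bilinear_inner] smooth_up_to_const U_smooth r_powr_smooth)
  then show ?thesis by (simp add: a_def case_prod_beta')
qed

abbreviation "rt \<equiv> time_deriv r"
abbreviation "gr t x \<equiv> grad (r t) x"
abbreviation "Ut \<equiv> time_deriv U"
abbreviation "J t x \<equiv> jacobian (U t) (at x)"
abbreviation "at' \<equiv> time_deriv a"
abbreviation "ga t x \<equiv> grad (a t) x"

lemma r_der:
  assumes "t \<in> {0<..<T}" "x \<in> \<Omega>"
  shows "((\<lambda>s. r s x) has_vector_derivative rt t x) (at t)" "(r t has_derivative (\<lambda>v. gr t x \<bullet> v)) (at x)"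
  by (rule smooth_scalar_partials[OF r_smooth]; use assms in blast)+

lemma U_der:
  assumes "t \<in> {0<..<T}" "x \<in> \<Omega>"
  shows "((\<lambda>s. U s x) has_vector_derivative Ut t x) (at t)" "(U t has_derivative (\<lambda>v. J t x *v v)) (at x)"
  by (rule smooth_vector_partials[OF U_smooth]; use assms in blast)+

lemma a_der:
  assumes "t \<in> {0<..<T}" "x \<in> \<Omega>"
  shows "((\<lambda>s. a s x) has_vector_derivative at' t x) (at t)" "(a t has_derivative (\<lambda>v. ga t x \<bullet> v)) (at x)"
  by (rule smooth_scalar_partials[OF a_smooth]; use assms in blast)+

lemma continuous_derivs:
  "continuous_on Q (\<lambda>(t, x). rt t x)" "continuous_on Q (\<lambda>(t, x). gr t x)"
  "continuous_on Q (\<lambda>(t, x). Ut t x)" "continuous_on Q (\<lambda>(t, x). J t x)"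
  "continuous_on Q (\<lambda>(t, x). at' t x)" "continuous_on Q (\<lambda>(t, x). ga t x)"
  by (rule smooth_scalar_partials[OF r_smooth], assumption)+
     (rule smooth_vector_partials[OF U_smooth], assumption,
      rule smooth_vector_partials[OF U_smooth], assumption,
      rule smooth_scalar_partials[OF a_smooth], assumption,
      rule smooth_scalar_partials[OF a_smooth], assumption)

lemma continuous_Qc:
  "continuous_on Qc (\<lambda>(t, x). r t x)" "continuous_on Qc (\<lambda>(t, x). U t x)" "continuous_on Qc (\<lambda>(t, x). a t x)"
  "continuous_on Qc (\<lambda>(t, x). r t x powr b)"
  using smooth_up_to_continuous_on r_smooth U_smooth a_smooth r_powr_smooth by blast+

lemma continuous_Q:
  "continuous_on Q (\<lambda>(t, x). r t x)" "continuous_on Q (\<lambda>(t, x). U t x)" "continuous_on Q (\<lambda>(t, x). a t x)"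
  "continuous_on Q (\<lambda>(t, x). r t x powr b)"
  using continuous_Qc continuous_on_subset[OF _ Q_subset] by blast+

lemma bounded_on_Qc:
  fixes f :: "real \<times> (real^3) \<Rightarrow> 'b::real_normed_vector"
  assumes "continuous_on Qc f"
  shows "\<exists>C\<ge>0. \<forall>t\<in>{0..T}. \<forall>x\<in>closure \<Omega>. norm (f (t, x)) \<le> C"
proof -
  have "bounded (f ` Qc)" by (intro compact_imp_bounded compact_continuous_image assms compact_Qc)
  then obtain C where "\<forall>y\<in>f ` Qc. norm y \<le> C" unfolding bounded_iff by blast
  then show ?thesis by (intro exI[of _ "max C 0"]) (auto simp: le_max_iff_disj)
qed

text \<open>The Euler flow enters all later estimates through one number \<open>K\<close>, chosen
  before the viscosity. Derivatives are bounded on the open cylinder, where they are meaningful, and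
  values on the closed one.\<close>

definition bounds :: "real \<Rightarrow> bool" where
  "bounds K \<longleftrightarrow> K \<ge> 0 \<and> (\<forall>t\<in>{0<..<T}. \<forall>x\<in>\<Omega>. \<bar>rt t x\<bar> \<le> K \<and> norm (gr t x) \<le> K \<and> norm (Ut t x) \<le> K
      \<and> (\<forall>i j. \<bar>J t x $ i $ j\<bar> \<le> K) \<and> (\<forall>v. norm (J t x *v v) \<le> K * norm v) \<and> \<bar>at' t x\<bar> \<le> K \<and> norm (ga t x) \<le> K)
    \<and> (\<forall>t\<in>{0..T}. \<forall>x\<in>closure \<Omega>. norm (U t x) \<le> K \<and> \<bar>a t x\<bar> \<le> K \<and> \<bar>r t x powr \<gamma>\<bar> \<le> K \<and> \<bar>r t x powr (\<gamma> - 1)\<bar> \<le> K)"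

lemma bounds_exist: "\<exists>K. bounds K"
proof -
  obtain C1 where C1: "C1 \<ge> 0" "\<And>t x. t \<in> {0<..<T} \<Longrightarrow> x \<in> \<Omega> \<Longrightarrow> \<bar>rt t x\<bar> \<le> C1" "\<And>t x. t \<in> {0<..<T} \<Longrightarrow> x \<in> \<Omega> \<Longrightarrow> norm (gr t x) \<le> C1"
    by (rule smooth_scalar_partials[OF r_smooth]) (rule that; assumption)
  obtain C2 where C2: "C2 \<ge> 0" "\<And>t x. t \<in> {0<..<T} \<Longrightarrow> x \<in> \<Omega> \<Longrightarrow> \<bar>at' t x\<bar> \<le> C2" "\<And>t x. t \<in> {0<..<T} \<Longrightarrow> x \<in> \<Omega> \<Longrightarrow> norm (ga t x) \<le> C2"
    by (rule smooth_scalar_partials[OF a_smooth]) (rule that; assumption)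
  obtain C3 where C3: "C3 \<ge> 0" "\<And>t x. t \<in> {0<..<T} \<Longrightarrow> x \<in> \<Omega> \<Longrightarrow> norm (Ut t x) \<le> C3"
    "\<And>t x i j. t \<in> {0<..<T} \<Longrightarrow> x \<in> \<Omega> \<Longrightarrow> \<bar>J t x $ i $ j\<bar> \<le> C3"
    "\<And>t x v. t \<in> {0<..<T} \<Longrightarrow> x \<in> \<Omega> \<Longrightarrow> norm (J t x *v v) \<le> C3 * norm v"
    by (rule smooth_vector_partials[OF U_smooth]) (rule that; assumption)
  obtain C4 where C4: "C4 \<ge> 0" "\<And>t x. t \<in> {0..T} \<Longrightarrow> x \<in> closure \<Omega> \<Longrightarrow> norm (U t x) \<le> C4"
    using bounded_on_Qc[OF continuous_Qc(2)] by auto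
  obtain C5 where C5: "C5 \<ge> 0" "\<And>t x. t \<in> {0..T} \<Longrightarrow> x \<in> closure \<Omega> \<Longrightarrow> \<bar>a t x\<bar> \<le> C5"
    using bounded_on_Qc[OF continuous_Qc(3)] by auto
  obtain C6 where C6: "C6 \<ge> 0" "\<And>t x. t \<in> {0..T} \<Longrightarrow> x \<in> closure \<Omega> \<Longrightarrow> \<bar>r t x powr \<gamma>\<bar> \<le> C6"
    using bounded_on_Qc[OF continuous_Qc(4)[of \<gamma>]] by auto
  obtain C7 where C7: "C7 \<ge> 0" "\<And>t x. t \<in> {0..T} \<Longrightarrow> x \<in> closure \<Omega> \<Longrightarrow> \<bar>r t x powr (\<gamma> - 1)\<bar> \<le> C7"
    using bounded_on_Qc[OF continuous_Qc(4)[of "\<gamma> - 1"]] by auto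
  define K where "K = C1 + C2 + C3 + C4 + C5 + C6 + C7"
  have K: "C1 \<le> K" "C2 \<le> K" "C3 \<le> K" "C4 \<le> K" "C5 \<le> K" "C6 \<le> K" "C7 \<le> K" "K \<ge> 0"
    using C1(1) C2(1) C3(1) C4(1) C5(1) C6(1) C7(1) by (auto simp: K_def)
  have "norm (J t x *v v) \<le> K * norm v" if "t \<in> {0<..<T}" "x \<in> \<Omega>" for t x v
    using C3(4)[OF that, of v] mult_right_mono[OF K(3), of "norm v"] by simp
  note J = this
  have "bounds K" unfolding bounds_def
  proof (intro conjI ballI allI K(8))
    fix t x assume tx: "t \<in> {0<..<T}" "x \<in> \<Omega>"
    show "\<bar>rt t x\<bar> \<le> K" "norm (gr t x) \<le> K" "\<bar>at' t x\<bar> \<le> K" "norm (ga t x) \<le> K" "norm (Ut t x) \<le> K"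
      using C1(2,3)[OF tx] C2(2,3)[OF tx] C3(2)[OF tx] K by linarith+
    show "\<bar>J t x $ i $ j\<bar> \<le> K" for i j using C3(3)[OF tx, of i j] K by linarith
    show "norm (J t x *v v) \<le> K * norm v" for v by (rule J[OF tx])
  next
    fix t x assume tx: "t \<in> {0..T}" "x \<in> closure \<Omega>"
    show "norm (U t x) \<le> K" "\<bar>a t x\<bar> \<le> K" "\<bar>r t x powr \<gamma>\<bar> \<le> K" "\<bar>r t x powr (\<gamma> - 1)\<bar> \<le> K"
      using C4(2)[OF tx] C5(2)[OF tx] C6(2)[OF tx] C7(2)[OF tx] K by linarith+
  qed
  then show ?thesis ..
qed

lemma continuity_pointwise:
  assumes tx: "t \<in> {0<..<T}" "x \<in> \<Omega>"
  shows "rt t x + gr t x \<bullet> U t x + r t x * trace (J t x) = 0"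
proof -
  have "rt t x + divergence (\<lambda>y. r t y *\<^sub>R U t y) x = 0"
    using euler tx by (auto simp: smooth_euler_solution_def)
  then show ?thesis using divergence_scaleR[OF r_der(2)[OF tx] U_der(2)[OF tx]] by simp
qed

lemma r_powr_arith:
  assumes "t \<in> {0..T}" "x \<in> closure \<Omega>"
  shows "r t x * r t x powr (\<gamma> - 2) = r t x powr (\<gamma> - 1)" "r t x * r t x powr (\<gamma> - 1) = r t x powr \<gamma>"
  using r_pos[OF assms] powr_add[of "r t x" 1 "\<gamma> - 2"] powr_add[of "r t x" 1 "\<gamma> - 1"] by auto

text \<open>Subtracting \<open>U t x\<close> times the continuity equation from the conservative
  momentum equation leaves \<open>r t x\<close> times the left side, and \<open>r t x\<close> is
  positive.\<close>

lemma momentum_pointwise: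
  assumes tx: "t \<in> {0<..<T}" "x \<in> \<Omega>"
  shows "Ut t x + J t x *v U t x + (\<gamma> * r t x powr (\<gamma> - 2)) *\<^sub>R gr t x = 0"
proof -
  have tx': "t \<in> {0..T}" "x \<in> closure \<Omega>" using tx in_Qc by auto
  note rd = r_der[OF tx] and Ud = U_der[OF tx]
  have "((\<lambda>s. r s x *\<^sub>R U s x) has_vector_derivative r t x *\<^sub>R Ut t x + rt t x *\<^sub>R U t x) (at t)"
    using has_vector_derivative_scaleR[OF _ Ud(1)] rd(1) by (simp add: has_real_derivative_iff_has_vector_derivative)
  then have 1: "time_deriv (\<lambda>s y. r s y *\<^sub>R U s y) t x = r t x *\<^sub>R Ut t x + rt t x *\<^sub>R U t x"
    unfolding time_deriv_def by (rule vector_derivative_at)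
  have 2: "grad (\<lambda>y. pressure \<gamma> (r t y)) x = (\<gamma> * r t x powr (\<gamma> - 1)) *\<^sub>R gr t x"
    unfolding pressure_def by (rule grad_eq[OF has_derivative_powr_grad[OF rd(2) r_pos[OF tx']]])
  have 3: "div_matrix (\<lambda>y. r t y *\<^sub>R tensor (U t y) (U t y)) x $ i
      = U t x $ i * (r t x * trace (J t x) + gr t x \<bullet> U t x) + r t x * (J t x *v U t x) $ i" for i
  proof -
    have Ui: "((\<lambda>y. U t y $ i) has_derivative (\<lambda>v. (J t x $ i) \<bullet> v)) (at x)"
      using bounded_linear.has_derivative[OF bounded_linear_vec_nth Ud(2), of i]
      by (simp add: matrix_vector_mult_def inner_vec_def)
    have "((\<lambda>y. r t y * U t y $ i) has_derivative (\<lambda>v. (r t x *\<^sub>R J t x $ i + U t x $ i *\<^sub>R gr t x) \<bullet> v)) (at x)"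
      using has_derivative_mult[OF rd(2) Ui] by (simp add: inner_add_left mult.commute)
    from divergence_scaleR[OF this Ud(2)]
    have "divergence (\<lambda>y. (r t y * U t y $ i) *\<^sub>R U t y) x
      = r t x * U t x $ i * trace (J t x) + (r t x *\<^sub>R J t x $ i + U t x $ i *\<^sub>R gr t x) \<bullet> U t x" .
    moreover have "(\<lambda>y. (r t y *\<^sub>R tensor (U t y) (U t y)) $ i) = (\<lambda>y. (r t y * U t y $ i) *\<^sub>R U t y)"
      by (simp add: tensor_def vec_eq_iff fun_eq_iff)
    moreover have "J t x $ i \<bullet> U t x = (J t x *v U t x) $ i" by (simp add: matrix_vector_mult_def inner_vec_def)
    ultimately show ?thesis by (simp add: div_matrix_def inner_add_left algebra_simps)
  qed
  have e: "time_deriv (\<lambda>s y. r s y *\<^sub>R U s y) t x + div_matrix (\<lambda>y. r t y *\<^sub>R tensor (U t y) (U t y)) x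
      + grad (\<lambda>y. pressure \<gamma> (r t y)) x = 0"
    using euler tx by (auto simp: smooth_euler_solution_def)
  have "r t x *\<^sub>R (Ut t x + J t x *v U t x + (\<gamma> * r t x powr (\<gamma> - 2)) *\<^sub>R gr t x) = 0"
  proof (rule vec_eq_iff[THEN iffD2], rule allI)
    fix i
    have "(r t x *\<^sub>R Ut t x + rt t x *\<^sub>R U t x) $ i + (U t x $ i * (r t x * trace (J t x) + gr t x \<bullet> U t x) + r t x * (J t x *v U t x) $ i)
       + ((\<gamma> * r t x powr (\<gamma> - 1)) *\<^sub>R gr t x) $ i = 0"
      using arg_cong[OF e, of "\<lambda>v. v $ i"] by (simp only: 1 2 3 vector_add_component zero_index)
    then have "r t x * Ut t x $ i + U t x $ i * (rt t x + gr t x \<bullet> U t x + r t x * trace (J t x)) + r t x * (J t x *v U t x) $ i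
       + \<gamma> * (r t x * r t x powr (\<gamma> - 2)) * gr t x $ i = 0"
      unfolding r_powr_arith(1)[OF tx'] by (simp add: algebra_simps)
    then show "(r t x *\<^sub>R (Ut t x + J t x *v U t x + (\<gamma> * r t x powr (\<gamma> - 2)) *\<^sub>R gr t x)) $ i = 0 $ i"
      unfolding continuity_pointwise[OF tx] by (simp add: algebra_simps)
  qed
  then show ?thesis using r_pos[OF tx'] by simp
qed

lemma a_partials:
  assumes tx: "t \<in> {0<..<T}" "x \<in> \<Omega>"
  shows "at' t x = U t x \<bullet> Ut t x - \<gamma> * r t x powr (\<gamma> - 2) * rt t x"
    and "ga t x \<bullet> v = U t x \<bullet> (J t x *v v) - \<gamma> * r t x powr (\<gamma> - 2) * (gr t x \<bullet> v)"
proof -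
  have tx': "t \<in> {0..T}" "x \<in> closure \<Omega>" using tx in_Qc by auto
  note rd = r_der[OF tx] and Ud = U_der[OF tx]
  have g1: "\<gamma> / (\<gamma> - 1) * ((\<gamma> - 1) * z) = \<gamma> * z" for z using gamma by simp
  have g2: "\<gamma> - 1 - 1 = \<gamma> - 2" by simp
  have "((\<lambda>s. U s x \<bullet> U s x) has_vector_derivative U t x \<bullet> Ut t x + Ut t x \<bullet> U t x) (at t)"
    using bounded_bilinear.has_vector_derivative[OF bounded_bilinear_inner Ud(1) Ud(1)] .
  from has_vector_derivative_diff[OF has_vector_derivative_mult_right[OF this, of "1/2"]
      has_vector_derivative_mult_right[OF has_real_derivative_powr_chain[OF rd(1) r_pos[OF tx'], of "\<gamma> - 1"], of "\<gamma> / (\<gamma> - 1)"]]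
  have "((\<lambda>s. a s x) has_vector_derivative U t x \<bullet> Ut t x - \<gamma> * r t x powr (\<gamma> - 2) * rt t x) (at t)"
    unfolding a_def g2 mult.assoc g1 by (simp add: inner_commute)
  from vector_derivative_at[OF this] show "at' t x = U t x \<bullet> Ut t x - \<gamma> * r t x powr (\<gamma> - 2) * rt t x"
    unfolding time_deriv_def .
  have "((\<lambda>y. U t y \<bullet> U t y) has_derivative (\<lambda>v. U t x \<bullet> (J t x *v v) + (J t x *v v) \<bullet> U t x)) (at x)"
    using has_derivative_inner[OF Ud(2) Ud(2)] .
  from has_derivative_diff[OF has_derivative_mult_right[OF this, of "1/2"]
      has_derivative_mult_right[OF has_derivative_powr_grad[OF rd(2) r_pos[OF tx'], of "\<gamma> - 1"], of "\<gamma> / (\<gamma> - 1)"]]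
  have "(a t has_derivative (\<lambda>v. U t x \<bullet> (J t x *v v) - \<gamma> * r t x powr (\<gamma> - 2) * (gr t x \<bullet> v))) (at x)"
    unfolding a_def[abs_def] inner_scaleR_left g2 mult.assoc g1 by (simp add: inner_commute)
  from grad_inner[OF this] show "ga t x \<bullet> v = U t x \<bullet> (J t x *v v) - \<gamma> * r t x powr (\<gamma> - 2) * (gr t x \<bullet> v)" .
qed

text \<open>The divergence of \<open>r\<^sup>\<gamma> U\<close>.\<close>

definition div_pU :: "real \<Rightarrow> real^3 \<Rightarrow> real" where
  "div_pU t x = r t x powr \<gamma> * trace (J t x) + \<gamma> * r t x powr (\<gamma> - 1) * (gr t x \<bullet> U t x)"

text \<open>Algebra in an arbitrary number \<open>\<rho>\<close> and vector \<open>u\<close>, once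
  the Euler equations have expressed \<open>rt\<close> and \<open>Ut\<close> by spatial derivatives.
  The pressure fits in because \<open>(\<gamma> - 1) * rel_potential \<gamma> \<rho> R\<close> is
  also the remainder of \<open>\<rho> powr \<gamma>\<close> after its tangent at
  \<open>R\<close>.\<close>

lemma bulk_identity:
  assumes tx: "t \<in> {0<..<T}" "x \<in> \<Omega>"
  shows "\<rho> * at' t x + (\<rho> *\<^sub>R u) \<bullet> ga t x
      - ((\<rho> *\<^sub>R u) \<bullet> Ut t x + (\<rho> *\<^sub>R tensor u u) \<bullet> J t x + pressure \<gamma> \<rho> * trace (J t x))
      + \<gamma> * r t x powr (\<gamma> - 1) * rt t x
    = - \<rho> * ((u - U t x) \<bullet> (J t x *v (u - U t x)))
      - (\<gamma> - 1) * trace (J t x) * rel_potential \<gamma> \<rho> (r t x) - div_pU t x"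
proof -
  have tx': "t \<in> {0..T}" "x \<in> closure \<Omega>" using tx in_Qc by auto
  define V where "V = U t x"
  define A where "A = J t x"
  define g where "g = gr t x"
  define R where "R = r t x"
  define c where "c = \<gamma> * R powr (\<gamma> - 2)"
  define q where "q = \<gamma> * R powr (\<gamma> - 1)"
  define tr where "tr = trace A"
  have cR: "c * R = q" "q * R = \<gamma> * R powr \<gamma>"
    using r_powr_arith[OF tx'] by (simp_all add: c_def q_def R_def mult_ac)
  have rt: "rt t x = - (g \<bullet> V) - R * tr"
    using continuity_pointwise[OF tx] by (simp add: g_def V_def R_def tr_def A_def)
  have "Ut t x + A *v V + c *\<^sub>R g = 0" using momentum_pointwise[OF tx] by (simp add: A_def V_def c_def g_def R_def)
  then have "Ut t x = - (A *v V + c *\<^sub>R g)" by (simp only: eq_neg_iff_add_eq_0 add.assoc)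
  then have Ut: "Ut t x = - (A *v V) - c *\<^sub>R g" by simp
  have at': "at' t x = V \<bullet> Ut t x - c * rt t x"
    using a_partials(1)[OF tx] by (simp add: V_def c_def R_def)
  have ga: "u \<bullet> ga t x = V \<bullet> (A *v u) - c * (g \<bullet> u)"
    using a_partials(2)[OF tx, of u] by (simp add: V_def c_def R_def A_def g_def inner_commute)
  have rel: "(\<gamma> - 1) * tr * rel_potential \<gamma> \<rho> R = tr * (\<rho> powr \<gamma> - R powr \<gamma> - q * (\<rho> - R))"
    using gamma by (simp add: rel_potential_def q_def)
  have quad: "(u - V) \<bullet> (A *v (u - V)) = u \<bullet> (A *v u) - u \<bullet> (A *v V) - V \<bullet> (A *v u) + V \<bullet> (A *v V)"
    by (simp add: matrix_vector_mult_diff_distrib inner_diff_left inner_diff_right)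
  have qR: "q * (\<rho> - R) = q * \<rho> - \<gamma> * R powr \<gamma>" using cR(2) by (simp add: algebra_simps)
  have "\<rho> * (V \<bullet> Ut t x - c * rt t x) + \<rho> * (V \<bullet> (A *v u) - c * (g \<bullet> u)) - (\<rho> * (u \<bullet> Ut t x) + \<rho> * (u \<bullet> (A *v u)) + \<rho> powr \<gamma> * tr) + q * rt t x
    = - \<rho> * (u \<bullet> (A *v u) - u \<bullet> (A *v V) - V \<bullet> (A *v u) + V \<bullet> (A *v V)) + \<rho> * (c * R) * tr - \<rho> powr \<gamma> * tr - q * (g \<bullet> V) - (q * R) * tr"
    unfolding Ut rt by (simp add: inner_diff_right inner_minus_right inner_commute algebra_simps)
  also have "\<dots> = - \<rho> * ((u - V) \<bullet> (A *v (u - V))) - tr * (\<rho> powr \<gamma> - R powr \<gamma> - q * (\<rho> - R)) - (R powr \<gamma> * tr + q * (g \<bullet> V))"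
    unfolding cR quad qR by (simp add: algebra_simps)
  finally show ?thesis
    unfolding at' inner_scaleR_left ga tensor_inner pressure_def div_pU_def
    unfolding V_def[symmetric] A_def[symmetric] g_def[symmetric] R_def[symmetric] tr_def[symmetric] q_def[symmetric] rel
    by simp
qed

lemma continuous_slice:
  assumes "continuous_on Q f" "t \<in> {0<..<T}" shows "continuous_on \<Omega> (\<lambda>x. f (t, x))"
  by (rule continuous_on_compose2[OF assms(1)]) (use assms(2) in \<open>auto intro!: continuous_intros\<close>)

text \<open>The flux \<open>r t x powr \<gamma> *\<^sub>R U t x\<close> is tangent because
  \<open>U\<close> is, and Lipschitz on the closure because it extends smoothly across the boundary,
  so the divergence theorem for tangent fields applies.\<close>

lemma integral_div_pU:
  assumes t: "t \<in> {0<..<T}"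
  shows "(LINT x:\<Omega>|lborel. div_pU t x) = 0"
proof -
  obtain K where K: "bounds K" using bounds_exist ..
  then have K0: "K \<ge> 0" by (simp add: bounds_def)
  define V where "V x = r t x powr \<gamma> *\<^sub>R U t x" for x
  define A where "A x = r t x powr \<gamma> *\<^sub>R J t x + tensor (U t x) ((\<gamma> * r t x powr (\<gamma> - 1)) *\<^sub>R gr t x)" for x
  have "smooth_up_to Qc (\<lambda>p. (case p of (t, x) \<Rightarrow> r t x powr \<gamma>) *\<^sub>R (case p of (t, x) \<Rightarrow> U t x))"
    by (rule smooth_up_to_bilinear[OF bounded_bilinear_scaleR r_powr_smooth U_smooth])
  then obtain W h where W: "Qc \<subseteq> W" "smooth_on W h" "\<forall>p\<in>Qc. h p = (case p of (t, x) \<Rightarrow> r t x powr \<gamma>) *\<^sub>R (case p of (t, x) \<Rightarrow> U t x)"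
    unfolding smooth_up_to_def by blast
  have hV: "h (t, x) = V x" if "x \<in> closure \<Omega>" for x using W(3) that t by (simp add: V_def)
  obtain L where L: "L-lipschitz_on Qc h"
    using C_1_lipschitz_on_compact[OF _ _ compact_Qc W(1)] W(2) unfolding smooth_on_def by blast
  have lip: "L-lipschitz_on (closure \<Omega>) V"
  proof (rule lipschitz_onI)
    fix x y assume "x \<in> closure \<Omega>" "y \<in> closure \<Omega>"
    then show "dist (V x) (V y) \<le> L * dist x y"
      using lipschitz_onD[OF L, of "(t, x)" "(t, y)"] t hV by (simp add: dist_Pair_Pair)
  qed (rule lipschitz_on_nonneg[OF L])
  have mem: "t \<in> {0..T}" using t by simp
  have "(LINT x:\<Omega>|lborel. trace (A x)) = 0"
  proof (rule integral_divergence_tangent[OF dom lip, where B = "K * K + K * (\<gamma> * K * K)"])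
    fix x assume x: "x \<in> \<Omega>"
    then have xc: "x \<in> closure \<Omega>" using closure_subset by blast
    show "(V has_derivative (\<lambda>v. A x *v v)) (at x)" unfolding V_def A_def
      by (rule has_derivative_scaleR_field[OF has_derivative_powr_grad[OF r_der(2)[OF t x] r_pos[OF mem xc]] U_der(2)[OF t x]])
    fix i j
    have b: "\<bar>J t x $ i $ j\<bar> \<le> K" "norm (gr t x) \<le> K" "norm (U t x) \<le> K" "\<bar>r t x powr \<gamma>\<bar> \<le> K" "\<bar>r t x powr (\<gamma> - 1)\<bar> \<le> K"
      using K t x xc mem unfolding bounds_def by blast+
    have 1: "\<bar>r t x powr \<gamma> * J t x $ i $ j\<bar> \<le> K * K" unfolding abs_mult using b K0 by (intro mult_mono) auto
    have 2: "\<bar>U t x $ i * (\<gamma> * r t x powr (\<gamma> - 1) * gr t x $ j)\<bar> \<le> K * (\<gamma> * K * K)"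
      unfolding abs_mult using b K0 gamma component_le_norm_cart[of "U t x" i] component_le_norm_cart[of "gr t x" j]
      by (intro mult_mono) auto
    show "\<bar>A x $ i $ j\<bar> \<le> K * K + K * (\<gamma> * K * K)"
      using 1 2 abs_triangle_ineq[of "r t x powr \<gamma> * J t x $ i $ j" "U t x $ i * (\<gamma> * r t x powr (\<gamma> - 1) * gr t x $ j)"]
      by (simp add: A_def tensor_def)
  next
    note sl = continuous_slice[OF _ t]
    show "continuous_on \<Omega> A" unfolding A_def tensor_def
      using sl[OF continuous_Q(4)[of \<gamma>]] sl[OF continuous_Q(4)[of "\<gamma> - 1"]] sl[OF continuous_derivs(2)]
        sl[OF continuous_derivs(4)] sl[OF continuous_Q(2)]
      by (auto intro!: continuous_intros)
    show "V x \<bullet> outward_normal \<Omega> x = 0" if "x \<in> frontier \<Omega>" for x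
      using tangent[OF mem that] by (simp add: V_def)
  qed
  moreover have "trace (A x) = div_pU t x" for x
    by (simp add: A_def trace_add trace_scaleR trace_tensor div_pU_def inner_commute)
  ultimately show ?thesis by simp
qed

lemma set_integrable_Q_continuous:
  fixes f :: "real \<times> (real^3) \<Rightarrow> 'b::euclidean_space"
  assumes "continuous_on Q f" "\<And>t x. t \<in> {0<..<T} \<Longrightarrow> x \<in> \<Omega> \<Longrightarrow> norm (f (t, x)) \<le> B"
  shows "set_integrable lborel Q f"
  by (rule set_integrable_continuous_bounded[OF Q_sets bounded_Q assms(1), where B = B]) (use assms(2) in auto)

lemma continuous_time_slice:
  assumes "continuous_on Qc f" "x \<in> closure \<Omega>" shows "continuous_on {0..T} (\<lambda>t. f (t, x))"
  by (rule continuous_on_compose2[OF assms(1)]) (use assms(2) in \<open>auto intro!: continuous_intros\<close>)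

lemma continuous_space_slice:
  assumes "continuous_on Qc f" "t \<in> {0..T}" shows "continuous_on (closure \<Omega>) (\<lambda>x. f (t, x))"
  by (rule continuous_on_compose2[OF assms(1)]) (use assms(2) in \<open>auto intro!: continuous_intros\<close>)

lemma continuous_pressure_time: "continuous_on Q (\<lambda>(t, x). \<gamma> * r t x powr (\<gamma> - 1) * rt t x)"
  using continuous_Q(4)[of "\<gamma> - 1"] continuous_derivs(1) unfolding case_prod_beta'
  by (intro continuous_on_mult continuous_on_const)

lemma pressure_time_integrable: "set_integrable lborel Q (\<lambda>(t, x). \<gamma> * r t x powr (\<gamma> - 1) * rt t x)"
proof -
  obtain K where K: "bounds K" using bounds_exist ..
  then have K0: "K \<ge> 0" by (simp add: bounds_def)
  show ?thesis
  proof (rule set_integrable_Q_continuous)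
    show "continuous_on Q (\<lambda>(t, x). \<gamma> * r t x powr (\<gamma> - 1) * rt t x)" by (rule continuous_pressure_time)
    show "norm (case (t, x) of (t, x) \<Rightarrow> \<gamma> * r t x powr (\<gamma> - 1) * rt t x) \<le> \<gamma> * K * K" if "t \<in> {0<..<T}" "x \<in> \<Omega>" for t x
    proof -
      have "\<bar>r t x powr (\<gamma> - 1)\<bar> \<le> K" "\<bar>rt t x\<bar> \<le> K" using K that in_Qc unfolding bounds_def by blast+
      then show ?thesis using gamma K0 by (simp add: abs_mult) (intro mult_mono, auto)
    qed
  qed
qed

lemma sub_Q: "\<tau> \<in> {0..T} \<Longrightarrow> {0<..<\<tau>} \<times> \<Omega> \<subseteq> Q" by auto

lemma sub_Q_sets: "{0<..<\<tau>::real} \<times> \<Omega> \<in> sets borel" by (intro borel_open open_Times open_dom) auto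

text \<open>Time derivatives are available for \<open>0 < t < T\<close> only, so at each
  \<open>x\<close> the fundamental theorem is used in its interior form, with continuity up to the
  end points. Exchanging the order of integration then gives the spatial integrals.\<close>

lemma pressure_evolution:
  assumes \<tau>: "\<tau> \<in> {0..T}"
  shows "(LINT x:\<Omega>|lborel. r \<tau> x powr \<gamma>) = (LINT x:\<Omega>|lborel. r 0 x powr \<gamma>)
    + (LINT t:{0<..<\<tau>}|lborel. LINT x:\<Omega>|lborel. \<gamma> * r t x powr (\<gamma> - 1) * rt t x)"
proof -
  have int: "set_integrable lborel ({0<..<\<tau>} \<times> \<Omega>) (\<lambda>(t, x). \<gamma> * r t x powr (\<gamma> - 1) * rt t x)"
    by (rule set_integrable_subset[OF pressure_time_integrable]) (use sub_Q[OF \<tau>] sub_Q_sets in auto)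
  have ftc: "(LINT t:{0<..<\<tau>}|lborel. \<gamma> * r t x powr (\<gamma> - 1) * rt t x) = r \<tau> x powr \<gamma> - r 0 x powr \<gamma>" if x: "x \<in> \<Omega>" for x
  proof -
    have xc: "x \<in> closure \<Omega>" using x closure_subset by blast
    have "((\<lambda>t. \<gamma> * r t x powr (\<gamma> - 1) * rt t x) has_integral (r \<tau> x powr \<gamma> - r 0 x powr \<gamma>)) {0..\<tau>}"
    proof (rule fundamental_theorem_of_calculus_interior)
      show "0 \<le> \<tau>" using \<tau> by simp
      show "continuous_on {0..\<tau>} (\<lambda>t. r t x powr \<gamma>)"
        using continuous_time_slice[OF continuous_Qc(4)[of \<gamma>] xc] \<tau> by (auto elim: continuous_on_subset)
      fix t assume t: "t \<in> {0<..<\<tau>}"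
      then have t': "t \<in> {0<..<T}" using \<tau> by auto
      show "((\<lambda>t. r t x powr \<gamma>) has_vector_derivative \<gamma> * r t x powr (\<gamma> - 1) * rt t x) (at t)"
        by (rule has_real_derivative_powr_chain[OF r_der(1)[OF t' x] r_pos[OF _ xc]]) (use t' in auto)
    qed
    moreover have "set_integrable lborel {0<..<\<tau>} (\<lambda>t. \<gamma> * r t x powr (\<gamma> - 1) * rt t x)"
    proof -
      obtain K where K: "bounds K" using bounds_exist ..
      then have K0: "K \<ge> 0" by (simp add: bounds_def)
      show ?thesis
      proof (rule set_integrable_continuous_bounded[where B = "\<gamma> * K * K"])
        have "continuous_on {0<..<\<tau>} (\<lambda>t. (\<lambda>(t, x). \<gamma> * r t x powr (\<gamma> - 1) * rt t x) (t, x))"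
          by (rule continuous_on_compose2[OF continuous_pressure_time]) (use x \<tau> in \<open>auto intro!: continuous_intros\<close>)
        then show "continuous_on {0<..<\<tau>} (\<lambda>t. \<gamma> * r t x powr (\<gamma> - 1) * rt t x)" by simp
        show "norm (\<gamma> * r t x powr (\<gamma> - 1) * rt t x) \<le> \<gamma> * K * K" if "t \<in> {0<..<\<tau>}" for t
        proof -
          have "t \<in> {0<..<T}" using that \<tau> by auto
          then have "\<bar>r t x powr (\<gamma> - 1)\<bar> \<le> K" "\<bar>rt t x\<bar> \<le> K" using K x in_Qc unfolding bounds_def by blast+
          then show ?thesis using gamma K0 by (simp add: abs_mult) (intro mult_mono, auto)
        qed
      qed auto
    qed
    ultimately show ?thesis using set_integral_Ioo_eq_integral_Icc(2) by (metis integral_unique)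
  qed
  have ci: "set_integrable lborel \<Omega> (\<lambda>x. r s x powr \<gamma>)" if "s \<in> {0..T}" for s
  proof -
    obtain K where K: "bounds K" using bounds_exist ..
    show ?thesis
    proof (rule set_integrable_continuous_bounded[OF borel_dom bounded_dom, where B = K])
      show "continuous_on \<Omega> (\<lambda>x. r s x powr \<gamma>)"
        using continuous_on_subset[OF continuous_space_slice[OF continuous_Qc(4)[of \<gamma>] that] closure_subset] by simp
      show "norm (r s x powr \<gamma>) \<le> K" if "x \<in> \<Omega>" for x
        using K that \<open>s \<in> {0..T}\<close> in_Qc unfolding bounds_def by auto
    qed
  qed
  have "(LINT t:{0<..<\<tau>}|lborel. LINT x:\<Omega>|lborel. \<gamma> * r t x powr (\<gamma> - 1) * rt t x)
      = (LINT x:\<Omega>|lborel. LINT t:{0<..<\<tau>}|lborel. \<gamma> * r t x powr (\<gamma> - 1) * rt t x)"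
    using set_fubini_swap[OF int] by simp
  also have "\<dots> = (LINT x:\<Omega>|lborel. r \<tau> x powr \<gamma> - r 0 x powr \<gamma>)"
    by (rule set_lebesgue_integral_cong) (use ftc in auto)
  also have "\<dots> = (LINT x:\<Omega>|lborel. r \<tau> x powr \<gamma>) - (LINT x:\<Omega>|lborel. r 0 x powr \<gamma>)"
    using ci \<tau> T by (intro set_integral_diff) auto
  finally show ?thesis by simp
qed

end


section \<open>Weak solutions\<close>

lemma in_Lp_set_integrable:
  fixes f :: "'a::euclidean_space \<Rightarrow> 'b::euclidean_space"
  assumes "in_Lp p S f" "p \<ge> 1" "S \<in> sets borel" "emeasure lborel S < \<infinity>"
  shows "set_integrable lborel S f"
proof (rule set_integrable_bound)
  have "set_integrable lborel S (\<lambda>x. 1 :: real)"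
    using assms(3,4) by (simp add: set_integrable_def)
  then show "set_integrable lborel S (\<lambda>x. 1 + norm (f x) powr p)"
    using assms(1) by (intro set_integral_add) (auto simp: in_Lp_def)
  show "set_borel_measurable lborel S f" using assms(1) by (simp add: in_Lp_def)
  have "norm (f x) \<le> 1 + norm (f x) powr p" for x
  proof (cases "norm (f x) \<le> 1")
    case False
    then have "norm (f x) powr 1 \<le> norm (f x) powr p" using assms(2) by (intro powr_mono) auto
    then show ?thesis by simp
  qed (simp add: add_increasing2)
  then show "AE x in lborel. x \<in> S \<longrightarrow> norm (f x) \<le> norm (1 + norm (f x) powr p)" by simp
qed

lemma set_measurable_iff_restrict:
  fixes f :: "'a::topological_space \<Rightarrow> 'b::real_normed_vector"
  assumes "S \<in> sets borel"
  shows "set_borel_measurable borel S f \<longleftrightarrow> f \<in> borel_measurable (restrict_space borel S)"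
  unfolding set_borel_measurable_def using assms by (subst borel_measurable_restrict_space_iff) auto

lemma norm_tensor: "norm (tensor a b) = norm a * norm b"
proof -
  have "tensor a b \<bullet> tensor a b = (a \<bullet> a) * (b \<bullet> b)"
    by (simp add: tensor_def inner_vec_def sum_product mult_ac)
  then show ?thesis by (simp add: norm_eq_sqrt_inner real_sqrt_mult)
qed

lemma norm_matrix_le:
  fixes A :: "real^3^3"
  assumes "\<And>i j. \<bar>A $ i $ j\<bar> \<le> K" shows "norm A \<le> 9 * K"
proof -
  have row: "norm (A $ i) \<le> 3 * K" for i
    using norm_le_l1_cart[of "A $ i"] assms[of i 1] assms[of i 2] assms[of i 3] by (simp add: sum_3)
  have "norm A \<le> (\<Sum>i\<in>UNIV. norm (A $ i))" unfolding norm_vec_def by (rule L2_set_le_sum) simp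
  then show ?thesis using row[of 1] row[of 2] row[of 3] by (simp add: sum_3)
qed

text \<open>A continuous function on the compact closure is bounded, and \<Omega> has finite
  measure, so it belongs to the dual of \<open>L^p\<close> for every
  \<open>p \<ge> 1\<close>.\<close>

lemma continuous_weak_test:
  fixes f :: "real \<Rightarrow> real^3 \<Rightarrow> 'b::euclidean_space"
  assumes w: "weakly_continuous_Lp T p \<Omega> f" and p: "p \<ge> 1"
    and \<psi>: "continuous_on (closure \<Omega>) \<psi>" and \<Omega>: "open \<Omega>" "bounded \<Omega>"
  shows "continuous_on {0..T} (\<lambda>t. LINT x:\<Omega>|lborel. f t x \<bullet> \<psi> x)"
proof -
  have "compact (closure \<Omega>)" using \<Omega>(2) by (simp add: compact_closure)
  then have "bounded (\<psi> ` closure \<Omega>)" by (intro compact_imp_bounded compact_continuous_image \<psi>)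
  then have b: "bounded (\<psi> ` \<Omega>)" by (rule bounded_subset) (use closure_subset in blast)
  then obtain B where B: "\<And>x. x \<in> \<Omega> \<Longrightarrow> norm (\<psi> x) \<le> B" unfolding bounded_iff by blast
  have c: "continuous_on \<Omega> \<psi>" by (rule continuous_on_subset[OF \<psi> closure_subset])
  have m: "set_borel_measurable lborel \<Omega> \<psi>"
    using borel_measurable_continuous_on_indicator[OF _ c] \<Omega>(1) by (simp add: set_borel_measurable_def)
  have "in_Lp_dual p \<Omega> \<psi>"
  proof (cases "p = 1")
    case False
    define q where "q = p / (p - 1)"
    have q: "q > 0" using p False by (simp add: q_def)
    have "set_integrable lborel \<Omega> (\<lambda>x. norm (\<psi> x) powr q)"
    proof (rule set_integrable_continuous_bounded[where B = "\<bar>B\<bar> powr q"])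
      show "continuous_on \<Omega> (\<lambda>x. norm (\<psi> x) powr q)" using q by (intro continuous_on_powr' continuous_intros c) auto
      show "norm (norm (\<psi> x) powr q) \<le> \<bar>B\<bar> powr q" if "x \<in> \<Omega>" for x
        using B[OF that] q by (simp add: powr_mono2)
    qed (use \<Omega> in auto)
    then show ?thesis using False m by (simp add: in_Lp_dual_def in_Lp_def q_def)
  qed (use b m in \<open>simp add: in_Lp_dual_def\<close>)
  then show ?thesis using w by (simp add: weakly_continuous_Lp_def)
qed

section \<open>Pairings with test fields that move in time\<close>

context cylinder
begin

lemma set_integrable_weight_space:
  fixes f :: "real^3 \<Rightarrow> 'b::euclidean_space" and g :: "real^3 \<Rightarrow> 'b"
  assumes "set_integrable lborel \<Omega> f" "continuous_on \<Omega> g" "\<And>x. x \<in> \<Omega> \<Longrightarrow> norm (g x) \<le> B"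
  shows "set_integrable lborel \<Omega> (\<lambda>x. f x \<bullet> g x)"
  by (rule set_integrable_continuous_weight[OF bounded_bilinear_inner borel_dom assms])

lemma set_integrable_weight_Q:
  fixes f :: "real \<times> (real^3) \<Rightarrow> 'b::euclidean_space" and g :: "real \<times> (real^3) \<Rightarrow> 'b"
  assumes "set_integrable lborel Q f" "continuous_on Q g" "\<And>t x. t \<in> {0<..<T} \<Longrightarrow> x \<in> \<Omega> \<Longrightarrow> norm (g (t, x)) \<le> B"
  shows "set_integrable lborel Q (\<lambda>p. f p \<bullet> g p)"
  by (rule set_integrable_continuous_weight[OF bounded_bilinear_inner Q_sets assms(1,2), where B = B]) (use assms(3) in auto)

text \<open>Weak continuity concerns a fixed test function. When the field moves with
  \<open>t\<close>, its change is controlled by uniform continuity on the compact cylinder together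
  with the bound \<open>M\<close> on the norms of \<open>f t\<close>, which is uniform in
  time.\<close>

lemma continuous_weak_pairing:
  fixes f \<Phi> :: "real \<Rightarrow> real^3 \<Rightarrow> 'b::euclidean_space"
  assumes w: "weakly_continuous_Lp T p \<Omega> f" and p: "p \<ge> 1"
    and M: "\<And>t. t \<in> {0..T} \<Longrightarrow> (LINT x:\<Omega>|lborel. norm (f t x)) \<le> M"
    and \<Phi>: "continuous_on Qc (\<lambda>(t, x). \<Phi> t x)"
  shows "continuous_on {0..T} (\<lambda>t. LINT x:\<Omega>|lborel. f t x \<bullet> \<Phi> t x)"
  unfolding continuous_on_iff
proof (intro ballI allI impI)
  fix t0 e :: real assume t0: "t0 \<in> {0..T}" and e: "e > 0"
  define M' where "M' = max M 0 + 1"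
  have M': "M' > 0" "M \<le> M'" by (auto simp: M'_def)
  have fi: "set_integrable lborel \<Omega> (f t)" if "t \<in> {0..T}" for t
    using w that by (intro in_Lp_set_integrable[OF _ p borel_dom finite_measure_dom]) (auto simp: weakly_continuous_Lp_def)
  have c: "continuous_on (closure \<Omega>) (\<Phi> t)" if "t \<in> {0..T}" for t
  proof -
    have "continuous_on (closure \<Omega>) (\<lambda>x. (\<lambda>(t, x). \<Phi> t x) (t, x))"
      by (rule continuous_on_compose2[OF \<Phi>]) (use that in \<open>auto intro!: continuous_intros\<close>)
    then show ?thesis by simp
  qed
  have bd: "\<exists>B. \<forall>x\<in>\<Omega>. norm (\<Phi> t x) \<le> B" if "t \<in> {0..T}" for t
  proof -
    have "bounded (\<Phi> t ` closure \<Omega>)"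
      using bounded_dom by (intro compact_imp_bounded compact_continuous_image c[OF that]) (simp add: compact_closure)
    then obtain B where "\<forall>y\<in>\<Phi> t ` closure \<Omega>. norm y \<le> B" unfolding bounded_iff by blast
    then show ?thesis using closure_subset by (intro exI[of _ B]) auto
  qed
  have fPi: "set_integrable lborel \<Omega> (\<lambda>x. f t x \<bullet> \<Phi> s x)" if ts: "t \<in> {0..T}" "s \<in> {0..T}" for t s
  proof -
    obtain B where "\<forall>x\<in>\<Omega>. norm (\<Phi> s x) \<le> B" using bd[OF ts(2)] by blast
    then show ?thesis
      using set_integrable_weight_space[OF fi[OF ts(1)] continuous_on_subset[OF c[OF ts(2)] closure_subset]] by blast
  qed
  have "uniformly_continuous_on Qc (\<lambda>(t, x). \<Phi> t x)" by (rule compact_uniformly_continuous[OF \<Phi> compact_Qc])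
  moreover have "e / (2 * M') > 0" using e M' by simp
  ultimately obtain d1 where d1: "d1 > 0" "\<And>p q. p \<in> Qc \<Longrightarrow> q \<in> Qc \<Longrightarrow> dist q p < d1 \<Longrightarrow>
      dist (case q of (t, x) \<Rightarrow> \<Phi> t x) (case p of (t, x) \<Rightarrow> \<Phi> t x) < e / (2 * M')"
    unfolding uniformly_continuous_on_def by metis
  obtain d2 where d2: "d2 > 0" "\<And>t. t \<in> {0..T} \<Longrightarrow> dist t t0 < d2 \<Longrightarrow>
      dist (LINT x:\<Omega>|lborel. f t x \<bullet> \<Phi> t0 x) (LINT x:\<Omega>|lborel. f t0 x \<bullet> \<Phi> t0 x) < e / 2"
    using continuous_weak_test[OF w p c[OF t0] open_dom bounded_dom, unfolded continuous_on_iff, rule_format, OF t0, of "e / 2"] e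
    by (auto simp only: half_gt_zero)
  show "\<exists>d>0. \<forall>t\<in>{0..T}. dist t t0 < d \<longrightarrow>
      dist (LINT x:\<Omega>|lborel. f t x \<bullet> \<Phi> t x) (LINT x:\<Omega>|lborel. f t0 x \<bullet> \<Phi> t0 x) < e"
  proof (intro exI[of _ "min d1 d2"] conjI ballI impI)
    show "min d1 d2 > 0" using d1 d2 by simp
    fix t assume t: "t \<in> {0..T}" "dist t t0 < min d1 d2"
    have close: "norm (\<Phi> t x - \<Phi> t0 x) \<le> e / (2 * M')" if "x \<in> \<Omega>" for x
    proof -
      have "x \<in> closure \<Omega>" using that closure_subset by blast
      then show ?thesis using d1(2)[of "(t0, x)" "(t, x)"] t t0 by (simp add: dist_Pair_Pair dist_norm)
    qed
    have "(LINT x:\<Omega>|lborel. f t x \<bullet> \<Phi> t x) - (LINT x:\<Omega>|lborel. f t x \<bullet> \<Phi> t0 x) = (LINT x:\<Omega>|lborel. f t x \<bullet> \<Phi> t x - f t x \<bullet> \<Phi> t0 x)"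
      using fPi t(1) t0 by (intro set_integral_diff(2)[symmetric]) auto
    also have "\<bar>\<dots>\<bar> \<le> (LINT x:\<Omega>|lborel. \<bar>f t x \<bullet> \<Phi> t x - f t x \<bullet> \<Phi> t0 x\<bar>)"
      using set_integral_norm_bound[OF set_integral_diff(1)[OF fPi[OF t(1) t(1)] fPi[OF t(1) t0]]] by simp
    also have "\<dots> \<le> (LINT x:\<Omega>|lborel. norm (f t x) * (e / (2 * M')))"
    proof (rule set_integral_mono)
      show "set_integrable lborel \<Omega> (\<lambda>x. \<bar>f t x \<bullet> \<Phi> t x - f t x \<bullet> \<Phi> t0 x\<bar>)"
        using fPi t(1) t0 by (intro set_integrable_abs set_integral_diff(1)) auto
      show "set_integrable lborel \<Omega> (\<lambda>x. norm (f t x) * (e / (2 * M')))"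
        using set_integrable_norm[OF fi[OF t(1)]] by (rule set_integrable_mult_left)
      show "\<bar>f t x \<bullet> \<Phi> t x - f t x \<bullet> \<Phi> t0 x\<bar> \<le> norm (f t x) * (e / (2 * M'))" if "x \<in> \<Omega>" for x
      proof -
        have "\<bar>f t x \<bullet> (\<Phi> t x - \<Phi> t0 x)\<bar> \<le> norm (f t x) * norm (\<Phi> t x - \<Phi> t0 x)" by (rule Cauchy_Schwarz_ineq2)
        also have "\<dots> \<le> norm (f t x) * (e / (2 * M'))" by (intro mult_left_mono close[OF that]) simp
        finally show ?thesis by (simp add: inner_diff_right)
      qed
    qed
    also have "\<dots> = (LINT x:\<Omega>|lborel. norm (f t x)) * (e / (2 * M'))" by simp
    also have "\<dots> \<le> M' * (e / (2 * M'))" using M[OF t(1)] M' e by (intro mult_right_mono) auto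
    also have "\<dots> = e / 2" using M' by simp
    finally have "\<bar>(LINT x:\<Omega>|lborel. f t x \<bullet> \<Phi> t x) - (LINT x:\<Omega>|lborel. f t x \<bullet> \<Phi> t0 x)\<bar> \<le> e / 2" .
    then show "dist (LINT x:\<Omega>|lborel. f t x \<bullet> \<Phi> t x) (LINT x:\<Omega>|lborel. f t0 x \<bullet> \<Phi> t0 x) < e"
      using d2(2)[OF t(1)] t(2) unfolding dist_real_def min_less_iff_conj by linarith
  qed
qed

text \<open>Differentiating \<open>t ^ n\<close> times a field gives one term with
  \<open>n * t ^ (n - 1)\<close> and one with \<open>t ^ n\<close>. Integrability on the cylinder is
  what permits the iterated integral to be split accordingly.\<close>

lemma iterated_test_split:
  fixes h1 h2 :: "real \<times> (real^3) \<Rightarrow> real"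
  assumes h: "set_integrable lborel Q h1" "set_integrable lborel Q h2"
    and k: "\<And>t x. t \<in> {0<..<T} \<Longrightarrow> x \<in> \<Omega> \<Longrightarrow> k t x = real n * t ^ (n - 1) * h1 (t, x) + t ^ n * h2 (t, x)"
  shows "(LINT t:{0<..<T}|lborel. LINT x:\<Omega>|lborel. k t x)
    = (LINT t:{0<..<T}|lborel. (LINT x:\<Omega>|lborel. h1 (t, x)) * (real n * t ^ (n - 1)) + (LINT x:\<Omega>|lborel. h2 (t, x)) * t ^ n)"
proof -
  have pw: "set_integrable lborel Q (\<lambda>p. h p \<bullet> (c * fst p ^ m))" if "set_integrable lborel Q h" for h :: "real \<times> (real^3) \<Rightarrow> real" and c m
  proof (rule set_integrable_weight_Q[OF that, where B = "\<bar>c\<bar> * T ^ m"])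
    show "norm (c * fst (t, x) ^ m) \<le> \<bar>c\<bar> * T ^ m" if "t \<in> {0<..<T}" for t and x :: "real^3"
      using that by (auto simp: abs_mult power_abs intro!: mult_left_mono power_mono)
  qed (intro continuous_intros)
  define k1 where "k1 p = h1 p \<bullet> (real n * fst p ^ (n - 1))" for p
  define k2 where "k2 p = h2 p \<bullet> (1 * fst p ^ n)" for p
  have ki: "set_integrable lborel Q k1" "set_integrable lborel Q k2"
    unfolding k1_def k2_def by (intro pw h)+
  have "(LINT t:{0<..<T}|lborel. LINT x:\<Omega>|lborel. k t x) = (LINT t:{0<..<T}|lborel. LINT x:\<Omega>|lborel. k1 (t, x) + k2 (t, x))"
    by (intro set_lebesgue_integral_cong ballI allI impI) (auto simp: k k1_def k2_def mult_ac)
  also have "\<dots> = (LINT p:Q|lborel. k1 p + k2 p)"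
    by (rule set_fubini(3)) (intro set_integral_add ki)
  also have "\<dots> = (LINT p:Q|lborel. k1 p) + (LINT p:Q|lborel. k2 p)" by (intro set_integral_add ki)
  also have "\<dots> = (LINT t:{0<..<T}|lborel. LINT x:\<Omega>|lborel. k1 (t, x)) + (LINT t:{0<..<T}|lborel. LINT x:\<Omega>|lborel. k2 (t, x))"
    by (simp only: set_fubini(3)[OF ki(1)] set_fubini(3)[OF ki(2)])
  also have "\<dots> = (LINT t:{0<..<T}|lborel. (LINT x:\<Omega>|lborel. k1 (t, x)) + (LINT x:\<Omega>|lborel. k2 (t, x)))"
    by (intro set_integral_add(2)[symmetric] set_fubini(2) ki)
  also have "\<dots> = (LINT t:{0<..<T}|lborel. (LINT x:\<Omega>|lborel. h1 (t, x)) * (real n * t ^ (n - 1)) + (LINT x:\<Omega>|lborel. h2 (t, x)) * t ^ n)"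
    by (simp add: k1_def k2_def)
  finally show ?thesis .
qed

end

section \<open>Integrability of the weak solution\<close>

locale navier_stokes = euler +
  fixes \<mu> \<eta> \<epsilon> \<beta> :: real and \<rho>\<^sub>0 :: "real^3 \<Rightarrow> real" and u\<^sub>0 :: "real^3 \<Rightarrow> real^3"
    and \<rho> :: "real \<Rightarrow> real^3 \<Rightarrow> real" and u :: "real \<Rightarrow> real^3 \<Rightarrow> real^3"
    and G :: "real \<Rightarrow> real^3 \<Rightarrow> real^3^3" and g :: "real \<Rightarrow> real^3 \<Rightarrow> real^3"
  assumes mu: "\<mu> > 0" and eta: "\<eta> \<ge> 0" and eps: "\<epsilon> > 0" and beta: "\<beta> \<ge> 0"
    and data: "admissible_data \<gamma> \<Omega> \<rho>\<^sub>0 u\<^sub>0"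
    and rho_meas: "set_borel_measurable borel Q (\<lambda>(t, x). \<rho> t x)"
    and u_meas: "set_borel_measurable borel Q (\<lambda>(t, x). u t x)"
    and rho_nonneg: "\<And>t. t \<in> {0..T} \<Longrightarrow> AE x in lborel. x \<in> \<Omega> \<longrightarrow> 0 \<le> \<rho> t x"
    and wc_rho: "weakly_continuous_Lp T \<gamma> \<Omega> \<rho>"
    and wc_mom: "weakly_continuous_Lp T (2 * \<gamma> / (\<gamma> + 1)) \<Omega> (\<lambda>t x. \<rho> t x *\<^sub>R u t x)"
    and wc_kin: "weakly_continuous_Lp T 1 \<Omega> (\<lambda>t x. \<rho> t x * (norm (u t x))\<^sup>2)"
    and weak_cont: "weak_continuity_equation \<Omega> T \<rho>\<^sub>0 \<rho> u"
    and G_Lp: "in_Lp 2 Q (\<lambda>(t, x). G t x)"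
    and g_meas: "set_borel_measurable borel ({0<..<T} \<times> frontier \<Omega>) (\<lambda>(t, x). g t x)"
    and weak_mom: "weak_momentum_equation \<gamma> \<mu> \<eta> \<Omega> T \<epsilon> \<beta> \<rho>\<^sub>0 u\<^sub>0 \<rho> u G g"
    and energy_ineq: "energy_inequality \<gamma> \<mu> \<eta> \<Omega> T \<epsilon> \<beta> \<rho>\<^sub>0 u\<^sub>0 \<rho> u G g"
begin

lemma mom_exponent: "2 * \<gamma> / (\<gamma> + 1) \<ge> 1" using gamma by (simp add: field_simps)

lemma in_Lp_at:
  assumes "t \<in> {0..T}"
  shows "in_Lp \<gamma> \<Omega> (\<rho> t)" "in_Lp (2 * \<gamma> / (\<gamma> + 1)) \<Omega> (\<lambda>x. \<rho> t x *\<^sub>R u t x)"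
    "in_Lp 1 \<Omega> (\<lambda>x. \<rho> t x * (norm (u t x))\<^sup>2)"
  using wc_rho wc_mom wc_kin assms by (auto simp: weakly_continuous_Lp_def)

lemma rho_integrable: "t \<in> {0..T} \<Longrightarrow> set_integrable lborel \<Omega> (\<rho> t)"
  by (rule in_Lp_set_integrable[OF in_Lp_at(1) _ borel_dom finite_measure_dom]) (use gamma in auto)

lemma mom_integrable: "t \<in> {0..T} \<Longrightarrow> set_integrable lborel \<Omega> (\<lambda>x. \<rho> t x *\<^sub>R u t x)"
  by (rule in_Lp_set_integrable[OF in_Lp_at(2) mom_exponent borel_dom finite_measure_dom])

lemma kin_integrable: "t \<in> {0..T} \<Longrightarrow> set_integrable lborel \<Omega> (\<lambda>x. \<rho> t x * (norm (u t x))\<^sup>2)"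
  by (rule in_Lp_set_integrable[OF in_Lp_at(3) _ borel_dom finite_measure_dom]) simp_all

lemma in_Lp_powr_integrable:
  assumes f: "in_Lp \<gamma> \<Omega> f" and nn: "AE x in lborel. x \<in> \<Omega> \<longrightarrow> 0 \<le> f x"
  shows "set_integrable lborel \<Omega> (\<lambda>x. f x powr \<gamma>)"
proof (rule set_integrable_bound)
  show "set_integrable lborel \<Omega> (\<lambda>x. norm (f x) powr \<gamma>)" using f by (simp add: in_Lp_def)
  have [measurable]: "(\<lambda>x. indicat_real \<Omega> x *\<^sub>R f x) \<in> borel_measurable lborel"
    using f unfolding in_Lp_def set_borel_measurable_def by blast
  have "(\<lambda>x. (indicat_real \<Omega> x *\<^sub>R f x) powr \<gamma>) \<in> borel_measurable lborel"
    by measurable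
  moreover have "(\<lambda>x. (indicat_real \<Omega> x *\<^sub>R f x) powr \<gamma>) = (\<lambda>x. indicat_real \<Omega> x *\<^sub>R f x powr \<gamma>)"
    by (auto simp: indicator_def)
  ultimately show "set_borel_measurable lborel \<Omega> (\<lambda>x. f x powr \<gamma>)" by (simp add: set_borel_measurable_def)
  show "AE x in lborel. x \<in> \<Omega> \<longrightarrow> norm (f x powr \<gamma>) \<le> norm (norm (f x) powr \<gamma>)"
    using nn by eventually_elim auto
qed

lemma rho_powr_integrable: "t \<in> {0..T} \<Longrightarrow> set_integrable lborel \<Omega> (\<lambda>x. \<rho> t x powr \<gamma>)"
  by (rule in_Lp_powr_integrable[OF in_Lp_at(1) rho_nonneg])

lemma mass_continuous: "continuous_on {0..T} (\<lambda>t. LINT x:\<Omega>|lborel. \<rho> t x)"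
  using continuous_weak_test[OF wc_rho _ _ open_dom bounded_dom, of "\<lambda>x. 1"] gamma by simp

lemma kin_continuous: "continuous_on {0..T} (\<lambda>t. LINT x:\<Omega>|lborel. \<rho> t x * (norm (u t x))\<^sup>2)"
  using continuous_weak_test[OF wc_kin _ _ open_dom bounded_dom, of "\<lambda>x. 1"] by simp

lemma norm_mom_le:
  fixes s :: real and v :: "real^3"
  assumes "s \<ge> 0" shows "norm (s *\<^sub>R v) \<le> s + s * (norm v)\<^sup>2"
proof -
  have "2 * norm v \<le> (norm v)\<^sup>2 + 1" using zero_le_power2[of "norm v - 1"] by (simp add: power2_diff)
  then have "norm v \<le> 1 + (norm v)\<^sup>2" using norm_ge_zero[of v] by linarith
  from mult_left_mono[OF this assms] show ?thesis using assms by (simp add: distrib_left)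
qed

text \<open>Testing weak continuity with the constant 1 makes mass and kinetic energy continuous in
  time, hence bounded, and the sign of the density turns them into absolute moments. The momentum is
  dominated by their sum. The bounds thus hold at every time, not only where the energy inequality
  does.\<close>

lemma uniform_moments:
  obtains M where "M \<ge> 0"
    "\<And>t. t \<in> {0..T} \<Longrightarrow> (LINT x:\<Omega>|lborel. \<bar>\<rho> t x\<bar>) \<le> M"
    "\<And>t. t \<in> {0..T} \<Longrightarrow> (LINT x:\<Omega>|lborel. \<bar>\<rho> t x * (norm (u t x))\<^sup>2\<bar>) \<le> M"
    "\<And>t. t \<in> {0..T} \<Longrightarrow> (LINT x:\<Omega>|lborel. norm (\<rho> t x *\<^sub>R u t x)) \<le> M"
proof -
  have "\<exists>M. \<forall>t\<in>{0..T}. f t \<le> M" if "continuous_on {0..T} f" for f :: "real \<Rightarrow> real"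
  proof -
    have "bounded (f ` {0..T})" by (intro compact_imp_bounded compact_continuous_image that) simp
    then obtain M where "\<forall>y\<in>f ` {0..T}. norm y \<le> M" unfolding bounded_iff by blast
    then show ?thesis by (intro exI[of _ M]) (auto simp: abs_le_iff)
  qed
  from this[OF mass_continuous] this[OF kin_continuous] obtain M1 M2
    where M1: "\<forall>t\<in>{0..T}. (LINT x:\<Omega>|lborel. \<rho> t x) \<le> M1" and M2: "\<forall>t\<in>{0..T}. (LINT x:\<Omega>|lborel. \<rho> t x * (norm (u t x))\<^sup>2) \<le> M2"
    by blast
  have eq1: "(LINT x:\<Omega>|lborel. \<bar>\<rho> t x\<bar>) = (LINT x:\<Omega>|lborel. \<rho> t x)" if "t \<in> {0..T}" for t
    using rho_nonneg[OF that] set_integrable_abs[OF rho_integrable[OF that]] rho_integrable[OF that]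
    by (intro antisym set_integral_mono_AE) (auto elim!: eventually_mono)
  have eq2: "(LINT x:\<Omega>|lborel. \<bar>\<rho> t x * (norm (u t x))\<^sup>2\<bar>) = (LINT x:\<Omega>|lborel. \<rho> t x * (norm (u t x))\<^sup>2)" if "t \<in> {0..T}" for t
    using rho_nonneg[OF that] set_integrable_abs[OF kin_integrable[OF that]] kin_integrable[OF that]
    by (intro antisym set_integral_mono_AE) (auto elim!: eventually_mono simp: abs_mult)
  have le3: "(LINT x:\<Omega>|lborel. norm (\<rho> t x *\<^sub>R u t x)) \<le> (LINT x:\<Omega>|lborel. \<rho> t x) + (LINT x:\<Omega>|lborel. \<rho> t x * (norm (u t x))\<^sup>2)" if "t \<in> {0..T}" for t
  proof -
    have "(LINT x:\<Omega>|lborel. norm (\<rho> t x *\<^sub>R u t x)) \<le> (LINT x:\<Omega>|lborel. \<rho> t x + \<rho> t x * (norm (u t x))\<^sup>2)"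
    proof (rule set_integral_mono_AE)
      show "set_integrable lborel \<Omega> (\<lambda>x. norm (\<rho> t x *\<^sub>R u t x))" by (rule set_integrable_norm[OF mom_integrable[OF that]])
      show "set_integrable lborel \<Omega> (\<lambda>x. \<rho> t x + \<rho> t x * (norm (u t x))\<^sup>2)"
        by (intro set_integral_add rho_integrable kin_integrable that)
      show "AE x\<in>\<Omega> in lborel. norm (\<rho> t x *\<^sub>R u t x) \<le> \<rho> t x + \<rho> t x * (norm (u t x))\<^sup>2"
        using rho_nonneg[OF that] by eventually_elim (blast intro: norm_mom_le)
    qed
    also have "\<dots> = (LINT x:\<Omega>|lborel. \<rho> t x) + (LINT x:\<Omega>|lborel. \<rho> t x * (norm (u t x))\<^sup>2)"
      by (intro set_integral_add rho_integrable kin_integrable that)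
    finally show ?thesis .
  qed
  show ?thesis
  proof (rule that[of "\<bar>M1\<bar> + \<bar>M2\<bar>"])
    fix t assume t: "t \<in> {0..T}"
    have "(LINT x:\<Omega>|lborel. \<rho> t x) \<le> \<bar>M1\<bar>" "(LINT x:\<Omega>|lborel. \<rho> t x * (norm (u t x))\<^sup>2) \<le> \<bar>M2\<bar>"
      using M1 M2 t abs_ge_self order_trans by blast+
    then show "(LINT x:\<Omega>|lborel. \<bar>\<rho> t x\<bar>) \<le> \<bar>M1\<bar> + \<bar>M2\<bar>" "(LINT x:\<Omega>|lborel. \<bar>\<rho> t x * (norm (u t x))\<^sup>2\<bar>) \<le> \<bar>M1\<bar> + \<bar>M2\<bar>"
      "(LINT x:\<Omega>|lborel. norm (\<rho> t x *\<^sub>R u t x)) \<le> \<bar>M1\<bar> + \<bar>M2\<bar>"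
      using eq1[OF t] eq2[OF t] le3[OF t] by linarith+
  qed simp
qed

definition Fc :: "real \<Rightarrow> real" where "Fc t = (LINT x:\<Omega>|lborel. \<rho> t x * a t x)"
definition Fm :: "real \<Rightarrow> real" where "Fm t = (LINT x:\<Omega>|lborel. (\<rho> t x *\<^sub>R u t x) \<bullet> U t x)"

lemma Fc_continuous: "continuous_on {0..T} Fc"
proof -
  obtain M where M: "\<And>t. t \<in> {0..T} \<Longrightarrow> (LINT x:\<Omega>|lborel. \<bar>\<rho> t x\<bar>) \<le> M" by (rule uniform_moments) blast
  show ?thesis unfolding Fc_def
    using continuous_weak_pairing[OF wc_rho _ _ continuous_Qc(3), of M] gamma M by simp
qed

lemma Fm_continuous: "continuous_on {0..T} Fm"
proof -
  obtain M where M: "\<And>t. t \<in> {0..T} \<Longrightarrow> (LINT x:\<Omega>|lborel. norm (\<rho> t x *\<^sub>R u t x)) \<le> M" by (rule uniform_moments) blast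
  show ?thesis unfolding Fm_def
    by (rule continuous_weak_pairing[OF wc_mom mom_exponent M continuous_Qc(2)])
qed

lemma rho_restrict[measurable]: "(\<lambda>p. \<rho> (fst p) (snd p)) \<in> borel_measurable (restrict_space borel Q)"
  using rho_meas unfolding set_measurable_iff_restrict[OF Q_sets] by (simp add: case_prod_beta')

lemma u_restrict[measurable]: "(\<lambda>p. u (fst p) (snd p)) \<in> borel_measurable (restrict_space borel Q)"
  using u_meas unfolding set_measurable_iff_restrict[OF Q_sets] by (simp add: case_prod_beta')

lemma finite_measure_time: "emeasure lborel {0<..<T} < \<infinity>" using T by simp

lemma rho_Q_integrable: "set_integrable lborel Q (\<lambda>p. \<rho> (fst p) (snd p))"
proof -
  obtain M where M: "\<And>t. t \<in> {0..T} \<Longrightarrow> (LINT x:\<Omega>|lborel. \<bar>\<rho> t x\<bar>) \<le> M" by (rule uniform_moments) blast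
  show ?thesis
  proof (rule set_integrable_prodI[where K = M])
    show "set_borel_measurable borel Q (\<lambda>p. \<rho> (fst p) (snd p))"
      unfolding set_measurable_iff_restrict[OF Q_sets] by measurable
  qed (use M rho_integrable finite_measure_time in auto)
qed

lemma kin_Q_integrable: "set_integrable lborel Q (\<lambda>p. \<rho> (fst p) (snd p) * (norm (u (fst p) (snd p)))\<^sup>2)"
proof -
  obtain M where M: "\<And>t. t \<in> {0..T} \<Longrightarrow> (LINT x:\<Omega>|lborel. \<bar>\<rho> t x * (norm (u t x))\<^sup>2\<bar>) \<le> M" by (rule uniform_moments) blast
  show ?thesis
  proof (rule set_integrable_prodI[where K = M])
    show "set_borel_measurable borel Q (\<lambda>p. \<rho> (fst p) (snd p) * (norm (u (fst p) (snd p)))\<^sup>2)"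
      unfolding set_measurable_iff_restrict[OF Q_sets] by measurable
  qed (use M kin_integrable finite_measure_time in auto)
qed

lemma mom_Q_integrable: "set_integrable lborel Q (\<lambda>p. \<rho> (fst p) (snd p) *\<^sub>R u (fst p) (snd p))"
proof (rule set_integrable_bound)
  show "set_integrable lborel Q (\<lambda>p. \<bar>\<rho> (fst p) (snd p)\<bar> + \<bar>\<rho> (fst p) (snd p) * (norm (u (fst p) (snd p)))\<^sup>2\<bar>)"
    by (intro set_integral_add set_integrable_abs rho_Q_integrable kin_Q_integrable)
  show "set_borel_measurable lborel Q (\<lambda>p. \<rho> (fst p) (snd p) *\<^sub>R u (fst p) (snd p))"
    unfolding set_borel_measurable_lborel set_measurable_iff_restrict[OF Q_sets] by measurable
  have "norm (s *\<^sub>R v) \<le> \<bar>s\<bar> + \<bar>s * (norm v)\<^sup>2\<bar>" for s and v :: "real^3"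
    using norm_mom_le[of "\<bar>s\<bar>" v] by (simp add: abs_mult)
  then show "AE p in lborel. p \<in> Q \<longrightarrow> norm (\<rho> (fst p) (snd p) *\<^sub>R u (fst p) (snd p))
      \<le> norm (\<bar>\<rho> (fst p) (snd p)\<bar> + \<bar>\<rho> (fst p) (snd p) * (norm (u (fst p) (snd p)))\<^sup>2\<bar>)" by simp
qed

lemma tensor_Q_integrable: "set_integrable lborel Q (\<lambda>p. \<rho> (fst p) (snd p) *\<^sub>R tensor (u (fst p) (snd p)) (u (fst p) (snd p)))"
proof (rule set_integrable_bound[OF kin_Q_integrable])
  have "continuous_on UNIV (\<lambda>v :: real^3. tensor v v)"
    unfolding tensor_def by (intro continuous_on_vec_lambda continuous_intros)
  then have t[measurable]: "(\<lambda>v :: real^3. tensor v v) \<in> borel_measurable borel" by (rule borel_measurable_continuous_onI)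
  have "(\<lambda>p. tensor (u (fst p) (snd p)) (u (fst p) (snd p))) \<in> borel_measurable (restrict_space borel Q)"
    using measurable_compose[OF u_restrict t] .
  then show "set_borel_measurable lborel Q (\<lambda>p. \<rho> (fst p) (snd p) *\<^sub>R tensor (u (fst p) (snd p)) (u (fst p) (snd p)))"
    unfolding set_borel_measurable_lborel set_measurable_iff_restrict[OF Q_sets]
    by (intro borel_measurable_scaleR rho_restrict)
qed (simp add: norm_tensor abs_mult power2_eq_square)

lemma energy_nonneg:
  assumes t: "t \<in> {0..T}"
  shows "(LINT x:\<Omega>|lborel. \<rho> t x powr \<gamma>) \<le> (\<gamma> - 1) * energy \<gamma> \<Omega> (\<rho> t) (u t)"
    and "energy \<gamma> \<Omega> (\<rho> t) (u t) \<ge> 0"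
proof -
  have i: "set_integrable lborel \<Omega> (\<lambda>x. 1/2 * \<rho> t x * (norm (u t x))\<^sup>2 + \<rho> t x powr \<gamma> / (\<gamma> - 1))"
    using kin_integrable[OF t] rho_powr_integrable[OF t] 
    by (intro set_integral_add(1) set_integrable_divide) (simp_all add: mult.assoc)
  have "(LINT x:\<Omega>|lborel. \<rho> t x powr \<gamma> / (\<gamma> - 1)) \<le> energy \<gamma> \<Omega> (\<rho> t) (u t)"
    unfolding energy_def
  proof (rule set_integral_mono_AE[OF _ i])
    show "set_integrable lborel \<Omega> (\<lambda>x. \<rho> t x powr \<gamma> / (\<gamma> - 1))"
      using rho_powr_integrable[OF t] by (rule set_integrable_divide)
    show "AE x\<in>\<Omega> in lborel. \<rho> t x powr \<gamma> / (\<gamma> - 1) \<le> 1/2 * \<rho> t x * (norm (u t x))\<^sup>2 + \<rho> t x powr \<gamma> / (\<gamma> - 1)"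
      using rho_nonneg[OF t] by eventually_elim auto
  qed
  then show le: "(LINT x:\<Omega>|lborel. \<rho> t x powr \<gamma>) \<le> (\<gamma> - 1) * energy \<gamma> \<Omega> (\<rho> t) (u t)"
    using gamma by (simp add: divide_le_eq mult.commute)
  have "0 \<le> (LINT x:\<Omega>|lborel. \<rho> t x powr \<gamma>)"
    unfolding set_lebesgue_integral_def by (rule Bochner_Integration.integral_nonneg) (simp add: indicator_def)
  then have "0 \<le> (\<gamma> - 1) * energy \<gamma> \<Omega> (\<rho> t) (u t)" using le by linarith
  then show "energy \<gamma> \<Omega> (\<rho> t) (u t) \<ge> 0" using gamma by (simp add: zero_le_mult_iff)
qed

lemma energy0_nonneg: "energy \<gamma> \<Omega> \<rho>\<^sub>0 u\<^sub>0 \<ge> 0"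
  unfolding energy_def set_lebesgue_integral_def
proof (rule integral_nonneg_AE)
  have "AE x in lborel. x \<in> \<Omega> \<longrightarrow> 0 \<le> \<rho>\<^sub>0 x" using data by (simp add: admissible_data_def)
  then show "AE x in lborel. 0 \<le> indicat_real \<Omega> x *\<^sub>R (1/2 * \<rho>\<^sub>0 x * (norm (u\<^sub>0 x))\<^sup>2 + \<rho>\<^sub>0 x powr \<gamma> / (\<gamma> - 1))"
    by eventually_elim (use gamma in \<open>auto simp: indicator_def intro!: add_nonneg_nonneg\<close>)
qed

lemma energy_AE_le: "AE t in lborel. t \<in> {0..T} \<longrightarrow> energy \<gamma> \<Omega> (\<rho> t) (u t) \<le> energy \<gamma> \<Omega> \<rho>\<^sub>0 u\<^sub>0"
  using energy_ineq unfolding energy_inequality_def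
proof eventually_elim
  case (elim t)
  show ?case
  proof
    assume "t \<in> {0..T}"
    then have "ennreal (energy \<gamma> \<Omega> (\<rho> t) (u t)) \<le> ennreal (energy \<gamma> \<Omega> \<rho>\<^sub>0 u\<^sub>0)"
      using elim by (auto intro: order_trans[rotated] simp: add.assoc)
    then show "energy \<gamma> \<Omega> (\<rho> t) (u t) \<le> energy \<gamma> \<Omega> \<rho>\<^sub>0 u\<^sub>0"
      using energy0_nonneg by (simp add: ennreal_le_iff)
  qed
qed

text \<open>The uniform bound on the pressure integral comes from the energy inequality and so holds
  for almost every time, which suffices for Tonelli's theorem.\<close>

lemma pressure_Q_integrable: "set_integrable lborel Q (\<lambda>p. \<rho> (fst p) (snd p) powr \<gamma>)"
proof (rule set_integrable_prodI[where K = "(\<gamma> - 1) * energy \<gamma> \<Omega> \<rho>\<^sub>0 u\<^sub>0"])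
  show "set_borel_measurable borel Q (\<lambda>p. \<rho> (fst p) (snd p) powr \<gamma>)"
    unfolding set_measurable_iff_restrict[OF Q_sets] by measurable
  show "AE t in lborel. t \<in> {0<..<T} \<longrightarrow> set_integrable lborel \<Omega> (\<lambda>x. \<rho> (fst (t, x)) (snd (t, x)) powr \<gamma>)
      \<and> (LINT x:\<Omega>|lborel. \<bar>\<rho> (fst (t, x)) (snd (t, x)) powr \<gamma>\<bar>) \<le> (\<gamma> - 1) * energy \<gamma> \<Omega> \<rho>\<^sub>0 u\<^sub>0"
    using energy_AE_le
  proof eventually_elim
    case (elim t)
    show ?case
    proof
      assume "t \<in> {0<..<T}"
      then have t: "t \<in> {0..T}" by simp
      have "(\<gamma> - 1) * energy \<gamma> \<Omega> (\<rho> t) (u t) \<le> (\<gamma> - 1) * energy \<gamma> \<Omega> \<rho>\<^sub>0 u\<^sub>0"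
        using elim t gamma by (intro mult_left_mono) auto
      then show "set_integrable lborel \<Omega> (\<lambda>x. \<rho> (fst (t, x)) (snd (t, x)) powr \<gamma>)
        \<and> (LINT x:\<Omega>|lborel. \<bar>\<rho> (fst (t, x)) (snd (t, x)) powr \<gamma>\<bar>) \<le> (\<gamma> - 1) * energy \<gamma> \<Omega> \<rho>\<^sub>0 u\<^sub>0"
        using rho_powr_integrable[OF t] energy_nonneg(1)[OF t] by simp
    qed
  qed
qed (use finite_measure_time in auto)

lemma finite_measure_Q: "emeasure lborel Q < \<infinity>" using emeasure_bounded_finite[OF bounded_Q] .

lemma G_Q_integrable: "set_integrable lborel Q (\<lambda>p. G (fst p) (snd p))"
  using in_Lp_set_integrable[OF G_Lp _ Q_sets finite_measure_Q] by (simp add: case_prod_beta')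

lemma G_sq_Q_integrable: "set_integrable lborel Q (\<lambda>p. (norm (G (fst p) (snd p)))\<^sup>2)"
proof -
  have "norm A powr 2 = (norm A)\<^sup>2" for A :: "real^3^3" by (cases "A = 0") simp_all
  then show ?thesis using G_Lp unfolding in_Lp_def case_prod_beta' by simp
qed

end


section \<open>Localisation in time\<close>

lemma matrix_inner_3:
  fixes A B :: "real^3^3"
  shows "A \<bullet> B = A$1$1*B$1$1 + A$1$2*B$1$2 + A$1$3*B$1$3 + A$2$1*B$2$1 + A$2$2*B$2$2 + A$2$3*B$2$3
    + A$3$1*B$3$1 + A$3$2*B$3$2 + A$3$3*B$3$3"
  by (simp add: inner_vec_def sum_3)

lemma viscous_stress_inner:
  "viscous_stress \<mu> \<eta> A \<bullet> B = \<mu> * (A \<bullet> B + transpose A \<bullet> B - 2/3 * trace A * trace B) + \<eta> * trace A * trace B"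
proof -
  have "mat 1 \<bullet> B = trace B" by (simp add: matrix_inner_3 mat_def trace_def sum_3)
  then show ?thesis unfolding viscous_stress_def
    by (simp add: inner_add_left inner_diff_left algebra_simps)
qed

lemma viscous_stress_inner_commute: "viscous_stress \<mu> \<eta> A \<bullet> B = viscous_stress \<mu> \<eta> B \<bullet> A"
proof -
  have "transpose A \<bullet> B = transpose B \<bullet> A" by (simp add: matrix_inner_3 transpose_def algebra_simps)
  then show ?thesis unfolding viscous_stress_inner by (simp add: inner_commute[of A B] mult_ac)
qed

text \<open>The quadratic form multiplied by \<mu> is half the squared norm of
  \<open>A + transpose A\<close> without its trace part, here written as a sum of squares.\<close>

lemma viscous_stress_nonneg:
  assumes "\<mu> \<ge> 0" "\<eta> \<ge> 0" shows "0 \<le> viscous_stress \<mu> \<eta> A \<bullet> A"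
proof -
  have "A \<bullet> A + transpose A \<bullet> A - 2/3 * trace A * trace A
     = (A$1$2 + A$2$1)\<^sup>2 + (A$1$3 + A$3$1)\<^sup>2 + (A$2$3 + A$3$2)\<^sup>2
       + 2/3 * ((A$1$1 - A$2$2)\<^sup>2 + (A$1$1 - A$3$3)\<^sup>2 + (A$2$2 - A$3$3)\<^sup>2)"
    by (simp add: matrix_inner_3 transpose_def trace_def sum_3 power2_eq_square algebra_simps)
  also have "\<dots> \<ge> 0" by simp
  finally have "A \<bullet> A + transpose A \<bullet> A - 2/3 * trace A * trace A \<ge> 0" .
  then show ?thesis unfolding viscous_stress_inner using assms by (simp add: mult.assoc)
qed

lemma linear_viscous_stress: "linear (viscous_stress \<mu> \<eta>)"
proof
  have tr: "trace (A + B) = trace A + trace B" "trace (c *\<^sub>R A) = c * trace A" for A B :: "real^3^3" and c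
    by (simp_all add: trace_add trace_scaleR)
  have tp: "transpose (A + B) = transpose A + transpose B" "transpose (c *\<^sub>R A) = c *\<^sub>R transpose A" for A B :: "real^3^3" and c
    by (simp_all add: transpose_def vec_eq_iff)
  show "viscous_stress \<mu> \<eta> (A + B) = viscous_stress \<mu> \<eta> A + viscous_stress \<mu> \<eta> B" for A B
    unfolding viscous_stress_def tr tp by (simp add: algebra_simps add_divide_distrib)
  show "viscous_stress \<mu> \<eta> (c *\<^sub>R A) = c *\<^sub>R viscous_stress \<mu> \<eta> A" for c A
    unfolding viscous_stress_def tr tp by (simp add: algebra_simps)
qed

text \<open>The stress is a symmetric positive semidefinite form; expanding it on
  \<open>A - D\<close> bounds twice the left side. The coefficient 1 of
  \<open>viscous_stress \<mu> \<eta> A \<bullet> A\<close> lets the dissipation in the energy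
  inequality absorb that term.\<close>

lemma viscous_stress_young:
  assumes "\<mu> \<ge> 0" "\<eta> \<ge> 0"
  shows "viscous_stress \<mu> \<eta> A \<bullet> D \<le> viscous_stress \<mu> \<eta> A \<bullet> A + viscous_stress \<mu> \<eta> D \<bullet> D"
proof -
  have "0 \<le> viscous_stress \<mu> \<eta> (A - D) \<bullet> (A - D)" by (rule viscous_stress_nonneg[OF assms])
  also have "\<dots> = viscous_stress \<mu> \<eta> A \<bullet> A - 2 * (viscous_stress \<mu> \<eta> A \<bullet> D) + viscous_stress \<mu> \<eta> D \<bullet> D"
    using viscous_stress_inner_commute[of \<mu> \<eta> D A]
    by (simp add: linear_diff[OF linear_viscous_stress] inner_diff_left inner_diff_right)
  finally show ?thesis using viscous_stress_nonneg[OF assms, of A] viscous_stress_nonneg[OF assms, of D] by linarith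
qed

lemma viscous_stress_bound: "\<exists>c\<ge>0. \<forall>A. norm (viscous_stress \<mu> \<eta> A) \<le> c * norm A"
proof -
  obtain B where B: "\<And>A. norm (viscous_stress \<mu> \<eta> A) \<le> B * norm A" using linear_bounded[OF linear_viscous_stress] by blast
  have "norm (viscous_stress \<mu> \<eta> A) \<le> \<bar>B\<bar> * norm A" for A
    using B[of A] mult_right_mono[OF abs_ge_self[of B] norm_ge_zero[of A]] by linarith
  then show ?thesis by (intro exI[of _ "\<bar>B\<bar>"]) auto
qed

text \<open>A null set cannot contain an interval. This selects, close to a given time, one at which
  an almost everywhere estimate is valid.\<close>

lemma AE_lborel_interval_witness:
  fixes a b :: real
  assumes "AE x in lborel. P x" "a < b"
  shows "\<exists>x. a < x \<and> x < b \<and> P x"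
proof (rule ccontr)
  assume "\<not> ?thesis"
  then have "AE x in lborel. \<not> x \<in> {a<..<b}" using assms(1) by (auto elim!: eventually_mono)
  then have "emeasure lborel {x \<in> space lborel. x \<in> {a<..<b}} = 0" by (rule emeasure_eq_0_AE)
  moreover have "{x \<in> space lborel. x \<in> {a<..<b}} = {a<..<b}" by auto
  ultimately have "emeasure lborel {a<..<b} = 0" by (simp only:)
  then show False using assms(2) by simp
qed

lemma set_integrable_times_power:
  fixes R :: "real \<Rightarrow> real"
  assumes "set_integrable lborel {0<..<T} R"
  shows "set_integrable lborel {0<..<T} (\<lambda>t. R t * t ^ n)"
proof (rule set_integrable_continuous_weight[OF bounded_bilinear_mult _ assms, where B = "T ^ n"])
  show "norm (t ^ n) \<le> T ^ n" if "t \<in> {0<..<T}" for t using that by (simp add: power_mono)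
qed (auto intro!: continuous_intros)

section \<open>The weak equations on an arbitrary time interval\<close>

context navier_stokes
begin

abbreviation "S \<equiv> viscous_stress \<mu> \<eta>"
abbreviation "\<sigma> \<equiv> surface_measure \<Omega>"

definition boundary_work :: "real \<Rightarrow> real" where "boundary_work t = (LINT x|\<sigma>. g t x \<bullet> U t x)"

definition h_cont :: "real \<times> (real^3) \<Rightarrow> real" where
  "h_cont = (\<lambda>(t, x). \<rho> t x * at' t x + (\<rho> t x *\<^sub>R u t x) \<bullet> ga t x)"

definition h_mom :: "real \<times> (real^3) \<Rightarrow> real" where
  "h_mom = (\<lambda>(t, x). (\<rho> t x *\<^sub>R u t x) \<bullet> Ut t x + (\<rho> t x *\<^sub>R tensor (u t x) (u t x)) \<bullet> J t x
    + pressure \<gamma> (\<rho> t x) * trace (J t x))"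

lemma S_bounded_linear: "bounded_linear S" using linear_viscous_stress linear_conv_bounded_linear by blast

lemma SG_Q_integrable: "set_integrable lborel Q (\<lambda>p. S (G (fst p) (snd p)))"
  using integrable_bounded_linear[OF S_bounded_linear G_Q_integrable[unfolded set_integrable_def]]
  by (simp add: set_integrable_def linear_scale[OF linear_viscous_stress])

lemma SGJ_Q_integrable: "set_integrable lborel Q (\<lambda>p. S (G (fst p) (snd p)) \<bullet> J (fst p) (snd p))"
proof -
  obtain K where K: "bounds K" using bounds_exist ..
  show ?thesis
    by (rule set_integrable_weight_Q[OF SG_Q_integrable, where B = "9 * K"])
       (use continuous_derivs(4) K in \<open>auto simp: case_prod_beta' bounds_def intro!: norm_matrix_le\<close>)
qed

lemma SGG_Q_integrable: "set_integrable lborel Q (\<lambda>p. S (G (fst p) (snd p)) \<bullet> G (fst p) (snd p))"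
proof -
  obtain c where c: "c \<ge> 0" "\<And>A. norm (S A) \<le> c * norm A" using viscous_stress_bound by blast
  show ?thesis
  proof (rule set_integrable_bound)
    show "set_integrable lborel Q (\<lambda>p. c * (norm (G (fst p) (snd p)))\<^sup>2)"
      using G_sq_Q_integrable by (rule set_integrable_mult_right)
    have [measurable]: "(\<lambda>p. G (fst p) (snd p)) \<in> borel_measurable (restrict_space borel Q)"
      using G_Lp unfolding in_Lp_def set_borel_measurable_lborel set_measurable_iff_restrict[OF Q_sets] by (simp add: case_prod_beta')
    have [measurable]: "S \<in> borel_measurable borel"
      by (intro borel_measurable_continuous_onI linear_continuous_on S_bounded_linear)
    show "set_borel_measurable lborel Q (\<lambda>p. S (G (fst p) (snd p)) \<bullet> G (fst p) (snd p))"
      unfolding set_borel_measurable_lborel set_measurable_iff_restrict[OF Q_sets] by measurable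
    have "\<bar>S A \<bullet> A\<bar> \<le> c * (norm A)\<^sup>2" for A
      using Cauchy_Schwarz_ineq2[of "S A" A] mult_right_mono[OF c(2)[of A] norm_ge_zero[of A]]
      by (simp add: power2_eq_square)
    then show "AE p in lborel. p \<in> Q \<longrightarrow> norm (S (G (fst p) (snd p)) \<bullet> G (fst p) (snd p)) \<le> norm (c * (norm (G (fst p) (snd p)))\<^sup>2)"
      using c(1) by simp
  qed
qed

lemma h_cont_integrable: "set_integrable lborel Q h_cont"
proof -
  obtain K where K: "bounds K" using bounds_exist ..
  have "set_integrable lborel Q (\<lambda>p. \<rho> (fst p) (snd p) \<bullet> at' (fst p) (snd p))"
    by (rule set_integrable_weight_Q[OF rho_Q_integrable, where B = K])
       (use continuous_derivs(5) K in \<open>auto simp: case_prod_beta' bounds_def\<close>)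
  moreover have "set_integrable lborel Q (\<lambda>p. (\<rho> (fst p) (snd p) *\<^sub>R u (fst p) (snd p)) \<bullet> ga (fst p) (snd p))"
    by (rule set_integrable_weight_Q[OF mom_Q_integrable, where B = K])
       (use continuous_derivs(6) K in \<open>auto simp: case_prod_beta' bounds_def\<close>)
  ultimately have "set_integrable lborel Q (\<lambda>p. \<rho> (fst p) (snd p) \<bullet> at' (fst p) (snd p) + (\<rho> (fst p) (snd p) *\<^sub>R u (fst p) (snd p)) \<bullet> ga (fst p) (snd p))"
    by (rule set_integral_add(1))
  then show ?thesis by (simp add: h_cont_def case_prod_beta')
qed

lemma h_mom_integrable: "set_integrable lborel Q h_mom"
proof -
  obtain K where K: "bounds K" using bounds_exist ..
  have "set_integrable lborel Q (\<lambda>p. (\<rho> (fst p) (snd p) *\<^sub>R u (fst p) (snd p)) \<bullet> Ut (fst p) (snd p))"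
    by (rule set_integrable_weight_Q[OF mom_Q_integrable, where B = K])
       (use continuous_derivs(3) K in \<open>auto simp: case_prod_beta' bounds_def\<close>)
  moreover have "set_integrable lborel Q (\<lambda>p. (\<rho> (fst p) (snd p) *\<^sub>R tensor (u (fst p) (snd p)) (u (fst p) (snd p))) \<bullet> J (fst p) (snd p))"
    by (rule set_integrable_weight_Q[OF tensor_Q_integrable, where B = "9 * K"])
       (use continuous_derivs(4) K in \<open>auto simp: case_prod_beta' bounds_def intro!: norm_matrix_le\<close>)
  moreover have "set_integrable lborel Q (\<lambda>p. \<rho> (fst p) (snd p) powr \<gamma> \<bullet> trace (J (fst p) (snd p)))"
  proof (rule set_integrable_weight_Q[OF pressure_Q_integrable, where B = "3 * K"])
    show "continuous_on Q (\<lambda>p. trace (J (fst p) (snd p)))"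
      unfolding trace_def sum_3 using continuous_derivs(4) by (auto simp: case_prod_beta' intro!: continuous_intros)
    show "norm (trace (J (fst (t, x)) (snd (t, x)))) \<le> 3 * K" if "t \<in> {0<..<T}" "x \<in> \<Omega>" for t x
    proof -
      have "\<bar>J t x $ i $ i\<bar> \<le> K" for i using K that by (auto simp: bounds_def)
      from this[of 1] this[of 2] this[of 3] show ?thesis unfolding trace_def sum_3 by simp
    qed
  qed
  ultimately have "set_integrable lborel Q (\<lambda>p. (\<rho> (fst p) (snd p) *\<^sub>R u (fst p) (snd p)) \<bullet> Ut (fst p) (snd p)
     + (\<rho> (fst p) (snd p) *\<^sub>R tensor (u (fst p) (snd p)) (u (fst p) (snd p))) \<bullet> J (fst p) (snd p)
     + \<rho> (fst p) (snd p) powr \<gamma> \<bullet> trace (J (fst p) (snd p)))"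
    by (intro set_integral_add(1))
  then show ?thesis by (simp add: h_mom_def case_prod_beta' pressure_def)
qed

definition "Fc0 = (LINT x:\<Omega>|lborel. \<rho>\<^sub>0 x * a 0 x)"
definition "Fm0 = (LINT x:\<Omega>|lborel. (\<rho>\<^sub>0 x *\<^sub>R u\<^sub>0 x) \<bullet> U 0 x)"

lemma continuity_localized:
  assumes "\<tau> \<in> {0..T}"
  shows "Fc \<tau> = Fc0 + (LINT t:{0<..<\<tau>}|lborel. LINT x:\<Omega>|lborel. h_cont (t, x))"
proof (rule moment_localization[OF T Fc_continuous _ _ assms])
  show "set_integrable lborel {0<..<T} (\<lambda>t. LINT x:\<Omega>|lborel. h_cont (t, x))"
    by (rule set_fubini(2)[OF h_cont_integrable])
  fix n
  \<comment> \<open>At time 0 this test function is \<open>0 ^ n\<close> times \<open>a 0\<close>,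
    so the initial datum is seen only for \<open>n = 0\<close>, as
    \<open>moment_localization\<close> expects.\<close>
  let ?\<phi> = "\<lambda>t x. t ^ n *\<^sub>R a t x"
  have a_int: "set_integrable lborel Q (\<lambda>p. \<rho> (fst p) (snd p) * a (fst p) (snd p))"
  proof -
    obtain K where K: "bounds K" using bounds_exist ..
    have "set_integrable lborel Q (\<lambda>p. \<rho> (fst p) (snd p) \<bullet> a (fst p) (snd p))"
      by (rule set_integrable_weight_Q[OF rho_Q_integrable, where B = K])
         (use continuous_Q(3) K in_Qc in \<open>auto simp: case_prod_beta' bounds_def\<close>)
    then show ?thesis by simp
  qed
  have "(LINT x:\<Omega>|lborel. \<rho> T x * ?\<phi> T x) - (LINT x:\<Omega>|lborel. \<rho>\<^sub>0 x * ?\<phi> 0 x)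
    = (LINT t:{0<..<T}|lborel. LINT x:\<Omega>|lborel. \<rho> t x * time_deriv ?\<phi> t x + (\<rho> t x *\<^sub>R u t x) \<bullet> grad (?\<phi> t) x)"
    using weak_cont smooth_monomial_scaleR[OF a_smooth, of n] unfolding weak_continuity_equation_def by blast
  also have "(LINT x:\<Omega>|lborel. \<rho> T x * ?\<phi> T x) = (LINT x:\<Omega>|lborel. T ^ n * (\<rho> T x * a T x))" by (simp add: mult_ac)
  also have "\<dots> = Fc T * T ^ n" by (simp add: Fc_def mult.commute)
  also have "(LINT x:\<Omega>|lborel. \<rho>\<^sub>0 x * ?\<phi> 0 x) = (LINT x:\<Omega>|lborel. 0 ^ n * (\<rho>\<^sub>0 x * a 0 x))" by (simp add: mult_ac)
  also have "\<dots> = Fc0 * 0 ^ n" by (simp add: Fc0_def mult.commute)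
  also have "(LINT t:{0<..<T}|lborel. LINT x:\<Omega>|lborel. \<rho> t x * time_deriv ?\<phi> t x + (\<rho> t x *\<^sub>R u t x) \<bullet> grad (?\<phi> t) x)
    = (LINT t:{0<..<T}|lborel. (LINT x:\<Omega>|lborel. \<rho> (fst (t, x)) (snd (t, x)) * a (fst (t, x)) (snd (t, x))) * (real n * t ^ (n - 1))
        + (LINT x:\<Omega>|lborel. h_cont (t, x)) * t ^ n)"
  proof (rule iterated_test_split[OF a_int h_cont_integrable])
    fix t x assume tx: "t \<in> {0<..<T}" "x \<in> \<Omega>"
    have 1: "time_deriv ?\<phi> t x = (real n * t ^ (n - 1)) *\<^sub>R a t x + t ^ n *\<^sub>R at' t x"
      by (rule time_deriv_monomial_scaleR[where f = a, OF a_der(1)[OF tx]])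
    have "(?\<phi> t has_derivative (\<lambda>v. (t ^ n *\<^sub>R ga t x) \<bullet> v)) (at x)"
      using has_derivative_scaleR_right[OF a_der(2)[OF tx], of "t ^ n"] by simp
    then have 2: "grad (?\<phi> t) x = t ^ n *\<^sub>R ga t x" by (rule grad_eq)
    show "\<rho> t x * time_deriv ?\<phi> t x + (\<rho> t x *\<^sub>R u t x) \<bullet> grad (?\<phi> t) x
      = real n * t ^ (n - 1) * (\<rho> (fst (t, x)) (snd (t, x)) * a (fst (t, x)) (snd (t, x))) + t ^ n * h_cont (t, x)"
      unfolding 1 2 by (simp add: h_cont_def algebra_simps)
  qed
  finally show "Fc T * T ^ n - Fc0 * 0 ^ n = (LINT t:{0<..<T}|lborel. Fc t * (real n * t ^ (n - 1)) + (LINT x:\<Omega>|lborel. h_cont (t, x)) * t ^ n)"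
    by (simp add: Fc_def)
qed

text \<open>The friction becomes one more function of time in the source term of
  \<open>moment_localization\<close>. Its integrability rests on the trace estimates and is supplied
  by \<open>boundary_term_integrable\<close>.\<close>

lemma momentum_localized:
  assumes \<tau>: "\<tau> \<in> {0..T}" and bi: "set_integrable lborel {0<..<T} (\<lambda>t. \<beta> * boundary_work t)"
  shows "Fm \<tau> = Fm0 + (LINT t:{0<..<\<tau>}|lborel. (LINT x:\<Omega>|lborel. h_mom (t, x) - \<epsilon> * (S (G t x) \<bullet> J t x)) - \<beta> * boundary_work t)"
proof (rule moment_localization[OF T Fm_continuous _ _ \<tau>])
  let ?h = "\<lambda>p. h_mom p - \<epsilon> * (S (G (fst p) (snd p)) \<bullet> J (fst p) (snd p))"
  have hi: "set_integrable lborel Q ?h"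
    by (intro set_integral_diff(1) set_integrable_mult_right h_mom_integrable SGJ_Q_integrable)
  have h2i: "set_integrable lborel {0<..<T} (\<lambda>t. LINT x:\<Omega>|lborel. h_mom (t, x) - \<epsilon> * (S (G t x) \<bullet> J t x))"
    using set_fubini(2)[OF hi] by simp
  show Ri: "set_integrable lborel {0<..<T} (\<lambda>t. (LINT x:\<Omega>|lborel. h_mom (t, x) - \<epsilon> * (S (G t x) \<bullet> J t x)) - \<beta> * boundary_work t)"
    by (intro set_integral_diff(1) h2i bi)
  fix n
  let ?\<phi> = "\<lambda>t x. t ^ n *\<^sub>R U t x"
  have U_int: "set_integrable lborel Q (\<lambda>p. (\<rho> (fst p) (snd p) *\<^sub>R u (fst p) (snd p)) \<bullet> U (fst p) (snd p))"
  proof -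
    obtain K where K: "bounds K" using bounds_exist ..
    show ?thesis
      by (rule set_integrable_weight_Q[OF mom_Q_integrable, where B = K])
         (use continuous_Q(2) K in_Qc in \<open>auto simp: case_prod_beta' bounds_def\<close>)
  qed
  have Fmi: "set_integrable lborel {0<..<T} (\<lambda>t. Fm t * (real n * t ^ (n - 1)))"
    by (intro set_integrable_Ioo_continuous continuous_intros Fm_continuous)
  have "(LINT x:\<Omega>|lborel. (\<rho> T x *\<^sub>R u T x) \<bullet> ?\<phi> T x) - (LINT x:\<Omega>|lborel. (\<rho>\<^sub>0 x *\<^sub>R u\<^sub>0 x) \<bullet> ?\<phi> 0 x)
    = - \<beta> * (LINT t:{0<..<T}|lborel. LINT x|\<sigma>. g t x \<bullet> ?\<phi> t x)
      + (LINT t:{0<..<T}|lborel. LINT x:\<Omega>|lborel.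
          (\<rho> t x *\<^sub>R u t x) \<bullet> time_deriv ?\<phi> t x + (\<rho> t x *\<^sub>R tensor (u t x) (u t x)) \<bullet> jacobian (?\<phi> t) (at x)
          + pressure \<gamma> (\<rho> t x) * divergence (?\<phi> t) x - \<epsilon> * (S (G t x) \<bullet> jacobian (?\<phi> t) (at x)))"
  proof (rule weak_mom[unfolded weak_momentum_equation_def, THEN spec[of _ ?\<phi>], THEN mp], intro conjI ballI)
    show "smooth_up_to Qc (\<lambda>(t, x). t ^ n *\<^sub>R U t x)" by (rule smooth_monomial_scaleR[OF U_smooth])
    show "t ^ n *\<^sub>R U t x \<bullet> outward_normal \<Omega> x = 0" if "t \<in> {0..T}" "x \<in> frontier \<Omega>" for t x
      using tangent[OF that] by simp
  qed
  also have "(LINT x:\<Omega>|lborel. (\<rho> T x *\<^sub>R u T x) \<bullet> ?\<phi> T x) = Fm T * T ^ n" by (simp add: Fm_def mult.commute)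
  also have "(LINT x:\<Omega>|lborel. (\<rho>\<^sub>0 x *\<^sub>R u\<^sub>0 x) \<bullet> ?\<phi> 0 x) = Fm0 * 0 ^ n" by (simp add: Fm0_def mult.commute)
  also have "- \<beta> * (LINT t:{0<..<T}|lborel. LINT x|\<sigma>. g t x \<bullet> ?\<phi> t x) = (LINT t:{0<..<T}|lborel. - ((\<beta> * boundary_work t) * t ^ n))"
    by (simp add: boundary_work_def set_lebesgue_integral_def mult_ac flip: integral_mult_right_zero)
  also have "(LINT t:{0<..<T}|lborel. LINT x:\<Omega>|lborel.
          (\<rho> t x *\<^sub>R u t x) \<bullet> time_deriv ?\<phi> t x + (\<rho> t x *\<^sub>R tensor (u t x) (u t x)) \<bullet> jacobian (?\<phi> t) (at x)
          + pressure \<gamma> (\<rho> t x) * divergence (?\<phi> t) x - \<epsilon> * (S (G t x) \<bullet> jacobian (?\<phi> t) (at x)))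
    = (LINT t:{0<..<T}|lborel. (LINT x:\<Omega>|lborel. (\<rho> (fst (t, x)) (snd (t, x)) *\<^sub>R u (fst (t, x)) (snd (t, x))) \<bullet> U (fst (t, x)) (snd (t, x))) * (real n * t ^ (n - 1))
        + (LINT x:\<Omega>|lborel. ?h (t, x)) * t ^ n)"
  proof (rule iterated_test_split[OF U_int hi])
    fix t x assume tx: "t \<in> {0<..<T}" "x \<in> \<Omega>"
    have 1: "time_deriv ?\<phi> t x = (real n * t ^ (n - 1)) *\<^sub>R U t x + t ^ n *\<^sub>R Ut t x"
      by (rule time_deriv_monomial_scaleR[where f = U, OF U_der(1)[OF tx]])
    have "(?\<phi> t has_derivative (\<lambda>v. (t ^ n *\<^sub>R J t x) *v v)) (at x)"
      using has_derivative_scaleR_right[OF U_der(2)[OF tx], of "t ^ n"] by (simp add: scaleR_matrix_vector_assoc)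
    then have 2: "jacobian (?\<phi> t) (at x) = t ^ n *\<^sub>R J t x" "divergence (?\<phi> t) x = t ^ n * trace (J t x)"
      by (simp_all only: jacobian_eq divergence_eq_trace trace_scaleR)
    show "(\<rho> t x *\<^sub>R u t x) \<bullet> time_deriv ?\<phi> t x + (\<rho> t x *\<^sub>R tensor (u t x) (u t x)) \<bullet> jacobian (?\<phi> t) (at x)
          + pressure \<gamma> (\<rho> t x) * divergence (?\<phi> t) x - \<epsilon> * (S (G t x) \<bullet> jacobian (?\<phi> t) (at x))
      = real n * t ^ (n - 1) * ((\<rho> (fst (t, x)) (snd (t, x)) *\<^sub>R u (fst (t, x)) (snd (t, x))) \<bullet> U (fst (t, x)) (snd (t, x))) + t ^ n * ?h (t, x)"
      unfolding 1 2 by (simp add: h_mom_def inner_add_right algebra_simps)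
  qed
  also have "\<dots> = (LINT t:{0<..<T}|lborel. Fm t * (real n * t ^ (n - 1)) + (LINT x:\<Omega>|lborel. h_mom (t, x) - \<epsilon> * (S (G t x) \<bullet> J t x)) * t ^ n)"
    by (simp add: Fm_def)
  also have "(LINT t:{0<..<T}|lborel. - ((\<beta> * boundary_work t) * t ^ n)) + \<dots>
    = (LINT t:{0<..<T}|lborel. - ((\<beta> * boundary_work t) * t ^ n) + (Fm t * (real n * t ^ (n - 1)) + (LINT x:\<Omega>|lborel. h_mom (t, x) - \<epsilon> * (S (G t x) \<bullet> J t x)) * t ^ n))"
  proof (rule set_integral_add(2)[symmetric])
    have "set_integrable lborel {0<..<T} (\<lambda>t. (-1) * ((\<beta> * boundary_work t) * t ^ n))"
      by (intro set_integrable_mult_right set_integrable_times_power bi)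
    then show "set_integrable lborel {0<..<T} (\<lambda>t. - ((\<beta> * boundary_work t) * t ^ n))" by simp
    show "set_integrable lborel {0<..<T} (\<lambda>t. Fm t * (real n * t ^ (n - 1)) + (LINT x:\<Omega>|lborel. h_mom (t, x) - \<epsilon> * (S (G t x) \<bullet> J t x)) * t ^ n)"
      by (intro set_integral_add(1) Fmi set_integrable_times_power h2i)
  qed
  also have "\<dots> = (LINT t:{0<..<T}|lborel. Fm t * (real n * t ^ (n - 1)) + ((LINT x:\<Omega>|lborel. h_mom (t, x) - \<epsilon> * (S (G t x) \<bullet> J t x)) - \<beta> * boundary_work t) * t ^ n)"
    by (simp add: algebra_simps)
  finally show "Fm T * T ^ n - Fm0 * 0 ^ n = (LINT t:{0<..<T}|lborel. Fm t * (real n * t ^ (n - 1)) + ((LINT x:\<Omega>|lborel. h_mom (t, x) - \<epsilon> * (S (G t x) \<bullet> J t x)) - \<beta> * boundary_work t) * t ^ n)" .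
qed

end


section \<open>The boundary term\<close>

context cylinder
begin

lemma surface_facts:
  "sets \<sigma>' = sets (restrict_space borel (frontier \<Omega>))" "space \<sigma>' = frontier \<Omega>" "finite_measure \<sigma>'"
  if "\<sigma>' = surface_measure \<Omega>"
proof -
  have s: "sets hausdorff2 = sets borel" "space hausdorff2 = UNIV"
    unfolding hausdorff2_def using sets.sigma_sets_eq[of borel] by (simp_all add: space_measure_of_conv sets_measure_of_conv)
  show "sets \<sigma>' = sets (restrict_space borel (frontier \<Omega>))"
    unfolding that surface_measure_def using s by (intro sets_restrict_space_cong) auto
  show "space \<sigma>' = frontier \<Omega>" unfolding that surface_measure_def by (simp add: space_restrict_space s)
  show "finite_measure \<sigma>'" unfolding that by (rule finite_measure_surface[OF dom])
qed

end

context navier_stokes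
begin

lemma sets_surface: "sets \<sigma> = sets (restrict_space borel (frontier \<Omega>))"
  and space_surface: "space \<sigma> = frontier \<Omega>" and finite_surface: "finite_measure \<sigma>"
  using surface_facts by blast+

lemma pair_surface_measurable: "(\<lambda>p. (fst p, snd p)) \<in> measurable (lborel \<Otimes>\<^sub>M \<sigma>) (borel :: (real \<times> (real^3)) measure)"
proof -
  have "(\<lambda>x. x) \<in> measurable (restrict_space borel (frontier \<Omega>)) (borel :: (real^3) measure)"
    by (rule measurable_restrict_space1) simp
  then have "(\<lambda>x. x) \<in> measurable \<sigma> (borel :: (real^3) measure)"
    by (simp only: measurable_cong_sets[OF sets_surface refl])
  then have "(\<lambda>p. snd p) \<in> measurable (lborel \<Otimes>\<^sub>M \<sigma>) borel" by (rule measurable_compose[OF measurable_snd])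
  moreover have "(\<lambda>p. fst p) \<in> measurable (lborel \<Otimes>\<^sub>M \<sigma>) borel" by simp
  ultimately show ?thesis unfolding borel_prod[symmetric] by (intro measurable_Pair)
qed

abbreviation "Qb \<equiv> {0<..<T} \<times> frontier \<Omega>"

text \<open>The trace is measurable on \<open>Qb\<close> only; extension by zero makes it measurable
  on the whole product space, as iterated integration requires.\<close>

definition trace_ext :: "real \<Rightarrow> real^3 \<Rightarrow> real^3" where "trace_ext t x = indicat_real Qb (t, x) *\<^sub>R g t x"
definition velocity_ext :: "real \<Rightarrow> real^3 \<Rightarrow> real^3" where "velocity_ext t x = indicat_real Qc (t, x) *\<^sub>R U t x"

lemma trace_ext_measurable[measurable]: "(\<lambda>p. trace_ext (fst p) (snd p)) \<in> borel_measurable (lborel \<Otimes>\<^sub>M \<sigma>)"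
proof -
  have "(\<lambda>(t, x). trace_ext t x) \<in> borel_measurable borel"
    using g_meas unfolding set_borel_measurable_def trace_ext_def by (simp add: case_prod_beta')
  from measurable_compose[OF pair_surface_measurable this] show ?thesis by simp
qed

lemma velocity_ext_measurable[measurable]: "(\<lambda>p. velocity_ext (fst p) (snd p)) \<in> borel_measurable (lborel \<Otimes>\<^sub>M \<sigma>)"
proof -
  have "Qc \<in> sets borel" using compact_Qc by (intro borel_closed compact_imp_closed)
  from borel_measurable_continuous_on_indicator[OF this continuous_Qc(2)]
  have "(\<lambda>(t, x). velocity_ext t x) \<in> borel_measurable borel" unfolding velocity_ext_def by (simp add: case_prod_beta')
  from measurable_compose[OF pair_surface_measurable this] show ?thesis by simp
qed

definition trace_sq :: "real \<Rightarrow> ennreal" where "trace_sq t = (\<integral>\<^sup>+x. ennreal ((norm (g t x))\<^sup>2) \<partial>\<sigma>)"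
definition trace_sq_ext :: "real \<Rightarrow> ennreal" where "trace_sq_ext t = (\<integral>\<^sup>+x. ennreal ((norm (trace_ext t x))\<^sup>2) \<partial>\<sigma>)"

lemma frontier_closure: "x \<in> frontier \<Omega> \<Longrightarrow> x \<in> closure \<Omega>" by (simp add: frontier_def)

lemma trace_sq_ext_eq: "t \<in> {0<..<T} \<Longrightarrow> trace_sq_ext t = trace_sq t"
  unfolding trace_sq_def trace_sq_ext_def by (rule nn_integral_cong) (simp add: space_surface trace_ext_def)

lemma trace_sq_ext_measurable[measurable]: "trace_sq_ext \<in> borel_measurable borel"
proof -
  interpret finite_measure \<sigma> by (rule finite_surface)
  have "(\<lambda>t. \<integral>\<^sup>+x. ennreal ((norm (trace_ext t x))\<^sup>2) \<partial>\<sigma>) \<in> borel_measurable lborel"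
    by (rule borel_measurable_nn_integral) (simp add: case_prod_beta')
  then show ?thesis unfolding trace_sq_ext_def[abs_def] by simp
qed

lemma boundary_work_eq: "t \<in> {0<..<T} \<Longrightarrow> boundary_work t = (LINT x|\<sigma>. trace_ext t x \<bullet> velocity_ext t x)"
  unfolding boundary_work_def by (rule Bochner_Integration.integral_cong) (auto simp: space_surface trace_ext_def velocity_ext_def frontier_closure)

lemma boundary_work_ext_measurable[measurable]: "(\<lambda>t. LINT x|\<sigma>. trace_ext t x \<bullet> velocity_ext t x) \<in> borel_measurable borel"
proof -
  interpret finite_measure \<sigma> by (rule finite_surface)
  have "(\<lambda>t. LINT x|\<sigma>. trace_ext t x \<bullet> velocity_ext t x) \<in> borel_measurable lborel"
    by (rule borel_measurable_lebesgue_integral) (simp add: case_prod_beta')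
  then show ?thesis by simp
qed

definition "surface_area = measure \<sigma> (space \<sigma>)"

text \<open>Young's inequality on a surface of finite area, with weight one on the squared trace to
  match the friction term of the energy inequality. The estimate lives in \<open>ennreal\<close>
  because the trace need not be square integrable at every time.\<close>

lemma boundary_work_bound:
  assumes K: "bounds K" and t: "t \<in> {0<..<T}"
  shows "ennreal \<bar>boundary_work t\<bar> \<le> trace_sq t + ennreal (K\<^sup>2 * surface_area)"
proof (cases "integrable \<sigma> (\<lambda>x. trace_ext t x \<bullet> velocity_ext t x)")
  case True
  interpret finite_measure \<sigma> by (rule finite_surface)
  have [measurable]: "trace_ext t \<in> borel_measurable \<sigma>"
    using measurable_compose[OF measurable_Pair1'[of t lborel \<sigma>] trace_ext_measurable] by simp
  have "ennreal \<bar>boundary_work t\<bar> \<le> (\<integral>\<^sup>+x. norm (trace_ext t x \<bullet> velocity_ext t x) \<partial>\<sigma>)"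
    unfolding boundary_work_eq[OF t] using integral_norm_bound_ennreal[OF True] by simp
  also have "\<dots> \<le> (\<integral>\<^sup>+x. ennreal ((norm (trace_ext t x))\<^sup>2) + ennreal (K\<^sup>2) \<partial>\<sigma>)"
  proof (rule nn_integral_mono)
    fix x assume "x \<in> space \<sigma>"
    then have "norm (U t x) \<le> K" using K t frontier_closure by (auto simp: bounds_def space_surface)
    then have velocity_ext: "norm (velocity_ext t x) \<le> K" by (auto simp: velocity_ext_def indicator_def intro: order_trans[OF norm_ge_zero])
    have "\<bar>trace_ext t x \<bullet> velocity_ext t x\<bar> \<le> norm (trace_ext t x) * norm (velocity_ext t x)" by (rule Cauchy_Schwarz_ineq2)
    also have "\<dots> \<le> norm (trace_ext t x) * K" by (rule mult_left_mono[OF velocity_ext]) simp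
    also have "\<dots> \<le> (norm (trace_ext t x))\<^sup>2 + K\<^sup>2"
      using sum_squares_bound[of "norm (trace_ext t x)" K] norm_ge_zero[of "trace_ext t x"] order_trans[OF norm_ge_zero velocity_ext]
        mult_nonneg_nonneg[of "norm (trace_ext t x)" K] by linarith
    finally show "ennreal (norm (trace_ext t x \<bullet> velocity_ext t x)) \<le> ennreal ((norm (trace_ext t x))\<^sup>2) + ennreal (K\<^sup>2)"
      by (simp add: ennreal_leI flip: ennreal_plus)
  qed
  also have "\<dots> = trace_sq_ext t + ennreal (K\<^sup>2) * emeasure \<sigma> (space \<sigma>)"
    unfolding trace_sq_ext_def by (subst nn_integral_add) auto
  also have "\<dots> = trace_sq t + ennreal (K\<^sup>2 * surface_area)"
    unfolding trace_sq_ext_eq[OF t] surface_area_def emeasure_eq_measure by (simp add: ennreal_mult')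
  finally show ?thesis .
next
  case False
  \<comment> \<open>An integral that does not exist has the value 0, so the bound is
    trivial.\<close>
  then show ?thesis unfolding boundary_work_eq[OF t] by (simp add: not_integrable_integral_eq)
qed

definition trace_dissipation :: "real \<Rightarrow> ennreal" where "trace_dissipation \<tau> = (\<integral>\<^sup>+t\<in>{0<..<\<tau>}. trace_sq t \<partial>lborel)"

lemma trace_dissipation_eq: "\<tau> \<le> T \<Longrightarrow> trace_dissipation \<tau> = (\<integral>\<^sup>+t\<in>{0<..<\<tau>}. trace_sq_ext t \<partial>lborel)"
  unfolding trace_dissipation_def by (rule nn_integral_cong) (auto simp: trace_sq_ext_eq indicator_def)

text \<open>The energy inequality may fail at \<open>T\<close> itself. Every \<open>s < T\<close>
  lies below a time at which it holds, which bounds \<open>trace_dissipation s\<close> by a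
  constant; increasing intervals and the measure with density \<open>trace_sq_ext\<close> carry the
  bound to \<open>T\<close>.\<close>

lemma trace_dissipation_finite:
  assumes b: "\<beta> > 0" shows "trace_dissipation T < \<infinity>"
proof -
  define c where "c = ennreal (energy \<gamma> \<Omega> \<rho>\<^sub>0 u\<^sub>0 / \<beta>)"
  have bc: "ennreal \<beta> * c = ennreal (energy \<gamma> \<Omega> \<rho>\<^sub>0 u\<^sub>0)"
    unfolding c_def using b energy0_nonneg by (simp flip: ennreal_mult)
  have le: "trace_dissipation s \<le> c" if s: "s < T" for s
  proof -
    have "max s 0 < T" using s T by simp
    obtain \<tau> where \<tau>: "max s 0 < \<tau>" "\<tau> < T" and P: "\<tau> \<in> {0..T} \<longrightarrow>
        ennreal (energy \<gamma> \<Omega> (\<rho> \<tau>) (u \<tau>)) + ennreal (\<epsilon> * (LINT t:{0<..<\<tau>}|lborel. LINT x:\<Omega>|lborel. S (G t x) \<bullet> G t x))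
        + ennreal \<beta> * trace_dissipation \<tau> \<le> ennreal (energy \<gamma> \<Omega> \<rho>\<^sub>0 u\<^sub>0)"
      using AE_lborel_interval_witness[OF energy_ineq[unfolded energy_inequality_def] \<open>max s 0 < T\<close>] unfolding trace_dissipation_def trace_sq_def by blast
    have "trace_dissipation s \<le> trace_dissipation \<tau>" unfolding trace_dissipation_def
      by (rule nn_integral_mono) (use \<tau> in \<open>auto simp: indicator_def\<close>)
    moreover have "ennreal \<beta> * trace_dissipation \<tau> \<le> ennreal (energy \<gamma> \<Omega> \<rho>\<^sub>0 u\<^sub>0)"
      using P \<tau> by (auto intro: order_trans[rotated])
    then have "ennreal \<beta> * trace_dissipation \<tau> \<le> ennreal \<beta> * c" by (simp add: bc)
    then have "trace_dissipation \<tau> \<le> c" using b by (simp add: ennreal_mult_le_mult_iff)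
    ultimately show ?thesis by (rule order_trans)
  qed
  let ?A = "\<lambda>n. {0<..<T - T / real (n + 2)}"
  have "trace_dissipation T = emeasure (density lborel trace_sq_ext) {0<..<T}"
    by (simp add: trace_dissipation_eq emeasure_density)
  also have "{0<..<T} = (\<Union>n. ?A n)"
  proof
    show "{0<..<T} \<subseteq> (\<Union>n. ?A n)"
    proof
      fix t assume t: "t \<in> {0<..<T}"
      obtain n :: nat where n: "T / (T - t) < real n" using reals_Archimedean2 by blast
      have "T / real (n + 2) < T - t"
      proof -
        have "T < real n * (T - t)" using n t by (simp add: divide_less_eq)
        also have "\<dots> \<le> real (n + 2) * (T - t)" using t by (intro mult_right_mono) auto
        finally show ?thesis by (simp add: divide_less_eq mult.commute)
      qed
      then show "t \<in> (\<Union>n. ?A n)" using t by (intro UN_I[of n]) auto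
    qed
    show "(\<Union>n. ?A n) \<subseteq> {0<..<T}"
    proof
      fix t assume "t \<in> (\<Union>n. ?A n)"
      then obtain n where "0 < t" "t < T - T / real (n + 2)" by auto
      moreover have "T / real (n + 2) > 0" using T by simp
      ultimately show "t \<in> {0<..<T}" by simp
    qed
  qed
  also have "emeasure (density lborel trace_sq_ext) (\<Union>n. ?A n) = (SUP n. emeasure (density lborel trace_sq_ext) (?A n))"
  proof (rule SUP_emeasure_incseq[symmetric])
    have "T / real (m + 2) \<ge> T / real (n + 2)" if "m \<le> n" for m n using T that by (intro divide_left_mono) auto
    then show "incseq ?A" by (intro monoI greaterThanLessThan_subseteq_greaterThanLessThan[THEN iffD2]) auto
  qed auto
  also have "\<dots> \<le> c"
  proof (rule SUP_least)
    fix n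
    have lt: "T - T / real (n + 2) < T" using T by simp
    have "emeasure (density lborel trace_sq_ext) (?A n) = trace_dissipation (T - T / real (n + 2))"
      using lt by (simp add: trace_dissipation_eq emeasure_density)
    then show "emeasure (density lborel trace_sq_ext) (?A n) \<le> c" using le[OF lt] by simp
  qed
  finally show ?thesis by (rule le_less_trans) (simp add: c_def)
qed

lemma nn_integral_bd:
  assumes K: "bounds K" and \<tau>: "\<tau> \<in> {0..T}"
  shows "(\<integral>\<^sup>+t\<in>{0<..<\<tau>}. ennreal \<bar>boundary_work t\<bar> \<partial>lborel) \<le> trace_dissipation \<tau> + ennreal (K\<^sup>2 * surface_area * \<tau>)"
proof -
  have "(\<integral>\<^sup>+t\<in>{0<..<\<tau>}. ennreal \<bar>boundary_work t\<bar> \<partial>lborel)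
      \<le> (\<integral>\<^sup>+t. trace_sq_ext t * indicator {0<..<\<tau>} t + ennreal (K\<^sup>2 * surface_area) * indicator {0<..<\<tau>} t \<partial>lborel)"
  proof (rule nn_integral_mono)
    fix t
    show "ennreal \<bar>boundary_work t\<bar> * indicator {0<..<\<tau>} t \<le> trace_sq_ext t * indicator {0<..<\<tau>} t + ennreal (K\<^sup>2 * surface_area) * indicator {0<..<\<tau>} t"
    proof (cases "t \<in> {0<..<\<tau>}")
      case True
      then have "t \<in> {0<..<T}" using \<tau> by auto
      then show ?thesis using boundary_work_bound[OF K] trace_sq_ext_eq True by simp
    qed simp
  qed
  also have "\<dots> = trace_dissipation \<tau> + ennreal (K\<^sup>2 * surface_area) * emeasure lborel {0<..<\<tau>}"
    using \<tau> by (subst nn_integral_add) (auto simp: trace_dissipation_eq nn_integral_cmult_indicator)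
  also have "\<dots> = trace_dissipation \<tau> + ennreal (K\<^sup>2 * surface_area * \<tau>)"
    using \<tau> by (simp add: surface_area_def ennreal_mult'')
  finally show ?thesis .
qed

lemma boundary_term_integrable: "set_integrable lborel {0<..<T} (\<lambda>t. \<beta> * boundary_work t)"
proof (cases "\<beta> = 0")
  case False
  obtain K where K: "bounds K" using bounds_exist ..
  have "integrable lborel (\<lambda>t. indicat_real {0<..<T} t *\<^sub>R boundary_work t)"
  proof (rule integrableI_bounded)
    have "(\<lambda>t. indicat_real {0<..<T} t *\<^sub>R boundary_work t) = (\<lambda>t. indicat_real {0<..<T} t *\<^sub>R (LINT x|\<sigma>. trace_ext t x \<bullet> velocity_ext t x))"
      using boundary_work_eq by (auto simp: indicator_def)
    moreover have "(\<lambda>t. indicat_real {0<..<T} t *\<^sub>R (LINT x|\<sigma>. trace_ext t x \<bullet> velocity_ext t x)) \<in> borel_measurable lborel" by measurable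
    ultimately show "(\<lambda>t. indicat_real {0<..<T} t *\<^sub>R boundary_work t) \<in> borel_measurable lborel" by (simp only:)
    have "(\<integral>\<^sup>+t. ennreal (norm (indicat_real {0<..<T} t *\<^sub>R boundary_work t)) \<partial>lborel) = (\<integral>\<^sup>+t\<in>{0<..<T}. ennreal \<bar>boundary_work t\<bar> \<partial>lborel)"
      by (rule nn_integral_cong) (auto simp: indicator_def)
    also have "\<dots> \<le> trace_dissipation T + ennreal (K\<^sup>2 * surface_area * T)" by (rule nn_integral_bd[OF K]) (use T in auto)
    also have "\<dots> < \<infinity>" using trace_dissipation_finite False beta by simp
    finally show "(\<integral>\<^sup>+t. ennreal (norm (indicat_real {0<..<T} t *\<^sub>R boundary_work t)) \<partial>lborel) < \<infinity>" .
  qed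
  then show ?thesis by (intro set_integrable_mult_right) (simp add: set_integrable_def)
qed (simp add: set_integrable_def)

lemma dissipation_nonneg: "0 \<le> (LINT t:{0<..<\<tau>}|lborel. LINT x:\<Omega>|lborel. S (G t x) \<bullet> G t x)"
  unfolding set_lebesgue_integral_def
  by (intro Bochner_Integration.integral_nonneg mult_nonneg_nonneg)
     (use mu eta in \<open>auto simp: indicator_def intro!: Bochner_Integration.integral_nonneg viscous_stress_nonneg\<close>)

text \<open>The relative energy contains \<open>- Fm\<close>, so the friction of the momentum
  equation enters it as plus the integral of \<open>\<beta> * boundary_work\<close>. This is at most
  the boundary dissipation, already present on the left of the energy inequality, plus a term of
  order \<beta>.\<close>

lemma energy_with_boundary:
  assumes K: "bounds K"
  shows "AE \<tau> in lborel. \<tau> \<in> {0..T} \<longrightarrow>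
    energy \<gamma> \<Omega> (\<rho> \<tau>) (u \<tau>) + \<epsilon> * (LINT t:{0<..<\<tau>}|lborel. LINT x:\<Omega>|lborel. S (G t x) \<bullet> G t x)
      + (LINT t:{0<..<\<tau>}|lborel. \<beta> * boundary_work t)
    \<le> energy \<gamma> \<Omega> \<rho>\<^sub>0 u\<^sub>0 + \<beta> * (K\<^sup>2 * surface_area * T)"
  using energy_ineq[unfolded energy_inequality_def]
proof eventually_elim
  case (elim \<tau>)
  show ?case
  proof
    assume \<tau>: "\<tau> \<in> {0..T}"
    let ?E = "energy \<gamma> \<Omega> (\<rho> \<tau>) (u \<tau>)" and ?D = "LINT t:{0<..<\<tau>}|lborel. LINT x:\<Omega>|lborel. S (G t x) \<bullet> G t x"
    have en: "ennreal ?E + ennreal (\<epsilon> * ?D) + ennreal \<beta> * trace_dissipation \<tau> \<le> ennreal (energy \<gamma> \<Omega> \<rho>\<^sub>0 u\<^sub>0)"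
      using elim \<tau> unfolding trace_dissipation_def trace_sq_def by blast
    have E0: "?E \<ge> 0" by (rule energy_nonneg(2)[OF \<tau>])
    have D0: "\<epsilon> * ?D \<ge> 0" using eps dissipation_nonneg[of \<tau>] by simp
    have KT: "0 \<le> \<beta> * (K\<^sup>2 * surface_area * T)" using beta T by (simp add: surface_area_def)
    show "?E + \<epsilon> * ?D + (LINT t:{0<..<\<tau>}|lborel. \<beta> * boundary_work t) \<le> energy \<gamma> \<Omega> \<rho>\<^sub>0 u\<^sub>0 + \<beta> * (K\<^sup>2 * surface_area * T)"
    \<comment> \<open>For \<open>\<beta> = 0\<close> the boundary dissipation may be infinite and is
      multiplied by 0 in \<open>ennreal\<close>; for \<open>\<beta> > 0\<close> it is a real number
      \<open>y\<close>.\<close>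
    proof (cases "\<beta> = 0")
      case True
      then have "ennreal (?E + \<epsilon> * ?D) \<le> ennreal (energy \<gamma> \<Omega> \<rho>\<^sub>0 u\<^sub>0)" using en E0 D0 by (simp add: ennreal_plus)
      then show ?thesis using True energy0_nonneg by (simp add: ennreal_le_iff)
    next
      case False
      then have b: "\<beta> > 0" using beta by simp
      have "trace_dissipation \<tau> \<le> trace_dissipation T" unfolding trace_dissipation_def by (rule nn_integral_mono) (use \<tau> in \<open>auto simp: indicator_def\<close>)
      then have "trace_dissipation \<tau> < \<infinity>" using trace_dissipation_finite[OF b] by (rule le_less_trans)
      then obtain y where y: "trace_dissipation \<tau> = ennreal y" "y \<ge> 0" by (cases "trace_dissipation \<tau>") auto
      have "ennreal (?E + \<epsilon> * ?D + \<beta> * y) \<le> ennreal (energy \<gamma> \<Omega> \<rho>\<^sub>0 u\<^sub>0)"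
        using en E0 D0 y b by (simp add: ennreal_plus ennreal_mult')
      then have 1: "?E + \<epsilon> * ?D + \<beta> * y \<le> energy \<gamma> \<Omega> \<rho>\<^sub>0 u\<^sub>0" using energy0_nonneg by (simp add: ennreal_le_iff)
      have bi: "set_integrable lborel {0<..<\<tau>} boundary_work"
      proof -
        have "set_integrable lborel {0<..<T} (\<lambda>t. (1 / \<beta>) * (\<beta> * boundary_work t))"
          by (rule set_integrable_mult_right) (rule boundary_term_integrable)
        then have "set_integrable lborel {0<..<T} boundary_work" using b by simp
        then show ?thesis by (rule set_integrable_subset) (use \<tau> in auto)
      qed
      have "ennreal (LINT t:{0<..<\<tau>}|lborel. \<bar>boundary_work t\<bar>) = (\<integral>\<^sup>+t. ennreal (indicat_real {0<..<\<tau>} t *\<^sub>R \<bar>boundary_work t\<bar>) \<partial>lborel)"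
        unfolding set_lebesgue_integral_def
        by (rule nn_integral_eq_integral[symmetric]) (use set_integrable_abs[OF bi] in \<open>auto simp: set_integrable_def\<close>)
      also have "\<dots> = (\<integral>\<^sup>+t\<in>{0<..<\<tau>}. ennreal \<bar>boundary_work t\<bar> \<partial>lborel)"
        by (rule nn_integral_cong) (auto simp: indicator_def)
      also have "\<dots> \<le> trace_dissipation \<tau> + ennreal (K\<^sup>2 * surface_area * \<tau>)" by (rule nn_integral_bd[OF K \<tau>])
      also have "\<dots> \<le> ennreal (y + K\<^sup>2 * surface_area * T)"
        unfolding y(1) using y(2) \<tau> T
        by (subst ennreal_plus[symmetric]) (auto simp: surface_area_def intro!: ennreal_leI mult_left_mono)
      finally have "ennreal (LINT t:{0<..<\<tau>}|lborel. \<bar>boundary_work t\<bar>) \<le> ennreal (y + K\<^sup>2 * surface_area * T)" .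
      moreover have "0 \<le> y + K\<^sup>2 * surface_area * T" using y T by (simp add: surface_area_def)
      ultimately have "(LINT t:{0<..<\<tau>}|lborel. \<bar>boundary_work t\<bar>) \<le> y + K\<^sup>2 * surface_area * T" by (simp add: ennreal_le_iff)
      moreover have "(LINT t:{0<..<\<tau>}|lborel. boundary_work t) \<le> (LINT t:{0<..<\<tau>}|lborel. \<bar>boundary_work t\<bar>)"
        by (rule set_integral_mono[OF bi set_integrable_abs[OF bi]]) simp
      ultimately have "(LINT t:{0<..<\<tau>}|lborel. boundary_work t) \<le> y + K\<^sup>2 * surface_area * T" by linarith
      then have "\<beta> * (LINT t:{0<..<\<tau>}|lborel. boundary_work t) \<le> \<beta> * (y + K\<^sup>2 * surface_area * T)" using b by (intro mult_left_mono) auto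
      then have "(LINT t:{0<..<\<tau>}|lborel. \<beta> * boundary_work t) \<le> \<beta> * y + \<beta> * (K\<^sup>2 * surface_area * T)" by (simp add: distrib_left)
      then show ?thesis using 1 by linarith
    qed
  qed
qed

end


section \<open>The relative energy\<close>

context euler
begin

text \<open>The power \<open>r s x powr \<gamma>\<close> equals \<open>r H'(r) - H(r)\<close>, the
  part of the relative potential that does not involve \<open>f\<close>. The factor
  \<open>a s x\<close> supplies the remaining coefficients of \<open>f\<close>, namely half the
  square of \<open>U\<close> and \<open>- H'(r)\<close>.\<close>

lemma relative_energy_pointwise:
  assumes "s \<in> {0..T}" "x \<in> closure \<Omega>"
  shows "1/2 * f * (norm w)\<^sup>2 + f powr \<gamma> / (\<gamma> - 1) - (f *\<^sub>R w) \<bullet> U s x + f * a s x + r s x powr \<gamma>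
    = 1/2 * f * (norm (w - U s x))\<^sup>2 + rel_potential \<gamma> f (r s x)"
proof -
  have q: "(norm (w - U s x))\<^sup>2 = (norm w)\<^sup>2 - 2 * (w \<bullet> U s x) + U s x \<bullet> U s x"
    by (simp add: power2_norm_eq_inner inner_diff inner_commute)
  define R where "R = r s x powr (\<gamma> - 1)"
  define P where "P = r s x powr \<gamma>"
  have P: "r s x * R = P" unfolding R_def P_def by (rule r_powr_arith(2)[OF assms])
  have g: "\<gamma> - 1 \<noteq> 0" using gamma by simp
  have "rel_potential \<gamma> f (r s x) = (f powr \<gamma> - P - \<gamma> * R * f + \<gamma> * (r s x * R)) / (\<gamma> - 1)"
    unfolding rel_potential_def R_def[symmetric] P_def[symmetric] by (simp add: algebra_simps)
  also have "f powr \<gamma> - P - \<gamma> * R * f + \<gamma> * (r s x * R) = f powr \<gamma> - \<gamma> * R * f + (\<gamma> - 1) * P"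
    unfolding P by (simp add: algebra_simps)
  also have "\<dots> / (\<gamma> - 1) = f powr \<gamma> / (\<gamma> - 1) - \<gamma> / (\<gamma> - 1) * R * f + P"
    using g by (simp add: add_divide_distrib diff_divide_distrib)
  finally have rp: "rel_potential \<gamma> f (r s x) = f powr \<gamma> / (\<gamma> - 1) - \<gamma> / (\<gamma> - 1) * R * f + P" .
  have a: "a s x = 1/2 * (U s x \<bullet> U s x) - \<gamma> / (\<gamma> - 1) * R" unfolding a_def R_def by simp
  have fa: "f * a s x = 1/2 * f * (U s x \<bullet> U s x) - \<gamma> / (\<gamma> - 1) * R * f" unfolding a by (simp add: algebra_simps)
  show ?thesis unfolding rp q fa P_def[symmetric] inner_scaleR_left by (simp add: algebra_simps)
qed

lemma weights_continuous:
  assumes "s \<in> {0..T}"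
  shows "continuous_on \<Omega> (U s)" "continuous_on \<Omega> (a s)" "continuous_on \<Omega> (\<lambda>x. r s x powr b)"
proof -
  have sub: "continuous_on \<Omega> (\<lambda>x. h (s, x))" if "continuous_on Qc h" for h :: "real \<times> (real^3) \<Rightarrow> 'c::topological_space"
    by (rule continuous_on_subset[OF continuous_space_slice[OF that assms] closure_subset])
  show "continuous_on \<Omega> (U s)" "continuous_on \<Omega> (a s)" "continuous_on \<Omega> (\<lambda>x. r s x powr b)"
    using sub[OF continuous_Qc(2)] sub[OF continuous_Qc(3)] sub[OF continuous_Qc(4)[of b]] by simp_all
qed

lemma weights_bounded:
  assumes "bounds K" "s \<in> {0..T}" "x \<in> \<Omega>"
  shows "norm (U s x) \<le> K" "\<bar>a s x\<bar> \<le> K" "\<bar>r s x powr \<gamma>\<bar> \<le> K" "\<bar>r s x powr (\<gamma> - 1)\<bar> \<le> K"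
  using assms in_Qc(2)[OF assms(3)] unfolding bounds_def by blast+

text \<open>The pair \<open>f\<close>, \<open>w\<close> is arbitrary so that both the solution at
  each time and the initial data are covered. The relative potential is integrable because all other
  terms of the pointwise identity are.\<close>

lemma relative_energy_split:
  fixes f :: "real^3 \<Rightarrow> real" and w :: "real^3 \<Rightarrow> real^3"
  assumes s: "s \<in> {0..T}"
    and f: "set_integrable lborel \<Omega> f" and kin: "set_integrable lborel \<Omega> (\<lambda>x. f x * (norm (w x))\<^sup>2)"
    and mom: "set_integrable lborel \<Omega> (\<lambda>x. f x *\<^sub>R w x)" and pw: "set_integrable lborel \<Omega> (\<lambda>x. f x powr \<gamma>)"
  shows "set_integrable lborel \<Omega> (\<lambda>x. 1/2 * f x * (norm (w x - U s x))\<^sup>2)" (is "?i1")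
    and "set_integrable lborel \<Omega> (\<lambda>x. rel_potential \<gamma> (f x) (r s x))" (is "?i2")
    and "energy \<gamma> \<Omega> f w - (LINT x:\<Omega>|lborel. (f x *\<^sub>R w x) \<bullet> U s x) + (LINT x:\<Omega>|lborel. f x * a s x) + (LINT x:\<Omega>|lborel. r s x powr \<gamma>)
      = (LINT x:\<Omega>|lborel. 1/2 * f x * (norm (w x - U s x))\<^sup>2) + (LINT x:\<Omega>|lborel. rel_potential \<gamma> (f x) (r s x))"
proof -
  obtain K where K: "bounds K" using bounds_exist ..
  have K0: "K \<ge> 0" using K by (simp add: bounds_def)
  note wc = weights_continuous[OF s] and wb = weights_bounded[OF K s]
  have mU: "set_integrable lborel \<Omega> (\<lambda>x. (f x *\<^sub>R w x) \<bullet> U s x)"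
    by (rule set_integrable_weight_space[OF mom wc(1), where B = K]) (use wb in auto)
  have fa: "set_integrable lborel \<Omega> (\<lambda>x. f x * a s x)"
    using set_integrable_weight_space[OF f wc(2), where B = K] wb by simp
  have fUU: "set_integrable lborel \<Omega> (\<lambda>x. f x * (U s x \<bullet> U s x))"
  proof -
    have "norm (U s x \<bullet> U s x) \<le> K * K" if "x \<in> \<Omega>" for x
    proof -
      have "\<bar>U s x \<bullet> U s x\<bar> \<le> norm (U s x) * norm (U s x)" by (rule Cauchy_Schwarz_ineq2)
      also have "\<dots> \<le> K * K" using wb(1)[OF that] K0 by (intro mult_mono) auto
      finally show ?thesis by simp
    qed
    then show ?thesis
      using set_integrable_weight_space[OF f continuous_on_inner[OF wc(1) wc(1)], where B = "K * K"] by simp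
  qed
  have rg: "set_integrable lborel \<Omega> (\<lambda>x. r s x powr \<gamma>)"
    by (rule set_integrable_continuous_bounded[OF borel_dom bounded_dom wc(3), where B = K]) (use wb in auto)
  have en: "set_integrable lborel \<Omega> (\<lambda>x. 1/2 * f x * (norm (w x))\<^sup>2 + f x powr \<gamma> / (\<gamma> - 1))"
    using kin pw by (intro set_integral_add(1) set_integrable_divide) (simp_all add: mult.assoc)
  have "set_integrable lborel \<Omega> (\<lambda>x. (1/2 * (f x * (norm (w x))\<^sup>2) - (f x *\<^sub>R w x) \<bullet> U s x) + 1/2 * (f x * (U s x \<bullet> U s x)))"
    using kin fUU by (intro set_integral_add(1) set_integral_diff(1) mU set_integrable_mult_right) auto
  moreover have "(1/2 * (f x * (norm (w x))\<^sup>2) - (f x *\<^sub>R w x) \<bullet> U s x) + 1/2 * (f x * (U s x \<bullet> U s x)) = 1/2 * f x * (norm (w x - U s x))\<^sup>2" for x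
    by (simp add: power2_norm_eq_inner inner_diff inner_commute algebra_simps)
  ultimately show i1: ?i1 by (simp only:)
  let ?T = "\<lambda>x. 1/2 * f x * (norm (w x))\<^sup>2 + f x powr \<gamma> / (\<gamma> - 1) - (f x *\<^sub>R w x) \<bullet> U s x + f x * a s x + r s x powr \<gamma>"
  have Ti: "set_integrable lborel \<Omega> ?T"
    by (intro set_integral_add(1) set_integral_diff(1) en mU fa rg)
  have pt: "?T x = 1/2 * f x * (norm (w x - U s x))\<^sup>2 + rel_potential \<gamma> (f x) (r s x)" if "x \<in> \<Omega>" for x
    using relative_energy_pointwise[OF s in_Qc(2)[OF that], of "f x" "w x"] .
  have "set_integrable lborel \<Omega> (\<lambda>x. ?T x - 1/2 * f x * (norm (w x - U s x))\<^sup>2)"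
    by (intro set_integral_diff(1) Ti i1)
  moreover have "indicat_real \<Omega> x *\<^sub>R (?T x - 1/2 * f x * (norm (w x - U s x))\<^sup>2) = indicat_real \<Omega> x *\<^sub>R rel_potential \<gamma> (f x) (r s x)" for x
    using pt[of x] by (cases "x \<in> \<Omega>") simp_all
  ultimately show i2: ?i2 unfolding set_integrable_def by (simp only:)
  have "energy \<gamma> \<Omega> f w - (LINT x:\<Omega>|lborel. (f x *\<^sub>R w x) \<bullet> U s x) + (LINT x:\<Omega>|lborel. f x * a s x) + (LINT x:\<Omega>|lborel. r s x powr \<gamma>)
      = (LINT x:\<Omega>|lborel. ?T x)"
    unfolding energy_def
    by (subst set_integral_add(2)[OF set_integral_add(1)[OF set_integral_diff(1)[OF en mU] fa] rg],
        subst set_integral_add(2)[OF set_integral_diff(1)[OF en mU] fa], subst set_integral_diff(2)[OF en mU]) (rule refl)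
  also have "\<dots> = (LINT x:\<Omega>|lborel. 1/2 * f x * (norm (w x - U s x))\<^sup>2 + rel_potential \<gamma> (f x) (r s x))"
    by (intro set_lebesgue_integral_cong) (use pt in auto)
  also have "\<dots> = (LINT x:\<Omega>|lborel. 1/2 * f x * (norm (w x - U s x))\<^sup>2) + (LINT x:\<Omega>|lborel. rel_potential \<gamma> (f x) (r s x))"
    by (rule set_integral_add(2)[OF i1 i2])
  finally show "energy \<gamma> \<Omega> f w - (LINT x:\<Omega>|lborel. (f x *\<^sub>R w x) \<bullet> U s x) + (LINT x:\<Omega>|lborel. f x * a s x) + (LINT x:\<Omega>|lborel. r s x powr \<gamma>)
      = (LINT x:\<Omega>|lborel. 1/2 * f x * (norm (w x - U s x))\<^sup>2) + (LINT x:\<Omega>|lborel. rel_potential \<gamma> (f x) (r s x))" .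
qed

lemma div_pU_integrable: "set_integrable lborel Q (\<lambda>(t, x). div_pU t x)"
proof -
  obtain K where K: "bounds K" using bounds_exist ..
  have K0: "K \<ge> 0" using K by (simp add: bounds_def)
  show ?thesis
  proof (rule set_integrable_Q_continuous)
    have "continuous_on Q (\<lambda>p. r (fst p) (snd p) powr \<gamma> * trace (J (fst p) (snd p))
      + \<gamma> * r (fst p) (snd p) powr (\<gamma> - 1) * (gr (fst p) (snd p) \<bullet> U (fst p) (snd p)))"
      unfolding trace_def sum_3
      using continuous_Q(4)[of \<gamma>] continuous_Q(4)[of "\<gamma> - 1"] continuous_derivs(2,4) continuous_Q(2)
      unfolding case_prod_beta'
      by (intro continuous_on_add continuous_on_mult continuous_on_const continuous_on_inner continuous_on_component) 
    then show "continuous_on Q (\<lambda>(t, x). div_pU t x)" by (simp add: div_pU_def case_prod_beta')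
    fix t x assume tx: "t \<in> {0<..<T}" "x \<in> \<Omega>"
    have t: "t \<in> {0..T}" using tx by simp
    note wb = weights_bounded[OF K t tx(2)]
    have "\<bar>J t x $ i $ i\<bar> \<le> K" for i using K tx by (auto simp: bounds_def)
    from this[of 1] this[of 2] this[of 3] have tr: "\<bar>trace (J t x)\<bar> \<le> 3 * K" unfolding trace_def sum_3 by simp
    have gr: "norm (gr t x) \<le> K" using K tx by (auto simp: bounds_def)
    have gU: "\<bar>gr t x \<bullet> U t x\<bar> \<le> K * K"
      using Cauchy_Schwarz_ineq2[of "gr t x" "U t x"] mult_mono[OF gr wb(1)] K0 by force
    have "\<bar>r t x powr \<gamma> * trace (J t x)\<bar> \<le> K * (3 * K)" unfolding abs_mult using wb tr K0 by (intro mult_mono) auto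
    moreover have "\<bar>\<gamma> * r t x powr (\<gamma> - 1) * (gr t x \<bullet> U t x)\<bar> \<le> \<gamma> * K * (K * K)"
      unfolding abs_mult using wb gU K0 gamma by (intro mult_mono) auto
    ultimately show "norm (case (t, x) of (t, x) \<Rightarrow> div_pU t x) \<le> K * (3 * K) + \<gamma> * K * (K * K)"
      unfolding div_pU_def using abs_triangle_ineq[of "r t x powr \<gamma> * trace (J t x)" "\<gamma> * r t x powr (\<gamma> - 1) * (gr t x \<bullet> U t x)"] by simp
  qed
qed

end

section \<open>The relative energy of the weak solution\<close>

context navier_stokes
begin

definition rel_density :: "real \<times> (real^3) \<Rightarrow> real" where
  "rel_density = (\<lambda>(t, x). 1/2 * \<rho> t x * (norm (u t x - U t x))\<^sup>2 + rel_potential \<gamma> (\<rho> t x) (r t x))"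

definition Erel :: "real \<Rightarrow> real" where
  "Erel t = (LINT x:\<Omega>|lborel. 1/2 * \<rho> t x * (norm (u t x - U t x))\<^sup>2) + (LINT x:\<Omega>|lborel. rel_potential \<gamma> (\<rho> t x) (r t x))"

definition Erel0 :: real where
  "Erel0 = (LINT x:\<Omega>|lborel. 1/2 * \<rho>\<^sub>0 x * (norm (u\<^sub>0 x - U 0 x))\<^sup>2) + (LINT x:\<Omega>|lborel. rel_potential \<gamma> (\<rho>\<^sub>0 x) (r 0 x))"

definition Fp :: "real \<Rightarrow> real" where "Fp t = (LINT x:\<Omega>|lborel. r t x powr \<gamma>)"

lemmas split_at = relative_energy_split[OF _ rho_integrable kin_integrable mom_integrable rho_powr_integrable]

lemma Erel_eq: "t \<in> {0..T} \<Longrightarrow> Erel t = energy \<gamma> \<Omega> (\<rho> t) (u t) - Fm t + Fc t + Fp t"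
  unfolding Erel_def Fm_def Fc_def Fp_def using split_at(3) by simp

lemma data_integrable:
  "set_integrable lborel \<Omega> \<rho>\<^sub>0" "set_integrable lborel \<Omega> (\<lambda>x. \<rho>\<^sub>0 x * (norm (u\<^sub>0 x))\<^sup>2)"
  "set_integrable lborel \<Omega> (\<lambda>x. \<rho>\<^sub>0 x *\<^sub>R u\<^sub>0 x)" "set_integrable lborel \<Omega> (\<lambda>x. \<rho>\<^sub>0 x powr \<gamma>)"
proof -
  have d: "AE x in lborel. x \<in> \<Omega> \<longrightarrow> 0 \<le> \<rho>\<^sub>0 x" "in_Lp \<gamma> \<Omega> \<rho>\<^sub>0" "set_borel_measurable lborel \<Omega> u\<^sub>0"
    "in_Lp 1 \<Omega> (\<lambda>x. \<rho>\<^sub>0 x * (norm (u\<^sub>0 x))\<^sup>2)"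
    using data by (auto simp: admissible_data_def)
  show 1: "set_integrable lborel \<Omega> \<rho>\<^sub>0"
    by (rule in_Lp_set_integrable[OF d(2) _ borel_dom finite_measure_dom]) (use gamma in auto)
  show 2: "set_integrable lborel \<Omega> (\<lambda>x. \<rho>\<^sub>0 x * (norm (u\<^sub>0 x))\<^sup>2)"
    by (rule in_Lp_set_integrable[OF d(4) _ borel_dom finite_measure_dom]) auto
  show "set_integrable lborel \<Omega> (\<lambda>x. \<rho>\<^sub>0 x powr \<gamma>)" by (rule in_Lp_powr_integrable[OF d(2,1)])
  show "set_integrable lborel \<Omega> (\<lambda>x. \<rho>\<^sub>0 x *\<^sub>R u\<^sub>0 x)"
  proof (rule set_integrable_bound)
    show "set_integrable lborel \<Omega> (\<lambda>x. \<bar>\<rho>\<^sub>0 x\<bar> + \<bar>\<rho>\<^sub>0 x * (norm (u\<^sub>0 x))\<^sup>2\<bar>)"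
      by (intro set_integral_add(1) set_integrable_abs 1 2)
    have [measurable]: "\<rho>\<^sub>0 \<in> borel_measurable (restrict_space borel \<Omega>)" "u\<^sub>0 \<in> borel_measurable (restrict_space borel \<Omega>)"
      using d(2,3) unfolding in_Lp_def set_borel_measurable_lborel set_measurable_iff_restrict[OF borel_dom] by auto
    show "set_borel_measurable lborel \<Omega> (\<lambda>x. \<rho>\<^sub>0 x *\<^sub>R u\<^sub>0 x)"
      unfolding set_borel_measurable_lborel set_measurable_iff_restrict[OF borel_dom] by measurable
    have "norm (s *\<^sub>R v) \<le> \<bar>s\<bar> + \<bar>s * (norm v)\<^sup>2\<bar>" for s and v :: "real^3"
      using norm_mom_le[of "\<bar>s\<bar>" v] by (simp add: abs_mult)
    then show "AE x in lborel. x \<in> \<Omega> \<longrightarrow> norm (\<rho>\<^sub>0 x *\<^sub>R u\<^sub>0 x) \<le> norm (\<bar>\<rho>\<^sub>0 x\<bar> + \<bar>\<rho>\<^sub>0 x * (norm (u\<^sub>0 x))\<^sup>2\<bar>)" by simp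
  qed
qed

lemma zero_in: "0 \<in> {0..T}" using T by simp

lemmas split_0 = relative_energy_split[OF zero_in data_integrable(1,2,3,4)]

lemma Erel0_eq: "Erel0 = energy \<gamma> \<Omega> \<rho>\<^sub>0 u\<^sub>0 - Fm0 + Fc0 + Fp 0"
  unfolding Erel0_def Fm0_def Fc0_def Fp_def using split_0(3) by simp

lemma rel_density_Q_integrable: "set_integrable lborel Q rel_density"
proof -
  obtain K where K: "bounds K" using bounds_exist ..
  let ?T = "\<lambda>p. 1/2 * (\<rho> (fst p) (snd p) * (norm (u (fst p) (snd p)))\<^sup>2) + \<rho> (fst p) (snd p) powr \<gamma> / (\<gamma> - 1)
    - (\<rho> (fst p) (snd p) *\<^sub>R u (fst p) (snd p)) \<bullet> U (fst p) (snd p) + \<rho> (fst p) (snd p) * a (fst p) (snd p) + r (fst p) (snd p) powr \<gamma>"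
  have b: "norm (U t x) \<le> K" "\<bar>a t x\<bar> \<le> K" "\<bar>r t x powr \<gamma>\<bar> \<le> K" if "t \<in> {0<..<T}" "x \<in> \<Omega>" for t x
    using weights_bounded[OF K in_Qc(1)[OF that(1)] that(2)] by auto
  have 1: "set_integrable lborel Q (\<lambda>p. (\<rho> (fst p) (snd p) *\<^sub>R u (fst p) (snd p)) \<bullet> U (fst p) (snd p))"
    by (rule set_integrable_weight_Q[OF mom_Q_integrable, where B = K])
       (use continuous_Q(2) b in \<open>auto simp: case_prod_beta'\<close>)
  have "set_integrable lborel Q (\<lambda>p. \<rho> (fst p) (snd p) \<bullet> a (fst p) (snd p))"
    by (rule set_integrable_weight_Q[OF rho_Q_integrable, where B = K])
       (use continuous_Q(3) b in \<open>auto simp: case_prod_beta'\<close>)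
  then have 2: "set_integrable lborel Q (\<lambda>p. \<rho> (fst p) (snd p) * a (fst p) (snd p))" by simp
  have 3: "set_integrable lborel Q (\<lambda>p. r (fst p) (snd p) powr \<gamma>)"
    by (rule set_integrable_Q_continuous[where B = K]) (use continuous_Q(4)[of \<gamma>] b in \<open>auto simp: case_prod_beta'\<close>)
  have "set_integrable lborel Q ?T"
    by (intro set_integral_add(1) set_integral_diff(1) 1 2 3 set_integrable_mult_right set_integrable_divide kin_Q_integrable pressure_Q_integrable)
  moreover have "indicat_real Q p *\<^sub>R ?T p = indicat_real Q p *\<^sub>R rel_density p" for p
  proof (cases "p \<in> Q")
    case True
    then show ?thesis
      using relative_energy_pointwise[of "fst p" "snd p" "\<rho> (fst p) (snd p)" "u (fst p) (snd p)"] in_Qc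
      by (auto simp: rel_density_def case_prod_beta' mult.assoc)
  qed simp
  ultimately show ?thesis unfolding set_integrable_def by (simp only:)
qed

lemma integral_rel_density: "t \<in> {0<..<T} \<Longrightarrow> (LINT x:\<Omega>|lborel. rel_density (t, x)) = Erel t"
  unfolding rel_density_def Erel_def using split_at(1,2)[of t] by (simp add: set_integral_add(2))

text \<open>The exceptional null set of positions depends on the time; joint measurability of
  \<open>\<rho>\<close> makes these sets together a null set of the cylinder.\<close>

lemma rho_nonneg_Q: "AE p in lborel. p \<in> Q \<longrightarrow> 0 \<le> \<rho> (fst p) (snd p)"
proof -
  let ?f = "\<lambda>p. indicat_real Q p *\<^sub>R \<rho> (fst p) (snd p)"
  have f[measurable]: "?f \<in> borel_measurable (lborel \<Otimes>\<^sub>M lborel)"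
    using rho_meas unfolding set_borel_measurable_def lborel_prod by (simp add: case_prod_beta')
  have "AE p in lborel \<Otimes>\<^sub>M lborel. 0 \<le> ?f p"
  proof (rule lborel_pair.AE_pair_measure)
    show "{p \<in> space (lborel \<Otimes>\<^sub>M lborel). 0 \<le> ?f p} \<in> sets (lborel \<Otimes>\<^sub>M lborel)" by measurable
    show "AE t in lborel. AE x in lborel. 0 \<le> ?f (t, x)"
    proof (rule AE_I2)
      fix t
      show "AE x in lborel. 0 \<le> ?f (t, x)"
      proof (cases "t \<in> {0<..<T}")
        case True
        then have "t \<in> {0..T}" by simp
        from rho_nonneg[OF this] show ?thesis by eventually_elim (auto simp: indicator_def)
      qed (auto simp: indicator_def)
    qed
  qed
  then have "AE p in lborel. 0 \<le> ?f p" by (simp only: lborel_prod)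
  then show ?thesis by eventually_elim (auto simp: indicator_def)
qed

definition h_press :: "real \<times> (real^3) \<Rightarrow> real" where "h_press = (\<lambda>(t, x). \<gamma> * r t x powr (\<gamma> - 1) * rt t x)"

text \<open>The signs follow \<open>Erel_eq\<close>: the momentum integrand is subtracted, the
  continuity and pressure integrands are added, and the dissipation comes from the energy
  inequality.\<close>

definition balance :: "real \<times> (real^3) \<Rightarrow> real" where
  "balance p = h_cont p - (h_mom p - \<epsilon> * (S (G (fst p) (snd p)) \<bullet> J (fst p) (snd p))) + h_press p - \<epsilon> * (S (G (fst p) (snd p)) \<bullet> G (fst p) (snd p))"

text \<open>In the factor of \<open>rel_density\<close>, \<open>2 * K\<close> accounts for the 1/2
  in the kinetic density, and \<open>3 * (\<gamma> - 1) * K\<close> for the three diagonal entries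
  in the trace of the Jacobian. The norm of the Jacobian is at most \<open>9 * K\<close>, its nine
  entries being bounded by \<open>K\<close>. The divergence is kept because it vanishes only after
  integration.\<close>

lemma balance_bound:
  assumes K: "bounds K" and c: "\<And>A. norm (S A) \<le> c * norm A" "c \<ge> 0"
  shows "AE p in lborel. p \<in> Q \<longrightarrow> balance p \<le> (2 * K + 3 * (\<gamma> - 1) * K) * rel_density p + \<epsilon> * (c * (9 * K)\<^sup>2) - (\<lambda>(t, x). div_pU t x) p"
  using rho_nonneg_Q
proof (eventually_elim, intro impI)
  fix p assume nn: "p \<in> Q \<longrightarrow> 0 \<le> \<rho> (fst p) (snd p)" and "p \<in> Q"
  then obtain t x where p: "p = (t, x)" and tx: "t \<in> {0<..<T}" "x \<in> \<Omega>" by (cases p) auto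
  have K0: "K \<ge> 0" using K by (simp add: bounds_def)
  have rho: "\<rho> t x \<ge> 0" using nn \<open>p \<in> Q\<close> p by simp
  have tx': "t \<in> {0..T}" "x \<in> closure \<Omega>" using tx in_Qc by auto
  define w where "w = u t x - U t x"
  define H where "H = rel_potential \<gamma> (\<rho> t x) (r t x)"
  have H0: "H \<ge> 0" unfolding H_def by (rule rel_potential_nonneg[OF gamma rho]) (use r_pos[OF tx'] in simp)
  have id: "h_cont p - h_mom p + h_press p = - \<rho> t x * (w \<bullet> (J t x *v w)) - (\<gamma> - 1) * trace (J t x) * H - div_pU t x"
    using bulk_identity[OF tx, of "\<rho> t x" "u t x"] by (simp add: h_cont_def h_mom_def h_press_def p w_def H_def)
  have Jw: "norm (J t x *v w) \<le> K * norm w" and Jb: "\<And>i j. \<bar>J t x $ i $ j\<bar> \<le> K" using K tx by (auto simp: bounds_def)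
  have "\<bar>w \<bullet> (J t x *v w)\<bar> \<le> norm w * (K * norm w)"
    using Cauchy_Schwarz_ineq2[of w "J t x *v w"] mult_left_mono[OF Jw norm_ge_zero[of w]] by linarith
  then have "- (w \<bullet> (J t x *v w)) \<le> K * (norm w)\<^sup>2" by (simp add: power2_eq_square mult_ac abs_le_iff)
  then have 1: "- \<rho> t x * (w \<bullet> (J t x *v w)) \<le> 2 * K * (1/2 * \<rho> t x * (norm w)\<^sup>2)"
    using mult_left_mono[OF _ rho, of "- (w \<bullet> (J t x *v w))" "K * (norm w)\<^sup>2"] by (simp add: mult_ac)
  have tr: "- trace (J t x) \<le> 3 * K" using Jb[of 1 1] Jb[of 2 2] Jb[of 3 3] unfolding trace_def sum_3 by linarith
  have 2: "- ((\<gamma> - 1) * trace (J t x) * H) \<le> 3 * (\<gamma> - 1) * K * H"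
    using mult_right_mono[OF mult_left_mono[OF tr, of "\<gamma> - 1"] H0] gamma by (simp add: mult_ac)
  have e0: "0 \<le> 1/2 * \<rho> t x * (norm w)\<^sup>2" using rho by simp
  have 3: "h_cont p - h_mom p + h_press p \<le> (2 * K + 3 * (\<gamma> - 1) * K) * rel_density p - div_pU t x"
  proof -
    have "0 \<le> 3 * (\<gamma> - 1) * K * (1/2 * \<rho> t x * (norm w)\<^sup>2)" "0 \<le> 2 * K * H"
      using e0 H0 K0 gamma by simp_all
    moreover have "rel_density p = 1/2 * \<rho> t x * (norm w)\<^sup>2 + H" by (simp add: rel_density_def p w_def H_def)
    ultimately show ?thesis unfolding id using 1 2 by (simp only: distrib_left distrib_right)
  qed
  have young: "S (G t x) \<bullet> J t x \<le> S (G t x) \<bullet> G t x + S (J t x) \<bullet> J t x"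
    using viscous_stress_young[of \<mu> \<eta>] mu eta by simp
  have nJ: "norm (J t x) \<le> 9 * K" by (rule norm_matrix_le[OF Jb])
  have "S (J t x) \<bullet> J t x \<le> norm (S (J t x)) * norm (J t x)" by (rule norm_cauchy_schwarz)
  also have "\<dots> \<le> (c * (9 * K)) * (9 * K)"
    using c(1)[of "J t x"] nJ mult_left_mono[OF nJ c(2)] K0 c(2) by (intro mult_mono) auto
  finally have "S (G t x) \<bullet> J t x - S (G t x) \<bullet> G t x \<le> c * (9 * K)\<^sup>2"
    using young by (simp add: power2_eq_square mult.assoc)
  from mult_left_mono[OF this less_imp_le[OF eps]]
  have "\<epsilon> * (S (G t x) \<bullet> J t x) - \<epsilon> * (S (G t x) \<bullet> G t x) \<le> \<epsilon> * (c * (9 * K)\<^sup>2)" by (simp add: right_diff_distrib)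
  then show "balance p \<le> (2 * K + 3 * (\<gamma> - 1) * K) * rel_density p + \<epsilon> * (c * (9 * K)\<^sup>2) - (\<lambda>(t, x). div_pU t x) p"
    using 3 by (simp add: balance_def p)
qed

end

section \<open>Gronwall's estimate and its validity at every time\<close>

context navier_stokes
begin

lemma balance_terms_integrable:
  "set_integrable lborel Q (\<lambda>p. h_mom p - \<epsilon> * (S (G (fst p) (snd p)) \<bullet> J (fst p) (snd p)))"
  "set_integrable lborel Q (\<lambda>p. \<epsilon> * (S (G (fst p) (snd p)) \<bullet> G (fst p) (snd p)))"
  "set_integrable lborel Q h_press"
  by (intro set_integral_diff(1) set_integrable_mult_right h_mom_integrable SGJ_Q_integrable)
     (intro set_integrable_mult_right SGG_Q_integrable, simp add: h_press_def pressure_time_integrable)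

lemma balance_integrable: "set_integrable lborel Q balance"
  unfolding balance_def[abs_def]
  by (intro set_integral_diff(1) set_integral_add(1) h_cont_integrable balance_terms_integrable)

lemma Q_restrict: "\<tau> \<in> {0..T} \<Longrightarrow> set_integrable lborel Q h \<Longrightarrow> set_integrable lborel ({0<..<\<tau>} \<times> \<Omega>) h"
  for h :: "real \<times> (real^3) \<Rightarrow> 'b::{banach, second_countable_topology}"
  by (erule set_integrable_subset) (use sub_Q sub_Q_sets in auto)

text \<open>The identities for \<open>Fm\<close>, \<open>Fc\<close> and \<open>Fp\<close> hold at
  every time; the energy inequality alone restricts the estimate to almost every time.\<close>

lemma relative_energy_AE:
  assumes K: "bounds K"
  shows "AE \<tau> in lborel. \<tau> \<in> {0<..<T} \<longrightarrow>
    Erel \<tau> \<le> Erel0 + \<beta> * (K\<^sup>2 * surface_area * T) + (LINT p:{0<..<\<tau>} \<times> \<Omega>|lborel. balance p)"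
  using energy_with_boundary[OF K]
proof (eventually_elim, intro impI)
  fix \<tau> assume *: "\<tau> \<in> {0..T} \<longrightarrow>
    energy \<gamma> \<Omega> (\<rho> \<tau>) (u \<tau>) + \<epsilon> * (LINT t:{0<..<\<tau>}|lborel. LINT x:\<Omega>|lborel. S (G t x) \<bullet> G t x)
      + (LINT t:{0<..<\<tau>}|lborel. \<beta> * boundary_work t)
    \<le> energy \<gamma> \<Omega> \<rho>\<^sub>0 u\<^sub>0 + \<beta> * (K\<^sup>2 * surface_area * T)" and "\<tau> \<in> {0<..<T}"
  then have \<tau>: "\<tau> \<in> {0..T}" by simp
  let ?A = "{0<..<\<tau>}"
  note i = balance_terms_integrable h_cont_integrable
  note iA = Q_restrict[OF \<tau> i(1)] Q_restrict[OF \<tau> i(2)] Q_restrict[OF \<tau> i(3)] Q_restrict[OF \<tau> i(4)]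
  have fub: "(LINT t:?A|lborel. LINT x:\<Omega>|lborel. h (t, x)) = (LINT p:?A \<times> \<Omega>|lborel. h p)"
    if "set_integrable lborel (?A \<times> \<Omega>) h" for h :: "real \<times> (real^3) \<Rightarrow> real"
    by (rule set_fubini(3)[OF that])
  have bi: "set_integrable lborel ?A (\<lambda>t. \<beta> * boundary_work t)"
    by (rule set_integrable_subset[OF boundary_term_integrable]) (use \<tau> in auto)
  have mi: "set_integrable lborel ?A (\<lambda>t. LINT x:\<Omega>|lborel. h_mom (t, x) - \<epsilon> * (S (G t x) \<bullet> J t x))"
    using set_fubini(2)[OF iA(1)] by simp
  have m: "Fm \<tau> = Fm0 + (LINT p:?A \<times> \<Omega>|lborel. h_mom p - \<epsilon> * (S (G (fst p) (snd p)) \<bullet> J (fst p) (snd p))) - (LINT t:?A|lborel. \<beta> * boundary_work t)"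
  proof -
    have "Fm \<tau> = Fm0 + ((LINT t:?A|lborel. LINT x:\<Omega>|lborel. h_mom (t, x) - \<epsilon> * (S (G t x) \<bullet> J t x)) - (LINT t:?A|lborel. \<beta> * boundary_work t))"
      unfolding momentum_localized[OF \<tau> boundary_term_integrable] set_integral_diff(2)[OF mi bi] ..
    then show ?thesis using fub[OF iA(1)] by simp
  qed
  have c: "Fc \<tau> = Fc0 + (LINT p:?A \<times> \<Omega>|lborel. h_cont p)"
    unfolding continuity_localized[OF \<tau>] fub[OF iA(4)] ..
  have p: "Fp \<tau> = Fp 0 + (LINT p:?A \<times> \<Omega>|lborel. h_press p)"
    using pressure_evolution[OF \<tau>] fub[OF iA(3)] by (simp add: Fp_def h_press_def)
  have d: "\<epsilon> * (LINT t:?A|lborel. LINT x:\<Omega>|lborel. S (G t x) \<bullet> G t x) = (LINT p:?A \<times> \<Omega>|lborel. \<epsilon> * (S (G (fst p) (snd p)) \<bullet> G (fst p) (snd p)))"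
    using fub[OF iA(2)] by simp
  have "(LINT p:?A \<times> \<Omega>|lborel. balance p) = (LINT p:?A \<times> \<Omega>|lborel. h_cont p)
      - (LINT p:?A \<times> \<Omega>|lborel. h_mom p - \<epsilon> * (S (G (fst p) (snd p)) \<bullet> J (fst p) (snd p)))
      + (LINT p:?A \<times> \<Omega>|lborel. h_press p)
      - (LINT p:?A \<times> \<Omega>|lborel. \<epsilon> * (S (G (fst p) (snd p)) \<bullet> G (fst p) (snd p)))"
    unfolding balance_def
    by (subst set_integral_diff(2)[OF set_integral_add(1)[OF set_integral_diff(1)[OF iA(4,1)] iA(3)] iA(2)],
        subst set_integral_add(2)[OF set_integral_diff(1)[OF iA(4,1)] iA(3)],
        subst set_integral_diff(2)[OF iA(4,1)]) (rule refl)
  then show "Erel \<tau> \<le> Erel0 + \<beta> * (K\<^sup>2 * surface_area * T) + (LINT p:?A \<times> \<Omega>|lborel. balance p)"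
    unfolding Erel_eq[OF \<tau>] Erel0_eq using * \<tau> m c p d by linarith
qed

lemma Erel_nonneg: "t \<in> {0..T} \<Longrightarrow> Erel t \<ge> 0"
  unfolding Erel_def set_lebesgue_integral_def
proof (intro add_nonneg_nonneg integral_nonneg_AE)
  assume t: "t \<in> {0..T}"
  show "AE x in lborel. 0 \<le> indicat_real \<Omega> x *\<^sub>R (1/2 * \<rho> t x * (norm (u t x - U t x))\<^sup>2)"
    using rho_nonneg[OF t] by eventually_elim (auto simp: indicator_def)
  show "AE x in lborel. 0 \<le> indicat_real \<Omega> x *\<^sub>R rel_potential \<gamma> (\<rho> t x) (r t x)"
    using rho_nonneg[OF t]
  proof eventually_elim
    case (elim x)
    show ?case
    proof (cases "x \<in> \<Omega>")
      case True
      then have "r t x > 0" using r_pos[OF t] in_Qc by blast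
      then show ?thesis using elim True by (simp add: rel_potential_nonneg gamma)
    qed simp
  qed
qed

definition vol :: real where "vol = measure lborel \<Omega>"

lemma relative_energy_gronwall_AE:
  assumes K: "bounds K" and c: "\<And>A. norm (S A) \<le> c * norm A" "c \<ge> 0"
  shows "AE \<tau> in lborel. \<tau> \<in> {0<..<T} \<longrightarrow>
    Erel \<tau> \<le> (Erel0 + \<beta> * (K\<^sup>2 * surface_area * T) + \<epsilon> * (c * (9 * K)\<^sup>2 * vol * T)) * exp ((2 * K + 3 * (\<gamma> - 1) * K) * \<tau>)"
proof (rule gronwall_AE)
  have K0: "K \<ge> 0" using K by (simp add: bounds_def)
  let ?C = "2 * K + 3 * (\<gamma> - 1) * K" and ?s = "\<epsilon> * (c * (9 * K)\<^sup>2)"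
  show "0 \<le> ?C" using K0 gamma by simp
  have ei: "set_integrable lborel {0<..<T} (\<lambda>t. LINT x:\<Omega>|lborel. rel_density (t, x))" by (rule set_fubini(2)[OF rel_density_Q_integrable])
  have cong: "indicat_real {0<..<T} t *\<^sub>R (LINT x:\<Omega>|lborel. rel_density (t, x)) = indicat_real {0<..<T} t *\<^sub>R Erel t" for t
    by (cases "t \<in> {0<..<T}") (simp_all add: integral_rel_density)
  show "set_integrable lborel {0<..<T} Erel" using ei unfolding set_integrable_def cong .
  show "AE \<tau> in lborel. \<tau> \<in> {0<..<T} \<longrightarrow>
    Erel \<tau> \<le> Erel0 + \<beta> * (K\<^sup>2 * surface_area * T) + \<epsilon> * (c * (9 * K)\<^sup>2 * vol * T) + ?C * (LINT s:{0<..<\<tau>}|lborel. Erel s)"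
    using relative_energy_AE[OF K]
  proof (eventually_elim, intro impI)
    fix \<tau> assume *: "\<tau> \<in> {0<..<T} \<longrightarrow> Erel \<tau> \<le> Erel0 + \<beta> * (K\<^sup>2 * surface_area * T) + (LINT p:{0<..<\<tau>} \<times> \<Omega>|lborel. balance p)"
      and \<tau>': "\<tau> \<in> {0<..<T}"
    then have \<tau>: "\<tau> \<in> {0..T}" by simp
    let ?A = "{0<..<\<tau>}"
    have eA: "set_integrable lborel (?A \<times> \<Omega>) rel_density" by (rule Q_restrict[OF \<tau> rel_density_Q_integrable])
    have dA: "set_integrable lborel (?A \<times> \<Omega>) (\<lambda>(t, x). div_pU t x)" by (rule Q_restrict[OF \<tau> div_pU_integrable])
    have mA: "emeasure lborel (?A \<times> \<Omega>) = ennreal (\<tau> * vol)"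
    proof -
      have "emeasure (lborel \<Otimes>\<^sub>M lborel) (?A \<times> \<Omega>) = emeasure lborel ?A * emeasure lborel \<Omega>"
        by (rule lborel.emeasure_pair_measure_Times) auto
      also have "emeasure lborel \<Omega> = ennreal vol"
        unfolding vol_def using finite_measure_dom by (simp add: emeasure_eq_ennreal_measure less_top)
      finally show ?thesis unfolding lborel_prod using \<tau> by (simp add: vol_def ennreal_mult)
    qed
    have cA: "set_integrable lborel (?A \<times> \<Omega>) (\<lambda>p. ?s)" "(LINT p:?A \<times> \<Omega>|lborel. ?s) = ?s * (\<tau> * vol)"
      using mA sub_Q_sets \<tau> by (simp_all add: set_integrable_def set_lebesgue_integral_def measure_def vol_def)
    have "(LINT p:?A \<times> \<Omega>|lborel. balance p) \<le> (LINT p:?A \<times> \<Omega>|lborel. ?C * rel_density p + ?s - (\<lambda>(t, x). div_pU t x) p)"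
    proof (rule set_integral_mono_AE[OF Q_restrict[OF \<tau> balance_integrable]])
      show "set_integrable lborel (?A \<times> \<Omega>) (\<lambda>p. ?C * rel_density p + ?s - (\<lambda>(t, x). div_pU t x) p)"
        by (intro set_integral_diff(1) set_integral_add(1) set_integrable_mult_right eA cA(1) dA)
      show "AE p\<in>?A \<times> \<Omega> in lborel. balance p \<le> ?C * rel_density p + ?s - (\<lambda>(t, x). div_pU t x) p"
        using balance_bound[OF K c] sub_Q[OF \<tau>] by (auto elim!: eventually_mono)
    qed
    also have "\<dots> = ?C * (LINT p:?A \<times> \<Omega>|lborel. rel_density p) + ?s * (\<tau> * vol) - (LINT p:?A \<times> \<Omega>|lborel. (\<lambda>(t, x). div_pU t x) p)"
      by (subst set_integral_diff(2)[OF set_integral_add(1)[OF set_integrable_mult_right[OF eA] cA(1)] dA],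
          subst set_integral_add(2)[OF set_integrable_mult_right[OF eA] cA(1)], subst cA(2)) simp
    also have "(LINT p:?A \<times> \<Omega>|lborel. rel_density p) = (LINT s:?A|lborel. Erel s)"
    proof -
      have "(LINT p:?A \<times> \<Omega>|lborel. rel_density p) = (LINT t:?A|lborel. LINT x:\<Omega>|lborel. rel_density (t, x))" by (rule set_fubini(3)[OF eA, symmetric])
      also have "\<dots> = (LINT s:?A|lborel. Erel s)"
        by (intro set_lebesgue_integral_cong) (use \<tau> integral_rel_density in auto)
      finally show ?thesis .
    qed
    also have "(LINT p:?A \<times> \<Omega>|lborel. (\<lambda>(t, x). div_pU t x) p) = 0"
    proof -
      have "(LINT p:?A \<times> \<Omega>|lborel. (\<lambda>(t, x). div_pU t x) p) = (LINT t:?A|lborel. LINT x:\<Omega>|lborel. div_pU t x)"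
        using set_fubini(3)[OF dA] by simp
      also have "\<dots> = (LINT t:?A|lborel. 0)"
        by (intro set_lebesgue_integral_cong) (use \<tau> integral_div_pU in auto)
      finally show ?thesis by simp
    qed
    finally have "(LINT p:?A \<times> \<Omega>|lborel. balance p) \<le> ?C * (LINT s:?A|lborel. Erel s) + ?s * (\<tau> * vol)" by simp
    \<comment> \<open>The time factor is enlarged to \<open>T\<close> because
      \<open>gronwall_AE\<close> has a constant inhomogeneity.\<close>
    moreover have "?s * (\<tau> * vol) \<le> ?s * (T * vol)"
      using \<tau> c(2) eps by (intro mult_left_mono mult_right_mono) (auto simp: vol_def)
    moreover have "?s * (T * vol) = \<epsilon> * (c * (9 * K)\<^sup>2 * vol * T)" by simp
    ultimately show "Erel \<tau> \<le> Erel0 + \<beta> * (K\<^sup>2 * surface_area * T) + \<epsilon> * (c * (9 * K)\<^sup>2 * vol * T) + ?C * (LINT s:?A|lborel. Erel s)"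
      using * \<tau>' by linarith
  qed
qed

lemma Fp_continuous: "continuous_on {0..T} Fp"
proof -
  have "set_integrable lborel {0<..<T} (\<lambda>t. LINT x:\<Omega>|lborel. \<gamma> * r t x powr (\<gamma> - 1) * rt t x)"
    using set_fubini(2)[OF pressure_time_integrable] by simp
  from continuous_on_primitive[OF this]
  have "continuous_on {0..T} (\<lambda>\<tau>. Fp 0 + (LINT t:{0<..<\<tau>}|lborel. LINT x:\<Omega>|lborel. \<gamma> * r t x powr (\<gamma> - 1) * rt t x))"
    by (intro continuous_intros)
  then show ?thesis
  proof (rule continuous_on_eq)
    fix \<tau> assume "\<tau> \<in> {0..T}"
    from pressure_evolution[OF this, symmetric]
    show "Fp 0 + (LINT t:{0<..<\<tau>}|lborel. LINT x:\<Omega>|lborel. \<gamma> * r t x powr (\<gamma> - 1) * rt t x) = Fp \<tau>"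
      unfolding Fp_def .
  qed
qed

text \<open>The energy is weakly lower semicontinuous in time: its kinetic part is continuous and the internal
  part dominates its tangent at \<open>\<rho> \<tau>\<close>, an admissible test function.\<close>

lemma energy_tangent:
  assumes \<tau>: "\<tau> \<in> {0..T}"
  obtains L where "continuous_on {0..T} L" "L \<tau> = energy \<gamma> \<Omega> (\<rho> \<tau>) (u \<tau>)"
    "\<And>s. s \<in> {0..T} \<Longrightarrow> L s \<le> energy \<gamma> \<Omega> (\<rho> s) (u s)"
proof -
  \<comment> \<open>\<open>\<psi>\<close> is \<open>H'\<close> at the density
    \<open>\<rho> \<tau>\<close>. Its power \<open>\<gamma> / (\<gamma> - 1)\<close> is a multiple
    of \<open>\<rho> \<tau> x powr \<gamma>\<close>, so it lies in the dual space.\<close>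
  define \<psi> where "\<psi> x = \<gamma> * \<rho> \<tau> x powr (\<gamma> - 1) / (\<gamma> - 1)" for x
  have q: "\<gamma> / (\<gamma> - 1) > 0" using gamma by simp
  have [measurable]: "(\<lambda>x. indicat_real \<Omega> x *\<^sub>R \<rho> \<tau> x) \<in> borel_measurable lborel"
    using rho_integrable[OF \<tau>] by (auto simp: set_integrable_def)
  have "in_Lp_dual \<gamma> \<Omega> \<psi>"
  proof -
    have m: "set_borel_measurable lborel \<Omega> \<psi>"
    proof -
      have "(\<lambda>x. \<gamma> * (indicat_real \<Omega> x *\<^sub>R \<rho> \<tau> x) powr (\<gamma> - 1) / (\<gamma> - 1)) \<in> borel_measurable lborel" by measurable
      moreover have "(\<lambda>x. \<gamma> * (indicat_real \<Omega> x *\<^sub>R \<rho> \<tau> x) powr (\<gamma> - 1) / (\<gamma> - 1)) = (\<lambda>x. indicat_real \<Omega> x *\<^sub>R \<psi> x)"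
        by (auto simp: \<psi>_def indicator_def)
      ultimately show ?thesis by (simp add: set_borel_measurable_def)
    qed
    have "set_integrable lborel \<Omega> (\<lambda>x. norm (\<psi> x) powr (\<gamma> / (\<gamma> - 1)))"
    proof (rule set_integrable_bound)
      show "set_integrable lborel \<Omega> (\<lambda>x. (\<gamma> / (\<gamma> - 1)) powr (\<gamma> / (\<gamma> - 1)) * \<rho> \<tau> x powr \<gamma>)"
        by (rule set_integrable_mult_right) (rule rho_powr_integrable[OF \<tau>])
      have [measurable]: "(\<lambda>x. indicat_real \<Omega> x *\<^sub>R \<psi> x) \<in> borel_measurable lborel" using m by (simp add: set_borel_measurable_def)
      have "(\<lambda>x. norm (indicat_real \<Omega> x *\<^sub>R \<psi> x) powr (\<gamma> / (\<gamma> - 1))) \<in> borel_measurable lborel" by measurable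
      moreover have "(\<lambda>x. norm (indicat_real \<Omega> x *\<^sub>R \<psi> x) powr (\<gamma> / (\<gamma> - 1))) = (\<lambda>x. indicat_real \<Omega> x *\<^sub>R norm (\<psi> x) powr (\<gamma> / (\<gamma> - 1)))"
        by (auto simp: indicator_def)
      ultimately show "set_borel_measurable lborel \<Omega> (\<lambda>x. norm (\<psi> x) powr (\<gamma> / (\<gamma> - 1)))" by (simp add: set_borel_measurable_def)
      show "AE x in lborel. x \<in> \<Omega> \<longrightarrow> norm (norm (\<psi> x) powr (\<gamma> / (\<gamma> - 1))) \<le> norm ((\<gamma> / (\<gamma> - 1)) powr (\<gamma> / (\<gamma> - 1)) * \<rho> \<tau> x powr \<gamma>)"
        using rho_nonneg[OF \<tau>]
      proof (eventually_elim, intro impI)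
        fix x assume "x \<in> \<Omega> \<longrightarrow> 0 \<le> \<rho> \<tau> x" "x \<in> \<Omega>"
        have n: "norm (\<psi> x) = \<gamma> / (\<gamma> - 1) * \<rho> \<tau> x powr (\<gamma> - 1)" using gamma by (simp add: \<psi>_def abs_mult)
        have "(\<gamma> - 1) * (\<gamma> / (\<gamma> - 1)) = \<gamma>" using gamma by simp
        then have "(\<rho> \<tau> x powr (\<gamma> - 1)) powr (\<gamma> / (\<gamma> - 1)) = \<rho> \<tau> x powr \<gamma>" by (simp only: powr_powr)
        then have "norm (\<psi> x) powr (\<gamma> / (\<gamma> - 1)) = (\<gamma> / (\<gamma> - 1)) powr (\<gamma> / (\<gamma> - 1)) * \<rho> \<tau> x powr \<gamma>"
          unfolding n using q by (subst powr_mult) auto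
        then show "norm (norm (\<psi> x) powr (\<gamma> / (\<gamma> - 1))) \<le> norm ((\<gamma> / (\<gamma> - 1)) powr (\<gamma> / (\<gamma> - 1)) * \<rho> \<tau> x powr \<gamma>)" by simp
      qed
    qed
    then show ?thesis using gamma m by (simp add: in_Lp_dual_def in_Lp_def)
  qed
  then have c: "continuous_on {0..T} (\<lambda>t. LINT x:\<Omega>|lborel. \<rho> t x \<bullet> \<psi> x)"
    using wc_rho by (simp add: weakly_continuous_Lp_def)
  have pr: "\<rho> \<tau> x * \<psi> x = \<gamma> / (\<gamma> - 1) * \<rho> \<tau> x powr \<gamma>" if "\<rho> \<tau> x \<ge> 0" for x
    using powr_add[of "\<rho> \<tau> x" 1 "\<gamma> - 1"] that gamma by (cases "\<rho> \<tau> x = 0") (auto simp: \<psi>_def)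
  define I where "I = (LINT x:\<Omega>|lborel. \<rho> \<tau> x powr \<gamma>)"
  define kin where "kin t = (LINT x:\<Omega>|lborel. \<rho> t x * (norm (u t x))\<^sup>2)" for t
  define m where "m t = (LINT x:\<Omega>|lborel. \<rho> t x * \<psi> x)" for t
  \<comment> \<open>The bracket is the integral of \<open>H(\<rho> \<tau>) + H'(\<rho> \<tau>)
    (\<rho> t - \<rho> \<tau>)\<close>, because
    \<open>s H'(s) - H(s) = s powr \<gamma>\<close>.\<close>
  define L where "L t = 1/2 * kin t + (m t - I)" for t
  have en: "energy \<gamma> \<Omega> (\<rho> s) (u s) = 1/2 * kin s + (LINT x:\<Omega>|lborel. \<rho> s x powr \<gamma> / (\<gamma> - 1))" if s: "s \<in> {0..T}" for s
  proof -
    have "energy \<gamma> \<Omega> (\<rho> s) (u s) = (LINT x:\<Omega>|lborel. 1/2 * (\<rho> s x * (norm (u s x))\<^sup>2) + \<rho> s x powr \<gamma> / (\<gamma> - 1))"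
      by (simp add: energy_def mult.assoc)
    also have "\<dots> = (LINT x:\<Omega>|lborel. 1/2 * (\<rho> s x * (norm (u s x))\<^sup>2)) + (LINT x:\<Omega>|lborel. \<rho> s x powr \<gamma> / (\<gamma> - 1))"
      by (intro set_integral_add(2) set_integrable_mult_right set_integrable_divide kin_integrable rho_powr_integrable s)
    finally show ?thesis by (simp add: kin_def)
  qed
  show ?thesis
  proof (rule that[of L])
    show "continuous_on {0..T} L" unfolding L_def kin_def m_def
      using c by (intro continuous_intros kin_continuous) simp
    have "m \<tau> = (LINT x:\<Omega>|lborel. \<gamma> / (\<gamma> - 1) * \<rho> \<tau> x powr \<gamma>)" unfolding m_def
      unfolding set_lebesgue_integral_def
    proof (rule integral_cong_AE)
      show "AE x in lborel. indicat_real \<Omega> x *\<^sub>R (\<rho> \<tau> x * \<psi> x) = indicat_real \<Omega> x *\<^sub>R (\<gamma> / (\<gamma> - 1) * \<rho> \<tau> x powr \<gamma>)"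
        using rho_nonneg[OF \<tau>] by eventually_elim (auto simp: indicator_def pr)
      have "(\<lambda>x. (indicat_real \<Omega> x *\<^sub>R \<rho> \<tau> x) * (\<gamma> * (indicat_real \<Omega> x *\<^sub>R \<rho> \<tau> x) powr (\<gamma> - 1) / (\<gamma> - 1))) \<in> borel_measurable lborel" by measurable
      moreover have "(\<lambda>x. (indicat_real \<Omega> x *\<^sub>R \<rho> \<tau> x) * (\<gamma> * (indicat_real \<Omega> x *\<^sub>R \<rho> \<tau> x) powr (\<gamma> - 1) / (\<gamma> - 1))) = (\<lambda>x. indicat_real \<Omega> x *\<^sub>R (\<rho> \<tau> x * \<psi> x))"
        by (auto simp: \<psi>_def indicator_def)
      ultimately show "(\<lambda>x. indicat_real \<Omega> x *\<^sub>R (\<rho> \<tau> x * \<psi> x)) \<in> borel_measurable lborel" by (simp only:)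
      show "(\<lambda>x. indicat_real \<Omega> x *\<^sub>R (\<gamma> / (\<gamma> - 1) * \<rho> \<tau> x powr \<gamma>)) \<in> borel_measurable lborel"
        using set_integrable_mult_right[OF rho_powr_integrable[OF \<tau>], of "\<gamma> / (\<gamma> - 1)"] by (auto simp: set_integrable_def)
    qed
    then have m\<tau>: "m \<tau> = \<gamma> / (\<gamma> - 1) * I" by (simp add: I_def)
    have "\<gamma> / (\<gamma> - 1) * I - I = I / (\<gamma> - 1)" using gamma by (simp add: field_simps)
    then show "L \<tau> = energy \<gamma> \<Omega> (\<rho> \<tau>) (u \<tau>)" unfolding L_def m\<tau> en[OF \<tau>] by (simp add: I_def)
    fix s assume s: "s \<in> {0..T}"
    have mi: "set_integrable lborel \<Omega> (\<lambda>x. \<rho> s x * \<psi> x - \<rho> \<tau> x powr \<gamma>)"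
    proof (rule set_integral_diff(1)[OF _ rho_powr_integrable[OF \<tau>]])
      show "set_integrable lborel \<Omega> (\<lambda>x. \<rho> s x * \<psi> x)"
      proof (rule set_integrable_bound)
        show "set_integrable lborel \<Omega> (\<lambda>x. \<gamma> / (\<gamma> - 1) * (\<rho> s x powr \<gamma> + \<rho> \<tau> x powr \<gamma>))"
          by (intro set_integrable_mult_right set_integral_add(1) rho_powr_integrable s \<tau>)
        have [measurable]: "(\<lambda>x. indicat_real \<Omega> x *\<^sub>R \<rho> s x) \<in> borel_measurable lborel"
          using rho_integrable[OF s] by (auto simp: set_integrable_def)
        have "(\<lambda>x. (indicat_real \<Omega> x *\<^sub>R \<rho> s x) * (\<gamma> * (indicat_real \<Omega> x *\<^sub>R \<rho> \<tau> x) powr (\<gamma> - 1) / (\<gamma> - 1))) \<in> borel_measurable lborel" by measurable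
        moreover have "(\<lambda>x. (indicat_real \<Omega> x *\<^sub>R \<rho> s x) * (\<gamma> * (indicat_real \<Omega> x *\<^sub>R \<rho> \<tau> x) powr (\<gamma> - 1) / (\<gamma> - 1))) = (\<lambda>x. indicat_real \<Omega> x *\<^sub>R (\<rho> s x * \<psi> x))"
          by (auto simp: \<psi>_def indicator_def)
        ultimately show "set_borel_measurable lborel \<Omega> (\<lambda>x. \<rho> s x * \<psi> x)" by (simp only: set_borel_measurable_def)
        show "AE x in lborel. x \<in> \<Omega> \<longrightarrow> norm (\<rho> s x * \<psi> x) \<le> norm (\<gamma> / (\<gamma> - 1) * (\<rho> s x powr \<gamma> + \<rho> \<tau> x powr \<gamma>))"
          using rho_nonneg[OF \<tau>] rho_nonneg[OF s]
        proof (eventually_elim, intro impI)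
          fix x assume "x \<in> \<Omega> \<longrightarrow> 0 \<le> \<rho> \<tau> x" "x \<in> \<Omega> \<longrightarrow> 0 \<le> \<rho> s x" "x \<in> \<Omega>"
          then have nn: "0 \<le> \<rho> \<tau> x" "0 \<le> \<rho> s x" by auto
          \<comment> \<open>The mixed product is bounded by replacing both densities with the larger
            one.\<close>
          define y where "y = max (\<rho> s x) (\<rho> \<tau> x)"
          have yy: "y * y powr (\<gamma> - 1) = y powr \<gamma>" using nn powr_add[of y 1 "\<gamma> - 1"] by (cases "y = 0") (auto simp: y_def)
          have "\<rho> s x * \<rho> \<tau> x powr (\<gamma> - 1) \<le> y * y powr (\<gamma> - 1)"
            using nn gamma by (intro mult_mono powr_mono2) (auto simp: y_def)
          also have "\<dots> \<le> \<rho> s x powr \<gamma> + \<rho> \<tau> x powr \<gamma>" unfolding yy by (auto simp: y_def max_def)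
          finally have "\<gamma> / (\<gamma> - 1) * (\<rho> s x * \<rho> \<tau> x powr (\<gamma> - 1)) \<le> \<gamma> / (\<gamma> - 1) * (\<rho> s x powr \<gamma> + \<rho> \<tau> x powr \<gamma>)"
            by (rule mult_left_mono) (use gamma in simp)
          then show "norm (\<rho> s x * \<psi> x) \<le> norm (\<gamma> / (\<gamma> - 1) * (\<rho> s x powr \<gamma> + \<rho> \<tau> x powr \<gamma>))"
            using nn gamma by (simp add: \<psi>_def abs_mult mult_ac)
        qed
      qed
    qed
    have "m s - I = (LINT x:\<Omega>|lborel. \<rho> s x * \<psi> x - \<rho> \<tau> x powr \<gamma>)"
    proof -
      have "set_integrable lborel \<Omega> (\<lambda>x. (\<rho> s x * \<psi> x - \<rho> \<tau> x powr \<gamma>) + \<rho> \<tau> x powr \<gamma>)"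
        by (rule set_integral_add(1)[OF mi rho_powr_integrable[OF \<tau>]])
      then have "set_integrable lborel \<Omega> (\<lambda>x. \<rho> s x * \<psi> x)" by simp
      from set_integral_diff(2)[OF this rho_powr_integrable[OF \<tau>]] show ?thesis by (simp add: m_def I_def)
    qed
    also have "\<dots> \<le> (LINT x:\<Omega>|lborel. \<rho> s x powr \<gamma> / (\<gamma> - 1))"
    proof (rule set_integral_mono_AE[OF mi set_integrable_divide[OF rho_powr_integrable[OF s]]])
      show "AE x\<in>\<Omega> in lborel. \<rho> s x * \<psi> x - \<rho> \<tau> x powr \<gamma> \<le> \<rho> s x powr \<gamma> / (\<gamma> - 1)"
        using rho_nonneg[OF \<tau>] rho_nonneg[OF s]
      proof (eventually_elim, intro impI)
        fix x assume "x \<in> \<Omega> \<longrightarrow> 0 \<le> \<rho> \<tau> x" "x \<in> \<Omega> \<longrightarrow> 0 \<le> \<rho> s x" "x \<in> \<Omega>"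
        then have nn: "0 \<le> \<rho> \<tau> x" "0 \<le> \<rho> s x" by auto
        have rr: "\<rho> \<tau> x * \<rho> \<tau> x powr (\<gamma> - 1) = \<rho> \<tau> x powr \<gamma>"
          using nn powr_add[of "\<rho> \<tau> x" 1 "\<gamma> - 1"] by (cases "\<rho> \<tau> x = 0") auto
        have t: "\<rho> s x powr \<gamma> \<ge> \<rho> \<tau> x powr \<gamma> + \<gamma> * \<rho> \<tau> x powr (\<gamma> - 1) * (\<rho> s x - \<rho> \<tau> x)"
          by (rule powr_tangent[OF gamma nn(2,1)])
        have "(\<gamma> - 1) * (\<rho> s x * \<psi> x - \<rho> \<tau> x powr \<gamma>) = \<gamma> * \<rho> \<tau> x powr (\<gamma> - 1) * \<rho> s x - (\<gamma> - 1) * \<rho> \<tau> x powr \<gamma>"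
          using gamma by (simp add: \<psi>_def right_diff_distrib)
        also have "\<dots> = \<rho> \<tau> x powr \<gamma> + \<gamma> * \<rho> \<tau> x powr (\<gamma> - 1) * (\<rho> s x - \<rho> \<tau> x)"
          unfolding rr[symmetric] by (simp add: algebra_simps)
        also have "\<dots> \<le> \<rho> s x powr \<gamma>" by (rule t)
        finally show "\<rho> s x * \<psi> x - \<rho> \<tau> x powr \<gamma> \<le> \<rho> s x powr \<gamma> / (\<gamma> - 1)"
          using gamma by (simp add: pos_le_divide_eq mult.commute)
      qed
    qed
    finally show "L s \<le> energy \<gamma> \<Omega> (\<rho> s) (u s)" unfolding L_def en[OF s] by simp
  qed
qed

text \<open>\<open>Z\<close> is continuous, coincides with \<open>Erel\<close> at
  \<open>\<tau>\<close> and lies below it elsewhere. If \<open>Erel \<tau>\<close> exceeded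
  \<open>A\<close>, so would \<open>Z\<close> on a whole interval, which contains times at which the
  assumed bound holds.\<close>

lemma Erel_le_of_AE:
  assumes A: "AE s in lborel. s \<in> {0<..<T} \<longrightarrow> Erel s \<le> A" and \<tau>: "\<tau> \<in> {0<..<T}"
  shows "Erel \<tau> \<le> A"
proof (rule ccontr)
  assume "\<not> Erel \<tau> \<le> A"
  have \<tau>': "\<tau> \<in> {0..T}" using \<tau> by simp
  obtain L where L: "continuous_on {0..T} L" "L \<tau> = energy \<gamma> \<Omega> (\<rho> \<tau>) (u \<tau>)"
    "\<And>s. s \<in> {0..T} \<Longrightarrow> L s \<le> energy \<gamma> \<Omega> (\<rho> s) (u s)"
    by (rule energy_tangent[OF \<tau>']) blast
  define Z where "Z s = L s - Fm s + Fc s + Fp s" for s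
  have cZ: "continuous_on {0..T} Z" unfolding Z_def by (intro continuous_intros L(1) Fm_continuous Fc_continuous Fp_continuous)
  have "Z \<tau> > A" using \<open>\<not> Erel \<tau> \<le> A\<close> by (simp add: Z_def L(2) Erel_eq[OF \<tau>'])
  then obtain d where d: "d > 0" "\<And>s. s \<in> {0..T} \<Longrightarrow> dist s \<tau> < d \<Longrightarrow> dist (Z s) (Z \<tau>) < Z \<tau> - A"
    using cZ[unfolded continuous_on_iff, rule_format, OF \<tau>', of "Z \<tau> - A"] by auto
  define l where "l = max 0 (\<tau> - d)"
  have "l < \<tau>" using d(1) \<tau> by (auto simp: l_def)
  from AE_lborel_interval_witness[OF A this] obtain s where s: "l < s" "s < \<tau>" "s \<in> {0<..<T} \<longrightarrow> Erel s \<le> A" by blast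
  have s': "s \<in> {0<..<T}" "s \<in> {0..T}" "dist s \<tau> < d" using s \<tau> by (auto simp: l_def dist_real_def)
  have "Z s \<le> Erel s" unfolding Z_def Erel_eq[OF s'(2)] using L(3)[OF s'(2)] by simp
  then have "Z s \<le> A" using s(3) s'(1) by simp
  moreover have "Z s > A" using d(2)[OF s'(2,3)] unfolding dist_real_def by linarith
  ultimately show False by simp
qed

theorem relative_energy_estimate:
  assumes K: "bounds K" and c: "\<And>A. norm (S A) \<le> c * norm A" "c \<ge> 0" and \<tau>: "\<tau> \<in> {0<..<T}"
  shows "Erel \<tau> \<le> (Erel0 + \<beta> * (K\<^sup>2 * surface_area * T) + \<epsilon> * (c * (9 * K)\<^sup>2 * vol * T)) * exp ((2 * K + 3 * (\<gamma> - 1) * K) * T)"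
proof (rule Erel_le_of_AE[OF _ \<tau>])
  let ?C = "2 * K + 3 * (\<gamma> - 1) * K"
  let ?B = "Erel0 + \<beta> * (K\<^sup>2 * surface_area * T) + \<epsilon> * (c * (9 * K)\<^sup>2 * vol * T)"
  have C: "?C \<ge> 0" using K gamma by (simp add: bounds_def)
  show "AE s in lborel. s \<in> {0<..<T} \<longrightarrow> Erel s \<le> ?B * exp (?C * T)"
    using relative_energy_gronwall_AE[OF K c]
  proof (eventually_elim, intro impI)
    fix s assume *: "s \<in> {0<..<T} \<longrightarrow> Erel s \<le> ?B * exp (?C * s)" and s: "s \<in> {0<..<T}"
    have "0 \<le> Erel s" by (rule Erel_nonneg) (use s in simp)
    then have "0 \<le> ?B * exp (?C * s)" using * s by linarith
    \<comment> \<open>The sign of \<open>?B\<close> is read off from \<open>Erel s \<ge> 0\<close>;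
      it permits the exponential to be evaluated at \<open>T\<close>.\<close>
    then have B: "?B \<ge> 0" using exp_gt_zero[of "?C * s"] by (simp only: zero_le_mult_iff) linarith
    have "exp (?C * s) \<le> exp (?C * T)" using s C by (simp add: mult_left_mono)
    from mult_left_mono[OF this B] show "Erel s \<le> ?B * exp (?C * T)" using * s by linarith
  qed
qed

end


section \<open>The inviscid limit\<close>

text \<open>\<open>C\<close> may grow without bound as \<delta> decreases: for fixed \<delta> first
  \<open>b\<close> tends to 0, and only then \<delta>. The bound on the initial relative energy has
  this shape.\<close>

lemma tendsto_zero_by_splitting:
  fixes f b :: "'a \<Rightarrow> real"
  assumes b: "(b \<longlongrightarrow> 0) F"
    and split: "\<And>\<delta>. \<delta> > 0 \<Longrightarrow> \<exists>C. \<forall>\<^sub>F x in F. 0 \<le> f x \<and> f x \<le> \<delta> + C * b x"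
  shows "(f \<longlongrightarrow> 0) F"
proof (rule tendstoI)
  fix e :: real assume "e > 0"
  then obtain C where C: "\<forall>\<^sub>F x in F. 0 \<le> f x \<and> f x \<le> e / 2 + C * b x" using split[of "e / 2"] by auto
  have "((\<lambda>x. C * b x) \<longlongrightarrow> C * 0) F" by (intro tendsto_intros b)
  then have "\<forall>\<^sub>F x in F. C * b x < e / 2" using \<open>e > 0\<close> by (intro order_tendstoD(2)) auto
  with C show "\<forall>\<^sub>F x in F. dist (f x) 0 < e"
  proof eventually_elim
    case (elim x)
    then show ?case by simp
  qed
qed

section \<open>Comparison of the relative potential with the density gap\<close>

context euler
begin

text \<open>The integrated form of \<open>rel_potential_coercive\<close>. The constant depends on
  \<delta> and on the bounds of the Euler density, but neither on the time nor on \<open>f\<close>,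
  hence not on the viscosity. Integrability is part of the conclusion because a nonexistent integral
  would be 0 and its bound void.\<close>

lemma density_gap_le_potential:
  assumes \<delta>: "\<delta> > 0"
  shows "\<exists>C\<ge>0. \<forall>s f. s \<in> {0..T} \<longrightarrow> set_integrable lborel \<Omega> f \<longrightarrow> (AE x in lborel. x \<in> \<Omega> \<longrightarrow> 0 \<le> f x)
      \<longrightarrow> set_integrable lborel \<Omega> (\<lambda>x. rel_potential \<gamma> (f x) (r s x))
    \<longrightarrow> set_integrable lborel \<Omega> (\<lambda>x. \<bar>f x - r s x\<bar> powr \<gamma>)
      \<and> (LINT x:\<Omega>|lborel. \<bar>f x - r s x\<bar> powr \<gamma>) \<le> \<delta> * measure lborel \<Omega> + C * (LINT x:\<Omega>|lborel. rel_potential \<gamma> (f x) (r s x))"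
proof -
  obtain m M where mM: "m > 0" "\<forall>t\<in>{0..T}. \<forall>x\<in>closure \<Omega>. m \<le> r t x \<and> r t x \<le> M" using r_bounds by blast
  have "m \<le> M"
  proof -
    obtain x where "x \<in> \<Omega>" using dom_nonempty by blast
    then show ?thesis using mM(2) in_Qc T by (meson atLeastAtMost_iff less_imp_le order_refl order_trans)
  qed
  then obtain C where C: "C \<ge> 0" "\<And>a b. 0 \<le> a \<Longrightarrow> m \<le> b \<Longrightarrow> b \<le> M \<Longrightarrow> \<bar>a - b\<bar> powr \<gamma> \<le> \<delta> + C * rel_potential \<gamma> a b"
    using rel_potential_coercive[OF gamma mM(1) _ \<delta>, of M] by blast
  have ci: "set_integrable lborel \<Omega> (\<lambda>x. c)" for c :: real
    using finite_measure_dom by (simp add: set_integrable_def)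
  show ?thesis
  proof (intro exI[of _ C] conjI allI impI C(1))
    fix s f assume s: "s \<in> {0..T}" and f: "set_integrable lborel \<Omega> f" and nn: "AE x in lborel. x \<in> \<Omega> \<longrightarrow> 0 \<le> f x"
      and h: "set_integrable lborel \<Omega> (\<lambda>x. rel_potential \<gamma> (f x) (r s x))"
    have rhs: "set_integrable lborel \<Omega> (\<lambda>x. \<delta> + C * rel_potential \<gamma> (f x) (r s x))"
      by (intro set_integral_add(1) ci set_integrable_mult_right h)
    have le: "AE x in lborel. x \<in> \<Omega> \<longrightarrow> \<bar>f x - r s x\<bar> powr \<gamma> \<le> \<delta> + C * rel_potential \<gamma> (f x) (r s x)"
      using nn by eventually_elim (use C(2) mM(2) s in_Qc in blast)
    show int: "set_integrable lborel \<Omega> (\<lambda>x. \<bar>f x - r s x\<bar> powr \<gamma>)"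
    proof (rule set_integrable_bound[OF rhs])
      have [measurable]: "(\<lambda>x. indicat_real \<Omega> x *\<^sub>R f x) \<in> borel_measurable lborel" using f by (auto simp: set_integrable_def)
      have "continuous_on \<Omega> (r s)"
        using continuous_on_subset[OF continuous_space_slice[OF continuous_Qc(1) s] closure_subset] by simp
      from borel_measurable_continuous_on_indicator[OF borel_dom this]
      have [measurable]: "(\<lambda>x. indicat_real \<Omega> x *\<^sub>R r s x) \<in> borel_measurable lborel" by simp
      have "(\<lambda>x. \<bar>indicat_real \<Omega> x *\<^sub>R f x - indicat_real \<Omega> x *\<^sub>R r s x\<bar> powr \<gamma>) \<in> borel_measurable lborel" by measurable
      moreover have "(\<lambda>x. \<bar>indicat_real \<Omega> x *\<^sub>R f x - indicat_real \<Omega> x *\<^sub>R r s x\<bar> powr \<gamma>) = (\<lambda>x. indicat_real \<Omega> x *\<^sub>R \<bar>f x - r s x\<bar> powr \<gamma>)"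
        by (auto simp: indicator_def)
      ultimately show "set_borel_measurable lborel \<Omega> (\<lambda>x. \<bar>f x - r s x\<bar> powr \<gamma>)" by (simp only: set_borel_measurable_def)
      show "AE x in lborel. x \<in> \<Omega> \<longrightarrow> norm (\<bar>f x - r s x\<bar> powr \<gamma>) \<le> norm (\<delta> + C * rel_potential \<gamma> (f x) (r s x))"
        using le by eventually_elim (auto intro: order_trans[OF _ abs_ge_self])
    qed
    have "(LINT x:\<Omega>|lborel. \<bar>f x - r s x\<bar> powr \<gamma>) \<le> (LINT x:\<Omega>|lborel. \<delta> + C * rel_potential \<gamma> (f x) (r s x))"
      by (rule set_integral_mono_AE[OF int rhs le])
    also have "\<dots> = (LINT x:\<Omega>|lborel. \<delta>) + (LINT x:\<Omega>|lborel. C * rel_potential \<gamma> (f x) (r s x))"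
      by (intro set_integral_add(2) ci set_integrable_mult_right h)
    also have "(LINT x:\<Omega>|lborel. \<delta>) = \<delta> * measure lborel \<Omega>" by (simp add: set_lebesgue_integral_def mult.commute)
    finally show "(LINT x:\<Omega>|lborel. \<bar>f x - r s x\<bar> powr \<gamma>) \<le> \<delta> * measure lborel \<Omega> + C * (LINT x:\<Omega>|lborel. rel_potential \<gamma> (f x) (r s x))"
      by simp
  qed
qed

text \<open>The bound of \<open>rel_potential_le\<close> has a term linear in the gap, which
  \<open>abs_le_powr\<close> trades for \<delta> and the power \<gamma>. Here \<open>C\<close> is
  chosen before \<delta>, so the term with \<delta> can be made small afterwards.\<close>

lemma potential_le_density_gap:
  "\<exists>C\<ge>0. \<forall>(\<delta>::real) s f. \<delta> > 0 \<longrightarrow> s \<in> {0..T} \<longrightarrow> set_integrable lborel \<Omega> f \<longrightarrow> (AE x in lborel. x \<in> \<Omega> \<longrightarrow> 0 \<le> f x)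
      \<longrightarrow> set_integrable lborel \<Omega> (\<lambda>x. rel_potential \<gamma> (f x) (r s x))
    \<longrightarrow> (LINT x:\<Omega>|lborel. rel_potential \<gamma> (f x) (r s x))
      \<le> C * (\<delta> * measure lborel \<Omega> + (\<delta> powr (1 - \<gamma>) + 1) * (LINT x:\<Omega>|lborel. \<bar>f x - r s x\<bar> powr \<gamma>))"
proof -
  obtain m M where mM: "m > 0" "\<forall>t\<in>{0..T}. \<forall>x\<in>closure \<Omega>. m \<le> r t x \<and> r t x \<le> M" using r_bounds by blast
  have M: "max M 1 > 0" by simp
  obtain C where C: "C \<ge> 0" "\<And>a b. 0 \<le> a \<Longrightarrow> 0 < b \<Longrightarrow> b \<le> max M 1 \<Longrightarrow> rel_potential \<gamma> a b \<le> C * (\<bar>a - b\<bar> + \<bar>a - b\<bar> powr \<gamma>)"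
    using rel_potential_le[OF gamma M] by blast
  \<comment> \<open>The case \<open>\<delta> = 1\<close> provides the integrability of the
    gap.\<close>
  obtain C1 where C1: "\<And>s f. s \<in> {0..T} \<Longrightarrow> set_integrable lborel \<Omega> f \<Longrightarrow> (AE x in lborel. x \<in> \<Omega> \<longrightarrow> 0 \<le> f x)
      \<Longrightarrow> set_integrable lborel \<Omega> (\<lambda>x. rel_potential \<gamma> (f x) (r s x)) \<Longrightarrow> set_integrable lborel \<Omega> (\<lambda>x. \<bar>f x - r s x\<bar> powr \<gamma>)"
    using density_gap_le_potential[of 1] by auto
  have ci: "set_integrable lborel \<Omega> (\<lambda>x. c)" for c :: real
    using finite_measure_dom by (simp add: set_integrable_def)
  show ?thesis
  proof (intro exI[of _ C] conjI allI impI C(1))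
    fix \<delta> :: real and s f assume \<delta>: "\<delta> > 0" and s: "s \<in> {0..T}" and f: "set_integrable lborel \<Omega> f" and nn: "AE x in lborel. x \<in> \<Omega> \<longrightarrow> 0 \<le> f x"
      and h: "set_integrable lborel \<Omega> (\<lambda>x. rel_potential \<gamma> (f x) (r s x))"
    have d: "set_integrable lborel \<Omega> (\<lambda>x. \<bar>f x - r s x\<bar> powr \<gamma>)" by (rule C1[OF s f nn h])
    let ?D = "\<delta> powr (1 - \<gamma>) + 1"
    have rhs: "set_integrable lborel \<Omega> (\<lambda>x. C * (\<delta> + ?D * \<bar>f x - r s x\<bar> powr \<gamma>))"
      by (intro set_integral_add(1) ci set_integrable_mult_right d)
    have "(LINT x:\<Omega>|lborel. rel_potential \<gamma> (f x) (r s x)) \<le> (LINT x:\<Omega>|lborel. C * (\<delta> + ?D * \<bar>f x - r s x\<bar> powr \<gamma>))"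
    proof (rule set_integral_mono_AE[OF h rhs])
      show "AE x\<in>\<Omega> in lborel. rel_potential \<gamma> (f x) (r s x) \<le> C * (\<delta> + ?D * \<bar>f x - r s x\<bar> powr \<gamma>)"
        using nn
      proof (eventually_elim, intro impI)
        fix x assume "x \<in> \<Omega> \<longrightarrow> 0 \<le> f x" and x: "x \<in> \<Omega>"
        then have "0 \<le> f x" by simp
        moreover have "m \<le> r s x \<and> r s x \<le> M" using mM(2) s x in_Qc by blast
        ultimately have "rel_potential \<gamma> (f x) (r s x) \<le> C * (\<bar>f x - r s x\<bar> + \<bar>f x - r s x\<bar> powr \<gamma>)"
          using C(2)[of "f x" "r s x"] mM(1) by auto
        also have "\<dots> \<le> C * (\<delta> + ?D * \<bar>f x - r s x\<bar> powr \<gamma>)"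
          using abs_le_powr[OF \<delta> gamma, of "f x - r s x"] C(1) by (intro mult_left_mono) (auto simp: distrib_right)
        finally show "rel_potential \<gamma> (f x) (r s x) \<le> C * (\<delta> + ?D * \<bar>f x - r s x\<bar> powr \<gamma>)" .
      qed
    qed
    also have "\<dots> = C * (LINT x:\<Omega>|lborel. \<delta> + ?D * \<bar>f x - r s x\<bar> powr \<gamma>)" by simp
    also have "(LINT x:\<Omega>|lborel. \<delta> + ?D * \<bar>f x - r s x\<bar> powr \<gamma>) = (LINT x:\<Omega>|lborel. \<delta>) + (LINT x:\<Omega>|lborel. ?D * \<bar>f x - r s x\<bar> powr \<gamma>)"
      by (intro set_integral_add(2) ci set_integrable_mult_right d)
    also have "(LINT x:\<Omega>|lborel. \<delta>) = \<delta> * measure lborel \<Omega>" by (simp add: set_lebesgue_integral_def mult.commute)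
    finally show "(LINT x:\<Omega>|lborel. rel_potential \<gamma> (f x) (r s x))
      \<le> C * (\<delta> * measure lborel \<Omega> + ?D * (LINT x:\<Omega>|lborel. \<bar>f x - r s x\<bar> powr \<gamma>))" by simp
  qed
qed

end

lemma navier_stokes_of_weak_solution:
  assumes "euler \<Omega> T \<gamma> r\<^sub>0 U\<^sub>0 r U" "\<mu> > 0" "\<eta> \<ge> 0" "\<epsilon> > 0" "\<beta> \<ge> 0" "admissible_data \<gamma> \<Omega> \<rho>\<^sub>0 u\<^sub>0"
    and "finite_energy_weak_solution \<gamma> \<mu> \<eta> \<Omega> T \<epsilon> \<beta> \<rho>\<^sub>0 u\<^sub>0 \<rho> u"
  shows "\<exists>G g. navier_stokes \<Omega> T \<gamma> r\<^sub>0 U\<^sub>0 r U \<mu> \<eta> \<epsilon> \<beta> \<rho>\<^sub>0 u\<^sub>0 \<rho> u G g"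
proof -
  interpret euler \<Omega> T \<gamma> r\<^sub>0 U\<^sub>0 r U by (rule assms(1))
  from assms(7) obtain G :: "real \<Rightarrow> real^3 \<Rightarrow> real^3^3" and g :: "real \<Rightarrow> real^3 \<Rightarrow> real^3"
    where "in_Lp 2 ({0<..<T} \<times> \<Omega>) (\<lambda>(t, x). G t x)"
      "set_borel_measurable borel ({0<..<T} \<times> frontier \<Omega>) (\<lambda>(t, x). g t x)"
      "weak_momentum_equation \<gamma> \<mu> \<eta> \<Omega> T \<epsilon> \<beta> \<rho>\<^sub>0 u\<^sub>0 \<rho> u G g"
      "energy_inequality \<gamma> \<mu> \<eta> \<Omega> T \<epsilon> \<beta> \<rho>\<^sub>0 u\<^sub>0 \<rho> u G g"
    unfolding finite_energy_weak_solution_def by blast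
  then have "navier_stokes \<Omega> T \<gamma> r\<^sub>0 U\<^sub>0 r U \<mu> \<eta> \<epsilon> \<beta> \<rho>\<^sub>0 u\<^sub>0 \<rho> u G g"
    using assms unfolding finite_energy_weak_solution_def by unfold_locales auto
  then show ?thesis by blast
qed

theorem theorem4:
  fixes \<Omega> :: "(real^3) set"
    and \<gamma> \<mu> \<eta> T :: real
    and \<rho>\<^sub>0E :: "real^3 \<Rightarrow> real" and u\<^sub>0E :: "real^3 \<Rightarrow> real^3"
    and \<rho>E :: "real \<Rightarrow> real^3 \<Rightarrow> real" and uE :: "real \<Rightarrow> real^3 \<Rightarrow> real^3"
    and \<beta> :: "real \<Rightarrow> real"
    and \<rho>\<^sub>0 :: "real \<Rightarrow> real^3 \<Rightarrow> real" and u\<^sub>0 :: "real \<Rightarrow> real^3 \<Rightarrow> real^3"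
    and \<rho> :: "real \<Rightarrow> real \<Rightarrow> real^3 \<Rightarrow> real" and u :: "real \<Rightarrow> real \<Rightarrow> real^3 \<Rightarrow> real^3"
  assumes "smooth_bounded_domain \<Omega>"
    and "\<gamma> > 3/2" and "\<mu> > 0" and "\<eta> \<ge> 0" and "T > 0"
    and "smooth_up_to (closure \<Omega>) \<rho>\<^sub>0E" and "smooth_up_to (closure \<Omega>) u\<^sub>0E"
    and "0 < (INF x\<in>\<Omega>. ereal (\<rho>\<^sub>0E x))" and "(SUP x\<in>\<Omega>. ereal (\<rho>\<^sub>0E x)) < \<infinity>"
    and "smooth_euler_solution \<gamma> \<Omega> T \<rho>\<^sub>0E u\<^sub>0E \<rho>E uE"
    and "0 < (INF (t, x)\<in>{0<..<T} \<times> \<Omega>. ereal (\<rho>E t x))"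
    and "(SUP (t, x)\<in>{0<..<T} \<times> \<Omega>. ereal (\<rho>E t x)) < \<infinity>"
    and "\<And>\<epsilon>. \<epsilon> \<in> {0<..<1} \<Longrightarrow> \<beta> \<epsilon> \<ge> 0"
    and "\<And>\<epsilon>. \<epsilon> \<in> {0<..<1} \<Longrightarrow> admissible_data \<gamma> \<Omega> (\<rho>\<^sub>0 \<epsilon>) (u\<^sub>0 \<epsilon>)"
    and "\<And>\<epsilon>. \<epsilon> \<in> {0<..<1} \<Longrightarrow>
           finite_energy_weak_solution \<gamma> \<mu> \<eta> \<Omega> T \<epsilon> (\<beta> \<epsilon>) (\<rho>\<^sub>0 \<epsilon>) (u\<^sub>0 \<epsilon>) (\<rho> \<epsilon>) (u \<epsilon>)"
    and "((\<lambda>\<epsilon>. Lp_norm \<gamma> \<Omega> (\<lambda>x. \<rho>\<^sub>0 \<epsilon> x - \<rho>\<^sub>0E x)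
            + (\<integral>x\<in>\<Omega>. (\<rho>\<^sub>0 \<epsilon> x * (norm (u\<^sub>0 \<epsilon> x - u\<^sub>0E x))^2) \<partial>lborel)) \<longlongrightarrow> 0) (at_right 0)"
    and "(\<beta> \<longlongrightarrow> 0) (at_right 0)"
  shows "((\<lambda>\<epsilon>. SUP t\<in>{0<..<T}. ennreal (Lp_norm \<gamma> \<Omega> (\<lambda>x. \<rho> \<epsilon> t x - \<rho>E t x)
            + (\<integral>x\<in>\<Omega>. (1/2 * \<rho> \<epsilon> t x * (norm (u \<epsilon> t x - uE t x))^2) \<partial>lborel))) \<longlongrightarrow> 0) (at_right 0)"
proof -
  have gamma: "\<gamma> > 1" using assms(2) by simp
  interpret E: euler \<Omega> T \<gamma> \<rho>\<^sub>0E u\<^sub>0E \<rho>E uE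
    by unfold_locales (use assms gamma in auto)
  obtain K where K: "E.bounds K" using E.bounds_exist ..
  obtain c where c: "c \<ge> 0" "\<And>A. norm (viscous_stress \<mu> \<eta> A) \<le> c * norm A" using viscous_stress_bound by blast
  have ns: "\<exists>G g. navier_stokes \<Omega> T \<gamma> \<rho>\<^sub>0E u\<^sub>0E \<rho>E uE \<mu> \<eta> \<epsilon> (\<beta> \<epsilon>) (\<rho>\<^sub>0 \<epsilon>) (u\<^sub>0 \<epsilon>) (\<rho> \<epsilon>) (u \<epsilon>) G g" if "\<epsilon> \<in> {0<..<1}" for \<epsilon>
    by (rule navier_stokes_of_weak_solution[OF E.euler_axioms])
       (use assms(3,4) assms(13,14,15)[OF that] that in auto)
  have ev: "\<forall>\<^sub>F \<epsilon> in at_right 0. \<epsilon> \<in> {0<..<1::real}" by (rule eventually_at_right_real) simp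
  define V where "V = measure lborel \<Omega>"
  have V: "V \<ge> 0" by (simp add: V_def)
  define kin0 where "kin0 \<epsilon> = (\<integral>x\<in>\<Omega>. (\<rho>\<^sub>0 \<epsilon> x * (norm (u\<^sub>0 \<epsilon> x - u\<^sub>0E x))^2) \<partial>lborel)" for \<epsilon>
  define gap0 where "gap0 \<epsilon> = (\<integral>x\<in>\<Omega>. \<bar>\<rho>\<^sub>0 \<epsilon> x - \<rho>\<^sub>0E x\<bar> powr \<gamma> \<partial>lborel)" for \<epsilon>
  have gap0_nonneg: "gap0 \<epsilon> \<ge> 0" for \<epsilon>
    unfolding gap0_def set_lebesgue_integral_def by (rule Bochner_Integration.integral_nonneg) simp
  have norm0: "Lp_norm \<gamma> \<Omega> (\<lambda>x. \<rho>\<^sub>0 \<epsilon> x - \<rho>\<^sub>0E x) = gap0 \<epsilon> powr (1 / \<gamma>)" for \<epsilon>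
    by (simp add: Lp_norm_def gap0_def)
  have kin0_nonneg: "kin0 \<epsilon> \<ge> 0" if "\<epsilon> \<in> {0<..<1}" for \<epsilon>
    unfolding kin0_def set_lebesgue_integral_def
  proof (rule integral_nonneg_AE)
    have "AE x in lborel. x \<in> \<Omega> \<longrightarrow> 0 \<le> \<rho>\<^sub>0 \<epsilon> x" using assms(14)[OF that] by (simp add: admissible_data_def)
    then show "AE x in lborel. 0 \<le> indicat_real \<Omega> x *\<^sub>R (\<rho>\<^sub>0 \<epsilon> x * (norm (u\<^sub>0 \<epsilon> x - u\<^sub>0E x))\<^sup>2)"
      by eventually_elim (auto simp: indicator_def)
  qed
  have lim0: "((\<lambda>\<epsilon>. gap0 \<epsilon> powr (1 / \<gamma>) + kin0 \<epsilon>) \<longlongrightarrow> 0) (at_right 0)"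
    using assms(16) unfolding norm0 kin0_def .
  \<comment> \<open>Both summands of \<open>lim0\<close> are nonnegative, so each tends to 0
    separately; for the gap the root in \<open>Lp_norm\<close> is then undone by the power
    \<gamma>.\<close>
  have kin0_lim: "(kin0 \<longlongrightarrow> 0) (at_right 0)"
    by (rule tendsto_sandwich[OF _ _ tendsto_const lim0]) (use ev kin0_nonneg in \<open>auto elim!: eventually_mono\<close>)
  have "((\<lambda>\<epsilon>. gap0 \<epsilon> powr (1 / \<gamma>)) \<longlongrightarrow> 0) (at_right 0)"
    by (rule tendsto_sandwich[OF _ _ tendsto_const lim0]) (use ev kin0_nonneg in \<open>auto elim!: eventually_mono\<close>)
  then have "((\<lambda>\<epsilon>. (gap0 \<epsilon> powr (1 / \<gamma>)) powr \<gamma>) \<longlongrightarrow> 0) (at_right 0)"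
    by (rule tendsto_zero_powrI[OF _ tendsto_const]) (use gamma in auto)
  then have gap0_lim: "(gap0 \<longlongrightarrow> 0) (at_right 0)"
    using gamma gap0_nonneg by (simp add: powr_powr)
  \<comment> \<open>The initial relative energy is determined by the data and the Euler flow, so it
    can be named before \<open>G\<close> and \<open>g\<close> are chosen for each
    \<epsilon>.\<close>
  define e0 where "e0 \<epsilon> = navier_stokes.Erel0 \<Omega> \<gamma> \<rho>E uE (\<rho>\<^sub>0 \<epsilon>) (u\<^sub>0 \<epsilon>)" for \<epsilon>
  have e0_lim: "(e0 \<longlongrightarrow> 0) (at_right 0)"
  proof -
    obtain C where C: "C \<ge> 0" "\<And>\<delta> s f. \<delta> > 0 \<Longrightarrow> s \<in> {0..T} \<Longrightarrow> set_integrable lborel \<Omega> f \<Longrightarrow> (AE x in lborel. x \<in> \<Omega> \<longrightarrow> 0 \<le> f x)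
      \<Longrightarrow> set_integrable lborel \<Omega> (\<lambda>x. rel_potential \<gamma> (f x) (\<rho>E s x))
      \<Longrightarrow> (LINT x:\<Omega>|lborel. rel_potential \<gamma> (f x) (\<rho>E s x))
        \<le> C * (\<delta> * V + (\<delta> powr (1 - \<gamma>) + 1) * (LINT x:\<Omega>|lborel. \<bar>f x - \<rho>E s x\<bar> powr \<gamma>))"
      using E.potential_le_density_gap unfolding V_def by blast
    have bound: "0 \<le> e0 \<epsilon> \<and> e0 \<epsilon> \<le> C * (\<delta> * V + (\<delta> powr (1 - \<gamma>) + 1) * gap0 \<epsilon>) + 1/2 * kin0 \<epsilon>"
      if \<epsilon>: "\<epsilon> \<in> {0<..<1}" and \<delta>: "\<delta> > 0" for \<epsilon> \<delta>
    proof -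
      obtain G g where "navier_stokes \<Omega> T \<gamma> \<rho>\<^sub>0E u\<^sub>0E \<rho>E uE \<mu> \<eta> \<epsilon> (\<beta> \<epsilon>) (\<rho>\<^sub>0 \<epsilon>) (u\<^sub>0 \<epsilon>) (\<rho> \<epsilon>) (u \<epsilon>) G g"
        using ns[OF \<epsilon>] by blast
      then interpret N: navier_stokes \<Omega> T \<gamma> \<rho>\<^sub>0E u\<^sub>0E \<rho>E uE \<mu> \<eta> \<epsilon> "\<beta> \<epsilon>" "\<rho>\<^sub>0 \<epsilon>" "u\<^sub>0 \<epsilon>" "\<rho> \<epsilon>" "u \<epsilon>" G g .
      have nn: "AE x in lborel. x \<in> \<Omega> \<longrightarrow> 0 \<le> \<rho>\<^sub>0 \<epsilon> x" using assms(14)[OF \<epsilon>] by (simp add: admissible_data_def)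
      have k: "(LINT x:\<Omega>|lborel. 1/2 * \<rho>\<^sub>0 \<epsilon> x * (norm (u\<^sub>0 \<epsilon> x - uE 0 x))\<^sup>2) = 1/2 * kin0 \<epsilon>"
      proof -
        have "(LINT x:\<Omega>|lborel. 1/2 * \<rho>\<^sub>0 \<epsilon> x * (norm (u\<^sub>0 \<epsilon> x - uE 0 x))\<^sup>2) = (LINT x:\<Omega>|lborel. 1/2 * (\<rho>\<^sub>0 \<epsilon> x * (norm (u\<^sub>0 \<epsilon> x - u\<^sub>0E x))\<^sup>2))"
          by (intro set_lebesgue_integral_cong) (use E.initial(2) E.in_Qc(2) in auto)
        then show ?thesis by (simp add: kin0_def)
      qed
      have gp: "(LINT x:\<Omega>|lborel. \<bar>\<rho>\<^sub>0 \<epsilon> x - \<rho>E 0 x\<bar> powr \<gamma>) = gap0 \<epsilon>"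
        unfolding gap0_def by (intro set_lebesgue_integral_cong) (use E.initial(1) E.in_Qc(2) in auto)
      have "0 \<le> (LINT x:\<Omega>|lborel. rel_potential \<gamma> (\<rho>\<^sub>0 \<epsilon> x) (\<rho>E 0 x))"
        unfolding set_lebesgue_integral_def
      proof (rule integral_nonneg_AE)
        show "AE x in lborel. 0 \<le> indicat_real \<Omega> x *\<^sub>R rel_potential \<gamma> (\<rho>\<^sub>0 \<epsilon> x) (\<rho>E 0 x)"
          using nn
        proof eventually_elim
          case (elim x)
          show ?case
          proof (cases "x \<in> \<Omega>")
            case True
            then have "\<rho>E 0 x > 0" using E.r_pos[of 0 x] E.in_Qc(2) assms(5) by simp
            then show ?thesis using elim True by (simp add: rel_potential_nonneg gamma)
          qed simp
        qed
      qed
      moreover have "(LINT x:\<Omega>|lborel. rel_potential \<gamma> (\<rho>\<^sub>0 \<epsilon> x) (\<rho>E 0 x)) \<le> C * (\<delta> * V + (\<delta> powr (1 - \<gamma>) + 1) * gap0 \<epsilon>)"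
        using C(2)[OF \<delta> N.zero_in N.data_integrable(1) nn N.split_0(2)] unfolding gp .
      ultimately show ?thesis
        using kin0_nonneg[OF \<epsilon>] unfolding e0_def N.Erel0_def k by linarith
    qed
    show ?thesis
    proof (rule tendsto_zero_by_splitting)
      show "((\<lambda>\<epsilon>. gap0 \<epsilon> + kin0 \<epsilon>) \<longlongrightarrow> 0) (at_right 0)" using tendsto_add[OF gap0_lim kin0_lim] by simp
      fix \<kappa> :: real assume \<kappa>: "\<kappa> > 0"
      \<comment> \<open>This choice gives \<open>C * (\<delta> * V) \<le> \<kappa>\<close>; the
        added 1 covers \<open>C * V = 0\<close>.\<close>
      define \<delta> where "\<delta> = \<kappa> / (C * V + 1)"
      have CV: "C * V + 1 > 0" using C(1) V by (simp add: add_nonneg_pos)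
      have \<delta>: "\<delta> > 0" using \<kappa> CV by (simp add: \<delta>_def)
      have "C * (\<delta> * V) \<le> \<delta> * (C * V + 1)" using \<delta> by (simp add: algebra_simps)
      also have "\<dots> = \<kappa>" using CV by (simp add: \<delta>_def)
      finally have \<delta>V: "C * (\<delta> * V) \<le> \<kappa>" .
      let ?D = "C * (\<delta> powr (1 - \<gamma>) + 1) + 1"
      show "\<exists>C. \<forall>\<^sub>F \<epsilon> in at_right 0. 0 \<le> e0 \<epsilon> \<and> e0 \<epsilon> \<le> \<kappa> + C * (gap0 \<epsilon> + kin0 \<epsilon>)"
      proof (intro exI[of _ ?D])
        show "\<forall>\<^sub>F \<epsilon> in at_right 0. 0 \<le> e0 \<epsilon> \<and> e0 \<epsilon> \<le> \<kappa> + ?D * (gap0 \<epsilon> + kin0 \<epsilon>)"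
          using ev
        proof eventually_elim
          case (elim \<epsilon>)
          have g: "gap0 \<epsilon> \<ge> 0" "kin0 \<epsilon> \<ge> 0" using gap0_nonneg kin0_nonneg[OF elim] by auto
          have "C * (\<delta> powr (1 - \<gamma>) + 1) * kin0 \<epsilon> \<ge> 0" using C(1) g by simp
          moreover have "C * (\<delta> * V + (\<delta> powr (1 - \<gamma>) + 1) * gap0 \<epsilon>) = C * (\<delta> * V) + C * (\<delta> powr (1 - \<gamma>) + 1) * gap0 \<epsilon>"
            by (simp add: algebra_simps)
          moreover have "?D * (gap0 \<epsilon> + kin0 \<epsilon>) = C * (\<delta> powr (1 - \<gamma>) + 1) * gap0 \<epsilon> + C * (\<delta> powr (1 - \<gamma>) + 1) * kin0 \<epsilon> + gap0 \<epsilon> + kin0 \<epsilon>"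
            by (simp add: algebra_simps)
          ultimately show ?case using bound[OF elim \<delta>] \<delta>V g by linarith
        qed
      qed
    qed
  qed
  define C1 where "C1 = K\<^sup>2 * navier_stokes.surface_area \<Omega> * T"
  define C2 where "C2 = c * (9 * K)\<^sup>2 * navier_stokes.vol \<Omega> * T"
  define C3 where "C3 = exp ((2 * K + 3 * (\<gamma> - 1) * K) * T)"
  \<comment> \<open>\<open>C1\<close>, \<open>C2\<close> and \<open>C3\<close> do not depend on
    \<epsilon>, which enters only through \<open>e0\<close>, \<open>\<beta>\<close> and the explicit
    factor.\<close>
  define A where "A \<epsilon> = (e0 \<epsilon> + \<beta> \<epsilon> * C1 + \<epsilon> * C2) * C3" for \<epsilon>
  have A_lim: "(A \<longlongrightarrow> 0) (at_right 0)"
  proof -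
    have "((\<lambda>\<epsilon>. (e0 \<epsilon> + \<beta> \<epsilon> * C1 + \<epsilon> * C2) * C3) \<longlongrightarrow> (0 + 0 * C1 + 0 * C2) * C3) (at_right 0)"
      by (intro tendsto_intros e0_lim assms(17))
    then show ?thesis by (simp add: A_def[abs_def])
  qed
  have key: "\<forall>\<^sub>F \<epsilon> in at_right 0. (SUP t\<in>{0<..<T}. ennreal (Lp_norm \<gamma> \<Omega> (\<lambda>x. \<rho> \<epsilon> t x - \<rho>E t x)
            + (\<integral>x\<in>\<Omega>. (1/2 * \<rho> \<epsilon> t x * (norm (u \<epsilon> t x - uE t x))^2) \<partial>lborel))) \<le> ennreal \<kappa>" if \<kappa>: "\<kappa> > 0" for \<kappa>
  proof -
    \<comment> \<open>Half of \<open>(\<kappa> / 2) powr \<gamma>\<close> is reserved for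
      \<open>\<delta> * V\<close> and half for \<open>C * h\<close>, so that the root in
      \<open>Lp_norm\<close> gives \<open>\<kappa> / 2\<close>; the other
      \<open>\<kappa> / 2\<close> is left for the kinetic part.\<close>
    define \<delta>' where "\<delta>' = (\<kappa> / 2) powr \<gamma> / 2"
    have \<delta>': "\<delta>' > 0" using \<kappa> by (simp add: \<delta>'_def)
    define \<delta> where "\<delta> = \<delta>' / (V + 1)"
    have \<delta>: "\<delta> > 0" "\<delta> * V \<le> \<delta>'" using \<delta>' V by (auto simp: \<delta>_def field_simps)
    obtain C where C: "C \<ge> 0" "\<And>s f. s \<in> {0..T} \<Longrightarrow> set_integrable lborel \<Omega> f \<Longrightarrow> (AE x in lborel. x \<in> \<Omega> \<longrightarrow> 0 \<le> f x)
      \<Longrightarrow> set_integrable lborel \<Omega> (\<lambda>x. rel_potential \<gamma> (f x) (\<rho>E s x))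
      \<Longrightarrow> (LINT x:\<Omega>|lborel. \<bar>f x - \<rho>E s x\<bar> powr \<gamma>) \<le> \<delta> * V + C * (LINT x:\<Omega>|lborel. rel_potential \<gamma> (f x) (\<rho>E s x))"
      using E.density_gap_le_potential[OF \<delta>(1)] unfolding V_def by blast
    have "0 < min (\<kappa> / 2) (\<delta>' / (C + 1))" using \<kappa> \<delta>' C(1) by simp
    then have "\<forall>\<^sub>F \<epsilon> in at_right 0. A \<epsilon> < min (\<kappa> / 2) (\<delta>' / (C + 1))" by (rule order_tendstoD(2)[OF A_lim])
    with ev show ?thesis
    proof eventually_elim
      case (elim \<epsilon>)
      obtain G g where "navier_stokes \<Omega> T \<gamma> \<rho>\<^sub>0E u\<^sub>0E \<rho>E uE \<mu> \<eta> \<epsilon> (\<beta> \<epsilon>) (\<rho>\<^sub>0 \<epsilon>) (u\<^sub>0 \<epsilon>) (\<rho> \<epsilon>) (u \<epsilon>) G g"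
        using ns[OF elim(1)] by blast
      then interpret N: navier_stokes \<Omega> T \<gamma> \<rho>\<^sub>0E u\<^sub>0E \<rho>E uE \<mu> \<eta> \<epsilon> "\<beta> \<epsilon>" "\<rho>\<^sub>0 \<epsilon>" "u\<^sub>0 \<epsilon>" "\<rho> \<epsilon>" "u \<epsilon>" G g .
      show ?case
      proof (rule SUP_least, rule ennreal_leI)
        fix t assume t: "t \<in> {0<..<T}"
        then have t': "t \<in> {0..T}" by simp
        have "N.Erel t \<le> A \<epsilon>"
          using N.relative_energy_estimate[OF K c(2,1) t] by (simp add: A_def C1_def C2_def C3_def e0_def)
        define k where "k = (LINT x:\<Omega>|lborel. 1/2 * \<rho> \<epsilon> t x * (norm (u \<epsilon> t x - uE t x))\<^sup>2)"
        define h where "h = (LINT x:\<Omega>|lborel. rel_potential \<gamma> (\<rho> \<epsilon> t x) (\<rho>E t x))"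
        have kh: "k \<ge> 0" "h \<ge> 0"
        proof -
          show "k \<ge> 0" unfolding k_def set_lebesgue_integral_def
          proof (rule integral_nonneg_AE)
            show "AE x in lborel. 0 \<le> indicat_real \<Omega> x *\<^sub>R (1/2 * \<rho> \<epsilon> t x * (norm (u \<epsilon> t x - uE t x))\<^sup>2)"
              using N.rho_nonneg[OF t'] by eventually_elim (auto simp: indicator_def)
          qed
          show "h \<ge> 0" unfolding h_def set_lebesgue_integral_def
          proof (rule integral_nonneg_AE)
            show "AE x in lborel. 0 \<le> indicat_real \<Omega> x *\<^sub>R rel_potential \<gamma> (\<rho> \<epsilon> t x) (\<rho>E t x)"
              using N.rho_nonneg[OF t']
            proof eventually_elim
              case (elim x)
              show ?case
              proof (cases "x \<in> \<Omega>")
                case True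
                then have "\<rho>E t x > 0" using E.r_pos[OF t'] E.in_Qc(2) by blast
                then show ?thesis using elim True by (simp add: rel_potential_nonneg gamma)
              qed simp
            qed
          qed
        qed
        have "k + h \<le> A \<epsilon>" using \<open>N.Erel t \<le> A \<epsilon>\<close> by (simp add: N.Erel_def k_def h_def)
        then have k: "k \<le> \<kappa> / 2" and h: "h \<le> \<delta>' / (C + 1)" using kh elim(2) by auto
        have "C * h \<le> C * (\<delta>' / (C + 1))" using h C(1) by (rule mult_left_mono)
        also have "\<dots> \<le> \<delta>'" using C(1) \<delta>' by (simp add: field_simps)
        finally have Ch: "C * h \<le> \<delta>'" .
        let ?I = "LINT x:\<Omega>|lborel. \<bar>\<rho> \<epsilon> t x - \<rho>E t x\<bar> powr \<gamma>"
        have I0: "?I \<ge> 0" unfolding set_lebesgue_integral_def by (rule Bochner_Integration.integral_nonneg) simp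
        have "?I \<le> \<delta> * V + C * h"
          using C(2)[OF t' N.rho_integrable[OF t'] N.rho_nonneg[OF t'] N.split_at(2)[OF t' t' t' t' t']] by (simp add: h_def)
        also have "\<dots> \<le> (\<kappa> / 2) powr \<gamma>" using \<delta>(2) Ch by (simp add: \<delta>'_def)
        finally have "?I powr (1 / \<gamma>) \<le> ((\<kappa> / 2) powr \<gamma>) powr (1 / \<gamma>)"
          using I0 gamma by (intro powr_mono2) auto
        also have "\<dots> = \<kappa> / 2" using gamma \<kappa> by (simp add: powr_powr)
        finally have "Lp_norm \<gamma> \<Omega> (\<lambda>x. \<rho> \<epsilon> t x - \<rho>E t x) \<le> \<kappa> / 2" by (simp add: Lp_norm_def)
        then show "Lp_norm \<gamma> \<Omega> (\<lambda>x. \<rho> \<epsilon> t x - \<rho>E t x)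
            + (\<integral>x\<in>\<Omega>. (1/2 * \<rho> \<epsilon> t x * (norm (u \<epsilon> t x - uE t x))^2) \<partial>lborel) \<le> \<kappa>"
          using k unfolding k_def by linarith
      qed
    qed
  qed
  show ?thesis
  \<comment> \<open>The limit is the least element of \<open>ennreal\<close>, so only upper bounds
    matter, and below every positive \<open>a\<close> there is a positive real to which
    \<open>key\<close> applies.\<close>
  proof (rule order_tendstoI)
    fix a :: ennreal assume "0 < a"
    then obtain b where b: "0 < b" "b < a" using dense by blast
    then have "b < top" using less_le_trans top_greatest by blast
    then obtain \<kappa> where \<kappa>: "b = ennreal \<kappa>" "\<kappa> \<ge> 0" by (cases b) auto
    have "\<kappa> > 0" using b(1) \<kappa> by (cases "\<kappa> = 0") auto
    from key[OF this]
    show "\<forall>\<^sub>F \<epsilon> in at_right 0. (SUP t\<in>{0<..<T}. ennreal (Lp_norm \<gamma> \<Omega> (\<lambda>x. \<rho> \<epsilon> t x - \<rho>E t x)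
            + (\<integral>x\<in>\<Omega>. (1/2 * \<rho> \<epsilon> t x * (norm (u \<epsilon> t x - uE t x))^2) \<partial>lborel))) < a"
      by eventually_elim (use b(2) \<kappa>(1) in \<open>auto intro: le_less_trans\<close>)
  qed simp
qed

end
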